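(* Let $\mathcal{E}$ be a category with pullbacks. The object map $X\mapsto\mathcal{E}/X$, the arrow map sending a polynomial $p=(X\xleftarrow{p_1}A\xrightarrow{p_2}B\xrightarrow{p_3}Y)$ to the functor $\Sigma_{p_3}\Pi_{p_2}\Delta_{p_1}:\mathcal{E}/X\to\mathcal{E}/Y$, and the 2-cell map sending a cartesian morphism $f:p\to q$ to the natural transformation $\mathbf{P}_{\mathcal{E}}(f)$ described in the context, are the object, arrow and 2-cell maps of a homomorphism of bicategories $$\mathbf{P}_{\mathcal{E}}:\mathbf{Poly}_{\mathcal{E}}\longrightarrow\mathbf{CAT}.$$
   Context: For $f:X\to Y$ in a category $\mathcal{E}$ with pullbacks, $\Sigma_f:\mathcal{E}/X\to\mathcal{E}/Y$ is composition with $f$, $\Delta_f$ is its right adjoint (pulling back along $f$), and $f$ is exponentiable when $\Delta_f$ has a right adjoint, denoted $\Pi_f$. A polynomial $p$ from $X$ to $Y$ is a diagram $X\xleftarrow{p_1}A\xrightarrow{p_2}B\xrightarrow{p_3}Y$ in $\mathcal{E}$ with $p_2$ exponentiable. A cartesian morphism $f:p\to q$, where $q=(X\xleftarrow{q_1}A'\xrightarrow{q_2}B'\xrightarrow{q_3}Y)$, is a pair $f_0:A\to A'$, $f_1:B\to B'$ with $q_1f_0=p_1$, $q_3f_1=p_3$, and $q_2f_0=f_1p_2$ a pullback square. $\mathbf{Poly}_{\mathcal{E}}$ is the bicategory whose objects are those of $\mathcal{E}$, 1-cells are polynomials, and 2-cells are cartesian morphisms. The identity on $X$ has all three maps equal to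 $1_X$. The composite $q\circ p$ of $p=(X\leftarrow A\to B\to Y)$ and $q=(Y\xleftarrow{q_1}C\xrightarrow{q_2}D\xrightarrow{q_3}Z)$ is obtained thus: form the pullback $P=B\times_YC$ of $p_3$ and $q_1$ with projections $\pi_B,\pi_C$; form a distributivity pullback $(\varepsilon:F\to P,\ e:F\to G,\ r:G\to D)$ around $(q_2,\pi_C)$; form the pullback $H$ of $p_2$ and $\pi_B\varepsilon:F\to B$; then $q\circ p$ is $X\leftarrow H\to G\to Z$ with maps $H\to A\xrightarrow{p_1}X$, $H\to F\xrightarrow{e}G$ and $q_3r$. Horizontal composition of 2-cells and the coherence isomorphisms are the canonical ones induced by the universal properties of these pullbacks and distributivity pullbacks. Here a distributivity pullback around composable $(f:A\to B,\ g:Z\to A)$ is a terminal object of the category of triples $(p:X\to Z,\ q:X\to Y,\ r:Y\to B)$ such that $fgp=rq$ is a pullback square exhibiting $X$ as the pullback of $f$ and $r$, with morphisms $(p,q,r)\to(p',q',r')$ the pairs $(s:X\to X',\ t:Y\to Y')$ with $p's=p$, $q's=tq$, $r't=r$. 2-cell map: $\mathbf{P}_{\mathcal{E}}(f)$ is the composite $$\Sigma_{p_3}\Pi_{p_2}\Delta_{p_1}\cong\Sigma_{p_3}\Pi_{p_2}\Delta_{f_0}\Delta_{q_1}\cong\Sigma_{p_3}\Delta_{f_1}\Pi_{q_2}\Delta_{q_1}\to\Sigma_{q_3}\Pi_{q_2}\Delta_{q_1}$$ where the first isomorphism comes from $p_1=q_1f_0$, the second is the Beck–Chevalley isomorphism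 of the pullback square $q_2f_0=f_1p_2$, and the last arrow is induced by $\Sigma_{p_3}\Delta_{f_1}\to\Sigma_{q_3}$, the mate of the identity $\Sigma_{p_3}=\Sigma_{q_3}\Sigma_{f_1}$ via $\Sigma_{f_1}\dashv\Delta_{f_1}$. $\mathbf{CAT}$ is the 2-category of categories, functors and natural transformations. A homomorphism of bicategories is a pseudofunctor. *)

theory Defs
  imports "HOL-Library.FuncSet"
begin

section \<open>Categories, functors, natural transformations\<close>

record ('o, 'a) cat =
  Obj :: "'o set"
  Arr :: "'a set"
  Dom :: "'a \<Rightarrow> 'o"
  Cod :: "'a \<Rightarrow> 'o"
  Idn :: "'o \<Rightarrow> 'a"
  Cmp :: "'a \<Rightarrow> 'a \<Rightarrow> 'a" (infixr "\<cdot>\<index>" 70)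

definition hom :: "('o, 'a) cat \<Rightarrow> 'o \<Rightarrow> 'o \<Rightarrow> 'a set" where
  "hom C X Y = {f \<in> Arr C. Dom C f = X \<and> Cod C f = Y}"

locale category =
  fixes C :: "('o, 'a) cat" (structure)
  assumes dom_in: "f \<in> Arr C \<Longrightarrow> Dom C f \<in> Obj C"
    and cod_in: "f \<in> Arr C \<Longrightarrow> Cod C f \<in> Obj C"
    and id_in: "X \<in> Obj C \<Longrightarrow> Idn C X \<in> hom C X X"
    and comp_in: "\<lbrakk>f \<in> hom C X Y; g \<in> hom C Y Z\<rbrakk> \<Longrightarrow> g \<cdot> f \<in> hom C X Z"
    and id_left: "f \<in> hom C X Y \<Longrightarrow> Idn C Y \<cdot> f = f"
    and id_right: "f \<in> hom C X Y \<Longrightarrow> f \<cdot> Idn C X = f"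
    and comp_assoc: "\<lbrakk>f \<in> hom C W X; g \<in> hom C X Y; h \<in> hom C Y Z\<rbrakk> \<Longrightarrow> (h \<cdot> g) \<cdot> f = h \<cdot> (g \<cdot> f)"

definition inverse_arrows :: "('o, 'a) cat \<Rightarrow> 'a \<Rightarrow> 'a \<Rightarrow> bool" where
  "inverse_arrows C f g \<longleftrightarrow> f \<in> Arr C \<and> g \<in> hom C (Cod C f) (Dom C f)
     \<and> g \<cdot>\<^bsub>C\<^esub> f = Idn C (Dom C f) \<and> f \<cdot>\<^bsub>C\<^esub> g = Idn C (Cod C f)"

definition is_iso :: "('o, 'a) cat \<Rightarrow> 'a \<Rightarrow> bool" where
  "is_iso C f \<longleftrightarrow> (\<exists>g. inverse_arrows C f g)"

definition inverse_of :: "('o, 'a) cat \<Rightarrow> 'a \<Rightarrow> 'a" where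
  "inverse_of C f = (THE g. inverse_arrows C f g)"

definition terminal :: "('o, 'a) cat \<Rightarrow> 'o \<Rightarrow> bool" where
  "terminal C T \<longleftrightarrow> T \<in> Obj C \<and> (\<forall>X\<in>Obj C. \<exists>!u. u \<in> hom C X T)"

definition prod_cat :: "('o, 'a) cat \<Rightarrow> ('p, 'b) cat \<Rightarrow> ('o \<times> 'p, 'a \<times> 'b) cat" where
  "prod_cat C D = \<lparr>Obj = Obj C \<times> Obj D, Arr = Arr C \<times> Arr D,
     Dom = (\<lambda>(f, g). (Dom C f, Dom D g)), Cod = (\<lambda>(f, g). (Cod C f, Cod D g)),
     Idn = (\<lambda>(X, Y). (Idn C X, Idn D Y)),
     Cmp = (\<lambda>(f', g') (f, g). (f' \<cdot>\<^bsub>C\<^esub> f, g' \<cdot>\<^bsub>D\<^esub> g))\<rparr>"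

definition functor_maps ::
  "('o, 'a) cat \<Rightarrow> ('p, 'b) cat \<Rightarrow> ('o \<Rightarrow> 'p) \<Rightarrow> ('a \<Rightarrow> 'b) \<Rightarrow> bool" where
  "functor_maps C D Fo Fa \<longleftrightarrow>
     (\<forall>X\<in>Obj C. Fo X \<in> Obj D \<and> Fa (Idn C X) = Idn D (Fo X))
   \<and> (\<forall>X Y. \<forall>f\<in>hom C X Y. Fa f \<in> hom D (Fo X) (Fo Y))
   \<and> (\<forall>X Y Z. \<forall>f\<in>hom C X Y. \<forall>g\<in>hom C Y Z. Fa (g \<cdot>\<^bsub>C\<^esub> f) = Fa g \<cdot>\<^bsub>D\<^esub> Fa f)"

text \<open>Functors and natural transformations, as elements of functor categories, are required to be
  extensional, so that HOL equality is equality of functors and of transformations.\<close>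

record ('o, 'a, 'p, 'b) func =
  fobj :: "'o \<Rightarrow> 'p"
  farr :: "'a \<Rightarrow> 'b"

definition is_functor :: "('o, 'a) cat \<Rightarrow> ('p, 'b) cat \<Rightarrow> ('o, 'a, 'p, 'b) func \<Rightarrow> bool" where
  "is_functor C D F \<longleftrightarrow> functor_maps C D (fobj F) (farr F)
     \<and> fobj F \<in> extensional (Obj C) \<and> farr F \<in> extensional (Arr C)"

definition id_func :: "('o, 'a) cat \<Rightarrow> ('o, 'a, 'o, 'a) func" where
  "id_func C = \<lparr>fobj = (\<lambda>X\<in>Obj C. X), farr = (\<lambda>f\<in>Arr C. f)\<rparr>"

definition comp_func ::
  "('o, 'a) cat \<Rightarrow> ('p, 'b, 'q, 'c) func \<Rightarrow> ('o, 'a, 'p, 'b) func \<Rightarrow> ('o, 'a, 'q, 'c) func" where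
  "comp_func C G F = \<lparr>fobj = (\<lambda>X\<in>Obj C. fobj G (fobj F X)), farr = (\<lambda>f\<in>Arr C. farr G (farr F f))\<rparr>"

record ('o, 'a, 'p, 'b) ntrans =
  ndom :: "('o, 'a, 'p, 'b) func"
  ncod :: "('o, 'a, 'p, 'b) func"
  ncmp :: "'o \<Rightarrow> 'b"

definition is_ntrans :: "('o, 'a) cat \<Rightarrow> ('p, 'b) cat \<Rightarrow> ('o, 'a, 'p, 'b) ntrans \<Rightarrow> bool" where
  "is_ntrans C D \<tau> \<longleftrightarrow> is_functor C D (ndom \<tau>) \<and> is_functor C D (ncod \<tau>)
   \<and> ncmp \<tau> \<in> extensional (Obj C)
   \<and> (\<forall>X\<in>Obj C. ncmp \<tau> X \<in> hom D (fobj (ndom \<tau>) X) (fobj (ncod \<tau>) X))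
   \<and> (\<forall>X Y. \<forall>f\<in>hom C X Y.
        ncmp \<tau> Y \<cdot>\<^bsub>D\<^esub> farr (ndom \<tau>) f = farr (ncod \<tau>) f \<cdot>\<^bsub>D\<^esub> ncmp \<tau> X)"

definition id_ntrans ::
  "('o, 'a) cat \<Rightarrow> ('p, 'b) cat \<Rightarrow> ('o, 'a, 'p, 'b) func \<Rightarrow> ('o, 'a, 'p, 'b) ntrans" where
  "id_ntrans C D F = \<lparr>ndom = F, ncod = F, ncmp = (\<lambda>X\<in>Obj C. Idn D (fobj F X))\<rparr>"

definition func_cat ::
  "('o, 'a) cat \<Rightarrow> ('p, 'b) cat \<Rightarrow> (('o, 'a, 'p, 'b) func, ('o, 'a, 'p, 'b) ntrans) cat" where
  "func_cat C D = \<lparr>Obj = {F. is_functor C D F}, Arr = {\<tau>. is_ntrans C D \<tau>},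
     Dom = ndom, Cod = ncod, Idn = id_ntrans C D,
     Cmp = (\<lambda>\<sigma> \<tau>. \<lparr>ndom = ndom \<tau>, ncod = ncod \<sigma>, ncmp = (\<lambda>X\<in>Obj C. ncmp \<sigma> X \<cdot>\<^bsub>D\<^esub> ncmp \<tau> X)\<rparr>)\<rparr>"

locale adjunction =
  fixes C :: "('o, 'a) cat" and D :: "('p, 'b) cat"
    and F :: "('o, 'a, 'p, 'b) func" and G :: "('p, 'b, 'o, 'a) func"
    and \<eta> :: "('o, 'a, 'o, 'a) ntrans" and \<epsilon> :: "('p, 'b, 'p, 'b) ntrans"
  assumes left_functor: "is_functor C D F"
    and right_functor: "is_functor D C G"
    and unit: "\<eta> \<in> hom (func_cat C C) (id_func C) (comp_func C G F)"
    and counit: "\<epsilon> \<in> hom (func_cat D D) (comp_func D F G) (id_func D)"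
    and triangle_left: "X \<in> Obj C \<Longrightarrow> ncmp \<epsilon> (fobj F X) \<cdot>\<^bsub>D\<^esub> farr F (ncmp \<eta> X) = Idn D (fobj F X)"
    and triangle_right: "Y \<in> Obj D \<Longrightarrow> farr G (ncmp \<epsilon> Y) \<cdot>\<^bsub>C\<^esub> ncmp \<eta> (fobj G Y) = Idn C (fobj G Y)"


section \<open>Bicategories and homomorphisms\<close>

text \<open>In \<open>Hcomp1 B x y z g f\<close> and \<open>Hcomp2 B x y z \<tau> \<sigma>\<close> the second argument, between \<open>x\<close> and \<open>y\<close>,
  comes first in the composite. The coherence cells are oriented as
  \<open>Assoc B w x y z h g f : (h g) f \<rightarrow> h (g f)\<close>, \<open>Lunit B x y f : 1 f \<rightarrow> f\<close>
  and \<open>Runit B x y f : f 1 \<rightarrow> f\<close>.\<close>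

record ('x, 'f, 't) bicat =
  Cell0 :: "'x set"
  HomCat :: "'x \<Rightarrow> 'x \<Rightarrow> ('f, 't) cat"
  Unit1 :: "'x \<Rightarrow> 'f"
  Hcomp1 :: "'x \<Rightarrow> 'x \<Rightarrow> 'x \<Rightarrow> 'f \<Rightarrow> 'f \<Rightarrow> 'f"
  Hcomp2 :: "'x \<Rightarrow> 'x \<Rightarrow> 'x \<Rightarrow> 't \<Rightarrow> 't \<Rightarrow> 't"
  Assoc :: "'x \<Rightarrow> 'x \<Rightarrow> 'x \<Rightarrow> 'x \<Rightarrow> 'f \<Rightarrow> 'f \<Rightarrow> 'f \<Rightarrow> 't"
  Lunit :: "'x \<Rightarrow> 'x \<Rightarrow> 'f \<Rightarrow> 't"
  Runit :: "'x \<Rightarrow> 'x \<Rightarrow> 'f \<Rightarrow> 't"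

locale bicategory =
  fixes B :: "('x, 'f, 't) bicat"
  assumes hom_category: "\<lbrakk>x \<in> Cell0 B; y \<in> Cell0 B\<rbrakk> \<Longrightarrow> category (HomCat B x y)"
    and unit1_in: "x \<in> Cell0 B \<Longrightarrow> Unit1 B x \<in> Obj (HomCat B x x)"
    and hcomp_functor: "\<lbrakk>x \<in> Cell0 B; y \<in> Cell0 B; z \<in> Cell0 B\<rbrakk> \<Longrightarrow>
      functor_maps (prod_cat (HomCat B y z) (HomCat B x y)) (HomCat B x z)
        (\<lambda>(g, f). Hcomp1 B x y z g f) (\<lambda>(\<tau>, \<sigma>). Hcomp2 B x y z \<tau> \<sigma>)"
    and assoc_in: "\<lbrakk>w \<in> Cell0 B; x \<in> Cell0 B; y \<in> Cell0 B; z \<in> Cell0 B;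
      f \<in> Obj (HomCat B w x); g \<in> Obj (HomCat B x y); h \<in> Obj (HomCat B y z)\<rbrakk> \<Longrightarrow>
      Assoc B w x y z h g f \<in> hom (HomCat B w z)
        (Hcomp1 B w x z (Hcomp1 B x y z h g) f) (Hcomp1 B w y z h (Hcomp1 B w x y g f))"
    and assoc_iso: "\<lbrakk>w \<in> Cell0 B; x \<in> Cell0 B; y \<in> Cell0 B; z \<in> Cell0 B;
      f \<in> Obj (HomCat B w x); g \<in> Obj (HomCat B x y); h \<in> Obj (HomCat B y z)\<rbrakk> \<Longrightarrow>
      is_iso (HomCat B w z) (Assoc B w x y z h g f)"
    and assoc_natural: "\<lbrakk>w \<in> Cell0 B; x \<in> Cell0 B; y \<in> Cell0 B; z \<in> Cell0 B;
      \<phi> \<in> hom (HomCat B w x) f f'; \<gamma> \<in> hom (HomCat B x y) g g'; \<theta> \<in> hom (HomCat B y z) h h'\<rbrakk> \<Longrightarrow>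
      Assoc B w x y z h' g' f' \<cdot>\<^bsub>HomCat B w z\<^esub> Hcomp2 B w x z (Hcomp2 B x y z \<theta> \<gamma>) \<phi>
      = Hcomp2 B w y z \<theta> (Hcomp2 B w x y \<gamma> \<phi>) \<cdot>\<^bsub>HomCat B w z\<^esub> Assoc B w x y z h g f"
    and lunit_in: "\<lbrakk>x \<in> Cell0 B; y \<in> Cell0 B; f \<in> Obj (HomCat B x y)\<rbrakk> \<Longrightarrow>
      Lunit B x y f \<in> hom (HomCat B x y) (Hcomp1 B x y y (Unit1 B y) f) f"
    and lunit_iso: "\<lbrakk>x \<in> Cell0 B; y \<in> Cell0 B; f \<in> Obj (HomCat B x y)\<rbrakk> \<Longrightarrow>
      is_iso (HomCat B x y) (Lunit B x y f)"
    and lunit_natural: "\<lbrakk>x \<in> Cell0 B; y \<in> Cell0 B; \<phi> \<in> hom (HomCat B x y) f f'\<rbrakk> \<Longrightarrow>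
      Lunit B x y f' \<cdot>\<^bsub>HomCat B x y\<^esub> Hcomp2 B x y y (Idn (HomCat B y y) (Unit1 B y)) \<phi>
      = \<phi> \<cdot>\<^bsub>HomCat B x y\<^esub> Lunit B x y f"
    and runit_in: "\<lbrakk>x \<in> Cell0 B; y \<in> Cell0 B; f \<in> Obj (HomCat B x y)\<rbrakk> \<Longrightarrow>
      Runit B x y f \<in> hom (HomCat B x y) (Hcomp1 B x x y f (Unit1 B x)) f"
    and runit_iso: "\<lbrakk>x \<in> Cell0 B; y \<in> Cell0 B; f \<in> Obj (HomCat B x y)\<rbrakk> \<Longrightarrow>
      is_iso (HomCat B x y) (Runit B x y f)"
    and runit_natural: "\<lbrakk>x \<in> Cell0 B; y \<in> Cell0 B; \<phi> \<in> hom (HomCat B x y) f f'\<rbrakk> \<Longrightarrow>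
      Runit B x y f' \<cdot>\<^bsub>HomCat B x y\<^esub> Hcomp2 B x x y \<phi> (Idn (HomCat B x x) (Unit1 B x))
      = \<phi> \<cdot>\<^bsub>HomCat B x y\<^esub> Runit B x y f"
    and pentagon: "\<lbrakk>v \<in> Cell0 B; w \<in> Cell0 B; x \<in> Cell0 B; y \<in> Cell0 B; z \<in> Cell0 B;
      f \<in> Obj (HomCat B v w); g \<in> Obj (HomCat B w x); h \<in> Obj (HomCat B x y); k \<in> Obj (HomCat B y z)\<rbrakk> \<Longrightarrow>
      Assoc B v x y z k h (Hcomp1 B v w x g f)
        \<cdot>\<^bsub>HomCat B v z\<^esub> Assoc B v w x z (Hcomp1 B x y z k h) g f
      = Hcomp2 B v y z (Idn (HomCat B y z) k) (Assoc B v w x y h g f)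
        \<cdot>\<^bsub>HomCat B v z\<^esub> Assoc B v w y z k (Hcomp1 B w x y h g) f
        \<cdot>\<^bsub>HomCat B v z\<^esub> Hcomp2 B v w z (Assoc B w x y z k h g) (Idn (HomCat B v w) f)"
    and triangle: "\<lbrakk>x \<in> Cell0 B; y \<in> Cell0 B; z \<in> Cell0 B;
      f \<in> Obj (HomCat B x y); g \<in> Obj (HomCat B y z)\<rbrakk> \<Longrightarrow>
      Hcomp2 B x y z (Idn (HomCat B y z) g) (Lunit B x y f)
        \<cdot>\<^bsub>HomCat B x z\<^esub> Assoc B x y y z g (Unit1 B y) f
      = Hcomp2 B x y z (Runit B y z g) (Idn (HomCat B x y) f)"

text \<open>The comparison cells are \<open>\<Phi> x y z g f : F g \<circ> F f \<rightarrow> F (g \<circ> f)\<close> and \<open>\<Psi> x : 1 \<rightarrow> F 1\<close>.\<close>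

locale homomorphism = B: bicategory B + D: bicategory D
  for B :: "('x, 'f, 't) bicat" and D :: "('y, 'g, 's) bicat" +
  fixes F0 :: "'x \<Rightarrow> 'y" and F1 :: "'x \<Rightarrow> 'x \<Rightarrow> 'f \<Rightarrow> 'g" and F2 :: "'x \<Rightarrow> 'x \<Rightarrow> 't \<Rightarrow> 's"
    and \<Phi> :: "'x \<Rightarrow> 'x \<Rightarrow> 'x \<Rightarrow> 'f \<Rightarrow> 'f \<Rightarrow> 's" and \<Psi> :: "'x \<Rightarrow> 's"
  assumes map0_in: "x \<in> Cell0 B \<Longrightarrow> F0 x \<in> Cell0 D"
    and local_functor: "\<lbrakk>x \<in> Cell0 B; y \<in> Cell0 B\<rbrakk> \<Longrightarrow>
      functor_maps (HomCat B x y) (HomCat D (F0 x) (F0 y)) (F1 x y) (F2 x y)"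
    and comp_cell_in: "\<lbrakk>x \<in> Cell0 B; y \<in> Cell0 B; z \<in> Cell0 B;
      f \<in> Obj (HomCat B x y); g \<in> Obj (HomCat B y z)\<rbrakk> \<Longrightarrow>
      \<Phi> x y z g f \<in> hom (HomCat D (F0 x) (F0 z))
        (Hcomp1 D (F0 x) (F0 y) (F0 z) (F1 y z g) (F1 x y f)) (F1 x z (Hcomp1 B x y z g f))"
    and comp_cell_iso: "\<lbrakk>x \<in> Cell0 B; y \<in> Cell0 B; z \<in> Cell0 B;
      f \<in> Obj (HomCat B x y); g \<in> Obj (HomCat B y z)\<rbrakk> \<Longrightarrow>
      is_iso (HomCat D (F0 x) (F0 z)) (\<Phi> x y z g f)"
    and comp_cell_natural: "\<lbrakk>x \<in> Cell0 B; y \<in> Cell0 B; z \<in> Cell0 B;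
      \<phi> \<in> hom (HomCat B x y) f f'; \<gamma> \<in> hom (HomCat B y z) g g'\<rbrakk> \<Longrightarrow>
      \<Phi> x y z g' f' \<cdot>\<^bsub>HomCat D (F0 x) (F0 z)\<^esub>
        Hcomp2 D (F0 x) (F0 y) (F0 z) (F2 y z \<gamma>) (F2 x y \<phi>)
      = F2 x z (Hcomp2 B x y z \<gamma> \<phi>) \<cdot>\<^bsub>HomCat D (F0 x) (F0 z)\<^esub> \<Phi> x y z g f"
    and unit_cell_in: "x \<in> Cell0 B \<Longrightarrow>
      \<Psi> x \<in> hom (HomCat D (F0 x) (F0 x)) (Unit1 D (F0 x)) (F1 x x (Unit1 B x))"
    and unit_cell_iso: "x \<in> Cell0 B \<Longrightarrow> is_iso (HomCat D (F0 x) (F0 x)) (\<Psi> x)"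
    and assoc_coherence: "\<lbrakk>w \<in> Cell0 B; x \<in> Cell0 B; y \<in> Cell0 B; z \<in> Cell0 B;
      f \<in> Obj (HomCat B w x); g \<in> Obj (HomCat B x y); h \<in> Obj (HomCat B y z)\<rbrakk> \<Longrightarrow>
      F2 w z (Assoc B w x y z h g f)
        \<cdot>\<^bsub>HomCat D (F0 w) (F0 z)\<^esub> \<Phi> w x z (Hcomp1 B x y z h g) f
        \<cdot>\<^bsub>HomCat D (F0 w) (F0 z)\<^esub> Hcomp2 D (F0 w) (F0 x) (F0 z) (\<Phi> x y z h g)
           (Idn (HomCat D (F0 w) (F0 x)) (F1 w x f))
      = \<Phi> w y z h (Hcomp1 B w x y g f)
        \<cdot>\<^bsub>HomCat D (F0 w) (F0 z)\<^esub> Hcomp2 D (F0 w) (F0 y) (F0 z)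
           (Idn (HomCat D (F0 y) (F0 z)) (F1 y z h)) (\<Phi> w x y g f)
        \<cdot>\<^bsub>HomCat D (F0 w) (F0 z)\<^esub>
           Assoc D (F0 w) (F0 x) (F0 y) (F0 z) (F1 y z h) (F1 x y g) (F1 w x f)"
    and lunit_coherence: "\<lbrakk>x \<in> Cell0 B; y \<in> Cell0 B; f \<in> Obj (HomCat B x y)\<rbrakk> \<Longrightarrow>
      F2 x y (Lunit B x y f)
        \<cdot>\<^bsub>HomCat D (F0 x) (F0 y)\<^esub> \<Phi> x y y (Unit1 B y) f
        \<cdot>\<^bsub>HomCat D (F0 x) (F0 y)\<^esub> Hcomp2 D (F0 x) (F0 y) (F0 y) (\<Psi> y)
           (Idn (HomCat D (F0 x) (F0 y)) (F1 x y f))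
      = Lunit D (F0 x) (F0 y) (F1 x y f)"
    and runit_coherence: "\<lbrakk>x \<in> Cell0 B; y \<in> Cell0 B; f \<in> Obj (HomCat B x y)\<rbrakk> \<Longrightarrow>
      F2 x y (Runit B x y f)
        \<cdot>\<^bsub>HomCat D (F0 x) (F0 y)\<^esub> \<Phi> x x y f (Unit1 B x)
        \<cdot>\<^bsub>HomCat D (F0 x) (F0 y)\<^esub> Hcomp2 D (F0 x) (F0 x) (F0 y)
           (Idn (HomCat D (F0 x) (F0 y)) (F1 x y f)) (\<Psi> x)
      = Runit D (F0 x) (F0 y) (F1 x y f)"

text \<open>The 2-category of all categories whose objects and arrows are drawn from two given types;
  its coherence cells are identities.\<close>

definition CAT :: "(('u, 'v) cat, ('u, 'v, 'u, 'v) func, ('u, 'v, 'u, 'v) ntrans) bicat" where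
  "CAT = \<lparr>Cell0 = {C. category C}, HomCat = func_cat, Unit1 = id_func,
     Hcomp1 = (\<lambda>C D E. comp_func C),
     Hcomp2 = (\<lambda>C D E \<sigma> \<tau>. \<lparr>ndom = comp_func C (ndom \<sigma>) (ndom \<tau>), ncod = comp_func C (ncod \<sigma>) (ncod \<tau>),
        ncmp = (\<lambda>X\<in>Obj C. ncmp \<sigma> (fobj (ncod \<tau>) X) \<cdot>\<^bsub>E\<^esub> farr (ndom \<sigma>) (ncmp \<tau> X))\<rparr>),
     Assoc = (\<lambda>B C D E H G F. id_ntrans B E (comp_func B H (comp_func B G F))),
     Lunit = (\<lambda>C D F. id_ntrans C D F),
     Runit = (\<lambda>C D F. id_ntrans C D F)\<rparr>"


section \<open>Pullbacks and distributivity pullbacks\<close>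

definition is_pullback :: "('o, 'a) cat \<Rightarrow> 'a \<Rightarrow> 'a \<Rightarrow> 'a \<Rightarrow> 'a \<Rightarrow> bool" where
  "is_pullback E f g p q \<longleftrightarrow>
     f \<in> Arr E \<and> g \<in> Arr E \<and> Cod E f = Cod E g
   \<and> p \<in> hom E (Dom E p) (Dom E f) \<and> q \<in> hom E (Dom E p) (Dom E g)
   \<and> f \<cdot>\<^bsub>E\<^esub> p = g \<cdot>\<^bsub>E\<^esub> q
   \<and> (\<forall>T. \<forall>h\<in>hom E T (Dom E f). \<forall>k\<in>hom E T (Dom E g). f \<cdot>\<^bsub>E\<^esub> h = g \<cdot>\<^bsub>E\<^esub> k \<longrightarrow>
        (\<exists>!u. u \<in> hom E T (Dom E p) \<and> p \<cdot>\<^bsub>E\<^esub> u = h \<and> q \<cdot>\<^bsub>E\<^esub> u = k))"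

definition has_pullbacks :: "('o, 'a) cat \<Rightarrow> bool" where
  "has_pullbacks E \<longleftrightarrow> (\<forall>f\<in>Arr E. \<forall>g\<in>Arr E. Cod E f = Cod E g \<longrightarrow> (\<exists>p q. is_pullback E f g p q))"

text \<open>An arbitrary but fixed choice of pullbacks, and the map into the chosen pullback of \<open>f\<close> and \<open>g\<close>
  with components \<open>h\<close> and \<open>k\<close>.\<close>

definition pb :: "('o, 'a) cat \<Rightarrow> 'a \<Rightarrow> 'a \<Rightarrow> 'a \<times> 'a" where
  "pb E f g = (SOME (p, q). is_pullback E f g p q)"

definition pb_lift :: "('o, 'a) cat \<Rightarrow> 'a \<Rightarrow> 'a \<Rightarrow> 'a \<Rightarrow> 'a \<Rightarrow> 'a" where
  "pb_lift E f g h k = (THE u. u \<in> hom E (Dom E h) (Dom E (fst (pb E f g)))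
      \<and> fst (pb E f g) \<cdot>\<^bsub>E\<^esub> u = h \<and> snd (pb E f g) \<cdot>\<^bsub>E\<^esub> u = k)"

text \<open>For \<open>f : A \<rightarrow> B\<close> and \<open>g : Z \<rightarrow> A\<close>, the category of pullbacks around \<open>(f, g)\<close>: triples
  \<open>p : X \<rightarrow> Z\<close>, \<open>q : X \<rightarrow> Y\<close>, \<open>r : Y \<rightarrow> B\<close> such that \<open>X\<close> is a pullback of \<open>f\<close> and \<open>r\<close> with
  projections \<open>g p\<close> and \<open>q\<close>. A distributivity pullback is a terminal object of it.\<close>

record 'a pba =
  pba_p :: 'a
  pba_q :: 'a
  pba_r :: 'a

record 'a pba_mor =
  pba_src :: "'a pba"
  pba_trg :: "'a pba"
  pba_s :: 'a
  pba_t :: 'a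

definition is_pba :: "('o, 'a) cat \<Rightarrow> 'a \<Rightarrow> 'a \<Rightarrow> 'a pba \<Rightarrow> bool" where
  "is_pba E f g P \<longleftrightarrow> (\<exists>X Y. pba_p P \<in> hom E X (Dom E g) \<and> pba_q P \<in> hom E X Y \<and> pba_r P \<in> hom E Y (Cod E f))
     \<and> is_pullback E f (pba_r P) (g \<cdot>\<^bsub>E\<^esub> pba_p P) (pba_q P)"

definition is_pba_mor :: "('o, 'a) cat \<Rightarrow> 'a \<Rightarrow> 'a \<Rightarrow> 'a pba_mor \<Rightarrow> bool" where
  "is_pba_mor E f g u \<longleftrightarrow> is_pba E f g (pba_src u) \<and> is_pba E f g (pba_trg u)
     \<and> pba_s u \<in> hom E (Dom E (pba_q (pba_src u))) (Dom E (pba_q (pba_trg u)))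
     \<and> pba_t u \<in> hom E (Cod E (pba_q (pba_src u))) (Cod E (pba_q (pba_trg u)))
     \<and> pba_p (pba_trg u) \<cdot>\<^bsub>E\<^esub> pba_s u = pba_p (pba_src u)
     \<and> pba_q (pba_trg u) \<cdot>\<^bsub>E\<^esub> pba_s u = pba_t u \<cdot>\<^bsub>E\<^esub> pba_q (pba_src u)
     \<and> pba_r (pba_trg u) \<cdot>\<^bsub>E\<^esub> pba_t u = pba_r (pba_src u)"

definition pba_cat :: "('o, 'a) cat \<Rightarrow> 'a \<Rightarrow> 'a \<Rightarrow> ('a pba, 'a pba_mor) cat" where
  "pba_cat E f g = \<lparr>Obj = {P. is_pba E f g P}, Arr = {u. is_pba_mor E f g u},
     Dom = pba_src, Cod = pba_trg,
     Idn = (\<lambda>P. \<lparr>pba_src = P, pba_trg = P, pba_s = Idn E (Dom E (pba_q P)), pba_t = Idn E (Cod E (pba_q P))\<rparr>),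
     Cmp = (\<lambda>v u. \<lparr>pba_src = pba_src u, pba_trg = pba_trg v,
        pba_s = pba_s v \<cdot>\<^bsub>E\<^esub> pba_s u, pba_t = pba_t v \<cdot>\<^bsub>E\<^esub> pba_t u\<rparr>)\<rparr>"

definition is_dpb :: "('o, 'a) cat \<Rightarrow> 'a \<Rightarrow> 'a \<Rightarrow> 'a pba \<Rightarrow> bool" where
  "is_dpb E f g P \<longleftrightarrow> terminal (pba_cat E f g) P"

definition dpb :: "('o, 'a) cat \<Rightarrow> 'a \<Rightarrow> 'a \<Rightarrow> 'a pba" where
  "dpb E f g = (SOME P. is_dpb E f g P)"

definition dpb_lift :: "('o, 'a) cat \<Rightarrow> 'a \<Rightarrow> 'a \<Rightarrow> 'a pba \<Rightarrow> 'a pba_mor" where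
  "dpb_lift E f g P = (THE u. u \<in> hom (pba_cat E f g) P (dpb E f g))"


section \<open>Slices and the functors between them\<close>

record 'a slice_arr =
  sdom :: 'a
  scod :: 'a
  sarr :: 'a

definition slice :: "('o, 'a) cat \<Rightarrow> 'o \<Rightarrow> ('a, 'a slice_arr) cat" where
  "slice E X = \<lparr>Obj = {h \<in> Arr E. Cod E h = X},
     Arr = {u. sdom u \<in> Arr E \<and> Cod E (sdom u) = X \<and> scod u \<in> Arr E \<and> Cod E (scod u) = X
              \<and> sarr u \<in> hom E (Dom E (sdom u)) (Dom E (scod u)) \<and> scod u \<cdot>\<^bsub>E\<^esub> sarr u = sdom u},
     Dom = sdom, Cod = scod,
     Idn = (\<lambda>h. \<lparr>sdom = h, scod = h, sarr = Idn E (Dom E h)\<rparr>),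
     Cmp = (\<lambda>v u. \<lparr>sdom = sdom u, scod = scod v, sarr = sarr v \<cdot>\<^bsub>E\<^esub> sarr u\<rparr>)\<rparr>"

type_synonym 'a slice_func = "('a, 'a slice_arr, 'a, 'a slice_arr) func"
type_synonym 'a slice_ntrans = "('a, 'a slice_arr, 'a, 'a slice_arr) ntrans"

definition Sigma_f :: "('o, 'a) cat \<Rightarrow> 'a \<Rightarrow> 'a slice_func" where
  "Sigma_f E f = \<lparr>fobj = (\<lambda>h\<in>Obj (slice E (Dom E f)). f \<cdot>\<^bsub>E\<^esub> h),
     farr = (\<lambda>u\<in>Arr (slice E (Dom E f)).
       \<lparr>sdom = f \<cdot>\<^bsub>E\<^esub> sdom u, scod = f \<cdot>\<^bsub>E\<^esub> scod u, sarr = sarr u\<rparr>)\<rparr>"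

definition Delta_f :: "('o, 'a) cat \<Rightarrow> 'a \<Rightarrow> 'a slice_func" where
  "Delta_f E f = \<lparr>fobj = (\<lambda>h\<in>Obj (slice E (Cod E f)). fst (pb E f h)),
     farr = (\<lambda>u\<in>Arr (slice E (Cod E f)).
       \<lparr>sdom = fst (pb E f (sdom u)), scod = fst (pb E f (scod u)),
        sarr = pb_lift E f (scod u) (fst (pb E f (sdom u))) (sarr u \<cdot>\<^bsub>E\<^esub> snd (pb E f (sdom u)))\<rparr>)\<rparr>"

definition is_right_adjoint_data ::
  "('o, 'a) cat \<Rightarrow> 'a \<Rightarrow> 'a slice_func \<times> 'a slice_ntrans \<times> 'a slice_ntrans \<Rightarrow> bool" where
  "is_right_adjoint_data E f = (\<lambda>(G, \<eta>, \<epsilon>).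
     adjunction (slice E (Cod E f)) (slice E (Dom E f)) (Delta_f E f) G \<eta> \<epsilon>)"

definition exponentiable :: "('o, 'a) cat \<Rightarrow> 'a \<Rightarrow> bool" where
  "exponentiable E f \<longleftrightarrow> f \<in> Arr E \<and> (\<exists>R. is_right_adjoint_data E f R)"

definition Pi_data :: "('o, 'a) cat \<Rightarrow> 'a \<Rightarrow> 'a slice_func \<times> 'a slice_ntrans \<times> 'a slice_ntrans" where
  "Pi_data E f = (SOME R. is_right_adjoint_data E f R)"

definition Pi_f :: "('o, 'a) cat \<Rightarrow> 'a \<Rightarrow> 'a slice_func" where
  "Pi_f E f = fst (Pi_data E f)"

definition Pi_unit :: "('o, 'a) cat \<Rightarrow> 'a \<Rightarrow> 'a slice_ntrans" where
  "Pi_unit E f = fst (snd (Pi_data E f))"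

definition Pi_counit :: "('o, 'a) cat \<Rightarrow> 'a \<Rightarrow> 'a slice_ntrans" where
  "Pi_counit E f = snd (snd (Pi_data E f))"

text \<open>The component at \<open>h\<close> of the canonical isomorphism
  \<open>\<Delta>\<^bsub>g f\<^esub> \<rightarrow> \<Delta>\<^bsub>f\<^esub> \<Delta>\<^bsub>g\<^esub>\<close>, for composable \<open>f\<close> and \<open>g\<close>.\<close>

definition Delta_comp :: "('o, 'a) cat \<Rightarrow> 'a \<Rightarrow> 'a \<Rightarrow> 'a \<Rightarrow> 'a slice_arr" where
  "Delta_comp E f g h = (let gf = g \<cdot>\<^bsub>E\<^esub> f; p = fst (pb E gf h); q = snd (pb E gf h) in
     \<lparr>sdom = p, scod = fobj (Delta_f E f) (fobj (Delta_f E g) h),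
      sarr = pb_lift E f (fobj (Delta_f E g) h) p (pb_lift E g h (f \<cdot>\<^bsub>E\<^esub> p) q)\<rparr>)"

text \<open>The component at \<open>h\<close> of the counit \<open>\<Sigma>\<^bsub>f\<^esub> \<Delta>\<^bsub>f\<^esub> \<rightarrow> 1\<close>.\<close>

definition Sigma_counit :: "('o, 'a) cat \<Rightarrow> 'a \<Rightarrow> 'a \<Rightarrow> 'a slice_arr" where
  "Sigma_counit E f h = \<lparr>sdom = f \<cdot>\<^bsub>E\<^esub> fst (pb E f h), scod = h, sarr = snd (pb E f h)\<rparr>"

text \<open>For a commuting square \<open>q2 f0 = f1 p2\<close>: the component at \<open>m\<close> of the canonical isomorphism
  \<open>\<Delta>\<^bsub>p2\<^esub> \<Delta>\<^bsub>f1\<^esub> \<rightarrow> \<Delta>\<^bsub>f0\<^esub> \<Delta>\<^bsub>q2\<^esub>\<close>, and the component at \<open>k\<close> of its mate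
  \<open>\<Delta>\<^bsub>f1\<^esub> \<Pi>\<^bsub>q2\<^esub> \<rightarrow> \<Pi>\<^bsub>p2\<^esub> \<Delta>\<^bsub>f0\<^esub>\<close>, which is the Beck-Chevalley isomorphism when
  the square is a pullback.\<close>

definition Delta_square :: "('o, 'a) cat \<Rightarrow> 'a \<Rightarrow> 'a \<Rightarrow> 'a \<Rightarrow> 'a \<Rightarrow> 'a \<Rightarrow> 'a slice_arr" where
  "Delta_square E p2 f1 f0 q2 m =
     Delta_comp E f0 q2 m \<cdot>\<^bsub>slice E (Dom E p2)\<^esub>
     inverse_of (slice E (Dom E p2)) (Delta_comp E p2 f1 m)"

definition Beck_Chevalley :: "('o, 'a) cat \<Rightarrow> 'a \<Rightarrow> 'a \<Rightarrow> 'a \<Rightarrow> 'a \<Rightarrow> 'a \<Rightarrow> 'a slice_arr" where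
  "Beck_Chevalley E p2 f1 f0 q2 k =
     farr (Pi_f E p2)
       (farr (Delta_f E f0) (ncmp (Pi_counit E q2) k) \<cdot>\<^bsub>slice E (Dom E p2)\<^esub>
        Delta_square E p2 f1 f0 q2 (fobj (Pi_f E q2) k))
     \<cdot>\<^bsub>slice E (Cod E p2)\<^esub>
     ncmp (Pi_unit E p2) (fobj (Delta_f E f1) (fobj (Pi_f E q2) k))"


section \<open>Polynomials\<close>

record 'a poly =
  pol1 :: 'a
  pol2 :: 'a
  pol3 :: 'a

definition is_poly :: "('o, 'a) cat \<Rightarrow> 'o \<Rightarrow> 'o \<Rightarrow> 'a poly \<Rightarrow> bool" where
  "is_poly E X Y p \<longleftrightarrow>
     (\<exists>A B. pol1 p \<in> hom E A X \<and> pol2 p \<in> hom E A B \<and> pol3 p \<in> hom E B Y) \<and> exponentiable E (pol2 p)"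

record 'a cart =
  csrc :: "'a poly"
  ctrg :: "'a poly"
  car0 :: 'a
  car1 :: 'a

definition is_cart :: "('o, 'a) cat \<Rightarrow> 'o \<Rightarrow> 'o \<Rightarrow> 'a cart \<Rightarrow> bool" where
  "is_cart E X Y f \<longleftrightarrow> is_poly E X Y (csrc f) \<and> is_poly E X Y (ctrg f)
     \<and> car0 f \<in> hom E (Dom E (pol2 (csrc f))) (Dom E (pol2 (ctrg f)))
     \<and> car1 f \<in> hom E (Cod E (pol2 (csrc f))) (Cod E (pol2 (ctrg f)))
     \<and> pol1 (ctrg f) \<cdot>\<^bsub>E\<^esub> car0 f = pol1 (csrc f)
     \<and> pol3 (ctrg f) \<cdot>\<^bsub>E\<^esub> car1 f = pol3 (csrc f)
     \<and> is_pullback E (pol2 (ctrg f)) (car1 f) (car0 f) (pol2 (csrc f))"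

definition poly_hom :: "('o, 'a) cat \<Rightarrow> 'o \<Rightarrow> 'o \<Rightarrow> ('a poly, 'a cart) cat" where
  "poly_hom E X Y = \<lparr>Obj = {p. is_poly E X Y p}, Arr = {f. is_cart E X Y f}, Dom = csrc, Cod = ctrg,
     Idn = (\<lambda>p. \<lparr>csrc = p, ctrg = p, car0 = Idn E (Dom E (pol2 p)), car1 = Idn E (Cod E (pol2 p))\<rparr>),
     Cmp = (\<lambda>g f. \<lparr>csrc = csrc f, ctrg = ctrg g,
        car0 = car0 g \<cdot>\<^bsub>E\<^esub> car0 f, car1 = car1 g \<cdot>\<^bsub>E\<^esub> car1 f\<rparr>)\<rparr>"

definition id_poly :: "('o, 'a) cat \<Rightarrow> 'o \<Rightarrow> 'a poly" where
  "id_poly E X = \<lparr>pol1 = Idn E X, pol2 = Idn E X, pol3 = Idn E X\<rparr>"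

text \<open>The diagram built to compose \<open>p : A \<rightarrow> B\<close> over \<open>X, Y\<close> with \<open>q : C \<rightarrow> D\<close> over \<open>Y, Z\<close>:
  the pullback \<open>(\<pi>\<^sub>B, \<pi>\<^sub>C)\<close> with vertex \<open>P\<close>, the distributivity pullback
  \<open>(\<epsilon> : F \<rightarrow> P, e : F \<rightarrow> G, r : G \<rightarrow> D)\<close> around \<open>(q\<^sub>2, \<pi>\<^sub>C)\<close> and the pullback \<open>H\<close> of \<open>p\<^sub>2\<close>
  and \<open>\<pi>\<^sub>B \<epsilon>\<close>.\<close>

definition piB :: "('o, 'a) cat \<Rightarrow> 'a poly \<Rightarrow> 'a poly \<Rightarrow> 'a" where
  "piB E q p = fst (pb E (pol3 p) (pol1 q))"

definition piC :: "('o, 'a) cat \<Rightarrow> 'a poly \<Rightarrow> 'a poly \<Rightarrow> 'a" where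
  "piC E q p = snd (pb E (pol3 p) (pol1 q))"

definition dp :: "('o, 'a) cat \<Rightarrow> 'a poly \<Rightarrow> 'a poly \<Rightarrow> 'a pba" where
  "dp E q p = dpb E (pol2 q) (piC E q p)"

definition FP :: "('o, 'a) cat \<Rightarrow> 'a poly \<Rightarrow> 'a poly \<Rightarrow> 'a" where
  "FP E q p = pba_p (dp E q p)"

definition FG :: "('o, 'a) cat \<Rightarrow> 'a poly \<Rightarrow> 'a poly \<Rightarrow> 'a" where
  "FG E q p = pba_q (dp E q p)"

definition GD :: "('o, 'a) cat \<Rightarrow> 'a poly \<Rightarrow> 'a poly \<Rightarrow> 'a" where
  "GD E q p = pba_r (dp E q p)"

definition FB :: "('o, 'a) cat \<Rightarrow> 'a poly \<Rightarrow> 'a poly \<Rightarrow> 'a" where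
  "FB E q p = piB E q p \<cdot>\<^bsub>E\<^esub> FP E q p"

definition FC :: "('o, 'a) cat \<Rightarrow> 'a poly \<Rightarrow> 'a poly \<Rightarrow> 'a" where
  "FC E q p = piC E q p \<cdot>\<^bsub>E\<^esub> FP E q p"

definition HA :: "('o, 'a) cat \<Rightarrow> 'a poly \<Rightarrow> 'a poly \<Rightarrow> 'a" where
  "HA E q p = fst (pb E (pol2 p) (FB E q p))"

definition HF :: "('o, 'a) cat \<Rightarrow> 'a poly \<Rightarrow> 'a poly \<Rightarrow> 'a" where
  "HF E q p = snd (pb E (pol2 p) (FB E q p))"

definition comp_poly :: "('o, 'a) cat \<Rightarrow> 'a poly \<Rightarrow> 'a poly \<Rightarrow> 'a poly" where
  "comp_poly E q p = \<lparr>pol1 = pol1 p \<cdot>\<^bsub>E\<^esub> HA E q p, pol2 = FG E q p \<cdot>\<^bsub>E\<^esub> HF E q p,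
     pol3 = pol3 q \<cdot>\<^bsub>E\<^esub> GD E q p\<rparr>"

text \<open>Horizontal composition of \<open>f : p \<rightarrow> p'\<close> and \<open>g : q \<rightarrow> q'\<close>: the induced maps are
  \<open>u : P \<rightarrow> P'\<close>, then \<open>F \<rightarrow> F'\<close> and \<open>G \<rightarrow> G'\<close> (the two components of \<open>st\<close>), then \<open>H \<rightarrow> H'\<close>.\<close>

definition hcomp_cart :: "('o, 'a) cat \<Rightarrow> 'a cart \<Rightarrow> 'a cart \<Rightarrow> 'a cart" where
  "hcomp_cart E g f =
    (let p = csrc f; p' = ctrg f; q = csrc g; q' = ctrg g;
       u = pb_lift E (pol3 p') (pol1 q') (car1 f \<cdot>\<^bsub>E\<^esub> piB E q p) (car0 g \<cdot>\<^bsub>E\<^esub> piC E q p);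
       st = dpb_lift E (pol2 q') (piC E q' p')
              \<lparr>pba_p = u \<cdot>\<^bsub>E\<^esub> FP E q p, pba_q = FG E q p, pba_r = car1 g \<cdot>\<^bsub>E\<^esub> GD E q p\<rparr>
     in \<lparr>csrc = comp_poly E q p, ctrg = comp_poly E q' p',
         car0 = pb_lift E (pol2 p') (FB E q' p')
                  (car0 f \<cdot>\<^bsub>E\<^esub> HA E q p) (pba_s st \<cdot>\<^bsub>E\<^esub> HF E q p),
         car1 = pba_t st\<rparr>)"

text \<open>The associator \<open>(r q) p \<rightarrow> r (q p)\<close>. Write \<open>P\<^sub>0, F\<^sub>0, G\<^sub>0, H\<^sub>0\<close> for the vertices in the diagram for
  \<open>q p\<close>, \<open>P', F', G', H'\<close> for those for \<open>r q\<close>, \<open>P\<^sub>1, F\<^sub>1, G\<^sub>1, H\<^sub>1\<close> for those for \<open>(r q) p\<close> and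
  \<open>P\<^sub>2, F\<^sub>2, G\<^sub>2, H\<^sub>2\<close> for those for \<open>r (q p)\<close>, and let \<open>M\<close> be the pullback of \<open>G\<^sub>1 \<rightarrow> G'\<close> and
  \<open>F' \<rightarrow> G'\<close>, through which \<open>F\<^sub>1 \<rightarrow> G\<^sub>1\<close> factors by \<open>n : F\<^sub>1 \<rightarrow> M\<close>. The distributivity pullback for
  \<open>q p\<close> yields \<open>ab : (F\<^sub>1 \<rightarrow> F\<^sub>0, M \<rightarrow> G\<^sub>0)\<close>, and then that for \<open>r (q p)\<close> yields
  \<open>cd : (M \<rightarrow> F\<^sub>2, G\<^sub>1 \<rightarrow> G\<^sub>2)\<close>.\<close>

definition assoc_cart :: "('o, 'a) cat \<Rightarrow> 'a poly \<Rightarrow> 'a poly \<Rightarrow> 'a poly \<Rightarrow> 'a cart" where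
  "assoc_cart E r q p =
    (let rq = comp_poly E r q; qp = comp_poly E q p;
       MG = fst (pb E (GD E rq p) (FG E r q));
       MF = snd (pb E (GD E rq p) (FG E r q));
       n = pb_lift E (GD E rq p) (FG E r q) (FG E rq p) (HF E r q \<cdot>\<^bsub>E\<^esub> FC E rq p);
       v = pb_lift E (pol3 p) (pol1 q) (FB E rq p) (HA E r q \<cdot>\<^bsub>E\<^esub> FC E rq p);
       ab = dpb_lift E (pol2 q) (piC E q p) \<lparr>pba_p = v, pba_q = n, pba_r = FB E r q \<cdot>\<^bsub>E\<^esub> MF\<rparr>;
       w = pb_lift E (pol3 qp) (pol1 r) (pba_t ab) (FC E r q \<cdot>\<^bsub>E\<^esub> MF);
       cd = dpb_lift E (pol2 r) (piC E r qp) \<lparr>pba_p = w, pba_q = MG, pba_r = GD E r q \<cdot>\<^bsub>E\<^esub> GD E rq p\<rparr>;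
       x = pb_lift E (pol2 p) (FB E q p) (HA E rq p) (pba_s ab \<cdot>\<^bsub>E\<^esub> HF E rq p)
     in \<lparr>csrc = comp_poly E rq p, ctrg = comp_poly E r qp,
         car0 = pb_lift E (pol2 qp) (FB E r qp) x (pba_s cd \<cdot>\<^bsub>E\<^esub> n \<cdot>\<^bsub>E\<^esub> HF E rq p),
         car1 = pba_t cd\<rparr>)"

text \<open>For the left unitor, \<open>F \<rightarrow> G\<close> is invertible, being a pullback of an identity.\<close>

definition lunit_cart :: "('o, 'a) cat \<Rightarrow> 'o \<Rightarrow> 'a poly \<Rightarrow> 'a cart" where
  "lunit_cart E Y p = \<lparr>csrc = comp_poly E (id_poly E Y) p, ctrg = p,
     car0 = HA E (id_poly E Y) p,
     car1 = FB E (id_poly E Y) p \<cdot>\<^bsub>E\<^esub> inverse_of E (FG E (id_poly E Y) p)\<rparr>"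

definition runit_cart :: "('o, 'a) cat \<Rightarrow> 'o \<Rightarrow> 'a poly \<Rightarrow> 'a cart" where
  "runit_cart E X p = \<lparr>csrc = comp_poly E p (id_poly E X), ctrg = p,
     car0 = FC E p (id_poly E X) \<cdot>\<^bsub>E\<^esub> HF E p (id_poly E X),
     car1 = GD E p (id_poly E X)\<rparr>"

definition Poly :: "('o, 'a) cat \<Rightarrow> ('o, 'a poly, 'a cart) bicat" where
  "Poly E = \<lparr>Cell0 = Obj E, HomCat = poly_hom E, Unit1 = id_poly E,
     Hcomp1 = (\<lambda>X Y Z. comp_poly E), Hcomp2 = (\<lambda>X Y Z. hcomp_cart E),
     Assoc = (\<lambda>W X Y Z. assoc_cart E),
     Lunit = (\<lambda>X Y. lunit_cart E Y), Runit = (\<lambda>X Y. runit_cart E X)\<rparr>"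


section \<open>The functors and transformations induced by polynomials\<close>

definition P1 :: "('o, 'a) cat \<Rightarrow> 'o \<Rightarrow> 'o \<Rightarrow> 'a poly \<Rightarrow> 'a slice_func" where
  "P1 E X Y p = comp_func (slice E X) (Sigma_f E (pol3 p))
     (comp_func (slice E X) (Pi_f E (pol2 p)) (Delta_f E (pol1 p)))"

text \<open>With \<open>p\<close> the source and \<open>q\<close> the target of \<open>f\<close>, the component at \<open>h\<close> is
  \<open>\<Sigma>\<^bsub>p3\<^esub> \<Pi>\<^bsub>p2\<^esub> \<Delta>\<^bsub>p1\<^esub> h \<rightarrow> \<Sigma>\<^bsub>p3\<^esub> \<Pi>\<^bsub>p2\<^esub> \<Delta>\<^bsub>f0\<^esub> \<Delta>\<^bsub>q1\<^esub> h
  \<rightarrow> \<Sigma>\<^bsub>p3\<^esub> \<Delta>\<^bsub>f1\<^esub> \<Pi>\<^bsub>q2\<^esub> \<Delta>\<^bsub>q1\<^esub> h \<rightarrow> \<Sigma>\<^bsub>q3\<^esub> \<Pi>\<^bsub>q2\<^esub> \<Delta>\<^bsub>q1\<^esub> h\<close>.\<close>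

definition P2 :: "('o, 'a) cat \<Rightarrow> 'o \<Rightarrow> 'o \<Rightarrow> 'a cart \<Rightarrow> 'a slice_ntrans" where
  "P2 E X Y f = (let p = csrc f; q = ctrg f; f0 = car0 f; f1 = car1 f in
     \<lparr>ndom = P1 E X Y p, ncod = P1 E X Y q,
      ncmp = (\<lambda>h\<in>Obj (slice E X). let k = fobj (Delta_f E (pol1 q)) h in
        farr (Sigma_f E (pol3 q)) (Sigma_counit E f1 (fobj (Pi_f E (pol2 q)) k))
        \<cdot>\<^bsub>slice E Y\<^esub>
        farr (Sigma_f E (pol3 p))
          (inverse_of (slice E (Cod E (pol2 p))) (Beck_Chevalley E (pol2 p) f1 f0 (pol2 q) k))
        \<cdot>\<^bsub>slice E Y\<^esub>
        farr (Sigma_f E (pol3 p)) (farr (Pi_f E (pol2 p)) (Delta_comp E f0 (pol1 q) h)))\<rparr>)"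

end

theory Submission
  imports Defs
begin

text \<open>
  Everything rests on one description of the values of polynomial functors. Let
  \<open>p = (X \<leftarrow> A \<rightarrow> B \<rightarrow> Y)\<close> and \<open>h : H \<rightarrow> X\<close>. In set-theoretic terms a point of the domain of
  \<open>\<Sigma>\<^bsub>p3\<^esub> \<Pi>\<^bsub>p2\<^esub> \<Delta>\<^bsub>p1\<^esub> h\<close> is a point \<open>b\<close> of \<open>B\<close> together with a choice, for each \<open>a\<close> in the fibre of \<open>p2\<close> over
  \<open>b\<close>, of a point of \<open>H\<close> over \<open>p1 a\<close>. So a map from \<open>W\<close> into this domain should be the same as an
  element at stage \<open>W\<close>: a map \<open>b : W \<rightarrow> B\<close>, a pullback \<open>(a, c)\<close> of \<open>p2\<close> and \<open>b\<close>, and a map \<open>s\<close> from its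
  vertex to \<open>H\<close> with \<open>h s = p1 a\<close>. That this is so is the adjunction \<open>\<Delta>\<^bsub>p2\<^esub> \<stileturn> \<Pi>\<^bsub>p2\<^esub>\<close>: its counit is
  a generic element, of which every element is the restriction along a unique map
  (\<open>Pi_element_generic\<close>, \<open>poly_element_generic\<close>). The map is said to name the element. Two maps that
  name the same element are equal, and for maps out of such a domain it is enough to compare what
  they do to the generic element.

  Each canonical map then has a short formula. The functor \<open>P1\<close> sends an arrow \<open>u\<close> of \<open>\<E>/X\<close> to the map
  \<open>(b, a, c, s) \<mapsto> (b, a, c, u s)\<close> (\<open>P1_arr_names\<close>). A cartesian morphism \<open>f\<close> acts by
  \<open>(b, a, c, s) \<mapsto> (f\<^sub>1 b, f\<^sub>0 a, c, s)\<close> (\<open>P2_names\<close>), which requires following the generic element through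
  the Beck-Chevalley mate. Naturality and functoriality of \<open>P2\<close> can be read off.

  Composition is treated in the same way, because a distributivity pullback is again a generic element
  (\<open>generic_dpb\<close>). A map \<open>W \<rightarrow> G\<close> into the vertex of the composite \<open>q p\<close> is named by a map \<open>d : W \<rightarrow> D\<close>, a
  fibre \<open>(c, g)\<close> of \<open>q2\<close> over \<open>d\<close>, a map \<open>b\<close> from the vertex of this fibre to \<open>B\<close> with \<open>p3 b = q1 c\<close>, and a fibre
  \<open>(a, e)\<close> of \<open>p2\<close> over \<open>b\<close> (\<open>composite_lift\<close>, \<open>composite_unique\<close>, \<open>composite_decompose\<close>). In terms of such
  composable data horizontal composition is componentwise (\<open>hcomp_composite\<close>) and the associator and
  the unitors are the evident rebracketings (\<open>assoc_composite\<close>, \<open>lunit_composite\<close>, \<open>runit_composite\<close>). A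
  coherence law holds because both sides send the identity of their source, decomposed into
  composable data, to the same data. An element of the composite polynomial functor is a
  composable pair of elements; this gives the comparison cells \<open>Phi\<close> and \<open>Psi\<close> (\<open>Phi_names\<close>, \<open>Phi_iso\<close>),
  and their naturality and coherence are once more comparisons of named elements.

  Two points are of a different kind. For a composite of polynomials to be a polynomial, exponentiable
  maps must be closed under pullback and composition. By \<open>exponentiableI\<close> a map is exponentiable as
  soon as generic elements exist, and they are constructed from the given ones
  (\<open>exponentiable_pullback\<close>, \<open>exponentiable_comp\<close>). Invertibility of the coherence cells of the bicategory of polynomials is
  obtained last: the local functors \<open>P2\<close> reflect isomorphisms (\<open>P2_reflects_iso\<close>), since the value of \<open>p\<close>
  at the terminal object of \<open>\<E>/X\<close> is \<open>p3\<close>, and the coherence equations for \<open>Phi\<close> and \<open>Psi\<close> exhibit the images of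
  the associator and the unitors as composites of invertible cells.
\<close>

section \<open>Arrows, isomorphisms and pullbacks\<close>

lemma in_hom [simp]: "f \<in> hom C X Y \<longleftrightarrow> f \<in> Arr C \<and> Dom C f = X \<and> Cod C f = Y"
  by (simp add: hom_def)

context category
begin

lemma dom_obj [simp]: "f \<in> Arr C \<Longrightarrow> Dom C f \<in> Obj C"
  and cod_obj [simp]: "f \<in> Arr C \<Longrightarrow> Cod C f \<in> Obj C"
  by (simp_all add: dom_in cod_in)

lemma idn_arr [simp]: "X \<in> Obj C \<Longrightarrow> Idn C X \<in> Arr C"
  and idn_dom [simp]: "X \<in> Obj C \<Longrightarrow> Dom C (Idn C X) = X"
  and idn_cod [simp]: "X \<in> Obj C \<Longrightarrow> Cod C (Idn C X) = X"
  using id_in[of X] by simp_all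

lemma comp_arr [simp]: "\<lbrakk>f \<in> Arr C; g \<in> Arr C; Cod C f = Dom C g\<rbrakk> \<Longrightarrow> g \<cdot> f \<in> Arr C"
  and comp_dom [simp]: "\<lbrakk>f \<in> Arr C; g \<in> Arr C; Cod C f = Dom C g\<rbrakk> \<Longrightarrow> Dom C (g \<cdot> f) = Dom C f"
  and comp_cod [simp]: "\<lbrakk>f \<in> Arr C; g \<in> Arr C; Cod C f = Dom C g\<rbrakk> \<Longrightarrow> Cod C (g \<cdot> f) = Cod C g"
  using comp_in[of f "Dom C f" "Cod C f" g "Cod C g"] by simp_all

lemma idn_comp [simp]: "\<lbrakk>f \<in> Arr C; Cod C f = X\<rbrakk> \<Longrightarrow> Idn C X \<cdot> f = f"
  and comp_idn [simp]: "\<lbrakk>f \<in> Arr C; Dom C f = X\<rbrakk> \<Longrightarrow> f \<cdot> Idn C X = f"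
  using id_left[of f] id_right[of f] by simp_all

lemma assoc [simp]: "\<lbrakk>f \<in> Arr C; g \<in> Arr C; h \<in> Arr C; Cod C f = Dom C g; Cod C g = Dom C h\<rbrakk>
  \<Longrightarrow> (h \<cdot> g) \<cdot> f = h \<cdot> (g \<cdot> f)"
  using comp_assoc[of f "Dom C f" "Cod C f" g "Cod C g" h "Cod C h"] by simp

text \<open>Composites are kept nested to the right. An equation between two of them then no longer matches once a
  further arrow is composed on the right; this rule restores it.\<close>

lemma comp_left_eq:
  "\<lbrakk>g \<cdot> f = k; x \<in> Arr C; f \<in> Arr C; g \<in> Arr C; Cod C x = Dom C f; Cod C f = Dom C g\<rbrakk>
    \<Longrightarrow> g \<cdot> (f \<cdot> x) = k \<cdot> x"
  by (metis assoc)

lemma inverse_arrows_unique: "\<lbrakk>inverse_arrows C f g; inverse_arrows C f h\<rbrakk> \<Longrightarrow> g = h"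
  unfolding inverse_arrows_def by simp (metis assoc comp_idn idn_comp)

lemma inverse_of_eq: "inverse_arrows C f g \<Longrightarrow> inverse_of C f = g"
  unfolding inverse_of_def using inverse_arrows_unique by blast

lemma inverse_arrowsI:
  "\<lbrakk>f \<in> Arr C; g \<in> Arr C; Dom C g = Cod C f; Cod C g = Dom C f;
    g \<cdot> f = Idn C (Dom C f); f \<cdot> g = Idn C (Cod C f)\<rbrakk> \<Longrightarrow> inverse_arrows C f g"
  by (simp add: inverse_arrows_def)

lemma iso_inverse:
  assumes "is_iso C f"
  shows "inverse_of C f \<in> Arr C" "Dom C (inverse_of C f) = Cod C f" "Cod C (inverse_of C f) = Dom C f"
    "inverse_of C f \<cdot> f = Idn C (Dom C f)" "f \<cdot> inverse_of C f = Idn C (Cod C f)" "f \<in> Arr C"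
proof -
  obtain g where g: "inverse_arrows C f g" using assms by (auto simp: is_iso_def)
  then show "inverse_of C f \<in> Arr C" "Dom C (inverse_of C f) = Cod C f" "Cod C (inverse_of C f) = Dom C f"
    "inverse_of C f \<cdot> f = Idn C (Dom C f)" "f \<cdot> inverse_of C f = Idn C (Cod C f)" "f \<in> Arr C"
    by (simp_all add: inverse_of_eq[OF g] inverse_arrows_def)
qed

lemma is_isoI:
  "\<lbrakk>f \<in> Arr C; g \<in> Arr C; Dom C g = Cod C f; Cod C g = Dom C f;
    g \<cdot> f = Idn C (Dom C f); f \<cdot> g = Idn C (Cod C f)\<rbrakk> \<Longrightarrow> is_iso C f"
  unfolding is_iso_def using inverse_arrowsI by blast

lemma iso_idn [simp]: "X \<in> Obj C \<Longrightarrow> is_iso C (Idn C X)"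
  by (rule is_isoI[where g = "Idn C X"]) simp_all

lemma iso_inverse_iso: "is_iso C f \<Longrightarrow> is_iso C (inverse_of C f)"
  using iso_inverse[of f] by (intro is_isoI[where g = f]) simp_all

lemma iso_comp:
  assumes "is_iso C f" "is_iso C g" "Cod C f = Dom C g" shows "is_iso C (g \<cdot> f)"
proof -
  note f = iso_inverse[OF assms(1)] and g = iso_inverse[OF assms(2)]
  show ?thesis
    by (rule is_isoI[where g = "inverse_of C f \<cdot> inverse_of C g"])
      (simp_all add: f g assms comp_left_eq[OF g(4)] comp_left_eq[OF f(5)])
qed

lemma iso_cancel_left:
  assumes "is_iso C g" "f \<in> Arr C" "f' \<in> Arr C" "Cod C f = Dom C g" "Cod C f' = Dom C g" "g \<cdot> f = g \<cdot> f'"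
  shows "f = f'"
proof -
  note g = iso_inverse[OF assms(1)]
  have "inverse_of C g \<cdot> (g \<cdot> f) = inverse_of C g \<cdot> (g \<cdot> f')" using assms(6) by simp
  then show ?thesis using assms(2-5) g comp_left_eq[OF g(4)] by simp
qed

lemma iso_cancel_right:
  assumes "is_iso C g" "f \<in> Arr C" "f' \<in> Arr C" "Dom C f = Cod C g" "Dom C f' = Cod C g" "f \<cdot> g = f' \<cdot> g"
  shows "f = f'"
proof -
  note g = iso_inverse[OF assms(1)]
  have "(f \<cdot> g) \<cdot> inverse_of C g = (f' \<cdot> g) \<cdot> inverse_of C g" using assms(6) by simp
  then show ?thesis using assms(2-5) g by simp
qed

lemma iso_left_factor:
  assumes "is_iso C (g \<cdot> f)" "is_iso C f" "g \<in> Arr C" "Dom C g = Cod C f" shows "is_iso C g"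
proof -
  note f = iso_inverse[OF assms(2)]
  have "g = (g \<cdot> f) \<cdot> inverse_of C f" using f assms by simp
  then show ?thesis
    using iso_comp[OF iso_inverse_iso[OF assms(2)] assms(1)] f assms by simp
qed

end

lemma is_pullbackD:
  assumes "is_pullback E f g p q"
  shows "f \<in> Arr E" "g \<in> Arr E" "p \<in> Arr E" "q \<in> Arr E" "Cod E f = Cod E g" "Dom E q = Dom E p"
    "Cod E p = Dom E f" "Cod E q = Dom E g" "f \<cdot>\<^bsub>E\<^esub> p = g \<cdot>\<^bsub>E\<^esub> q"
  using assms by (simp_all add: is_pullback_def)

locale pullback_category = category E for E :: "('o, 'a) cat" (structure) +
  assumes has_pullbacks: "has_pullbacks E"
begin

text \<open>The lifts of \<open>(h, k)\<close> through a pair of arrows that need not form a pullback, so that existence and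
  uniqueness can be proved apart.\<close>

definition is_lift :: "'a \<Rightarrow> 'a \<Rightarrow> 'a \<Rightarrow> 'a \<Rightarrow> 'a \<Rightarrow> bool" where
  "is_lift p q h k u \<longleftrightarrow> u \<in> Arr E \<and> Dom E u = Dom E h \<and> Cod E u = Dom E p \<and> p \<cdot> u = h \<and> q \<cdot> u = k"

lemma is_liftD:
  assumes "is_lift p q h k u"
  shows "u \<in> Arr E" "Dom E u = Dom E h" "Cod E u = Dom E p" "p \<cdot> u = h" "q \<cdot> u = k"
  using assms by (simp_all add: is_lift_def)

lemma pullback_lift:
  assumes "is_pullback E f g p q" "h \<in> Arr E" "k \<in> Arr E" "Dom E h = Dom E k" "Cod E h = Dom E f"
    "Cod E k = Dom E g" "f \<cdot> h = g \<cdot> k"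
  shows "\<exists>u. is_lift p q h k u"
proof -
  have "\<exists>!u. u \<in> hom E (Dom E h) (Dom E p) \<and> p \<cdot> u = h \<and> q \<cdot> u = k"
    using assms unfolding is_pullback_def by simp
  then show ?thesis unfolding is_lift_def by auto
qed

lemma pullback_eqI:
  assumes pb: "is_pullback E f g p q" and "u \<in> Arr E" "v \<in> Arr E" "Dom E u = Dom E v"
    "Cod E u = Dom E p" "Cod E v = Dom E p" "p \<cdot> u = p \<cdot> v" "q \<cdot> u = q \<cdot> v"
  shows "u = v"
proof -
  note D = is_pullbackD[OF pb]
  have "f \<cdot> (p \<cdot> u) = g \<cdot> (q \<cdot> u)"
    using assms D comp_left_eq[OF D(9), of u] by simp
  then have "\<exists>!w. w \<in> hom E (Dom E u) (Dom E p) \<and> p \<cdot> w = p \<cdot> u \<and> q \<cdot> w = q \<cdot> u"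
    using assms D unfolding is_pullback_def by simp
  then show ?thesis using assms(2-) by (metis in_hom)
qed

lemma is_pullbackI:
  assumes "f \<in> Arr E" "g \<in> Arr E" "p \<in> Arr E" "q \<in> Arr E" "Cod E f = Cod E g" "Dom E q = Dom E p"
    "Cod E p = Dom E f" "Cod E q = Dom E g" "f \<cdot> p = g \<cdot> q"
    and lift: "\<And>h k. \<lbrakk>h \<in> Arr E; k \<in> Arr E; Dom E h = Dom E k; Cod E h = Dom E f; Cod E k = Dom E g;
      f \<cdot> h = g \<cdot> k\<rbrakk> \<Longrightarrow> \<exists>u. is_lift p q h k u"
    and mono: "\<And>u v. \<lbrakk>u \<in> Arr E; v \<in> Arr E; Dom E u = Dom E v; Cod E u = Dom E p; Cod E v = Dom E p;
      p \<cdot> u = p \<cdot> v; q \<cdot> u = q \<cdot> v\<rbrakk> \<Longrightarrow> u = v"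
  shows "is_pullback E f g p q"
  unfolding is_pullback_def
proof (intro conjI allI ballI impI)
  fix T h k assume "h \<in> hom E T (Dom E f)" "k \<in> hom E T (Dom E g)" "f \<cdot> h = g \<cdot> k"
  then show "\<exists>!u. u \<in> hom E T (Dom E p) \<and> p \<cdot> u = h \<and> q \<cdot> u = k"
    using lift[of h k] mono by (auto simp: is_lift_def intro!: ex_ex1I)
qed (use assms(1-9) in simp_all)

lemma is_pullback_sym: "is_pullback E f g p q \<Longrightarrow> is_pullback E g f q p"
proof -
  assume pb: "is_pullback E f g p q"
  note D = is_pullbackD[OF pb]
  show ?thesis
  proof (rule is_pullbackI)
    fix h k assume hk: "h \<in> Arr E" "k \<in> Arr E" "Dom E h = Dom E k" "Cod E h = Dom E g" "Cod E k = Dom E f" "g \<cdot> h = f \<cdot> k"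
    then have "\<exists>u. is_lift p q k h u"
      by (intro pullback_lift[OF pb]) simp_all
    then show "\<exists>u. is_lift q p h k u"
      using D(6) hk(3) by (simp add: is_lift_def conj_ac)
  qed (use D pullback_eqI[OF pb] in simp_all)
qed

lemma pullback_paste:
  assumes 1: "is_pullback E f g p q" and 2: "is_pullback E q k r s"
  shows "is_pullback E f (g \<cdot> k) (p \<cdot> r) s"
proof -
  note D = is_pullbackD[OF 1] is_pullbackD[OF 2]
  note A = comp_left_eq[OF D(9)] comp_left_eq[OF D(18)]
  show ?thesis
  proof (rule is_pullbackI)
    show "f \<cdot> (p \<cdot> r) = (g \<cdot> k) \<cdot> s" using D by (simp add: A)
  next
    fix h m assume h: "h \<in> Arr E" "m \<in> Arr E" "Dom E h = Dom E m" "Cod E h = Dom E f"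
      "Cod E m = Dom E (g \<cdot> k)" "f \<cdot> h = (g \<cdot> k) \<cdot> m"
    have c: "Cod E m = Dom E k" using h(5) D by simp
    have e: "f \<cdot> h = g \<cdot> k \<cdot> m" using h(2,6) c D by simp
    have "\<exists>u. is_lift p q h (k \<cdot> m) u"
      by (rule pullback_lift[OF 1]) (use h(1-4) c e D in simp_all)
    then obtain u where "is_lift p q h (k \<cdot> m) u" by blast
    note u = is_liftD[OF this]
    have "\<exists>v. is_lift r s u m v"
      by (rule pullback_lift[OF 2]) (use h(1-4) c u D in simp_all)
    then obtain v where "is_lift r s u m v" by blast
    note v = is_liftD[OF this]
    show "\<exists>u. is_lift (p \<cdot> r) s h m u"
      using u v D by (intro exI[of _ v]) (simp add: is_lift_def)
  next
    fix u v assume h: "u \<in> Arr E" "v \<in> Arr E" "Dom E u = Dom E v" "Cod E u = Dom E (p \<cdot> r)"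
      "Cod E v = Dom E (p \<cdot> r)" "(p \<cdot> r) \<cdot> u = (p \<cdot> r) \<cdot> v" "s \<cdot> u = s \<cdot> v"
    have c: "Cod E u = Dom E r" "Cod E v = Dom E r" using h(4,5) D by simp_all
    have e: "p \<cdot> r \<cdot> u = p \<cdot> r \<cdot> v" using h(1,2,6) c D by simp
    have "q \<cdot> r \<cdot> u = q \<cdot> r \<cdot> v" using h(1,2,7) c D A(2)[of u] A(2)[of v] by simp
    then have "r \<cdot> u = r \<cdot> v"
      by (intro pullback_eqI[OF 1 _ _ _ _ _ e]) (use h(1-3) c D in simp_all)
    then show "u = v" by (intro pullback_eqI[OF 2 _ _ _ _ _ _ h(7)]) (use h(1-3) c D in simp_all)
  qed (use D in simp_all)
qed

lemma pullback_cancel: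
  assumes 1: "is_pullback E f g p q" and 2: "is_pullback E f (g \<cdot> k) (p \<cdot> r) s"
    and r: "r \<in> Arr E" "Cod E r = Dom E p" and k: "k \<in> Arr E" "Cod E k = Dom E g" and eq: "q \<cdot> r = k \<cdot> s"
  shows "is_pullback E q k r s"
proof -
  note D = is_pullbackD[OF 1] is_pullbackD[OF 2] r k
  have s: "Dom E s = Dom E r" "Cod E s = Dom E k" using D by simp_all
  note A = comp_left_eq[OF D(9)] comp_left_eq[OF eq]
  show ?thesis
  proof (rule is_pullbackI)
    fix h m assume h: "h \<in> Arr E" "m \<in> Arr E" "Dom E h = Dom E m" "Cod E h = Dom E q"
      "Cod E m = Dom E k" "q \<cdot> h = k \<cdot> m"
    have eq': "f \<cdot> (p \<cdot> h) = (g \<cdot> k) \<cdot> m" using h s D(1-9) k by (simp add: A)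
    have "\<exists>v. is_lift (p \<cdot> r) s (p \<cdot> h) m v"
      by (rule pullback_lift[OF 2]) (use h s eq' D(1-9) r k in simp_all)
    then obtain v where "is_lift (p \<cdot> r) s (p \<cdot> h) m v" by blast
    note v = is_liftD[OF this]
    have sA: "s \<in> Arr E" using D by simp
    have e1: "p \<cdot> (r \<cdot> v) = p \<cdot> h" using v r D(1-9) by simp
    have e2: "q \<cdot> (r \<cdot> v) = q \<cdot> h" using v r D(1-9) k s sA h(6) comp_left_eq[OF eq, of v] by simp
    have "r \<cdot> v = h" by (rule pullback_eqI[OF 1]) (use e1 e2 h(1-4) v(1-3) D(1-9) r in simp_all)
    then show "\<exists>u. is_lift r s h m u"
      using v(1,3,5) h(1-4) v(2) r D(1-9) by (intro exI[of _ v]) (simp add: is_lift_def)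
  next
    fix u v assume h: "u \<in> Arr E" "v \<in> Arr E" "Dom E u = Dom E v" "Cod E u = Dom E r"
      "Cod E v = Dom E r" "r \<cdot> u = r \<cdot> v" "s \<cdot> u = s \<cdot> v"
    show "u = v" by (rule pullback_eqI[OF 2]) (use h s D(1-9) r k in simp_all)
  qed (use D s eq in simp_all)
qed

text \<open>Pasting and cancelling with the two legs of the cospan interchanged: here the map that is pulled back
  is the composite.\<close>

lemma pullback_paste':
  assumes "is_pullback E f p p' q'" and "is_pullback E g k p q"
  shows "is_pullback E (g \<cdot> f) k p' (q \<cdot> q')"
  using pullback_paste[OF is_pullback_sym[OF assms(2)] is_pullback_sym[OF assms(1)]] is_pullback_sym by blast

lemma pullback_cancel':
  assumes "is_pullback E g k p q" "is_pullback E (g \<cdot> f) k p' (q \<cdot> w)"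
    "f \<in> Arr E" "Cod E f = Dom E g" "w \<in> Arr E" "Cod E w = Dom E p" "p \<cdot> w = f \<cdot> p'"
  shows "is_pullback E f p p' w"
proof -
  have "is_pullback E p f w p'"
    by (rule pullback_cancel[OF is_pullback_sym[OF assms(1)] is_pullback_sym[OF assms(2)]])
      (simp_all add: assms(3-) is_pullbackD[OF assms(1)])
  then show ?thesis by (rule is_pullback_sym)
qed

lemma pullback_of_isos:
  assumes "is_iso E g" "is_iso E p" "f \<in> Arr E" "q \<in> Arr E" "Cod E p = Dom E f" "Cod E g = Cod E f"
    "Dom E q = Dom E p" "Cod E q = Dom E g" and eq: "f \<cdot> p = g \<cdot> q"
  shows "is_pullback E f g p q"
proof -
  note I = iso_inverse[OF assms(1)] iso_inverse[OF assms(2)]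
  show ?thesis
  proof (rule is_pullbackI)
    fix h m assume h: "h \<in> Arr E" "m \<in> Arr E" "Dom E h = Dom E m" "Cod E h = Dom E f"
      "Cod E m = Dom E g" "f \<cdot> h = g \<cdot> m"
    let ?u = "inverse_of E p \<cdot> h"
    have "g \<cdot> (q \<cdot> ?u) = g \<cdot> m"
      using comp_left_eq[OF I(11), of h] comp_left_eq[OF eq, of ?u] h I assms by simp
    then have "q \<cdot> ?u = m" using iso_cancel_left[OF assms(1)] assms h I by simp
    then show "\<exists>u. is_lift p q h m u"
      using h I assms comp_left_eq[OF I(11), of h] by (intro exI[of _ ?u]) (simp add: is_lift_def)
  qed (use assms I iso_cancel_left[OF assms(2)] in simp_all)
qed

lemma pullback_idn_left: "\<lbrakk>f \<in> Arr E; X = Cod E f; Y = Dom E f\<rbrakk> \<Longrightarrow> is_pullback E (Idn E X) f f (Idn E Y)"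
  by (intro is_pullback_sym[OF pullback_of_isos]) simp_all

lemma pullback_idn_right: "\<lbrakk>f \<in> Arr E; X = Cod E f; Y = Dom E f\<rbrakk> \<Longrightarrow> is_pullback E f (Idn E X) (Idn E Y) f"
  using pullback_idn_left is_pullback_sym by blast

text \<open>Transfers facts between the chosen pullbacks and arbitrary ones.\<close>

lemma pullback_compare:
  assumes 1: "is_pullback E f g p q" and 2: "is_pullback E f g p' q'"
  obtains i where "is_iso E i" "i \<in> Arr E" "Dom E i = Dom E p'" "Cod E i = Dom E p" "p \<cdot> i = p'" "q \<cdot> i = q'"
proof -
  note D = is_pullbackD[OF 1] is_pullbackD[OF 2]
  have "\<exists>i. is_lift p q p' q' i" by (rule pullback_lift[OF 1]) (use D in simp_all)
  then obtain i where "is_lift p q p' q' i" by blast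
  note i = is_liftD[OF this]
  have "\<exists>j. is_lift p' q' p q j" by (rule pullback_lift[OF 2]) (use D in simp_all)
  then obtain j where "is_lift p' q' p q j" by blast
  note j = is_liftD[OF this]
  have "i \<cdot> j = Idn E (Cod E i)"
    by (rule pullback_eqI[OF 1]) (use D i(1-3) j comp_left_eq[OF i(4), of j] comp_left_eq[OF i(5), of j] in simp_all)
  moreover have "j \<cdot> i = Idn E (Dom E i)"
    by (rule pullback_eqI[OF 2]) (use D i j(1-3) comp_left_eq[OF j(4), of i] comp_left_eq[OF j(5), of i] in simp_all)
  ultimately have "is_iso E i" using i j by (intro is_isoI[of i j]) simp_all
  then show ?thesis using that i by blast
qed

lemma pullback_iso_left:
  assumes pb: "is_pullback E f g p q" and i: "is_iso E f" shows "is_iso E q"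
proof -
  note D = is_pullbackD[OF pb] and I = iso_inverse[OF i]
  have "is_pullback E f g (inverse_of E f \<cdot> g) (Idn E (Dom E g))"
    using D I comp_left_eq[OF I(5), of g] by (intro is_pullback_sym[OF pullback_of_isos]) (simp_all add: i)
  then obtain i where "is_iso E i" "i \<in> Arr E" "Dom E i = Dom E p" "Cod E i = Dom E g" "Idn E (Dom E g) \<cdot> i = q"
    using pullback_compare[OF _ pb] I D by (metis comp_dom comp_arr)
  then show ?thesis using D by simp
qed

lemma pullback_iso_right: "\<lbrakk>is_pullback E f g p q; is_iso E g\<rbrakk> \<Longrightarrow> is_iso E p"
  using pullback_iso_left is_pullback_sym by blast

lemma pb_pullback:
  assumes "f \<in> Arr E" "g \<in> Arr E" "Cod E f = Cod E g"
  shows "is_pullback E f g (fst (pb E f g)) (snd (pb E f g))"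
proof -
  have "\<exists>z. case z of (p, q) \<Rightarrow> is_pullback E f g p q"
    using has_pullbacks assms unfolding has_pullbacks_def by fast
  from someI_ex[OF this] show ?thesis unfolding pb_def by (simp add: case_prod_unfold)
qed

lemma pb_lift:
  assumes "f \<in> Arr E" "g \<in> Arr E" "Cod E f = Cod E g" "h \<in> Arr E" "k \<in> Arr E" "Dom E h = Dom E k"
    "Cod E h = Dom E f" "Cod E k = Dom E g" "f \<cdot> h = g \<cdot> k"
  shows "pb_lift E f g h k \<in> Arr E" "Dom E (pb_lift E f g h k) = Dom E h"
    "Cod E (pb_lift E f g h k) = Dom E (fst (pb E f g))"
    "fst (pb E f g) \<cdot> pb_lift E f g h k = h" "snd (pb E f g) \<cdot> pb_lift E f g h k = k"
proof -
  note pb = pb_pullback[OF assms(1-3)]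
  have "\<exists>!u. u \<in> hom E (Dom E h) (Dom E (fst (pb E f g))) \<and> fst (pb E f g) \<cdot> u = h \<and> snd (pb E f g) \<cdot> u = k"
    using pb assms unfolding is_pullback_def by simp
  from theI'[OF this] show "pb_lift E f g h k \<in> Arr E" "Dom E (pb_lift E f g h k) = Dom E h"
    "Cod E (pb_lift E f g h k) = Dom E (fst (pb E f g))"
    "fst (pb E f g) \<cdot> pb_lift E f g h k = h" "snd (pb E f g) \<cdot> pb_lift E f g h k = k"
    by (simp_all add: pb_lift_def)
qed

end

section \<open>Functors, transformations and adjunctions\<close>

lemma is_functorD:
  assumes "is_functor C D F"
  shows "X \<in> Obj C \<Longrightarrow> fobj F X \<in> Obj D"
    and "f \<in> Arr C \<Longrightarrow> farr F f \<in> Arr D"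
    and "f \<in> Arr C \<Longrightarrow> Dom D (farr F f) = fobj F (Dom C f)"
    and "f \<in> Arr C \<Longrightarrow> Cod D (farr F f) = fobj F (Cod C f)"
    and "X \<in> Obj C \<Longrightarrow> farr F (Idn C X) = Idn D (fobj F X)"
    and "\<lbrakk>f \<in> Arr C; g \<in> Arr C; Cod C f = Dom C g\<rbrakk> \<Longrightarrow> farr F (g \<cdot>\<^bsub>C\<^esub> f) = farr F g \<cdot>\<^bsub>D\<^esub> farr F f"
    and "fobj F \<in> extensional (Obj C)" and "farr F \<in> extensional (Arr C)"
  using assms unfolding is_functor_def functor_maps_def by (simp_all add: extensional_def)

lemma is_functorI:
  assumes "\<And>X. X \<in> Obj C \<Longrightarrow> fobj F X \<in> Obj D"
    and "\<And>f. f \<in> Arr C \<Longrightarrow> farr F f \<in> Arr D \<and> Dom D (farr F f) = fobj F (Dom C f) \<and> Cod D (farr F f) = fobj F (Cod C f)"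
    and "\<And>X. X \<in> Obj C \<Longrightarrow> farr F (Idn C X) = Idn D (fobj F X)"
    and "\<And>f g. \<lbrakk>f \<in> Arr C; g \<in> Arr C; Cod C f = Dom C g\<rbrakk> \<Longrightarrow> farr F (g \<cdot>\<^bsub>C\<^esub> f) = farr F g \<cdot>\<^bsub>D\<^esub> farr F f"
    and "fobj F \<in> extensional (Obj C)" and "farr F \<in> extensional (Arr C)"
  shows "is_functor C D F"
  using assms unfolding is_functor_def functor_maps_def by simp

lemma functor_iso:
  assumes C: "category C" and D: "category D" and F: "is_functor C D F" and i: "is_iso C f"
  shows "is_iso D (farr F f)"
proof -
  interpret C: category C by (rule C)
  interpret D: category D by (rule D)
  note F' = is_functorD[OF F] and I = C.iso_inverse[OF i]
  show ?thesis
    by (rule D.is_isoI[of _ "farr F (inverse_of C f)"])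
      (use F'(6)[of f "inverse_of C f"] F'(6)[of "inverse_of C f" f] in \<open>simp_all add: F'(1-5) I\<close>)
qed

lemma id_func_functor: "category C \<Longrightarrow> is_functor C C (id_func C)"
  by (rule is_functorI)
    (auto simp: id_func_def category.dom_obj category.cod_obj category.idn_arr category.comp_arr)

lemma id_func_simps [simp]:
  "X \<in> Obj C \<Longrightarrow> fobj (id_func C) X = X" "f \<in> Arr C \<Longrightarrow> farr (id_func C) f = f"
  by (simp_all add: id_func_def)

lemma comp_func_simps [simp]:
  "X \<in> Obj C \<Longrightarrow> fobj (comp_func C G F) X = fobj G (fobj F X)"
  "f \<in> Arr C \<Longrightarrow> farr (comp_func C G F) f = farr G (farr F f)"
  by (simp_all add: comp_func_def)

lemma comp_func_functor:
  assumes C: "category C" and F: "is_functor C D F" and G: "is_functor D K G"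
  shows "is_functor C K (comp_func C G F)"
proof -
  interpret C: category C by (rule C)
  note F' = is_functorD[OF F] and G' = is_functorD[OF G]
  show ?thesis
    by (rule is_functorI) (simp_all add: F'(1-6) G'(1-6), simp_all add: comp_func_def)
qed

lemma comp_func_assoc:
  assumes F: "is_functor B C F"
  shows "comp_func B (comp_func C H G) F = comp_func B H (comp_func B G F)"
  by (auto simp: comp_func_def is_functorD(1,2)[OF F] restrict_def)

lemma comp_func_id:
  assumes F: "is_functor C D F"
  shows "comp_func C (id_func D) F = F" "comp_func C F (id_func C) = F"
  using is_functorD(1,2,7,8)[OF F]
  by (auto intro!: func.equality ext simp: comp_func_def id_func_def extensional_def restrict_def)

lemma is_ntransD:
  assumes "is_ntrans C D \<tau>"
  shows "is_functor C D (ndom \<tau>)" "is_functor C D (ncod \<tau>)"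
    "X \<in> Obj C \<Longrightarrow> ncmp \<tau> X \<in> Arr D"
    "X \<in> Obj C \<Longrightarrow> Dom D (ncmp \<tau> X) = fobj (ndom \<tau>) X"
    "X \<in> Obj C \<Longrightarrow> Cod D (ncmp \<tau> X) = fobj (ncod \<tau>) X"
    "f \<in> Arr C \<Longrightarrow> ncmp \<tau> (Cod C f) \<cdot>\<^bsub>D\<^esub> farr (ndom \<tau>) f = farr (ncod \<tau>) f \<cdot>\<^bsub>D\<^esub> ncmp \<tau> (Dom C f)"
    "ncmp \<tau> \<in> extensional (Obj C)"
  using assms unfolding is_ntrans_def by simp_all

lemma is_ntransI:
  assumes "is_functor C D (ndom \<tau>)" "is_functor C D (ncod \<tau>)"
    "\<And>X. X \<in> Obj C \<Longrightarrow> ncmp \<tau> X \<in> Arr D \<and> Dom D (ncmp \<tau> X) = fobj (ndom \<tau>) X \<and> Cod D (ncmp \<tau> X) = fobj (ncod \<tau>) X"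
    "\<And>f. f \<in> Arr C \<Longrightarrow> ncmp \<tau> (Cod C f) \<cdot>\<^bsub>D\<^esub> farr (ndom \<tau>) f = farr (ncod \<tau>) f \<cdot>\<^bsub>D\<^esub> ncmp \<tau> (Dom C f)"
    "ncmp \<tau> \<in> extensional (Obj C)"
  shows "is_ntrans C D \<tau>"
  using assms unfolding is_ntrans_def by auto

lemma ntrans_eqI:
  assumes "is_ntrans C D \<sigma>" "is_ntrans C D \<tau>" "ndom \<sigma> = ndom \<tau>" "ncod \<sigma> = ncod \<tau>"
    "\<And>X. X \<in> Obj C \<Longrightarrow> ncmp \<sigma> X = ncmp \<tau> X"
  shows "\<sigma> = (\<tau> :: ('o, 'a, 'p, 'b) ntrans)"
proof (rule ntrans.equality)
  show "ncmp \<sigma> = ncmp \<tau>"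
    using is_ntransD(7)[OF assms(1)] is_ntransD(7)[OF assms(2)] assms(5) by (rule extensionalityI)
qed (use assms in simp_all)

lemma func_cat_simps [simp]:
  "Obj (func_cat C D) = {F. is_functor C D F}" "Arr (func_cat C D) = {\<tau>. is_ntrans C D \<tau>}"
  "Dom (func_cat C D) = ndom" "Cod (func_cat C D) = ncod" "Idn (func_cat C D) = id_ntrans C D"
  "ndom (\<sigma> \<cdot>\<^bsub>func_cat C D\<^esub> \<tau>) = ndom \<tau>" "ncod (\<sigma> \<cdot>\<^bsub>func_cat C D\<^esub> \<tau>) = ncod \<sigma>"
  "X \<in> Obj C \<Longrightarrow> ncmp (\<sigma> \<cdot>\<^bsub>func_cat C D\<^esub> \<tau>) X = ncmp \<sigma> X \<cdot>\<^bsub>D\<^esub> ncmp \<tau> X"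
  by (simp_all add: func_cat_def)

lemma id_ntrans_simps [simp]:
  "ndom (id_ntrans C D F) = F" "ncod (id_ntrans C D F) = F"
  "X \<in> Obj C \<Longrightarrow> ncmp (id_ntrans C D F) X = Idn D (fobj F X)"
  by (simp_all add: id_ntrans_def)

lemma id_ntrans_ntrans:
  assumes "category C" "category D" "is_functor C D F"
  shows "is_ntrans C D (id_ntrans C D F)"
proof -
  interpret C: category C by (rule assms)
  interpret D: category D by (rule assms)
  note F = is_functorD[OF assms(3)]
  show ?thesis
    by (rule is_ntransI) (simp_all add: F(1-6) assms, simp add: id_ntrans_def)
qed

lemma vcomp_ntrans:
  assumes C: "category C" and D: "category D" and s: "is_ntrans C D \<sigma>" and t: "is_ntrans C D \<tau>"
    and m: "ndom \<sigma> = ncod \<tau>"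
  shows "is_ntrans C D (\<sigma> \<cdot>\<^bsub>func_cat C D\<^esub> \<tau>)"
proof -
  interpret C: category C by (rule C)
  interpret D: category D by (rule D)
  note S = is_ntransD[OF s] and T = is_ntransD[OF t]
  note FS = is_functorD[OF S(1)] is_functorD[OF S(2)] and FT = is_functorD[OF T(1)] is_functorD[OF T(2)]
  show ?thesis
  proof (rule is_ntransI)
    fix f assume f: "f \<in> Arr C"
    show "ncmp (\<sigma> \<cdot>\<^bsub>func_cat C D\<^esub> \<tau>) (Cod C f) \<cdot>\<^bsub>D\<^esub> farr (ndom (\<sigma> \<cdot>\<^bsub>func_cat C D\<^esub> \<tau>)) f
      = farr (ncod (\<sigma> \<cdot>\<^bsub>func_cat C D\<^esub> \<tau>)) f \<cdot>\<^bsub>D\<^esub> ncmp (\<sigma> \<cdot>\<^bsub>func_cat C D\<^esub> \<tau>) (Dom C f)"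
      using f D.comp_left_eq[OF S(6)[OF f], of "ncmp \<tau> (Dom C f)"] T(6)[OF f]
      by (simp add: S(3-5) T(3-5) FS FT m)
  qed (simp_all add: S(1-5) T(1-5) m, simp add: func_cat_def)
qed

lemma func_cat_category:
  assumes C: "category C" and D: "category D"
  shows "category (func_cat C D)"
proof -
  interpret C: category C by (rule C)
  interpret D: category D by (rule D)
  show ?thesis
  proof (unfold_locales)
    fix \<tau> X Y assume t: "\<tau> \<in> hom (func_cat C D) X Y"
    note T = is_ntransD[of C D \<tau>]
    show "Idn (func_cat C D) Y \<cdot>\<^bsub>func_cat C D\<^esub> \<tau> = \<tau>"
      using t by (intro ntrans_eqI[of C D]) (auto simp: T C D vcomp_ntrans id_ntrans_ntrans)
    show "\<tau> \<cdot>\<^bsub>func_cat C D\<^esub> Idn (func_cat C D) X = \<tau>"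
      using t by (intro ntrans_eqI[of C D]) (auto simp: T C D vcomp_ntrans id_ntrans_ntrans)
  next
    fix \<rho> \<sigma> \<tau> W X Y Z
    assume t: "\<rho> \<in> hom (func_cat C D) W X" "\<sigma> \<in> hom (func_cat C D) X Y" "\<tau> \<in> hom (func_cat C D) Y Z"
    show "(\<tau> \<cdot>\<^bsub>func_cat C D\<^esub> \<sigma>) \<cdot>\<^bsub>func_cat C D\<^esub> \<rho> = \<tau> \<cdot>\<^bsub>func_cat C D\<^esub> (\<sigma> \<cdot>\<^bsub>func_cat C D\<^esub> \<rho>)"
      using t by (intro ntrans_eqI[of C D]) (auto simp: C D vcomp_ntrans is_ntransD[of C D])
  qed (auto simp: is_ntransD id_ntrans_ntrans vcomp_ntrans C D)
qed

lemma iso_ntransI: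
  assumes C: "category C" and D: "category D" and t: "is_ntrans C D \<tau>"
    and iso: "\<And>X. X \<in> Obj C \<Longrightarrow> is_iso D (ncmp \<tau> X)"
  shows "is_iso (func_cat C D) \<tau>"
proof -
  interpret C: category C by (rule C)
  interpret D: category D by (rule D)
  note T = is_ntransD[OF t] note F = is_functorD[OF T(1)] is_functorD[OF T(2)]
  note I = D.iso_inverse[OF iso]
  define \<sigma> where "\<sigma> = \<lparr>ndom = ncod \<tau>, ncod = ndom \<tau>, ncmp = (\<lambda>X\<in>Obj C. inverse_of D (ncmp \<tau> X))\<rparr>"
  have s: "is_ntrans C D \<sigma>"
  proof (rule is_ntransI)
    fix f assume f: "f \<in> Arr C"
    let ?d = "ncmp \<tau> (Dom C f)" and ?c = "ncmp \<tau> (Cod C f)"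
    have "?c \<cdot>\<^bsub>D\<^esub> inverse_of D ?c \<cdot>\<^bsub>D\<^esub> farr (ncod \<tau>) f = ?c \<cdot>\<^bsub>D\<^esub> farr (ndom \<tau>) f \<cdot>\<^bsub>D\<^esub> inverse_of D ?d"
      using f D.comp_left_eq[OF T(6)[OF f], of "inverse_of D ?d"] D.comp_left_eq[OF I(5), of "Cod C f" "farr (ncod \<tau>) f"]
      by (simp add: T(3-5) F I)
    then have "inverse_of D ?c \<cdot>\<^bsub>D\<^esub> farr (ncod \<tau>) f = farr (ndom \<tau>) f \<cdot>\<^bsub>D\<^esub> inverse_of D ?d"
      by (rule D.iso_cancel_left[OF iso[of "Cod C f"], rotated -1]) (use f in \<open>simp_all add: T(3-5) F I\<close>)
    then show "ncmp \<sigma> (Cod C f) \<cdot>\<^bsub>D\<^esub> farr (ndom \<sigma>) f = farr (ncod \<sigma>) f \<cdot>\<^bsub>D\<^esub> ncmp \<sigma> (Dom C f)"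
      using f by (simp add: \<sigma>_def)
  qed (simp_all add: \<sigma>_def T I)
  note fc = func_cat_category[OF C D]
  have 1: "\<sigma> \<cdot>\<^bsub>func_cat C D\<^esub> \<tau> = id_ntrans C D (ndom \<tau>)"
    by (rule ntrans_eqI[of C D]) (use s t T I in \<open>simp_all add: vcomp_ntrans id_ntrans_ntrans C D \<sigma>_def\<close>)
  have 2: "\<tau> \<cdot>\<^bsub>func_cat C D\<^esub> \<sigma> = id_ntrans C D (ncod \<tau>)"
    by (rule ntrans_eqI[of C D]) (use s t T I in \<open>simp_all add: vcomp_ntrans id_ntrans_ntrans C D \<sigma>_def\<close>)
  show ?thesis
    by (rule category.is_isoI[OF fc, of _ \<sigma>]) (use s t 1 2 in \<open>simp_all\<close>, simp_all add: \<sigma>_def)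
qed

lemma iso_ntransD:
  assumes C: "category C" and D: "category D" and iso: "is_iso (func_cat C D) \<tau>" and X: "X \<in> Obj C"
  shows "is_iso D (ncmp \<tau> X)"
proof -
  interpret D: category D by (rule D)
  note I = category.iso_inverse[OF func_cat_category[OF C D] iso]
  let ?s = "inverse_of (func_cat C D) \<tau>"
  note T = is_ntransD[of C D \<tau>] is_ntransD[of C D ?s]
  have "ncmp ?s X \<cdot>\<^bsub>D\<^esub> ncmp \<tau> X = Idn D (fobj (ndom \<tau>) X)" "ncmp \<tau> X \<cdot>\<^bsub>D\<^esub> ncmp ?s X = Idn D (fobj (ncod \<tau>) X)"
    using arg_cong[OF I(4), of "\<lambda>t. ncmp t X"] arg_cong[OF I(5), of "\<lambda>t. ncmp t X"] X by simp_all
  then show ?thesis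
    by (intro D.is_isoI[of _ "ncmp ?s X"]) (use I(1-3,6) X T in simp_all)
qed

text \<open>Transposition across an adjunction is bijective.\<close>

context adjunction
begin

lemma transpose:
  assumes cats: "category C" "category D" and X: "X \<in> Obj C" and Y: "Y \<in> Obj D"
    and f: "f \<in> Arr D" "Dom D f = fobj F X" "Cod D f = Y"
  shows "farr G f \<cdot>\<^bsub>C\<^esub> ncmp \<eta> X \<in> Arr C" "Dom C (farr G f \<cdot>\<^bsub>C\<^esub> ncmp \<eta> X) = X"
    "Cod C (farr G f \<cdot>\<^bsub>C\<^esub> ncmp \<eta> X) = fobj G Y"
    "ncmp \<epsilon> Y \<cdot>\<^bsub>D\<^esub> farr F (farr G f \<cdot>\<^bsub>C\<^esub> ncmp \<eta> X) = f"
proof -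
  interpret C: category C by (rule cats)
  interpret D: category D by (rule cats)
  note F = is_functorD(1-6)[OF left_functor] and G = is_functorD(1-6)[OF right_functor]
  have e: "is_ntrans C C \<eta>" "ndom \<eta> = id_func C" "ncod \<eta> = comp_func C G F" using unit by simp_all
  have c: "is_ntrans D D \<epsilon>" "ndom \<epsilon> = comp_func D F G" "ncod \<epsilon> = id_func D" using counit by simp_all
  note E = is_ntransD[OF e(1), unfolded e(2,3)] and K = is_ntransD[OF c(1), unfolded c(2,3)]
  show "farr G f \<cdot>\<^bsub>C\<^esub> ncmp \<eta> X \<in> Arr C" "Dom C (farr G f \<cdot>\<^bsub>C\<^esub> ncmp \<eta> X) = X"
    "Cod C (farr G f \<cdot>\<^bsub>C\<^esub> ncmp \<eta> X) = fobj G Y"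
    using X f by (simp_all add: E G F)
  have n: "ncmp \<epsilon> Y \<cdot>\<^bsub>D\<^esub> farr F (farr G f) = f \<cdot>\<^bsub>D\<^esub> ncmp \<epsilon> (fobj F X)"
    using K(6)[OF f(1)] f by simp
  show "ncmp \<epsilon> Y \<cdot>\<^bsub>D\<^esub> farr F (farr G f \<cdot>\<^bsub>C\<^esub> ncmp \<eta> X) = f"
    using D.comp_left_eq[OF n, of "farr F (ncmp \<eta> X)"] X Y f triangle_left[OF X]
    by (simp add: E F G K)
qed

lemma transpose_transpose:
  assumes cats: "category C" "category D" and X: "X \<in> Obj C" and Y: "Y \<in> Obj D"
    and u: "u \<in> Arr C" "Dom C u = X" "Cod C u = fobj G Y"
  shows "farr G (ncmp \<epsilon> Y \<cdot>\<^bsub>D\<^esub> farr F u) \<cdot>\<^bsub>C\<^esub> ncmp \<eta> X = u"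
proof -
  interpret C: category C by (rule cats)
  interpret D: category D by (rule cats)
  note F = is_functorD(1-6)[OF left_functor] and G = is_functorD(1-6)[OF right_functor]
  have e: "is_ntrans C C \<eta>" "ndom \<eta> = id_func C" "ncod \<eta> = comp_func C G F" using unit by simp_all
  have c: "is_ntrans D D \<epsilon>" "ndom \<epsilon> = comp_func D F G" "ncod \<epsilon> = id_func D" using counit by simp_all
  note E = is_ntransD[OF e(1), unfolded e(2,3)] and K = is_ntransD[OF c(1), unfolded c(2,3)]
  have n: "ncmp \<eta> (fobj G Y) \<cdot>\<^bsub>C\<^esub> u = farr G (farr F u) \<cdot>\<^bsub>C\<^esub> ncmp \<eta> X"
    using E(6)[OF u(1)] u by simp
  show ?thesis
    using C.comp_left_eq[OF triangle_right[OF Y], of u] n X Y u by (simp add: E F G K)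
qed

end

text \<open>Conversely, a right adjoint only needs to be given on objects, by universal arrows.\<close>

lemma adjunction_of_universal_arrows:
  fixes C :: "('o, 'a) cat" and D :: "('p, 'b) cat"
  assumes cats: "category C" "category D" and F: "is_functor C D F"
    and R: "\<And>Y. Y \<in> Obj D \<Longrightarrow> R Y \<in> Obj C"
    and e: "\<And>Y. Y \<in> Obj D \<Longrightarrow> e Y \<in> hom D (fobj F (R Y)) Y"
    and univ: "\<And>X Y f. \<lbrakk>X \<in> Obj C; Y \<in> Obj D; f \<in> hom D (fobj F X) Y\<rbrakk>
      \<Longrightarrow> \<exists>!u. u \<in> hom C X (R Y) \<and> e Y \<cdot>\<^bsub>D\<^esub> farr F u = f"
  shows "\<exists>G \<eta> \<epsilon>. adjunction C D F G \<eta> \<epsilon>"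
proof -
  interpret C: category C by (rule cats)
  interpret D: category D by (rule cats)
  note F' = is_functorD(1-6)[OF F]
  have e': "e Y \<in> Arr D" "Dom D (e Y) = fobj F (R Y)" "Cod D (e Y) = Y" if "Y \<in> Obj D" for Y
    using e[OF that] by simp_all
  define tr where "tr X Y f = (THE u. u \<in> hom C X (R Y) \<and> e Y \<cdot>\<^bsub>D\<^esub> farr F u = f)" for X Y f
  have tr: "tr X Y f \<in> Arr C" "Dom C (tr X Y f) = X" "Cod C (tr X Y f) = R Y" "e Y \<cdot>\<^bsub>D\<^esub> farr F (tr X Y f) = f"
    if "X \<in> Obj C" "Y \<in> Obj D" "f \<in> Arr D" "Dom D f = fobj F X" "Cod D f = Y" for X Y f
    using theI'[OF univ[of X Y f]] that unfolding tr_def by simp_all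
  have eq: "u = v" if "Y \<in> Obj D" "u \<in> Arr C" "v \<in> Arr C" "Dom C u = Dom C v" "Cod C u = R Y" "Cod C v = R Y"
    "e Y \<cdot>\<^bsub>D\<^esub> farr F u = e Y \<cdot>\<^bsub>D\<^esub> farr F v" for u v Y
    using univ[of "Dom C u" Y "e Y \<cdot>\<^bsub>D\<^esub> farr F u"] that by (auto simp: F' e')
  define G where "G = \<lparr>fobj = (\<lambda>Y\<in>Obj D. R Y), farr = (\<lambda>g\<in>Arr D. tr (R (Dom D g)) (Cod D g) (g \<cdot>\<^bsub>D\<^esub> e (Dom D g)))\<rparr>"
  have G1: "fobj G Y = R Y" if "Y \<in> Obj D" for Y using that by (simp add: G_def)
  have G2: "farr G g = tr (R (Dom D g)) (Cod D g) (g \<cdot>\<^bsub>D\<^esub> e (Dom D g))" if "g \<in> Arr D" for g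
    using that by (simp add: G_def)
  have G3: "farr G g \<in> Arr C" "Dom C (farr G g) = R (Dom D g)" "Cod C (farr G g) = R (Cod D g)"
    "e (Cod D g) \<cdot>\<^bsub>D\<^esub> farr F (farr G g) = g \<cdot>\<^bsub>D\<^esub> e (Dom D g)" if "g \<in> Arr D" for g
    using that tr[of "R (Dom D g)" "Cod D g" "g \<cdot>\<^bsub>D\<^esub> e (Dom D g)"] by (simp_all add: G2 R e')
  have G: "is_functor D C G"
  proof (rule is_functorI)
    fix X assume X: "X \<in> Obj D"
    show "farr G (Idn D X) = Idn C (fobj G X)"
      using X G3[of "Idn D X"] by (intro eq[of X]) (simp_all add: G1 R e' F')
  next
    fix f g assume fg: "f \<in> Arr D" "g \<in> Arr D" "Cod D f = Dom D g"
    show "farr G (g \<cdot>\<^bsub>D\<^esub> f) = farr G g \<cdot>\<^bsub>C\<^esub> farr G f"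
      using fg G3[OF fg(1)] G3[OF fg(2)] G3[of "g \<cdot>\<^bsub>D\<^esub> f"] D.comp_left_eq[OF G3(4)[OF fg(2)], of "farr F (farr G f)"]
      by (intro eq[of "Cod D g"]) (simp_all add: R e' F')
  qed (simp_all add: G1 G3 R, simp_all add: G_def)
  define \<epsilon> where "\<epsilon> = \<lparr>ndom = comp_func D F G, ncod = id_func D, ncmp = (\<lambda>Y\<in>Obj D. e Y)\<rparr>"
  define \<eta> where "\<eta> = \<lparr>ndom = id_func C, ncod = comp_func C G F,
    ncmp = (\<lambda>X\<in>Obj C. tr X (fobj F X) (Idn D (fobj F X)))\<rparr>"
  have eps: "ncmp \<epsilon> Y = e Y" if "Y \<in> Obj D" for Y using that by (simp add: \<epsilon>_def)
  have \<epsilon>: "is_ntrans D D \<epsilon>"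
    by (rule is_ntransI)
      (simp_all add: eps e' G1 G3, simp_all add: \<epsilon>_def comp_func_functor[OF cats(2) G F] id_func_functor cats G3 G1 e')
  have eta: "ncmp \<eta> X \<in> Arr C" "Dom C (ncmp \<eta> X) = X" "Cod C (ncmp \<eta> X) = R (fobj F X)"
    "e (fobj F X) \<cdot>\<^bsub>D\<^esub> farr F (ncmp \<eta> X) = Idn D (fobj F X)" if "X \<in> Obj C" for X
    using that tr[of X "fobj F X" "Idn D (fobj F X)"] by (simp_all add: \<eta>_def F')
  have \<eta>: "is_ntrans C C \<eta>"
  proof (rule is_ntransI)
    fix f assume f: "f \<in> Arr C"
    have "ncmp \<eta> (Cod C f) \<cdot>\<^bsub>C\<^esub> f = farr G (farr F f) \<cdot>\<^bsub>C\<^esub> ncmp \<eta> (Dom C f)"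
      using f G3[of "farr F f"] eta D.comp_left_eq[OF G3(4)[of "farr F f"], of "farr F (ncmp \<eta> (Dom C f))"]
        D.comp_left_eq[OF eta(4)[of "Cod C f"], of "farr F f"]
      by (intro eq[of "fobj F (Cod C f)"]) (simp_all add: F' e' R)
    then show "ncmp \<eta> (Cod C f) \<cdot>\<^bsub>C\<^esub> farr (ndom \<eta>) f = farr (ncod \<eta>) f \<cdot>\<^bsub>C\<^esub> ncmp \<eta> (Dom C f)"
      using f by (simp add: \<eta>_def)
  qed (simp_all add: eta F', simp_all add: \<eta>_def comp_func_functor[OF cats(1) F G] id_func_functor cats F' G1)
  have "adjunction C D F G \<eta> \<epsilon>"
  proof
    show "\<eta> \<in> hom (func_cat C C) (id_func C) (comp_func C G F)" using \<eta> by (simp add: \<eta>_def)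
    show "\<epsilon> \<in> hom (func_cat D D) (comp_func D F G) (id_func D)" using \<epsilon> by (simp add: \<epsilon>_def)
  next
    fix X assume "X \<in> Obj C"
    then show "ncmp \<epsilon> (fobj F X) \<cdot>\<^bsub>D\<^esub> farr F (ncmp \<eta> X) = Idn D (fobj F X)" by (simp add: eps F' eta)
  next
    fix Y assume Y: "Y \<in> Obj D"
    note 1 = G3[of "e Y"] and 2 = eta[of "R Y"]
    show "farr G (ncmp \<epsilon> Y) \<cdot>\<^bsub>C\<^esub> ncmp \<eta> (fobj G Y) = Idn C (fobj G Y)"
      using Y 1 2 D.comp_left_eq[OF 1(4), of "farr F (ncmp \<eta> (R Y))"]
      by (intro eq[of Y]) (simp_all add: eps G1 R e' F')
  qed (use F G in simp_all)
  then show ?thesis by blast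
qed

section \<open>Slices\<close>

lemma slice_simps [simp]:
  "h \<in> Obj (slice E X) \<longleftrightarrow> h \<in> Arr E \<and> Cod E h = X"
  "Dom (slice E X) = sdom" "Cod (slice E X) = scod"
  "Idn (slice E X) h = \<lparr>sdom = h, scod = h, sarr = Idn E (Dom E h)\<rparr>"
  "v \<cdot>\<^bsub>slice E X\<^esub> u = \<lparr>sdom = sdom u, scod = scod v, sarr = sarr v \<cdot>\<^bsub>E\<^esub> sarr u\<rparr>"
  by (simp_all add: slice_def)

lemma in_slice_arr:
  "u \<in> Arr (slice E X) \<longleftrightarrow> sdom u \<in> Arr E \<and> Cod E (sdom u) = X \<and> scod u \<in> Arr E \<and> Cod E (scod u) = X
    \<and> sarr u \<in> Arr E \<and> Dom E (sarr u) = Dom E (sdom u) \<and> Cod E (sarr u) = Dom E (scod u) \<and> scod u \<cdot>\<^bsub>E\<^esub> sarr u = sdom u"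
  by (simp add: slice_def)

lemma slice_arr_eqI: "\<lbrakk>sdom u = sdom v; scod u = scod v; sarr u = sarr v\<rbrakk> \<Longrightarrow> u = (v :: 'a slice_arr)"
  by simp

context category
begin

lemma slice_category: "category (slice C X)"
proof
  fix f g h W X' Y Z
  assume "f \<in> hom (slice C X) W X'" "g \<in> hom (slice C X) X' Y" "h \<in> hom (slice C X) Y Z"
  then show "(h \<cdot>\<^bsub>slice C X\<^esub> g) \<cdot>\<^bsub>slice C X\<^esub> f = h \<cdot>\<^bsub>slice C X\<^esub> (g \<cdot>\<^bsub>slice C X\<^esub> f)"
    by (auto simp: in_slice_arr)
next
  fix f g X' Y Z assume "f \<in> hom (slice C X) X' Y" "g \<in> hom (slice C X) Y Z"
  then show "g \<cdot>\<^bsub>slice C X\<^esub> f \<in> hom (slice C X) X' Z"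
    using comp_left_eq[of "scod g" "sarr g" "sdom g" "sarr f"] by (auto simp: in_slice_arr)
qed (auto simp: in_slice_arr)

text \<open>An inverse in the base is automatically an arrow over \<open>X\<close>.\<close>

lemma slice_inverse_arrows:
  assumes u: "u \<in> Arr (slice C X)" and i: "is_iso C (sarr u)"
  shows "inverse_arrows (slice C X) u \<lparr>sdom = scod u, scod = sdom u, sarr = inverse_of C (sarr u)\<rparr>"
proof -
  note U = u[unfolded in_slice_arr] and I = iso_inverse[OF i]
  have "sdom u \<cdot> inverse_of C (sarr u) = scod u \<cdot> sarr u \<cdot> inverse_of C (sarr u)"
    using U I comp_left_eq[of "scod u" "sarr u" "sdom u" "inverse_of C (sarr u)"] by simp
  then show ?thesis
    using U I by (simp add: inverse_arrows_def in_slice_arr)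
qed

lemma slice_isoI: "\<lbrakk>u \<in> Arr (slice C X); is_iso C (sarr u)\<rbrakk> \<Longrightarrow> is_iso (slice C X) u"
  using slice_inverse_arrows unfolding is_iso_def by blast

lemma slice_inverse_of:
  "\<lbrakk>u \<in> Arr (slice C X); is_iso C (sarr u)\<rbrakk>
    \<Longrightarrow> inverse_of (slice C X) u = \<lparr>sdom = scod u, scod = sdom u, sarr = inverse_of C (sarr u)\<rparr>"
  using category.inverse_of_eq[OF slice_category slice_inverse_arrows] .

lemma slice_isoD: "is_iso (slice C X) u \<Longrightarrow> is_iso C (sarr u)"
proof -
  assume "is_iso (slice C X) u"
  then obtain g where "inverse_arrows (slice C X) u g" unfolding is_iso_def by blast
  then show ?thesis
    by (intro is_isoI[of "sarr u" "sarr g"]) (auto simp: inverse_arrows_def in_slice_arr)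
qed

lemma Sigma_functor:
  assumes f: "f \<in> Arr C" shows "is_functor (slice C (Dom C f)) (slice C (Cod C f)) (Sigma_f C f)"
proof -
  interpret S: category "slice C (Dom C f)" by (rule slice_category)
  show ?thesis
  proof (rule is_functorI)
    fix u assume "u \<in> Arr (slice C (Dom C f))"
    then show "farr (Sigma_f C f) u \<in> Arr (slice C (Cod C f)) \<and>
        Dom (slice C (Cod C f)) (farr (Sigma_f C f) u) = fobj (Sigma_f C f) (Dom (slice C (Dom C f)) u) \<and>
        Cod (slice C (Cod C f)) (farr (Sigma_f C f) u) = fobj (Sigma_f C f) (Cod (slice C (Dom C f)) u)"
      using f by (simp add: Sigma_f_def in_slice_arr)
  next
    fix u v assume uv: "u \<in> Arr (slice C (Dom C f))" "v \<in> Arr (slice C (Dom C f))"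
      "Cod (slice C (Dom C f)) u = Dom (slice C (Dom C f)) v"
    show "farr (Sigma_f C f) (v \<cdot>\<^bsub>slice C (Dom C f)\<^esub> u) = farr (Sigma_f C f) v \<cdot>\<^bsub>slice C (Cod C f)\<^esub> farr (Sigma_f C f) u"
      using S.comp_arr[OF uv] uv by (simp add: Sigma_f_def)
  qed (use f in \<open>auto simp: Sigma_f_def in_slice_arr\<close>)
qed

end

lemma Sigma_f_simps:
  "\<lbrakk>h \<in> Arr E; Cod E h = Dom E f\<rbrakk> \<Longrightarrow> fobj (Sigma_f E f) h = f \<cdot>\<^bsub>E\<^esub> h"
  "u \<in> Arr (slice E (Dom E f)) \<Longrightarrow> farr (Sigma_f E f) u = \<lparr>sdom = f \<cdot>\<^bsub>E\<^esub> sdom u, scod = f \<cdot>\<^bsub>E\<^esub> scod u, sarr = sarr u\<rparr>"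
  by (simp_all add: Sigma_f_def)

context pullback_category
begin

lemma Delta_obj: "\<lbrakk>h \<in> Arr E; Cod E h = Cod E f\<rbrakk> \<Longrightarrow> fobj (Delta_f E f) h = fst (pb E f h)"
  by (simp add: Delta_f_def)

lemma Delta_pullback:
  "\<lbrakk>f \<in> Arr E; h \<in> Arr E; Cod E h = Cod E f\<rbrakk> \<Longrightarrow> is_pullback E f h (fobj (Delta_f E f) h) (snd (pb E f h))"
  using pb_pullback[of f h] by (simp add: Delta_obj)

lemma Delta_arr:
  assumes f: "f \<in> Arr E" and u: "u \<in> Arr (slice E (Cod E f))"
  shows "sdom (farr (Delta_f E f) u) = fobj (Delta_f E f) (sdom u)"
    "scod (farr (Delta_f E f) u) = fobj (Delta_f E f) (scod u)"
    "sarr (farr (Delta_f E f) u) \<in> Arr E"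
    "Dom E (sarr (farr (Delta_f E f) u)) = Dom E (fobj (Delta_f E f) (sdom u))"
    "Cod E (sarr (farr (Delta_f E f) u)) = Dom E (fobj (Delta_f E f) (scod u))"
    "fobj (Delta_f E f) (scod u) \<cdot> sarr (farr (Delta_f E f) u) = fobj (Delta_f E f) (sdom u)"
    "snd (pb E f (scod u)) \<cdot> sarr (farr (Delta_f E f) u) = sarr u \<cdot> snd (pb E f (sdom u))"
proof -
  note U = u[unfolded in_slice_arr]
  note P = is_pullbackD[OF Delta_pullback[of f "sdom u"]]
  have e: "f \<cdot> fst (pb E f (sdom u)) = scod u \<cdot> sarr u \<cdot> snd (pb E f (sdom u))"
    using U f P comp_left_eq[of "scod u" "sarr u" "sdom u" "snd (pb E f (sdom u))"] by (simp add: Delta_obj)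
  have "sarr (farr (Delta_f E f) u) = pb_lift E f (scod u) (fst (pb E f (sdom u))) (sarr u \<cdot> snd (pb E f (sdom u)))"
    using u by (simp add: Delta_f_def)
  then show "sdom (farr (Delta_f E f) u) = fobj (Delta_f E f) (sdom u)"
    "scod (farr (Delta_f E f) u) = fobj (Delta_f E f) (scod u)"
    "sarr (farr (Delta_f E f) u) \<in> Arr E"
    "Dom E (sarr (farr (Delta_f E f) u)) = Dom E (fobj (Delta_f E f) (sdom u))"
    "Cod E (sarr (farr (Delta_f E f) u)) = Dom E (fobj (Delta_f E f) (scod u))"
    "fobj (Delta_f E f) (scod u) \<cdot> sarr (farr (Delta_f E f) u) = fobj (Delta_f E f) (sdom u)"
    "snd (pb E f (scod u)) \<cdot> sarr (farr (Delta_f E f) u) = sarr u \<cdot> snd (pb E f (sdom u))"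
    using pb_lift[of f "scod u" "fst (pb E f (sdom u))" "sarr u \<cdot> snd (pb E f (sdom u))"] U f P e u
    by (simp_all add: Delta_obj Delta_f_def)
qed

lemma Delta_functor:
  assumes f: "f \<in> Arr E" shows "is_functor (slice E (Cod E f)) (slice E (Dom E f)) (Delta_f E f)"
proof -
  let ?D = "Delta_f E f"
  interpret S: category "slice E (Cod E f)" by (rule slice_category)
  have P: "is_pullback E f h (fobj ?D h) (snd (pb E f h))" if "h \<in> Arr E" "Cod E h = Cod E f" for h
    using that f by (simp add: Delta_pullback)
  note PD = is_pullbackD(3,4,6-9)[OF P]
  have A: "farr ?D u \<in> Arr (slice E (Dom E f))" if u: "u \<in> Arr (slice E (Cod E f))" for u
    using u[unfolded in_slice_arr] f PD[of "sdom u"] PD[of "scod u"]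
    by (simp add: in_slice_arr Delta_arr[OF f u])
  show ?thesis
  proof (rule is_functorI)
    fix u assume u: "u \<in> Arr (slice E (Cod E f))"
    show "farr ?D u \<in> Arr (slice E (Dom E f)) \<and>
        Dom (slice E (Dom E f)) (farr ?D u) = fobj ?D (Dom (slice E (Cod E f)) u) \<and>
        Cod (slice E (Dom E f)) (farr ?D u) = fobj ?D (Cod (slice E (Cod E f)) u)"
      using A[OF u] by (simp add: Delta_arr[OF f u])
  next
    fix h assume h: "h \<in> Obj (slice E (Cod E f))"
    have i: "\<lparr>sdom = h, scod = h, sarr = Idn E (Dom E h)\<rparr> \<in> Arr (slice E (Cod E f))"
      using h by (simp add: in_slice_arr)
    note D = Delta_arr[OF f i, simplified]
    have "sarr (farr ?D \<lparr>sdom = h, scod = h, sarr = Idn E (Dom E h)\<rparr>) = Idn E (Dom E (fobj ?D h))"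
      by (rule pullback_eqI[OF P[of h]]) (use h D PD[of h] in simp_all)
    then show "farr ?D (Idn (slice E (Cod E f)) h) = Idn (slice E (Dom E f)) (fobj ?D h)"
      by (intro slice_arr_eqI) (simp_all add: D)
  next
    fix u v assume uv: "u \<in> Arr (slice E (Cod E f))" "v \<in> Arr (slice E (Cod E f))"
      "Cod (slice E (Cod E f)) u = Dom (slice E (Cod E f)) v"
    note U = uv(1)[unfolded in_slice_arr] and V = uv(2)[unfolded in_slice_arr]
    have c: "scod u = sdom v" using uv(3) by simp
    note DU = Delta_arr[OF f uv(1)] and DV = Delta_arr[OF f uv(2)] and DW = Delta_arr[OF f S.comp_arr[OF uv], simplified]
    note PU = PD[of "sdom u"] and PV = PD[of "sdom v"] and PW = PD[of "scod v"]
    have "sarr (farr ?D (v \<cdot>\<^bsub>slice E (Cod E f)\<^esub> u)) = sarr (farr ?D v) \<cdot> sarr (farr ?D u)"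
    proof (rule pullback_eqI[OF P[of "scod v"]])
      show "fobj ?D (scod v) \<cdot> sarr (farr ?D (v \<cdot>\<^bsub>slice E (Cod E f)\<^esub> u)) = fobj ?D (scod v) \<cdot> sarr (farr ?D v) \<cdot> sarr (farr ?D u)"
        using U V c DU DV DW PU PV PW comp_left_eq[OF DV(6), of "sarr (farr ?D u)"] by simp
      show "snd (pb E f (scod v)) \<cdot> sarr (farr ?D (v \<cdot>\<^bsub>slice E (Cod E f)\<^esub> u)) = snd (pb E f (scod v)) \<cdot> sarr (farr ?D v) \<cdot> sarr (farr ?D u)"
        using U V c DU DV DW PU PV PW comp_left_eq[OF DV(7), of "sarr (farr ?D u)"] by simp
    qed (use U V c DU DV DW in simp_all)
    then show "farr ?D (v \<cdot>\<^bsub>slice E (Cod E f)\<^esub> u) = farr ?D v \<cdot>\<^bsub>slice E (Dom E f)\<^esub> farr ?D u"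
      by (intro slice_arr_eqI) (simp_all add: DU DV DW)
  qed (use f PD in \<open>auto simp: Delta_f_def in_slice_arr Delta_obj\<close>)
qed

end

section \<open>Generic elements\<close>

text \<open>For \<open>x : A \<rightarrow> X\<close>, \<open>f : A \<rightarrow> B\<close> and \<open>h : H \<rightarrow> X\<close>, the record \<open>El b a c s\<close> is to describe a map \<open>W \<rightarrow> \<Pi>\<^bsub>f\<^esub> \<Delta>\<^bsub>x\<^esub> h\<close>:
  \<open>b : W \<rightarrow> B\<close> is its underlying map, \<open>a : V \<rightarrow> A\<close> and \<open>c : V \<rightarrow> W\<close> form the fibre of \<open>f\<close> over \<open>b\<close>, and
  \<open>s : V \<rightarrow> H\<close> assigns to each point of the fibre a point of \<open>H\<close>. The fibre may be any pullback, not just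
  the chosen one, so that elements can be restricted and pasted strictly. The variables \<open>b\<close>, \<open>a\<close>, \<open>c\<close>
  and \<open>s\<close> keep these meanings below.\<close>

record 'a element =
  elB :: 'a
  elA :: 'a
  elC :: 'a
  elS :: 'a

abbreviation El :: "'a \<Rightarrow> 'a \<Rightarrow> 'a \<Rightarrow> 'a \<Rightarrow> 'a element" where
  "El b a c s \<equiv> \<lparr>elB = b, elA = a, elC = c, elS = s\<rparr>"

context pullback_category
begin

definition is_element :: "'a \<Rightarrow> 'a \<Rightarrow> 'a \<Rightarrow> 'a element \<Rightarrow> bool" where
  "is_element x f h D \<longleftrightarrow> is_pullback E f (elB D) (elA D) (elC D)
     \<and> x \<in> Arr E \<and> h \<in> Arr E \<and> Dom E x = Dom E f \<and> Cod E x = Cod E h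
     \<and> elS D \<in> Arr E \<and> Dom E (elS D) = Dom E (elA D) \<and> Cod E (elS D) = Dom E h \<and> h \<cdot> elS D = x \<cdot> elA D"

text \<open>The map \<open>v\<close> between the fibres of \<open>D\<close> and \<open>U\<close> that lies over \<open>u\<close> and exhibits \<open>D\<close> as the restriction of
  \<open>U\<close> along \<open>u\<close>.\<close>

definition is_cover :: "'a element \<Rightarrow> 'a \<Rightarrow> 'a element \<Rightarrow> 'a \<Rightarrow> bool" where
  "is_cover U u D v \<longleftrightarrow> v \<in> Arr E \<and> Dom E v = Dom E (elA D) \<and> Cod E v = Dom E (elA U)
          \<and> elA U \<cdot> v = elA D \<and> elC U \<cdot> v = u \<cdot> elC D \<and> elS U \<cdot> v = elS D"

definition classifies :: "'a element \<Rightarrow> 'a \<Rightarrow> 'a element \<Rightarrow> bool" where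
  "classifies U u D \<longleftrightarrow> u \<in> Arr E \<and> Dom E u = Dom E (elB D) \<and> Cod E u = Dom E (elB U) \<and> elB U \<cdot> u = elB D
     \<and> (\<exists>v. is_cover U u D v)"

text \<open>A generic element represents elements: for \<open>x\<close> an identity, \<open>elB U\<close> is a value of \<open>\<Pi>\<^bsub>f\<^esub>\<close> at \<open>h\<close> and
  \<open>elS U\<close> is evaluation.\<close>

definition is_generic :: "'a \<Rightarrow> 'a \<Rightarrow> 'a \<Rightarrow> 'a element \<Rightarrow> bool" where
  "is_generic x f h U \<longleftrightarrow> is_element x f h U \<and> (\<forall>D. is_element x f h D \<longrightarrow> (\<exists>!u. classifies U u D))"

lemma is_elementD:
  assumes "is_element x f h D"
  shows "is_pullback E f (elB D) (elA D) (elC D)" "x \<in> Arr E" "h \<in> Arr E" "Dom E x = Dom E f" "Cod E x = Cod E h"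
    "elS D \<in> Arr E" "Dom E (elS D) = Dom E (elA D)" "Cod E (elS D) = Dom E h" "h \<cdot> elS D = x \<cdot> elA D"
    "f \<in> Arr E" "elB D \<in> Arr E" "elA D \<in> Arr E" "elC D \<in> Arr E" "Cod E (elB D) = Cod E f" "Dom E (elC D) = Dom E (elA D)"
    "Cod E (elA D) = Dom E f" "Cod E (elC D) = Dom E (elB D)" "f \<cdot> elA D = elB D \<cdot> elC D"
  using assms is_pullbackD[of E f "elB D" "elA D" "elC D"] by (simp_all add: is_element_def)

lemma classifiesI:
  assumes "u \<in> Arr E" "Dom E u = Dom E (elB D)" "Cod E u = Dom E (elB U)" "elB U \<cdot> u = elB D"
    "v \<in> Arr E" "Dom E v = Dom E (elA D)" "Cod E v = Dom E (elA U)"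
    "elA U \<cdot> v = elA D" "elC U \<cdot> v = u \<cdot> elC D" "elS U \<cdot> v = elS D"
  shows "classifies U u D"
  using assms unfolding classifies_def is_cover_def by blast

lemma classifiesD:
  assumes "classifies U u D"
  shows "u \<in> Arr E" "Dom E u = Dom E (elB D)" "Cod E u = Dom E (elB U)" "elB U \<cdot> u = elB D"
  using assms unfolding classifies_def by blast+

lemma classifies_cover: "classifies U u D \<Longrightarrow> \<exists>v. is_cover U u D v"
  unfolding classifies_def by blast

lemma is_coverD:
  assumes "is_cover U u D v"
  shows "v \<in> Arr E" "Dom E v = Dom E (elA D)" "Cod E v = Dom E (elA U)"
    "elA U \<cdot> v = elA D" "elC U \<cdot> v = u \<cdot> elC D" "elS U \<cdot> v = elS D"
  using assms unfolding is_cover_def by blast+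

lemma generic_element: "is_generic x f h U \<Longrightarrow> is_element x f h U"
  and generic_ex: "\<lbrakk>is_generic x f h U; is_element x f h D\<rbrakk> \<Longrightarrow> \<exists>u. classifies U u D"
  and generic_unique: "\<lbrakk>is_generic x f h U; is_element x f h D; classifies U u D; classifies U u' D\<rbrakk> \<Longrightarrow> u = u'"
  unfolding is_generic_def by blast+

lemma classifies_self: "is_element x f h U \<Longrightarrow> classifies U (Idn E (Dom E (elB U))) U"
  by (rule classifiesI[where v = "Idn E (Dom E (elA U))"]) (use is_elementD[of x f h U] in simp_all)

lemma element_restrict:
  assumes D: "is_element x f h D" and pb: "is_pullback E (elC D) t t' c'"
  shows "is_element x f h (El (elB D \<cdot> t) (elA D \<cdot> t') c' (elS D \<cdot> t'))"
proof -
  note d = is_elementD[OF D] and p = is_pullbackD[OF pb]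
  have "is_pullback E f (elB D \<cdot> t) (elA D \<cdot> t') c'" by (rule pullback_paste[OF d(1) pb])
  then show ?thesis
    using d(2-17) p comp_left_eq[OF d(9), of t'] by (simp add: is_element_def)
qed

text \<open>Restriction along \<open>t\<close>, with \<open>t'\<close> the map of fibres over it. The square of \<open>t'\<close> over \<open>t\<close> is a pullback as
  soon as the restricted data form an element.\<close>

lemma classifies_restrict:
  assumes U: "is_element x f h U" and D: "is_element x f h D" and u: "classifies U u D"
    and t: "t \<in> Arr E" "Cod E t = Dom E (elB D)" "t' \<in> Arr E" "Cod E t' = Dom E (elA D)"
      "c' \<in> Arr E" "Dom E c' = Dom E t'" "Cod E c' = Dom E t" "elC D \<cdot> t' = t \<cdot> c'"
  shows "classifies U (u \<cdot> t) (El (elB D \<cdot> t) (elA D \<cdot> t') c' (elS D \<cdot> t'))"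
proof -
  obtain v where "is_cover U u D v" using classifies_cover[OF u] by blast
  note V = is_coverD[OF this] and u = classifiesD[OF u] and d = is_elementD[OF D] and g = is_elementD[OF U]
  have "elC U \<cdot> v \<cdot> t' = u \<cdot> t \<cdot> c'"
    using comp_left_eq[OF V(5), of t'] comp_left_eq[OF t(8)[symmetric]] t V(1-3) u d g by simp
  then show ?thesis
    using t V(1-3) u d g comp_left_eq[OF V(4), of t'] comp_left_eq[OF V(6), of t'] comp_left_eq[OF u(4), of t]
    by (intro classifiesI[where v = "v \<cdot> t'"]) simp_all
qed

lemma ex_classified:
  assumes U: "is_element x f h U" and u: "u \<in> Arr E" "Cod E u = Dom E (elB U)"
  obtains D where "is_element x f h D" "classifies U u D"
proof -
  note g = is_elementD[OF U]
  let ?v = "fst (pb E (elC U) u)" and ?c = "snd (pb E (elC U) u)"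
  have pb: "is_pullback E (elC U) u ?v ?c" using pb_pullback[of "elC U" u] u g by simp
  note p = is_pullbackD[OF pb]
  have "classifies U (Idn E (Dom E (elB U)) \<cdot> u) (El (elB U \<cdot> u) (elA U \<cdot> ?v) ?c (elS U \<cdot> ?v))"
    by (rule classifies_restrict[OF U U classifies_self[OF U]]) (use u g p in simp_all)
  then show ?thesis using that[OF element_restrict[OF U pb]] u by simp
qed

text \<open>A map from a fibre of \<open>f\<close> to \<open>H\<close> over \<open>X\<close> is the same as a section over that fibre of the pullback of \<open>h\<close>
  along \<open>x\<close>. This reduces \<open>\<Pi>\<^bsub>f\<^esub> \<Delta>\<^bsub>x\<^esub>\<close> to \<open>\<Pi>\<^bsub>f\<^esub>\<close>.\<close>

lemma generic_pullback:
  assumes G: "is_generic (Idn E (Dom E f)) f k U" and pb: "is_pullback E x h k l" and x: "Dom E x = Dom E f"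
  shows "is_generic x f h (El (elB U) (elA U) (elC U) (l \<cdot> elS U))"
proof -
  note g = is_elementD[OF generic_element[OF G]] and p = is_pullbackD[OF pb]
  have kU: "k \<cdot> elS U = elA U" using g by simp
  let ?U = "El (elB U) (elA U) (elC U) (l \<cdot> elS U)"
  have U: "is_element x f h ?U"
    using g p x comp_left_eq[OF p(9), of "elS U"] by (simp add: is_element_def)
  have "\<exists>!u. classifies ?U u D" if D: "is_element x f h D" for D
  proof -
    note d = is_elementD[OF D]
    have "\<exists>s. is_lift k l (elA D) (elS D) s"
      by (rule pullback_lift[OF pb]) (use d x p in simp_all)
    then obtain s where "is_lift k l (elA D) (elS D) s" by blast
    note s = is_liftD[OF this]
    let ?D = "El (elB D) (elA D) (elC D) s"
    have D': "is_element (Idn E (Dom E f)) f k ?D" using d s g by (simp add: is_element_def)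
    have "classifies ?U u D \<longleftrightarrow> classifies U u ?D" for u
    proof
      assume c: "classifies U u ?D"
      obtain v where "is_cover U u ?D v" using classifies_cover[OF c] by blast
      note v = is_coverD[OF this, simplified]
      show "classifies ?U u D"
        by (rule classifiesI[where v = v]) (use classifiesD[OF c] v g p s in simp_all)
    next
      assume c: "classifies ?U u D"
      obtain v where "is_cover ?U u D v" using classifies_cover[OF c] by blast
      note v = is_coverD[OF this, simplified]
      have "elS U \<cdot> v = s"
        by (rule pullback_eqI[OF pb]) (use v g p s kU comp_left_eq[OF kU, of v] in simp_all)
      then show "classifies U u ?D"
        by (intro classifiesI[where v = v]) (use classifiesD[OF c] v g p s in simp_all)
    qed
    then show ?thesis using G D' unfolding is_generic_def by simp
  qed
  then show ?thesis using U by (simp add: is_generic_def)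
qed

section \<open>Exponentiable maps\<close>

text \<open>For \<open>x\<close> an identity the second leg \<open>a\<close> of an element is determined by \<open>s\<close>, and the facts are recorded
  in this simplified form.\<close>

lemma is_element_idnD:
  assumes "is_element (Idn E (Dom E f)) f g D"
  shows "is_pullback E f (elB D) (elA D) (elC D)" "g \<in> Arr E" "Cod E g = Dom E f"
    "elS D \<in> Arr E" "Dom E (elS D) = Dom E (elA D)" "Cod E (elS D) = Dom E g" "g \<cdot> elS D = elA D"
    "f \<in> Arr E" "elB D \<in> Arr E" "elA D \<in> Arr E" "elC D \<in> Arr E" "Cod E (elB D) = Cod E f" "Dom E (elC D) = Dom E (elA D)"
    "Cod E (elA D) = Dom E f" "Cod E (elC D) = Dom E (elB D)" "f \<cdot> elA D = elB D \<cdot> elC D"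
  using is_elementD[OF assms] by simp_all

lemma Pi_adjunction:
  assumes "exponentiable E f"
  shows "adjunction (slice E (Cod E f)) (slice E (Dom E f)) (Delta_f E f) (Pi_f E f) (Pi_unit E f) (Pi_counit E f)"
proof -
  have "\<exists>R. is_right_adjoint_data E f R" using assms by (simp add: exponentiable_def)
  from someI_ex[OF this] have "is_right_adjoint_data E f (Pi_data E f)" by (simp add: Pi_data_def)
  then show ?thesis
    by (simp add: is_right_adjoint_data_def Pi_f_def Pi_unit_def Pi_counit_def case_prod_unfold)
qed

text \<open>Evaluation, that is, the counit \<open>\<Delta>\<^bsub>f\<^esub> \<Pi>\<^bsub>f\<^esub> g \<rightarrow> g\<close>, read as an element.\<close>

definition Pi_element :: "'a \<Rightarrow> 'a \<Rightarrow> 'a element" where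
  "Pi_element f g = (let r = fobj (Pi_f E f) g in
     El r (fobj (Delta_f E f) r) (snd (pb E f r)) (sarr (ncmp (Pi_counit E f) g)))"

lemma Pi_element_simps [simp]:
  "elB (Pi_element f g) = fobj (Pi_f E f) g"
  "elA (Pi_element f g) = fobj (Delta_f E f) (fobj (Pi_f E f) g)"
  "elC (Pi_element f g) = snd (pb E f (fobj (Pi_f E f) g))"
  "elS (Pi_element f g) = sarr (ncmp (Pi_counit E f) g)"
  by (simp_all add: Pi_element_def Let_def)

lemma Pi_obj:
  assumes f: "exponentiable E f" and g: "g \<in> Arr E" "Cod E g = Dom E f"
  shows "fobj (Pi_f E f) g \<in> Arr E" "Cod E (fobj (Pi_f E f) g) = Cod E f"
proof -
  interpret A: adjunction "slice E (Cod E f)" "slice E (Dom E f)" "Delta_f E f" "Pi_f E f" "Pi_unit E f" "Pi_counit E f"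
    by (rule Pi_adjunction[OF f])
  show "fobj (Pi_f E f) g \<in> Arr E" "Cod E (fobj (Pi_f E f) g) = Cod E f"
    using is_functorD(1)[OF A.right_functor, of g] g by simp_all
qed

lemma
  assumes f: "exponentiable E f"
  shows Pi_counit: "\<lbrakk>g \<in> Arr E; Cod E g = Dom E f\<rbrakk> \<Longrightarrow> ncmp (Pi_counit E f) g \<in> Arr (slice E (Dom E f))"
    "\<lbrakk>g \<in> Arr E; Cod E g = Dom E f\<rbrakk> \<Longrightarrow> sdom (ncmp (Pi_counit E f) g) = fobj (Delta_f E f) (fobj (Pi_f E f) g)"
    "\<lbrakk>g \<in> Arr E; Cod E g = Dom E f\<rbrakk> \<Longrightarrow> scod (ncmp (Pi_counit E f) g) = g"
    and Pi_counit_natural: "u \<in> Arr (slice E (Dom E f)) \<Longrightarrow>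
      sarr (ncmp (Pi_counit E f) (scod u)) \<cdot> sarr (farr (Delta_f E f) (farr (Pi_f E f) u))
      = sarr u \<cdot> sarr (ncmp (Pi_counit E f) (sdom u))"
proof -
  interpret A: adjunction "slice E (Cod E f)" "slice E (Dom E f)" "Delta_f E f" "Pi_f E f" "Pi_unit E f" "Pi_counit E f"
    by (rule Pi_adjunction[OF f])
  have t: "is_ntrans (slice E (Dom E f)) (slice E (Dom E f)) (Pi_counit E f)"
    "ndom (Pi_counit E f) = comp_func (slice E (Dom E f)) (Delta_f E f) (Pi_f E f)"
    "ncod (Pi_counit E f) = id_func (slice E (Dom E f))"
    using A.counit by simp_all
  note T = is_ntransD[OF t(1), unfolded t(2,3)]
  show "ncmp (Pi_counit E f) g \<in> Arr (slice E (Dom E f))"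
    "sdom (ncmp (Pi_counit E f) g) = fobj (Delta_f E f) (fobj (Pi_f E f) g)"
    "scod (ncmp (Pi_counit E f) g) = g"
    if "g \<in> Arr E" "Cod E g = Dom E f" using T(3-5)[of g] that by simp_all
  show "sarr (ncmp (Pi_counit E f) (scod u)) \<cdot> sarr (farr (Delta_f E f) (farr (Pi_f E f) u))
      = sarr u \<cdot> sarr (ncmp (Pi_counit E f) (sdom u))" if "u \<in> Arr (slice E (Dom E f))"
    using arg_cong[OF T(6)[OF that], of sarr] that by simp
qed

lemma Pi_element_element:
  assumes f: "exponentiable E f" and g: "g \<in> Arr E" "Cod E g = Dom E f"
  shows "is_element (Idn E (Dom E f)) f g (Pi_element f g)"
proof -
  have fA: "f \<in> Arr E" using f by (simp add: exponentiable_def)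
  note P = Pi_obj[OF f g] and K = Pi_counit[OF f, of g]
  note pb = Delta_pullback[OF fA P] note p = is_pullbackD[OF pb]
  show ?thesis
    unfolding is_element_def using pb K(1)[unfolded in_slice_arr] K(2,3) g fA p by simp
qed

text \<open>Move the fibre of an element \<open>D\<close> to the chosen pullback along \<open>f\<close>. Its section becomes an arrow
  \<open>\<Delta>\<^bsub>f\<^esub> b \<rightarrow> g\<close>, and the arrows that classify \<open>D\<close> are the transposes of this arrow, of which there is
  exactly one.\<close>

lemma Pi_element_generic:
  assumes f: "exponentiable E f" and g: "g \<in> Arr E" "Cod E g = Dom E f"
  shows "is_generic (Idn E (Dom E f)) f g (Pi_element f g)"
  unfolding is_generic_def
proof (intro conjI allI impI)
  let ?S = "slice E (Cod E f)" and ?T = "slice E (Dom E f)"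
  interpret A: adjunction "slice E (Cod E f)" "slice E (Dom E f)" "Delta_f E f" "Pi_f E f" "Pi_unit E f" "Pi_counit E f"
    by (rule Pi_adjunction[OF f])
  have fA: "f \<in> Arr E" using f by (simp add: exponentiable_def)
  show U: "is_element (Idn E (Dom E f)) f g (Pi_element f g)" by (rule Pi_element_element[OF assms])
  note P = Pi_obj[OF f g] and K = Pi_counit[OF f g]
  fix D assume D: "is_element (Idn E (Dom E f)) f g D"
  note d = is_element_idnD[OF D] and u = is_element_idnD[OF U, simplified]
  have b: "elB D \<in> Obj ?S" and g': "g \<in> Obj ?T" using d g by simp_all
  have pb: "is_pullback E f (elB D) (fobj (Delta_f E f) (elB D)) (snd (pb E f (elB D)))"
    by (rule Delta_pullback) (simp_all add: d)
  note p = is_pullbackD[OF pb]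
  obtain i where i: "is_iso E i" "i \<in> Arr E" "Dom E i = Dom E (elA D)" "Cod E i = Dom E (fobj (Delta_f E f) (elB D))"
    "fobj (Delta_f E f) (elB D) \<cdot> i = elA D" "snd (pb E f (elB D)) \<cdot> i = elC D"
    by (rule pullback_compare[OF pb d(1)])
  note j = iso_inverse(1-5)[OF i(1)]
  let ?j = "inverse_of E i"
  \<comment> \<open>The section of \<open>D\<close> over the chosen fibre.\<close>
  let ?\<phi> = "\<lparr>sdom = fobj (Delta_f E f) (elB D), scod = g, sarr = elS D \<cdot> ?j\<rparr>"
  have dj: "elA D \<cdot> ?j = fobj (Delta_f E f) (elB D)"
    using comp_left_eq[OF i(5), of ?j] i j p by simp
  have \<phi>: "?\<phi> \<in> Arr ?T" using i j p d g dj comp_left_eq[OF d(7), of ?j] by (simp add: in_slice_arr)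
  \<comment> \<open>An arrow classifies \<open>D\<close> exactly when it is the transpose of \<open>\<phi>\<close>.\<close>
  have iff: "classifies (Pi_element f g) v D \<longleftrightarrow>
      (\<exists>w. w \<in> Arr ?S \<and> sdom w = elB D \<and> scod w = fobj (Pi_f E f) g \<and> sarr w = v \<and>
        ncmp (Pi_counit E f) g \<cdot>\<^bsub>?T\<^esub> farr (Delta_f E f) w = ?\<phi>)" (is "_ \<longleftrightarrow> (\<exists>w. ?Q w)") for v
  proof
    assume c: "classifies (Pi_element f g) v D"
    note C = classifiesD[OF c, simplified]
    obtain v' where "is_cover (Pi_element f g) v D v'" using classifies_cover[OF c] by blast
    note v' = is_coverD[OF this, simplified]
    let ?w = "\<lparr>sdom = elB D, scod = fobj (Pi_f E f) g, sarr = v\<rparr>"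
    have w: "?w \<in> Arr ?S" using C d P by (simp add: in_slice_arr)
    note W = Delta_arr[OF fA w, simplified]
    have "sarr (farr (Delta_f E f) ?w) \<cdot> i = v'"
    proof (rule pullback_eqI[OF u(1)])
      show "fobj (Delta_f E f) (fobj (Pi_f E f) g) \<cdot> sarr (farr (Delta_f E f) ?w) \<cdot> i
        = fobj (Delta_f E f) (fobj (Pi_f E f) g) \<cdot> v'"
        using W(3-5) v'(4) i u(10) p(3) comp_left_eq[OF W(6), of i] by simp
      show "snd (pb E f (fobj (Pi_f E f) g)) \<cdot> sarr (farr (Delta_f E f) ?w) \<cdot> i
        = snd (pb E f (fobj (Pi_f E f) g)) \<cdot> v'"
        using W(3-5) v'(5) i u(11,13) p(4,6,8) C(1,2) comp_left_eq[OF W(7), of i] by simp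
    qed (simp_all add: W(3-5) v'(1-3) i(2-4))
    then have "sarr (ncmp (Pi_counit E f) g) \<cdot> sarr (farr (Delta_f E f) ?w) \<cdot> i = elS D" using v' by simp
    from arg_cong[OF this, of "\<lambda>x. x \<cdot> ?j"]
    have "sarr (ncmp (Pi_counit E f) g) \<cdot> sarr (farr (Delta_f E f) ?w) = elS D \<cdot> ?j"
      by (simp add: W u i j)
    then show "\<exists>w. ?Q w" by (intro exI[of _ ?w]) (simp add: w K W)
  next
    assume "\<exists>w. ?Q w"
    then obtain w where w: "w \<in> Arr ?S" "sdom w = elB D" "scod w = fobj (Pi_f E f) g" "sarr w = v"
      and e: "ncmp (Pi_counit E f) g \<cdot>\<^bsub>?T\<^esub> farr (Delta_f E f) w = ?\<phi>" by blast
    note W = Delta_arr[OF fA w(1), unfolded w(2-4)] and w' = w(1)[unfolded in_slice_arr w(2-4)]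
    have e': "sarr (ncmp (Pi_counit E f) g) \<cdot> sarr (farr (Delta_f E f) w) = elS D \<cdot> ?j"
      using arg_cong[OF e, of sarr] by simp
    show "classifies (Pi_element f g) v D"
      by (rule classifiesI[where v = "sarr (farr (Delta_f E f) w) \<cdot> i"])
        (simp_all add: W w' i j u d p comp_left_eq[OF W(6), of i] comp_left_eq[OF W(7), of i] comp_left_eq[OF e', of i])
  qed
  note cats = slice_category[of "Cod E f"] slice_category[of "Dom E f"]
  show "\<exists>!v. classifies (Pi_element f g) v D"
  proof (rule ex_ex1I)
    show "\<exists>v. classifies (Pi_element f g) v D"
      unfolding iff using A.transpose[OF cats b g' \<phi>] by (metis (no_types, lifting) slice_simps(2,3) slice_arr.select_convs(1,2))
  next
    fix v v' assume "classifies (Pi_element f g) v D" "classifies (Pi_element f g) v' D"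
    then obtain w w' where w: "?Q v w" "?Q v' w'" unfolding iff by blast
    have "w = w'"
      using A.transpose_transpose[OF cats b g', of w] A.transpose_transpose[OF cats b g', of w'] w
      by (metis slice_simps(2,3))
    then show "v = v'" using w by blast
  qed
qed

text \<open>The converse of the preceding lemma: a generic element for every \<open>g\<close> amounts to a universal arrow from
  \<open>\<Delta>\<^bsub>f\<^esub>\<close> to \<open>g\<close>, and these suffice for a right adjoint.\<close>

lemma exponentiableI:
  assumes f: "f \<in> Arr E" and gen: "\<And>g. \<lbrakk>g \<in> Arr E; Cod E g = Dom E f\<rbrakk> \<Longrightarrow> \<exists>U. is_generic (Idn E (Dom E f)) f g U"
  shows "exponentiable E f"
proof -
  let ?S = "slice E (Cod E f)" and ?T = "slice E (Dom E f)" and ?D = "Delta_f E f"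
  define U where "U g = (SOME U. is_generic (Idn E (Dom E f)) f g U)" for g
  have U: "is_generic (Idn E (Dom E f)) f g (U g)" if "g \<in> Arr E" "Cod E g = Dom E f" for g
    unfolding U_def using gen[OF that] by (rule someI_ex)
  note u = is_element_idnD[OF generic_element[OF U]]
  have pb: "is_pullback E f h (fobj ?D h) (snd (pb E f h))" if "h \<in> Arr E" "Cod E h = Cod E f" for h
    using that f by (simp add: Delta_pullback)
  \<comment> \<open>The section of a generic element starts at a pullback that need not be the chosen one.\<close>
  have "\<exists>i. i \<in> Arr E \<and> is_iso E i \<and> Dom E i = Dom E (fobj ?D (elB (U g))) \<and> Cod E i = Dom E (elA (U g))
      \<and> elA (U g) \<cdot> i = fobj ?D (elB (U g)) \<and> elC (U g) \<cdot> i = snd (pb E f (elB (U g)))"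
    if g: "g \<in> Arr E" "Cod E g = Dom E f" for g
    by (rule pullback_compare[OF u(1)[OF g] pb]) (use u[OF g] g in auto)
  then obtain i where i: "\<And>g. \<lbrakk>g \<in> Arr E; Cod E g = Dom E f\<rbrakk> \<Longrightarrow> i g \<in> Arr E \<and> is_iso E (i g) \<and>
      Dom E (i g) = Dom E (fobj ?D (elB (U g))) \<and> Cod E (i g) = Dom E (elA (U g))
      \<and> elA (U g) \<cdot> i g = fobj ?D (elB (U g)) \<and> elC (U g) \<cdot> i g = snd (pb E f (elB (U g)))" by metis
  define e where "e g = \<lparr>sdom = fobj ?D (elB (U g)), scod = g, sarr = elS (U g) \<cdot> i g\<rparr>" for g
  have e: "e g \<in> Arr ?T" if g: "g \<in> Arr E" "Cod E g = Dom E f" for g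
    using i[OF g] u[OF g] g comp_left_eq[OF u(7)[OF g], of "i g"] is_pullbackD[OF pb[of "elB (U g)"]]
    by (simp add: e_def in_slice_arr)
  have "\<exists>G \<eta> \<epsilon>. adjunction ?S ?T ?D G \<eta> \<epsilon>"
  proof (rule adjunction_of_universal_arrows[where R = "\<lambda>g. elB (U g)" and e = e])
    fix b g \<phi> assume b: "b \<in> Obj ?S" and g: "g \<in> Obj ?T" and \<phi>: "\<phi> \<in> hom ?T (fobj ?D b) g"
    have g': "g \<in> Arr E" "Cod E g = Dom E f" and b': "b \<in> Arr E" "Cod E b = Cod E f" using g b by simp_all
    note u = u[OF g'] and i = i[OF g'] and p = is_pullbackD[OF pb[OF b']]
    have ph: "sdom \<phi> = fobj ?D b" "scod \<phi> = g" "sarr \<phi> \<in> Arr E" "Dom E (sarr \<phi>) = Dom E (fobj ?D b)"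
      "Cod E (sarr \<phi>) = Dom E g" "g \<cdot> sarr \<phi> = fobj ?D b"
      using \<phi> by (auto simp: in_slice_arr)
    let ?B = "El b (fobj ?D b) (snd (pb E f b)) (sarr \<phi>)"
    have B: "is_element (Idn E (Dom E f)) f g ?B"
      using pb[OF b'] p g' ph by (simp add: is_element_def)
    have iff: "classifies (U g) (sarr w) ?B \<longleftrightarrow> e g \<cdot>\<^bsub>?T\<^esub> farr ?D w = \<phi>"
      if w: "w \<in> Arr ?S" "sdom w = b" "scod w = elB (U g)" for w
    proof
      note W = Delta_arr[OF f w(1), unfolded w(2,3)] and w' = w(1)[unfolded in_slice_arr w(2,3)]
      note p' = is_pullbackD[OF pb[of "elB (U g)"]]
      show "e g \<cdot>\<^bsub>?T\<^esub> farr ?D w = \<phi>" if c: "classifies (U g) (sarr w) ?B"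
      proof -
        obtain v where "is_cover (U g) (sarr w) ?B v" using classifies_cover[OF c] by blast
        note v = is_coverD[OF this, simplified]
        have "i g \<cdot> sarr (farr ?D w) = v"
          by (rule pullback_eqI[OF u(1)])
            (simp_all add: v W w' i u p p' comp_left_eq[of "elA (U g)" "i g" "fobj ?D (elB (U g))" "sarr (farr ?D w)"]
              comp_left_eq[of "elC (U g)" "i g" "snd (pb E f (elB (U g)))" "sarr (farr ?D w)"])
        then have "elS (U g) \<cdot> i g \<cdot> sarr (farr ?D w) = sarr \<phi>" using v(6) by simp
        then show ?thesis by (intro slice_arr_eqI) (simp_all add: e_def ph W w' i u)
      qed
      show "classifies (U g) (sarr w) ?B" if c: "e g \<cdot>\<^bsub>?T\<^esub> farr ?D w = \<phi>"
      proof (rule classifiesI[where v = "i g \<cdot> sarr (farr ?D w)"])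
        have "(elS (U g) \<cdot> i g) \<cdot> sarr (farr ?D w) = sarr \<phi>"
          using arg_cong[OF c, of sarr] by (simp add: e_def)
        then show "elS (U g) \<cdot> i g \<cdot> sarr (farr ?D w) = elS ?B" by (simp add: W w' i u p p')
      qed (simp_all add: W w' i u p p' comp_left_eq[of "elA (U g)" "i g" "fobj ?D (elB (U g))" "sarr (farr ?D w)"]
              comp_left_eq[of "elC (U g)" "i g" "snd (pb E f (elB (U g)))" "sarr (farr ?D w)"])
    qed
    show "\<exists>!w. w \<in> hom ?S b (elB (U g)) \<and> e g \<cdot>\<^bsub>?T\<^esub> farr ?D w = \<phi>"
    proof (rule ex_ex1I)
      obtain v where v: "classifies (U g) v ?B" using generic_ex[OF U[OF g'] B] by blast
      let ?w = "\<lparr>sdom = b, scod = elB (U g), sarr = v\<rparr>"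
      have "?w \<in> Arr ?S" using classifiesD[OF v] b' u by (simp add: in_slice_arr)
      then show "\<exists>w. w \<in> hom ?S b (elB (U g)) \<and> e g \<cdot>\<^bsub>?T\<^esub> farr ?D w = \<phi>"
        using iff[of ?w] v by (intro exI[of _ ?w]) simp
    next
      fix w w' assume "w \<in> hom ?S b (elB (U g)) \<and> e g \<cdot>\<^bsub>?T\<^esub> farr ?D w = \<phi>"
        "w' \<in> hom ?S b (elB (U g)) \<and> e g \<cdot>\<^bsub>?T\<^esub> farr ?D w' = \<phi>"
      then show "w = w'"
        using iff[of w] iff[of w'] generic_unique[OF U[OF g'] B, of "sarr w" "sarr w'"]
        by (intro slice_arr_eqI) simp_all
    qed
  qed (use slice_category Delta_functor[OF f] u e in \<open>simp_all add: e_def\<close>)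
  then show ?thesis unfolding exponentiable_def is_right_adjoint_data_def using f by auto
qed

text \<open>The map of fibres over \<open>u\<close> is a map into a pullback, so it is fixed by \<open>u\<close> and by the fibre, and it
  determines the section.\<close>

lemma classified_unique:
  assumes U: "is_element x f h U" and D: "is_element x f h D"
    and u: "classifies U u D" "classifies U u D'" and eq: "elA D' = elA D" "elC D' = elC D"
  shows "elS D = elS D'"
proof -
  note g = is_elementD[OF U]
  obtain v v' where "is_cover U u D v" "is_cover U u D' v'" using u[THEN classifies_cover] by blast
  note v = this[THEN is_coverD(1)] this[THEN is_coverD(2)] this[THEN is_coverD(3)] this[THEN is_coverD(4)]
    this[THEN is_coverD(5)] this[THEN is_coverD(6)]
  have "v = v'" by (rule pullback_eqI[OF g(1)]) (simp_all add: v eq)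
  then show ?thesis using v by simp
qed

lemma exponentiable_arr: "exponentiable E f \<Longrightarrow> f \<in> Arr E"
  by (simp add: exponentiable_def)

lemma is_element_idnI:
  "\<lbrakk>is_pullback E f b a c; g \<in> Arr E; Cod E g = Dom E f; s \<in> Arr E; Dom E s = Dom E a; Cod E s = Dom E g; g \<cdot> s = a\<rbrakk>
    \<Longrightarrow> is_element (Idn E (Dom E f)) f g (El b a c s)"
  using is_pullbackD[of E f b a c] by (simp add: is_element_def)

text \<open>Let \<open>f' : A' \<rightarrow> B'\<close> be the pullback of \<open>f\<close> along \<open>b\<close>, with \<open>a : A' \<rightarrow> A\<close>. A fibre of \<open>f'\<close> is a fibre of \<open>f\<close>
  with a given map to \<open>A'\<close> over \<open>A\<close>, and a section of \<open>g\<close> over it is a section of \<open>a g\<close> that becomes this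
  given map when composed with \<open>g\<close>. Hence \<open>\<Pi>\<^bsub>f'\<^esub> g\<close> is constructed as the pullback of
  \<open>\<Pi>\<^bsub>f\<^esub> (a g) \<rightarrow> \<Pi>\<^bsub>f\<^esub> a\<close> along the map \<open>B' \<rightarrow> \<Pi>\<^bsub>f\<^esub> a\<close> that names the given maps.\<close>

lemma exponentiable_pullback:
  assumes f: "exponentiable E f" and pb: "is_pullback E f b a f'"
  shows "exponentiable E f'"
proof -
  note P = is_pullbackD[OF pb]
  define V where "V = Pi_element f a"
  have V: "is_generic (Idn E (Dom E f)) f a V" using Pi_element_generic[OF f, of a] P by (simp add: V_def)
  note VE = generic_element[OF V] and Ve = is_element_idnD[OF generic_element[OF V]]
  have I: "is_element (Idn E (Dom E f)) f a (El b a f' (Idn E (Dom E a)))"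
    by (rule is_element_idnI) (simp_all add: P pb)
  \<comment> \<open>Over each point of \<open>B'\<close>, \<open>m\<close> names the inclusion of the fibre into \<open>A'\<close>.\<close>
  obtain m where m: "classifies V m (El b a f' (Idn E (Dom E a)))" using generic_ex[OF V I] by blast
  note M = classifiesD[OF m, simplified]
  show ?thesis
  proof (rule exponentiableI)
    show "f' \<in> Arr E" using P by simp
    fix g assume g: "g \<in> Arr E" "Cod E g = Dom E f'"
    have g': "Cod E g = Dom E a" using g P by simp
    define U where "U = Pi_element f (a \<cdot> g)"
    have U: "is_generic (Idn E (Dom E f)) f (a \<cdot> g) U"
      using Pi_element_generic[OF f, of "a \<cdot> g"] P g' g by (simp add: U_def)
    note Ue0 = is_element_idnD[OF generic_element[OF U]]
    have agU: "a \<cdot> g \<cdot> elS U = elA U" and cU: "Cod E (elS U) = Dom E g"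
      using Ue0(4,6,7) g g' P by simp_all
    note Ue = Ue0(1-5,8-16)
    let ?gU = "El (elB U) (elA U) (elC U) (g \<cdot> elS U)"
    have K: "is_element (Idn E (Dom E f)) f a ?gU"
      by (rule is_element_idnI) (simp_all add: Ue(1-5) cU g' g P agU)
    \<comment> \<open>Composition of sections with \<open>g\<close>.\<close>
    obtain k where k: "classifies V k ?gU" using generic_ex[OF V K] by blast
    note kD = classifiesD[OF k, unfolded element.select_convs]
    let ?r1 = "fst (pb E k m)" and ?r2 = "snd (pb E k m)"
    have R: "is_pullback E k m ?r1 ?r2" by (rule pb_pullback) (simp_all add: kD M)
    note r = is_pullbackD[OF R]
    let ?\<alpha> = "fst (pb E f' ?r2)" and ?\<gamma> = "snd (pb E f' ?r2)"
    have W: "is_pullback E f' ?r2 ?\<alpha> ?\<gamma>" by (rule pb_pullback) (simp_all add: r P M)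
    note w = is_pullbackD[OF W]
    have r12: "elB U \<cdot> ?r1 = b \<cdot> ?r2"
      using comp_left_eq[OF kD(4), of ?r1] comp_left_eq[OF M(4), of ?r2]
      by (simp add: r kD M Ve)
    have "\<exists>v. is_lift (elA U) (elC U) (a \<cdot> ?\<alpha>) (?r1 \<cdot> ?\<gamma>) v"
      by (rule pullback_lift[OF Ue(1)])
        (simp_all add: w r P kD comp_left_eq[OF P(9), of ?\<alpha>] comp_left_eq[OF r12, of ?\<gamma>] Ue M)
    then obtain v where "is_lift (elA U) (elC U) (a \<cdot> ?\<alpha>) (?r1 \<cdot> ?\<gamma>) v" by blast
    note v = is_liftD[OF this]
    have vd: "Dom E v = Dom E ?\<alpha>" using v(2) w P by simp
    have fW: "is_pullback E f (b \<cdot> ?r2) (a \<cdot> ?\<alpha>) ?\<gamma>" by (rule pullback_paste[OF pb W])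
    \<comment> \<open>Both legs of the pullback of \<open>k\<close> and \<open>m\<close> name the same element, so the two copies of \<open>\<alpha>\<close> agree.\<close>
    have c1: "classifies V (k \<cdot> ?r1) (El (b \<cdot> ?r2) (a \<cdot> ?\<alpha>) ?\<gamma> (g \<cdot> elS U \<cdot> v))"
      using classifies_restrict[OF VE K k, of ?r1 v ?\<gamma>]
      by (simp add: r12 v(1,3-5) vd Ue g cU w r(1-8) kD)
    have c2: "classifies V (k \<cdot> ?r1) (El (b \<cdot> ?r2) (a \<cdot> ?\<alpha>) ?\<gamma> ?\<alpha>)"
      using classifies_restrict[OF VE I m, of ?r2 ?\<alpha> ?\<gamma>] by (simp add: w r M P)
    have e2: "is_element (Idn E (Dom E f)) f a (El (b \<cdot> ?r2) (a \<cdot> ?\<alpha>) ?\<gamma> ?\<alpha>)"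
      by (rule is_element_idnI[OF fW]) (simp_all add: P w)
    have gsv: "g \<cdot> elS U \<cdot> v = ?\<alpha>"
      using classified_unique[OF VE e2 c2 c1] by simp
    have "is_generic (Idn E (Dom E f')) f' g (El ?r2 ?\<alpha> ?\<gamma> (elS U \<cdot> v))"
      unfolding is_generic_def
    proof (intro conjI allI impI ex_ex1I)
      show "is_element (Idn E (Dom E f')) f' g (El ?r2 ?\<alpha> ?\<gamma> (elS U \<cdot> v))"
        by (rule is_element_idnI[OF W]) (simp_all add: g gsv v(1,3-5) vd Ue cU)
    next
      fix D assume D: "is_element (Idn E (Dom E f')) f' g D"
      note d = is_element_idnD[OF D]
      have pbD: "is_pullback E f (b \<cdot> elB D) (a \<cdot> elA D) (elC D)" by (rule pullback_paste[OF pb d(1)])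
      let ?D = "El (b \<cdot> elB D) (a \<cdot> elA D) (elC D) (elS D)"
      have D': "is_element (Idn E (Dom E f)) f (a \<cdot> g) ?D"
        by (rule is_element_idnI[OF pbD]) (simp_all add: d P g g')
      obtain u1 where u1: "classifies U u1 ?D" using generic_ex[OF U D'] by blast
      obtain v1 where "is_cover U u1 ?D v1" using classifies_cover[OF u1] by blast
      note u1D = classifiesD[OF u1, unfolded element.select_convs] and v1 = is_coverD[OF this, unfolded element.select_convs]
      note dd = d(3-15) and u1d = u1D(1,3,4)
      have u1t: "Dom E u1 = Dom E (elB D)" and v1t: "Dom E v1 = Dom E (elA D)"
        using u1D(2) v1(2) d(8-16) P by simp_all
      let ?aD = "El (b \<cdot> elB D) (a \<cdot> elA D) (elC D) (elA D)"
      have aD: "is_element (Idn E (Dom E f)) f a ?aD"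
        by (rule is_element_idnI[OF pbD]) (simp_all add: d P)
      have "classifies V (k \<cdot> u1) ?aD"
      proof -
        have "classifies V (k \<cdot> u1) (El (elB U \<cdot> u1) (elA U \<cdot> v1) (elC D) ((g \<cdot> elS U) \<cdot> v1))"
          using classifies_restrict[OF VE K k, of u1 v1 "elC D"] by (simp add: v1(1,3,5) v1t u1t u1D(1,3) dd Ue cU g kD)
        then show ?thesis using v1(6) by (simp add: v1(1,3,4) v1t cU d(7,10) g(1) Ue(4,5) u1D(4))
      qed
      moreover have "classifies V (m \<cdot> elB D) ?aD"
        using classifies_restrict[OF VE I m, of "elB D" "elA D" "elC D"] by (simp add: M d P)
      ultimately have km: "k \<cdot> u1 = m \<cdot> elB D" using generic_unique[OF V aD] by blast
      have "\<exists>u. is_lift ?r1 ?r2 u1 (elB D) u"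
        by (rule pullback_lift[OF R]) (simp_all add: km kD M u1t u1d dd P)
      then obtain u where "is_lift ?r1 ?r2 u1 (elB D) u" by blast
      note u = is_liftD[OF this]
      have ut: "Dom E u = Dom E (elB D)" using u(2) u1t by simp
      have "\<exists>v'. is_lift ?\<alpha> ?\<gamma> (elA D) (u \<cdot> elC D) v'"
        by (rule pullback_lift[OF W]) (simp_all add: dd d(16) u(1,3-5) ut w r M comp_left_eq[OF u(5), of "elC D"])
      then obtain v' where "is_lift ?\<alpha> ?\<gamma> (elA D) (u \<cdot> elC D) v'" by blast
      note v' = is_liftD[OF this]
      have "v \<cdot> v' = v1"
        by (rule pullback_eqI[OF Ue(1)])
          (simp_all add: v(1,3) vd v' v1 v1t Ue comp_left_eq[OF v(4), of v'] comp_left_eq[OF v(5), of v'] P w r kD dd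
            u(1,3-5) ut comp_left_eq[OF u(4), of "elC D"])
      then have s: "elS U \<cdot> v \<cdot> v' = elS D" using v1 by simp
      show "\<exists>u. classifies (El ?r2 ?\<alpha> ?\<gamma> (elS U \<cdot> v)) u D"
        by (intro exI[of _ u] classifiesI[where v = v'])
          (simp_all add: u(1,3-5) v' ut s r v(1,3) vd Ue w)
    next
      fix D u u' assume D: "is_element (Idn E (Dom E f')) f' g D"
        and cl: "classifies (El ?r2 ?\<alpha> ?\<gamma> (elS U \<cdot> v)) u D" "classifies (El ?r2 ?\<alpha> ?\<gamma> (elS U \<cdot> v)) u' D"
      note d = is_element_idnD[OF D]
      have pbD: "is_pullback E f (b \<cdot> elB D) (a \<cdot> elA D) (elC D)" by (rule pullback_paste[OF pb d(1)])
      let ?D = "El (b \<cdot> elB D) (a \<cdot> elA D) (elC D) (elS D)"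
      have D': "is_element (Idn E (Dom E f)) f (a \<cdot> g) ?D"
        by (rule is_element_idnI[OF pbD]) (simp_all add: d P g g')
      have "classifies U (?r1 \<cdot> u) ?D" if c: "classifies (El ?r2 ?\<alpha> ?\<gamma> (elS U \<cdot> v)) u D" for u
      proof -
        obtain v' where "is_cover (El ?r2 ?\<alpha> ?\<gamma> (elS U \<cdot> v)) u D v'" using classifies_cover[OF c] by blast
        note v' = is_coverD[OF this, unfolded element.select_convs] and uD = classifiesD[OF c, unfolded element.select_convs]
        have s: "elS U \<cdot> v \<cdot> v' = elS D" using v'(6) by (simp add: v'(1-3) v(1,3) vd Ue w)
        show ?thesis
          by (rule classifiesI[where v = "v \<cdot> v'"])
            (simp_all add: v(1,3) vd v' Ue comp_left_eq[OF v(4), of v'] comp_left_eq[OF v(5), of v'] P w r kD d(9-15)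
              uD M comp_left_eq[OF r12, of u] s)
      qed
      then have e: "?r1 \<cdot> u = ?r1 \<cdot> u'" using generic_unique[OF U D'] cl by blast
      note uu = cl[THEN classifiesD(1)] cl[THEN classifiesD(2)] cl[THEN classifiesD(3)] cl[THEN classifiesD(4)]
      show "u = u'" by (rule pullback_eqI[OF R _ _ _ _ _ e]) (use uu r in simp_all)
    qed
    then show "\<exists>U. is_generic (Idn E (Dom E f')) f' g U" by blast
  qed
qed

text \<open>A fibre of \<open>g f\<close> is a family of fibres of \<open>f\<close> indexed by a fibre of \<open>g\<close>, so that a section over it is a
  section over the fibre of \<open>g\<close> of the family of sections over the fibres of \<open>f\<close>: \<open>\<Pi>\<^bsub>g f\<^esub> = \<Pi>\<^bsub>g\<^esub> \<Pi>\<^bsub>f\<^esub>\<close>.\<close>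

lemma exponentiable_comp:
  assumes f: "exponentiable E f" and g: "exponentiable E g" and fg: "Cod E f = Dom E g"
  shows "exponentiable E (g \<cdot> f)"
proof (rule exponentiableI)
  note A = exponentiable_arr[OF f] exponentiable_arr[OF g]
  show "g \<cdot> f \<in> Arr E" using A fg by simp
  fix h assume h: "h \<in> Arr E" "Cod E h = Dom E (g \<cdot> f)"
  then have h': "h \<in> Arr E" "Cod E h = Dom E f" using A fg by simp_all
  define U where "U = Pi_element f h"
  have U: "is_generic (Idn E (Dom E f)) f h U" using Pi_element_generic[OF f h'] by (simp add: U_def)
  note u = is_element_idnD[OF generic_element[OF U]]
  define V where "V = Pi_element g (elB U)"
  have V: "is_generic (Idn E (Dom E g)) g (elB U) V"
    using Pi_element_generic[OF g, of "elB U"] u fg by (simp add: V_def)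
  note v = is_element_idnD[OF generic_element[OF V]]
  let ?t = "fst (pb E (elC U) (elS V))" and ?c = "snd (pb E (elC U) (elS V))"
  have T: "is_pullback E (elC U) (elS V) ?t ?c" by (rule pb_pullback) (simp_all add: u v)
  note t = is_pullbackD[OF T]
  \<comment> \<open>The fibre of \<open>V\<close> is mapped to \<open>elB U\<close> by \<open>elS V\<close>; pulling the fibre of \<open>U\<close> back along it pastes the two.\<close>
  let ?W = "El (elB V) (elA U \<cdot> ?t) (elC V \<cdot> ?c) (elS U \<cdot> ?t)"
  have F: "is_pullback E f (elA V) (elA U \<cdot> ?t) ?c"
    using pullback_paste[OF u(1) T] v(7) by simp
  have gf: "is_pullback E (g \<cdot> f) (elB V) (elA U \<cdot> ?t) (elC V \<cdot> ?c)"
    by (rule pullback_paste'[OF F v(1)])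
  have hU: "h \<cdot> elS U \<cdot> x = elA U \<cdot> x" if "x \<in> Arr E" "Cod E x = Dom E (elA U)" for x
    using comp_left_eq[OF u(7), of x] that u by simp
  have "is_generic (Idn E (Dom E (g \<cdot> f))) (g \<cdot> f) h ?W"
    unfolding is_generic_def
  proof (intro conjI allI impI)
    show "is_element (Idn E (Dom E (g \<cdot> f))) (g \<cdot> f) h ?W"
      by (rule is_element_idnI[OF gf]) (simp_all add: h' A fg u t hU)
    fix D assume D: "is_element (Idn E (Dom E (g \<cdot> f))) (g \<cdot> f) h D"
    note d = is_element_idnD[OF D]
    have dc: "Cod E (elB D) = Cod E g" "Cod E (elA D) = Dom E f" using d(12,14) A fg by simp_all
    let ?a = "fst (pb E g (elB D))" and ?c1 = "snd (pb E g (elB D))"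
    have P1: "is_pullback E g (elB D) ?a ?c1" by (rule pb_pullback) (simp_all add: A d(9) dc)
    note p1 = is_pullbackD[OF P1]
    have "\<exists>w. is_lift ?a ?c1 (f \<cdot> elA D) (elC D) w"
      by (rule pullback_lift[OF P1]) (use d(16) A fg in \<open>simp_all add: d(9-11,13,15) dc\<close>)
    then obtain w where "is_lift ?a ?c1 (f \<cdot> elA D) (elC D) w" by blast
    note w = is_liftD[OF this]
    have wd: "Dom E w = Dom E (elA D)" using w(2) A dc d(10) by simp
    have P2: "is_pullback E f ?a (elA D) w"
      by (rule pullback_cancel'[OF P1]) (simp_all add: d(1) w A fg)
    let ?D1 = "El ?a (elA D) w (elS D)"
    have D1: "is_element (Idn E (Dom E f)) f h ?D1"
      by (rule is_element_idnI[OF P2]) (simp_all add: h' d)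
    obtain u1 where u1: "classifies U u1 ?D1" using generic_ex[OF U D1] by blast
    note u1D = classifiesD[OF u1, simplified]
    obtain v2 where "is_cover U u1 ?D1 v2" using classifies_cover[OF u1] by blast
    note v2 = is_coverD[OF this, simplified]
    let ?D2 = "El (elB D) ?a ?c1 u1"
    have D2: "is_element (Idn E (Dom E g)) g (elB U) ?D2"
      by (rule is_element_idnI[OF P1]) (simp_all add: u1D u fg)
    show "\<exists>!x. classifies ?W x D"
    proof (rule ex_ex1I)
      obtain x where x: "classifies V x ?D2" using generic_ex[OF V D2] by blast
      note xD = classifiesD[OF x, simplified]
      obtain v1 where "is_cover V x ?D2 v1" using classifies_cover[OF x] by blast
      note v1 = is_coverD[OF this, simplified]
      have "\<exists>y. is_lift ?t ?c v2 (v1 \<cdot> w) y"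
        by (rule pullback_lift[OF T]) (simp_all add: v2 v1 w(1,3-5) wd u v comp_left_eq[OF v1(6), of w])
      then obtain y where "is_lift ?t ?c v2 (v1 \<cdot> w) y" by blast
      note y = is_liftD[OF this]
      have "classifies ?W x D"
        by (rule classifiesI[where v = y])
          (simp_all add: xD y t u v v2 v1 w(1,3-5) wd comp_left_eq[OF y(4)] comp_left_eq[OF v1(5), of w] p1)
      then show "\<exists>x. classifies ?W x D" by blast
    next
      fix x x' assume x: "classifies ?W x D" "classifies ?W x' D"
      have "classifies V x ?D2" if x: "classifies ?W x D" for x
      proof -
        note xD = classifiesD[OF x, simplified]
        obtain y where "is_cover ?W x D y" using classifies_cover[OF x] by blast
        note y = is_coverD[OF this, unfolded element.select_convs]
        have yt: "Cod E y = Dom E ?t" using y(3) u t by simp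
        have ye: "elA U \<cdot> ?t \<cdot> y = elA D" "elC V \<cdot> ?c \<cdot> y = x \<cdot> elC D" "elS U \<cdot> ?t \<cdot> y = elS D"
          using y(4-6) yt y(1) u t v by simp_all
        have "\<exists>v1. is_lift (elA V) (elC V) ?a (x \<cdot> ?c1) v1"
          by (rule pullback_lift[OF v(1)]) (simp_all add: xD p1 v comp_left_eq[OF xD(4), of ?c1])
        then obtain v1 where "is_lift (elA V) (elC V) ?a (x \<cdot> ?c1) v1" by blast
        note v1 = is_liftD[OF this]
        have cy: "?c \<cdot> y = v1 \<cdot> w"
        proof (rule pullback_eqI[OF v(1)])
          have "elA V \<cdot> ?c \<cdot> y = f \<cdot> elA D"
            using comp_left_eq[OF is_pullbackD(9)[OF F, symmetric], of y] by (simp add: ye(1) y(1) yt u t v A)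
          then show "elA V \<cdot> ?c \<cdot> y = elA V \<cdot> v1 \<cdot> w"
            using comp_left_eq[OF v1(4), of w] by (simp add: w(1,3,4) v1 v(9-15))
          show "elC V \<cdot> ?c \<cdot> y = elC V \<cdot> v1 \<cdot> w"
            using comp_left_eq[OF v1(5), of w] by (simp add: w(1,3-5) v1(1-3) v(9-15) xD p1(1-8) ye)
        qed (simp_all add: y(1,2) yt t v1 w(1,3-5) wd v)
        have "classifies U (elS V \<cdot> v1) ?D1"
          by (rule classifiesI[where v = "?t \<cdot> y"])
            (simp_all add: v v1 t u y(1,2) yt ye comp_left_eq[OF v(7), of v1] comp_left_eq[OF t(9), of y] cy w(1,3-5) wd)
        then have "elS V \<cdot> v1 = u1" using generic_unique[OF U D1 _ u1] by blast
        then show ?thesis by (intro classifiesI[where v = v1]) (simp_all add: xD v1)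
      qed
      then show "x = x'" using generic_unique[OF V D2] x by blast
    qed
  qed
  then show "\<exists>U. is_generic (Idn E (Dom E (g \<cdot> f))) (g \<cdot> f) h U" by blast
qed

section \<open>Canonical maps in terms of generic elements\<close>

lemma classifies_map_source:
  assumes c: "classifies U u (El b a c s)" and U: "is_element x f h U" and l: "l \<in> Arr E" "Dom E l = Dom E h"
  shows "classifies (El (elB U) (elA U) (elC U) (l \<cdot> elS U)) u (El b a c (l \<cdot> s))"
proof -
  note g = is_elementD[OF U]
  obtain v where "is_cover U u (El b a c s) v" using classifies_cover[OF c] by blast
  note v = is_coverD[OF this, simplified]
  show ?thesis
    by (rule classifiesI[where v = v]) (use classifiesD[OF c] in \<open>simp_all add: v g l\<close>)
qed

text \<open>What \<open>m\<close> does to the generic element it does to every element, by restriction. All formulas for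
  canonical maps are proved for the generic element only and then extended by this lemma.\<close>

lemma classifies_comp:
  assumes U': "is_element x' f' h' U'" and U: "is_element x f h U"
    and m: "classifies U' m (El (i \<cdot> elB U) (j \<cdot> elA U) (elC U) (k \<cdot> elS U))"
    and E: "is_element x' f' h' (El (i \<cdot> elB U) (j \<cdot> elA U) (elC U) (k \<cdot> elS U))"
    and D: "is_element x f h D" and w: "classifies U w D"
    and ty: "i \<in> Arr E" "Dom E i = Cod E (elB U)" "j \<in> Arr E" "Dom E j = Cod E (elA U)"
      "k \<in> Arr E" "Dom E k = Cod E (elS U)"
  shows "classifies U' (m \<cdot> w) (El (i \<cdot> elB D) (j \<cdot> elA D) (elC D) (k \<cdot> elS D))"
proof -
  note g = is_elementD[OF U] and d = is_elementD[OF D] and wD = classifiesD[OF w]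
  obtain v where "is_cover U w D v" using classifies_cover[OF w] by blast
  note v = is_coverD[OF this]
  have "classifies U' (m \<cdot> w) (El ((i \<cdot> elB U) \<cdot> w) ((j \<cdot> elA U) \<cdot> v) (elC D) ((k \<cdot> elS U) \<cdot> v))"
    using classifies_restrict[OF U' E m, of w v "elC D"] by (simp add: g d wD v ty)
  then show ?thesis using wD(4) v(4,6) by (simp add: g ty wD(1-3) v(1-3))
qed

text \<open>The action of a pullback square on elements: the fibre stays the same and is mapped along.\<close>

lemma element_comp:
  assumes D: "is_element x f h D" and sq: "is_pullback E f' i j f"
    and x': "x' \<in> Arr E" "Dom E x' = Dom E f'" "x' \<cdot> j = x"
  shows "is_element x' f' h (El (i \<cdot> elB D) (j \<cdot> elA D) (elC D) (elS D))"
proof -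
  note d = is_elementD[OF D] and q = is_pullbackD[OF sq]
  have pb: "is_pullback E f' (i \<cdot> elB D) (j \<cdot> elA D) (elC D)" by (rule pullback_paste[OF sq d(1)])
  have xj: "x' \<cdot> j \<cdot> elA D = h \<cdot> elS D" using comp_left_eq[OF x'(3), of "elA D"] by (simp add: d q x')
  have cx: "Cod E x' = Cod E h" using d(5) x'(3) comp_cod[of j x'] q x' by simp
  show ?thesis unfolding is_element_def using pb xj cx by (simp add: d(2,3,6-17) q x')
qed

text \<open>Source and target are both pullbacks of \<open>h\<close> along \<open>g f\<close>. Compatibility with the projections to the domain
  of \<open>h\<close> is what matters later, since these projections are applied to sections.\<close>

lemma Delta_comp:
  assumes fg: "f \<in> Arr E" "g \<in> Arr E" "Cod E f = Dom E g" and h: "h \<in> Arr E" "Cod E h = Cod E g"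
  shows "Delta_comp E f g h \<in> Arr (slice E (Dom E f))"
    "sdom (Delta_comp E f g h) = fobj (Delta_f E (g \<cdot> f)) h"
    "scod (Delta_comp E f g h) = fobj (Delta_f E f) (fobj (Delta_f E g) h)"
    "is_iso E (sarr (Delta_comp E f g h))"
    "snd (pb E g h) \<cdot> snd (pb E f (fobj (Delta_f E g) h)) \<cdot> sarr (Delta_comp E f g h) = snd (pb E (g \<cdot> f) h)"
proof -
  let ?p = "fst (pb E (g \<cdot> f) h)" and ?q = "snd (pb E (g \<cdot> f) h)" and ?D = "fobj (Delta_f E g) h"
  have P: "is_pullback E (g \<cdot> f) h ?p ?q" by (rule pb_pullback) (simp_all add: fg h)
  have G: "is_pullback E g h ?D (snd (pb E g h))" by (rule Delta_pullback) (simp_all add: fg h)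
  note p = is_pullbackD[OF P] and d = is_pullbackD[OF G]
  have F: "is_pullback E f ?D (fobj (Delta_f E f) ?D) (snd (pb E f ?D))"
    by (rule Delta_pullback) (simp_all add: fg h d)
  note q = is_pullbackD[OF F]
  have pd: "Cod E ?p = Dom E f" using p(7) fg by simp
  have e: "g \<cdot> f \<cdot> ?p = h \<cdot> ?q" using p(9) fg pd p(3) by simp
  note l = pb_lift[of g h "f \<cdot> ?p" ?q]
  have l': "pb_lift E g h (f \<cdot> ?p) ?q \<in> Arr E" "Dom E (pb_lift E g h (f \<cdot> ?p) ?q) = Dom E ?p"
    "Cod E (pb_lift E g h (f \<cdot> ?p) ?q) = Dom E ?D" "?D \<cdot> pb_lift E g h (f \<cdot> ?p) ?q = f \<cdot> ?p"
    "snd (pb E g h) \<cdot> pb_lift E g h (f \<cdot> ?p) ?q = ?q"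
    using l by (simp_all add: fg h p(2-4,6,8) pd e Delta_obj)
  have m: "sarr (Delta_comp E f g h) = pb_lift E f ?D ?p (pb_lift E g h (f \<cdot> ?p) ?q)"
    by (simp add: Delta_comp_def Let_def)
  have m': "sarr (Delta_comp E f g h) \<in> Arr E" "Dom E (sarr (Delta_comp E f g h)) = Dom E ?p"
    "Cod E (sarr (Delta_comp E f g h)) = Dom E (fobj (Delta_f E f) ?D)"
    "fobj (Delta_f E f) ?D \<cdot> sarr (Delta_comp E f g h) = ?p"
    "snd (pb E f ?D) \<cdot> sarr (Delta_comp E f g h) = pb_lift E g h (f \<cdot> ?p) ?q"
    unfolding m using pb_lift[of f ?D ?p "pb_lift E g h (f \<cdot> ?p) ?q"]
    by (simp_all add: fg d(3,7) pd p(3) l' Delta_obj[of ?D])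
  show s: "sdom (Delta_comp E f g h) = fobj (Delta_f E (g \<cdot> f)) h"
    "scod (Delta_comp E f g h) = fobj (Delta_f E f) (fobj (Delta_f E g) h)"
    by (simp_all add: Delta_comp_def Let_def Delta_obj fg h)
  show "Delta_comp E f g h \<in> Arr (slice E (Dom E f))"
    unfolding in_slice_arr s by (simp add: m' q(1-4,6-9) Delta_obj[of h "g \<cdot> f"] fg h p(3) pd)
  show b: "snd (pb E g h) \<cdot> snd (pb E f ?D) \<cdot> sarr (Delta_comp E f g h) = ?q"
    by (simp add: m' l')
  have "is_pullback E (g \<cdot> f) h (fobj (Delta_f E f) ?D) (snd (pb E g h) \<cdot> snd (pb E f ?D))"
    by (rule pullback_paste'[OF F G])
  from pullback_compare[OF this P] obtain i where i: "is_iso E i" "i \<in> Arr E" "Dom E i = Dom E ?p"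
    "Cod E i = Dom E (fobj (Delta_f E f) ?D)" "fobj (Delta_f E f) ?D \<cdot> i = ?p"
    "(snd (pb E g h) \<cdot> snd (pb E f ?D)) \<cdot> i = ?q" by blast
  have "snd (pb E f ?D) \<cdot> i = snd (pb E f ?D) \<cdot> sarr (Delta_comp E f g h)"
  proof (rule pullback_eqI[OF G])
    show "?D \<cdot> snd (pb E f ?D) \<cdot> i = ?D \<cdot> snd (pb E f ?D) \<cdot> sarr (Delta_comp E f g h)"
      using comp_left_eq[OF q(9)[symmetric], of i] comp_left_eq[OF q(9)[symmetric], of "sarr (Delta_comp E f g h)"]
      by (simp add: i(1-5) m'(1-4) q(1-8) d)
    show "snd (pb E g h) \<cdot> snd (pb E f ?D) \<cdot> i = snd (pb E g h) \<cdot> snd (pb E f ?D) \<cdot> sarr (Delta_comp E f g h)"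
      using i(6) b by (simp add: i(2-4) d q)
  qed (simp_all add: i(1-4) m'(1-3) q d)
  then have "i = sarr (Delta_comp E f g h)"
    by (rule pullback_eqI[OF F, rotated -1]) (simp_all add: i(1-5) m'(1-4))
  then show "is_iso E (sarr (Delta_comp E f g h))" using i by simp
qed

lemma Delta_square:
  assumes p2: "p2 \<in> Arr E" and f1: "f1 \<in> Arr E" "Dom E f1 = Cod E p2" and f0: "f0 \<in> Arr E"
    and q2: "q2 \<in> Arr E" "Dom E q2 = Cod E f0" and eq: "q2 \<cdot> f0 = f1 \<cdot> p2" and m: "m \<in> Arr E" "Cod E m = Cod E q2"
  shows "Delta_square E p2 f1 f0 q2 m \<in> Arr (slice E (Dom E p2))"
    "sdom (Delta_square E p2 f1 f0 q2 m) = fobj (Delta_f E p2) (fobj (Delta_f E f1) m)"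
    "scod (Delta_square E p2 f1 f0 q2 m) = fobj (Delta_f E f0) (fobj (Delta_f E q2) m)"
    "snd (pb E q2 m) \<cdot> snd (pb E f0 (fobj (Delta_f E q2) m)) \<cdot> sarr (Delta_square E p2 f1 f0 q2 m)
      = snd (pb E f1 m) \<cdot> snd (pb E p2 (fobj (Delta_f E f1) m))"
proof -
  have c: "Cod E f1 = Cod E q2" "Dom E f0 = Dom E p2"
    using comp_cod[of f0 q2] comp_cod[of p2 f1] comp_dom[of f0 q2] comp_dom[of p2 f1] assms by metis+
  interpret S: category "slice E (Dom E p2)" by (rule slice_category)
  let ?a = "Delta_comp E f0 q2 m" and ?b = "Delta_comp E p2 f1 m"
  have A: "?a \<in> Arr (slice E (Dom E p2))" "sdom ?a = fobj (Delta_f E (q2 \<cdot> f0)) m"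
    "scod ?a = fobj (Delta_f E f0) (fobj (Delta_f E q2) m)" "is_iso E (sarr ?a)"
    "snd (pb E q2 m) \<cdot> snd (pb E f0 (fobj (Delta_f E q2) m)) \<cdot> sarr ?a = snd (pb E (q2 \<cdot> f0) m)"
    using Delta_comp[of f0 q2 m] assms c by simp_all
  have B: "?b \<in> Arr (slice E (Dom E p2))" "sdom ?b = fobj (Delta_f E (q2 \<cdot> f0)) m"
    "scod ?b = fobj (Delta_f E p2) (fobj (Delta_f E f1) m)" "is_iso E (sarr ?b)"
    "snd (pb E f1 m) \<cdot> snd (pb E p2 (fobj (Delta_f E f1) m)) \<cdot> sarr ?b = snd (pb E (q2 \<cdot> f0) m)"
    using Delta_comp[of p2 f1 m] assms c by simp_all
  note b = slice_inverse_of[OF B(1,4)] and bi = iso_inverse[OF B(4)]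
  note ib = S.iso_inverse(1)[OF slice_isoI[OF B(1,4)]]
  have sA: "sarr (Delta_square E p2 f1 f0 q2 m) = sarr ?a \<cdot> inverse_of E (sarr ?b)"
    by (simp add: Delta_square_def b)
  show 1: "Delta_square E p2 f1 f0 q2 m \<in> Arr (slice E (Dom E p2))"
    unfolding Delta_square_def by (rule S.comp_arr[OF ib A(1)]) (simp add: b A B)
  show "sdom (Delta_square E p2 f1 f0 q2 m) = fobj (Delta_f E p2) (fobj (Delta_f E f1) m)"
    "scod (Delta_square E p2 f1 f0 q2 m) = fobj (Delta_f E f0) (fobj (Delta_f E q2) m)"
    by (simp_all add: Delta_square_def b A B)
  have Q: "is_pullback E q2 m (fobj (Delta_f E q2) m) (snd (pb E q2 m))" by (rule Delta_pullback) (simp_all add: q2 m)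
  note q = is_pullbackD[OF Q]
  have F0: "is_pullback E f0 (fobj (Delta_f E q2) m) (fobj (Delta_f E f0) (fobj (Delta_f E q2) m)) (snd (pb E f0 (fobj (Delta_f E q2) m)))"
    by (rule Delta_pullback) (simp_all add: f0 q q2)
  note f0' = is_pullbackD[OF F0]
  have R: "is_pullback E f1 m (fobj (Delta_f E f1) m) (snd (pb E f1 m))" by (rule Delta_pullback) (simp_all add: f1 m c)
  note r = is_pullbackD[OF R]
  have P2: "is_pullback E p2 (fobj (Delta_f E f1) m) (fobj (Delta_f E p2) (fobj (Delta_f E f1) m)) (snd (pb E p2 (fobj (Delta_f E f1) m)))"
    by (rule Delta_pullback) (simp_all add: p2 r f1)
  note p2' = is_pullbackD[OF P2]
  note a1 = A(1)[unfolded in_slice_arr A(2,3)] and b1 = B(1)[unfolded in_slice_arr B(2,3)]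
  have "snd (pb E q2 m) \<cdot> snd (pb E f0 (fobj (Delta_f E q2) m)) \<cdot> sarr ?a \<cdot> inverse_of E (sarr ?b)
    = (snd (pb E q2 m) \<cdot> snd (pb E f0 (fobj (Delta_f E q2) m)) \<cdot> sarr ?a) \<cdot> inverse_of E (sarr ?b)"
    using a1 b1 by (simp add: bi q(1-8) f0'(1-8))
  also have "\<dots> = (snd (pb E f1 m) \<cdot> snd (pb E p2 (fobj (Delta_f E f1) m)) \<cdot> sarr ?b) \<cdot> inverse_of E (sarr ?b)"
    using A(5) B(5) by simp
  also have "\<dots> = snd (pb E f1 m) \<cdot> snd (pb E p2 (fobj (Delta_f E f1) m))"
    using b1 by (simp add: bi r(1-8) p2'(1-8))
  finally show "snd (pb E q2 m) \<cdot> snd (pb E f0 (fobj (Delta_f E q2) m)) \<cdot> sarr (Delta_square E p2 f1 f0 q2 m)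
      = snd (pb E f1 m) \<cdot> snd (pb E p2 (fobj (Delta_f E f1) m))" by (simp add: sA)
qed

text \<open>Translates the unit, from which the Beck-Chevalley mate is built, into elements.\<close>

lemma Pi_transpose_classifies:
  assumes f: "exponentiable E f" and b: "b \<in> Arr E" "Cod E b = Cod E f" and g: "g \<in> Arr E" "Cod E g = Dom E f"
    and \<phi>: "\<phi> \<in> Arr (slice E (Dom E f))" "sdom \<phi> = fobj (Delta_f E f) b" "scod \<phi> = g"
  defines "z \<equiv> farr (Pi_f E f) \<phi> \<cdot>\<^bsub>slice E (Cod E f)\<^esub> ncmp (Pi_unit E f) b"
  shows "z \<in> Arr (slice E (Cod E f))" "sdom z = b" "scod z = fobj (Pi_f E f) g"
    "classifies (Pi_element f g) (sarr z) (El b (fobj (Delta_f E f) b) (snd (pb E f b)) (sarr \<phi>))"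
proof -
  interpret A: adjunction "slice E (Cod E f)" "slice E (Dom E f)" "Delta_f E f" "Pi_f E f" "Pi_unit E f" "Pi_counit E f"
    by (rule Pi_adjunction[OF f])
  have b': "b \<in> Obj (slice E (Cod E f))" and g': "g \<in> Obj (slice E (Dom E f))" using b g by simp_all
  note T = A.transpose[OF slice_category slice_category b' g' \<phi>(1), unfolded slice_simps(2,3), OF \<phi>(2,3), folded z_def]
  show z: "z \<in> Arr (slice E (Cod E f))" "sdom z = b" "scod z = fobj (Pi_f E f) g" by (fact T)+
  note f' = exponentiable_arr[OF f]
  note W = Delta_arr[OF f' z(1), unfolded z(2,3)] and z' = z(1)[unfolded in_slice_arr z(2,3)]
  have e: "sarr (ncmp (Pi_counit E f) g) \<cdot> sarr (farr (Delta_f E f) z) = sarr \<phi>"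
    using arg_cong[OF T(4), of sarr] by simp
  have p: "Dom E (snd (pb E f b)) = Dom E (fobj (Delta_f E f) b)"
    using is_pullbackD[OF Delta_pullback[OF f' b]] by simp
  show "classifies (Pi_element f g) (sarr z) (El b (fobj (Delta_f E f) b) (snd (pb E f b)) (sarr \<phi>))"
    by (rule classifiesI[where v = "sarr (farr (Delta_f E f) z)"]) (use z' in \<open>simp_all add: W e\<close>)
qed

text \<open>Naturality of the counit in terms of elements: on arrows \<open>\<Pi>\<^bsub>f\<^esub>\<close> composes sections with \<open>u\<close>.\<close>

lemma Pi_arr_classifies:
  assumes f: "exponentiable E f" and u: "u \<in> Arr (slice E (Dom E f))"
  defines "U \<equiv> Pi_element f (sdom u)"
  shows "farr (Pi_f E f) u \<in> Arr (slice E (Cod E f))"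
    "sdom (farr (Pi_f E f) u) = fobj (Pi_f E f) (sdom u)" "scod (farr (Pi_f E f) u) = fobj (Pi_f E f) (scod u)"
    "classifies (Pi_element f (scod u)) (sarr (farr (Pi_f E f) u)) (El (elB U) (elA U) (elC U) (sarr u \<cdot> elS U))"
proof -
  interpret A: adjunction "slice E (Cod E f)" "slice E (Dom E f)" "Delta_f E f" "Pi_f E f" "Pi_unit E f" "Pi_counit E f"
    by (rule Pi_adjunction[OF f])
  note F = is_functorD[OF A.right_functor]
  show z: "farr (Pi_f E f) u \<in> Arr (slice E (Cod E f))"
    "sdom (farr (Pi_f E f) u) = fobj (Pi_f E f) (sdom u)" "scod (farr (Pi_f E f) u) = fobj (Pi_f E f) (scod u)"
    using F(2-4)[OF u] by simp_all
  note f' = exponentiable_arr[OF f]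
  note W = Delta_arr[OF f' z(1), unfolded z(2,3)] and z' = z(1)[unfolded in_slice_arr z(2,3)]
  have u1: "sdom u \<in> Arr E" "Cod E (sdom u) = Dom E f" using u by (simp_all add: in_slice_arr)
  note p = is_pullbackD[OF Delta_pullback[OF f' Pi_obj[OF f u1]]]
  show "classifies (Pi_element f (scod u)) (sarr (farr (Pi_f E f) u)) (El (elB U) (elA U) (elC U) (sarr u \<cdot> elS U))"
    by (rule classifiesI[where v = "sarr (farr (Delta_f E f) (farr (Pi_f E f) u))"])
      (use z' in \<open>simp_all add: W U_def Pi_counit_natural[OF f u] p\<close>)
qed

text \<open>Since the square is a pullback, the fibre of \<open>p2\<close> over a point of its base and the fibre of \<open>q2\<close> over the
  image of this point under \<open>f1\<close> agree. The mate sends a section over the latter to the same section over the former. It is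
  invertible because sections over a fibre of \<open>p2\<close> can be read back, and the last clause is the formula
  for the inverse, followed by the projection to \<open>\<Pi>\<^bsub>q2\<^esub> k\<close>.\<close>

lemma Beck_Chevalley:
  assumes ex: "exponentiable E p2" "exponentiable E q2" and sq: "is_pullback E q2 f1 f0 p2"
    and k: "k \<in> Arr E" "Cod E k = Dom E q2"
  defines "z \<equiv> Beck_Chevalley E p2 f1 f0 q2 k" and "U \<equiv> Pi_element p2 (fobj (Delta_f E f0) k)"
  shows "z \<in> Arr (slice E (Cod E p2))" "sdom z = fobj (Delta_f E f1) (fobj (Pi_f E q2) k)"
    "scod z = fobj (Pi_f E p2) (fobj (Delta_f E f0) k)" "is_iso E (sarr z)"
    "classifies (Pi_element q2 k) (snd (pb E f1 (fobj (Pi_f E q2) k)) \<cdot> inverse_of E (sarr z))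
       (El (f1 \<cdot> elB U) (f0 \<cdot> elA U) (elC U) (snd (pb E f0 k) \<cdot> elS U))"
proof -
  note s = is_pullbackD[OF sq]
  define V where "V = Pi_element q2 k"
  have V: "is_generic (Idn E (Dom E q2)) q2 k V" using Pi_element_generic[OF ex(2) k] by (simp add: V_def)
  note v = is_element_idnD[OF generic_element[OF V]]
  define K where "K = fobj (Delta_f E f0) k"
  define l where "l = snd (pb E f0 k)"
  have PK: "is_pullback E f0 k K l" unfolding K_def l_def by (rule Delta_pullback) (simp_all add: s k)
  note pk = is_pullbackD[OF PK]
  have U': "is_generic (Idn E (Dom E p2)) p2 K U"
    using Pi_element_generic[OF ex(1), of K] by (simp add: U_def K_def[symmetric] pk s)
  note u = is_element_idnD[OF generic_element[OF U']]
  define U0 where "U0 = El (elB U) (elA U) (elC U) (l \<cdot> elS U)"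
  have U0: "is_generic f0 p2 k U0"
    using generic_pullback[OF U' PK] s by (simp add: U0_def)
  note u0E = generic_element[OF U0]
  define r where "r = elB V"
  have rP: "fobj (Pi_f E q2) k = r" by (simp add: r_def V_def)
  have r: "r \<in> Arr E" "Cod E r = Cod E q2" using v by (simp_all add: r_def)
  define M where "M = fobj (Delta_f E f1) r"
  define m where "m = snd (pb E f1 r)"
  have PM: "is_pullback E f1 r M m" unfolding M_def m_def by (rule Delta_pullback) (use s r in simp_all)
  note pm = is_pullbackD[OF PM]
  define A where "A = fobj (Delta_f E p2) M"
  define c where "c = snd (pb E p2 M)"
  have PA: "is_pullback E p2 M A c" unfolding A_def c_def by (rule Delta_pullback) (use s pm in simp_all)
  note pa = is_pullbackD[OF PA]
  define S where "S = Delta_square E p2 f1 f0 q2 r"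
  have S: "S \<in> Arr (slice E (Dom E p2))" "sdom S = A" "scod S = fobj (Delta_f E f0) (fobj (Delta_f E q2) r)"
    "elC V \<cdot> snd (pb E f0 (fobj (Delta_f E q2) r)) \<cdot> sarr S = m \<cdot> c"
    using Delta_square[of p2 f1 f0 q2 r] s r by (simp_all add: S_def A_def M_def c_def m_def V_def rP)
  note s' = S(1)[unfolded in_slice_arr S(2,3)]
  define D where "D = fobj (Delta_f E q2) r"
  have D: "elA V = D" by (simp add: V_def D_def rP)
  define t where "t = snd (pb E f0 D)"
  have PT: "is_pullback E f0 D (fobj (Delta_f E f0) D) t" unfolding t_def
    by (rule Delta_pullback) (use v s D in simp_all)
  note pt = is_pullbackD[OF PT]
  note s' = S(1)[unfolded in_slice_arr S(2,3), folded D_def] and S4 = S(4)[folded D_def, folded t_def]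
  \<comment> \<open>The identification of the two fibres, from the one over \<open>p2\<close> to the one over \<open>q2\<close>.\<close>
  define x where "x = t \<cdot> sarr S"
  have x: "x \<in> Arr E" "Dom E x = Dom E A" "Cod E x = Dom E (elA V)"
    using s' pt by (simp_all add: x_def D)
  have xA: "elA V \<cdot> x = f0 \<cdot> A"
    using comp_left_eq[OF pt(9)[symmetric], of "sarr S"] s' by (simp add: x_def pt(1-8) D)
  have xC: "elC V \<cdot> x = m \<cdot> c" using S4 by (simp add: x_def)
  define e where "e = ncmp (Pi_counit E q2) k"
  have e: "e \<in> Arr (slice E (Cod E f0))" "sdom e = D" "scod e = k" "sarr e = elS V"
    using Pi_counit[OF ex(2) k] s by (simp_all add: e_def D_def rP V_def)
  note eD = Delta_arr[OF s(3) e(1), unfolded e(2-4), folded t_def l_def K_def]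
  have e': "farr (Delta_f E f0) e \<in> Arr (slice E (Dom E p2))"
    using is_functorD(2)[OF Delta_functor[OF s(3)] e(1)] s by simp
  interpret S: category "slice E (Dom E p2)" by (rule slice_category)
  define \<phi> where "\<phi> = farr (Delta_f E f0) e \<cdot>\<^bsub>slice E (Dom E p2)\<^esub> S"
  have ph: "\<phi> \<in> Arr (slice E (Dom E p2))" "sdom \<phi> = A" "scod \<phi> = K"
    unfolding \<phi>_def using S.comp_arr[OF S(1) e'] S(2,3) eD(1,2) by (simp_all add: D_def)
  have lph: "l \<cdot> sarr \<phi> = elS V \<cdot> x"
    using comp_left_eq[OF eD(7), of "sarr S"] s' by (simp add: \<phi>_def x_def eD(3-5) pk pt v D)
  have zz: "z = farr (Pi_f E p2) \<phi> \<cdot>\<^bsub>slice E (Cod E p2)\<^esub> ncmp (Pi_unit E p2) M"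
    unfolding z_def Beck_Chevalley_def \<phi>_def S_def e_def M_def rP ..
  have M2: "M \<in> Arr E" "Cod E M = Cod E p2" using pm s by simp_all
  have K2: "K \<in> Arr E" "Cod E K = Dom E p2" using pk s by simp_all
  note Z = Pi_transpose_classifies[OF ex(1) M2 K2 ph(1) ph(2)[unfolded A_def] ph(3), folded zz A_def c_def]
  show "z \<in> Arr (slice E (Cod E p2))" "sdom z = fobj (Delta_f E f1) (fobj (Pi_f E q2) k)"
    "scod z = fobj (Pi_f E p2) (fobj (Delta_f E f0) k)"
    using Z(1-3) by (simp_all add: M_def rP K_def)
  have cz: "classifies U0 (sarr z) (El M A c (elS V \<cdot> x))"
    using classifies_map_source[OF Z(4) _ pk(4)] generic_element[OF U'] pk(6)
    by (simp add: U_def K_def[symmetric] U0_def lph)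
  note z = classifiesD[OF cz, simplified]
  have kV: "k \<cdot> elS V \<cdot> x = f0 \<cdot> A" using comp_left_eq[OF v(7), of x] by (simp add: x v xA)
  have Dz: "is_element f0 p2 k (El M A c (elS V \<cdot> x))"
    unfolding is_element_def using PA by (simp add: s(3,6) k x v kV s(7) pk(5))
  have cm: "classifies V m (El (f1 \<cdot> M) (f0 \<cdot> A) c (elS V \<cdot> x))"
    by (rule classifiesI[where v = x]) (simp_all add: pm pa s x xA xC r_def[symmetric])
  have Dm: "is_element (Idn E (Dom E q2)) q2 k (El (f1 \<cdot> M) (f0 \<cdot> A) c (elS V \<cdot> x))"
    using element_comp[OF Dz sq, of "Idn E (Dom E q2)"] s by simp
  let ?W = "El (f1 \<cdot> elB U) (f0 \<cdot> elA U) (elC U) (l \<cdot> elS U)"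
  have W: "is_element (Idn E (Dom E q2)) q2 k ?W"
    using element_comp[OF u0E sq, of "Idn E (Dom E q2)"] s by (simp add: U0_def)
  \<comment> \<open>Reading a section over a fibre of \<open>p2\<close> as one over the fibre of \<open>q2\<close>; \<open>y\<close> is the induced inverse of the mate.\<close>
  obtain w where w: "classifies V w ?W" using generic_ex[OF V W] by blast
  note wD = classifiesD[OF w, simplified]
  have fB: "Cod E (elB U) = Dom E f1" using u s by simp
  have "\<exists>y. is_lift M m (elB U) w y"
    by (rule pullback_lift[OF PM]) (simp_all add: u(9) fB wD s r r_def[symmetric] wD(4)[folded r_def])
  then obtain y where "is_lift M m (elB U) w y" by blast
  note y = is_liftD[OF this]
  have "\<exists>y'. is_lift A c (elA U) (y \<cdot> elC U) y'"
    by (rule pullback_lift[OF PA])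
      (simp_all add: u y pm s comp_left_eq[OF y(4), of "elC U"])
  then obtain y' where "is_lift A c (elA U) (y \<cdot> elC U) y'" by blast
  note y' = is_liftD[OF this]
  have "classifies V (m \<cdot> y) (El (f1 \<cdot> elB U) (f0 \<cdot> elA U) (elC U) (elS V \<cdot> x \<cdot> y'))"
    using classifies_restrict[OF generic_element[OF V] Dm cm, of y y' "elC U"]
    by (simp add: y y' u s pm(1-8) pa(1-8) v x)
  then have sx: "elS V \<cdot> x \<cdot> y' = l \<cdot> elS U"
    using classified_unique[OF generic_element[OF V] W w] y(5) by simp
  have "classifies U0 (sarr z \<cdot> y) (El (elB U) (elA U) (elC U) (l \<cdot> elS U))"
    using classifies_restrict[OF u0E Dz cz, of y y' "elC U"] sx
    by (simp add: y y' u pm(1-8) pa(1-8) v x)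
  then have zy: "sarr z \<cdot> y = Idn E (Dom E (elB U))"
    using generic_unique[OF U0 u0E _ classifies_self[OF u0E]] by (simp add: U0_def)
  have "classifies V (w \<cdot> sarr z) (El (f1 \<cdot> M) (f0 \<cdot> A) c (Idn E (Dom E k) \<cdot> elS V \<cdot> x))"
    using classifies_comp[OF generic_element[OF V] u0E _ _ Dz cz, of w f1 f0 "Idn E (Dom E k)"] w W
    by (simp add: U0_def pk u s(2,3,6,8) fB k)
  then have wz: "w \<cdot> sarr z = m"
    using generic_unique[OF V Dm _ cm] by (simp add: v x)
  have "y \<cdot> sarr z = Idn E (Dom E M)"
    by (rule pullback_eqI[OF PM])
      (use z in \<open>simp_all add: y pm(1-8) U0_def comp_left_eq[OF y(4), of "sarr z"] comp_left_eq[OF y(5), of "sarr z"] wz u\<close>)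
  then have inv: "inverse_arrows E (sarr z) y"
    using z by (intro inverse_arrowsI) (simp_all add: y zy U0_def)
  then show "is_iso E (sarr z)" unfolding is_iso_def by blast
  show "classifies (Pi_element q2 k) (snd (pb E f1 (fobj (Pi_f E q2) k)) \<cdot> inverse_of E (sarr z))
       (El (f1 \<cdot> elB U) (f0 \<cdot> elA U) (elC U) (snd (pb E f0 k) \<cdot> elS U))"
    using w by (simp add: inverse_of_eq[OF inv] rP m_def[symmetric] y V_def l_def)
qed

section \<open>Polynomial functors\<close>

lemma is_polyD:
  assumes "is_poly E X Y p"
  shows "pol1 p \<in> Arr E" "pol2 p \<in> Arr E" "pol3 p \<in> Arr E" "Cod E (pol1 p) = X" "Cod E (pol3 p) = Y"
    "Dom E (pol1 p) = Dom E (pol2 p)" "Cod E (pol2 p) = Dom E (pol3 p)" "exponentiable E (pol2 p)"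
  using assms by (auto simp: is_poly_def)

text \<open>The generic element of \<open>\<Pi>\<^bsub>p2\<^esub>\<close> at the pullback of \<open>h\<close> along \<open>p1\<close>, with sections composed down to the domain of \<open>h\<close>.\<close>

definition poly_element :: "'a poly \<Rightarrow> 'a \<Rightarrow> 'a element" where
  "poly_element p h = (let U = Pi_element (pol2 p) (fobj (Delta_f E (pol1 p)) h) in
     El (elB U) (elA U) (elC U) (snd (pb E (pol1 p) h) \<cdot> elS U))"

lemma poly_element_simps:
  "elB (poly_element p h) = elB (Pi_element (pol2 p) (fobj (Delta_f E (pol1 p)) h))"
  "elA (poly_element p h) = elA (Pi_element (pol2 p) (fobj (Delta_f E (pol1 p)) h))"
  "elC (poly_element p h) = elC (Pi_element (pol2 p) (fobj (Delta_f E (pol1 p)) h))"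
  "elS (poly_element p h) = snd (pb E (pol1 p) h) \<cdot> elS (Pi_element (pol2 p) (fobj (Delta_f E (pol1 p)) h))"
  by (simp_all add: poly_element_def Let_def)

lemma poly_element_generic:
  assumes p: "is_poly E X Y p" and h: "h \<in> Arr E" "Cod E h = X"
  shows "is_generic (pol1 p) (pol2 p) h (poly_element p h)"
proof -
  note P = is_polyD[OF p]
  have pb: "is_pullback E (pol1 p) h (fobj (Delta_f E (pol1 p)) h) (snd (pb E (pol1 p) h))"
    by (rule Delta_pullback) (simp_all add: P h)
  note d = is_pullbackD[OF pb]
  have "is_generic (Idn E (Dom E (pol2 p))) (pol2 p) (fobj (Delta_f E (pol1 p)) h)
      (Pi_element (pol2 p) (fobj (Delta_f E (pol1 p)) h))"
    by (rule Pi_element_generic) (simp_all add: P d)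
  from generic_pullback[OF this pb] P(6) show ?thesis by (simp add: poly_element_def Let_def)
qed

text \<open>The arrow \<open>w\<close> is a map into the domain of \<open>elB (poly_element p h)\<close>, which is also the domain of the value
  at \<open>h\<close> of the polynomial functor, because \<open>\<Sigma>\<^bsub>p3\<^esub>\<close> only composes with \<open>p3\<close>.\<close>

definition names :: "'a poly \<Rightarrow> 'a \<Rightarrow> 'a \<Rightarrow> 'a element \<Rightarrow> bool" where
  "names p h w D \<longleftrightarrow> is_element (pol1 p) (pol2 p) h D \<and> classifies (poly_element p h) w D"

lemma names_self:
  assumes p: "is_poly E X Y p" and h: "h \<in> Arr E" "Cod E h = X"
  shows "names p h (Idn E (Dom E (elB (poly_element p h)))) (poly_element p h)"
  unfolding names_def
  using generic_element[OF poly_element_generic[OF assms]] classifies_self by blast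

lemma names_arr: "names p h w D \<Longrightarrow> w \<in> Arr E \<and> Dom E w = Dom E (elB D) \<and> Cod E w = Dom E (elB (poly_element p h))"
  by (auto simp: names_def dest: classifiesD)

lemma names_ex:
  assumes p: "is_poly E X Y p" and h: "h \<in> Arr E" "Cod E h = X" and "is_element (pol1 p) (pol2 p) h D"
  shows "\<exists>w. names p h w D"
  unfolding names_def using generic_ex[OF poly_element_generic[OF p h]] assms(4) by blast

lemma names_unique:
  assumes p: "is_poly E X Y p" and h: "h \<in> Arr E" "Cod E h = X" and "names p h w D" "names p h w' D"
  shows "w = w'"
  using generic_unique[OF poly_element_generic[OF p h]] assms(4,5) unfolding names_def by blast

lemma ex_names:
  assumes p: "is_poly E X Y p" and h: "h \<in> Arr E" "Cod E h = X"
    and w: "w \<in> Arr E" "Cod E w = Dom E (elB (poly_element p h))"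
  shows "\<exists>D. names p h w D"
  unfolding names_def using ex_classified[OF generic_element[OF poly_element_generic[OF p h]] w] by metis

lemma P1_obj:
  assumes p: "is_poly E X Y p" and h: "h \<in> Arr E" "Cod E h = X"
  shows "fobj (P1 E X Y p) h = pol3 p \<cdot> elB (poly_element p h)"
proof -
  note P = is_polyD[OF p]
  note d = is_pullbackD[OF Delta_pullback[of "pol1 p" h]]
  have "fobj (Delta_f E (pol1 p)) h \<in> Arr E" "Cod E (fobj (Delta_f E (pol1 p)) h) = Dom E (pol2 p)"
    using d P h by simp_all
  then show ?thesis
    using Pi_obj[OF P(8), of "fobj (Delta_f E (pol1 p)) h"] h
    by (simp add: P1_def Sigma_f_simps poly_element_simps P)
qed

lemma P1_obj_arr:
  assumes p: "is_poly E X Y p" and h: "h \<in> Arr E" "Cod E h = X"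
  shows "fobj (P1 E X Y p) h \<in> Arr E" "Cod E (fobj (P1 E X Y p) h) = Y"
    "Dom E (fobj (P1 E X Y p) h) = Dom E (elB (poly_element p h))"
  using is_polyD[OF p] is_elementD[OF generic_element[OF poly_element_generic[OF assms]]]
  by (simp_all add: P1_obj[OF assms])

lemma P1_functor:
  assumes p: "is_poly E X Y p"
  shows "is_functor (slice E X) (slice E Y) (P1 E X Y p)"
proof -
  note P = is_polyD[OF p]
  interpret A: adjunction "slice E (Cod E (pol2 p))" "slice E (Dom E (pol2 p))" "Delta_f E (pol2 p)" "Pi_f E (pol2 p)"
    "Pi_unit E (pol2 p)" "Pi_counit E (pol2 p)"
    by (rule Pi_adjunction[OF P(8)])
  have 1: "is_functor (slice E X) (slice E (Dom E (pol2 p))) (Delta_f E (pol1 p))"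
    using Delta_functor[OF P(1)] P by simp
  have 2: "is_functor (slice E (Dom E (pol3 p))) (slice E Y) (Sigma_f E (pol3 p))"
    using Sigma_functor[OF P(3)] P by simp
  show ?thesis
    unfolding P1_def
    by (rule comp_func_functor[OF slice_category comp_func_functor[OF slice_category 1 A.right_functor] 2[folded P(7)]])
qed

lemma P1_arr:
  assumes p: "is_poly E X Y p" and u: "u \<in> Arr (slice E X)"
  shows "farr (P1 E X Y p) u \<in> Arr (slice E Y)"
    "sdom (farr (P1 E X Y p) u) = fobj (P1 E X Y p) (sdom u)" "scod (farr (P1 E X Y p) u) = fobj (P1 E X Y p) (scod u)"
  using is_functorD(2-4)[OF P1_functor[OF p] u] by simp_all

text \<open>Both \<open>\<Delta>\<^bsub>p1\<^esub>\<close> and \<open>\<Pi>\<^bsub>p2\<^esub>\<close> act on sections by composition, which is first checked for the generic element.\<close>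

lemma P1_arr_names:
  assumes p: "is_poly E X Y p" and u: "u \<in> Arr (slice E X)" and w: "names p (sdom u) w D"
  shows "names p (scod u) (sarr (farr (P1 E X Y p) u) \<cdot> w) (El (elB D) (elA D) (elC D) (sarr u \<cdot> elS D))"
proof -
  note P = is_polyD[OF p]
  note u' = u[unfolded in_slice_arr]
  have D: "is_element (pol1 p) (pol2 p) (sdom u) D" and c: "classifies (poly_element p (sdom u)) w D"
    using w by (simp_all add: names_def)
  note d = is_elementD[OF D]
  have su: "scod u \<cdot> sarr u \<cdot> s = sdom u \<cdot> s" if "s \<in> Arr E" "Cod E s = Dom E (sdom u)" for s
    using comp_left_eq[of "scod u" "sarr u" "sdom u" s] u' that by simp
  have el: "is_element (pol1 p) (pol2 p) (scod u) (El (elB D) (elA D) (elC D) (sarr u \<cdot> elS D))"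
    if D: "is_element (pol1 p) (pol2 p) (sdom u) D" for D
    using is_elementD[OF D] u' by (simp add: is_element_def su P)
  let ?u = "farr (Delta_f E (pol1 p)) u"
  have u1: "u \<in> Arr (slice E (Cod E (pol1 p)))" using u P by simp
  have du: "?u \<in> Arr (slice E (Dom E (pol2 p)))"
    using is_functorD(2)[OF Delta_functor[OF P(1)] u1] P by simp
  note dl = Delta_arr[OF P(1) u1]
  note pi = Pi_arr_classifies[OF P(8) du, unfolded dl(1,2)]
  let ?m = "sarr (farr (Pi_f E (pol2 p)) ?u)"
  have m: "sarr (farr (P1 E X Y p) u) = ?m"
    using u pi(1) P by (simp add: P1_def Sigma_f_simps)
  let ?U = "poly_element p (sdom u)" and ?V = "poly_element p (scod u)"
  have U: "is_element (pol1 p) (pol2 p) (sdom u) ?U" and V: "is_element (pol1 p) (pol2 p) (scod u) ?V"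
    using poly_element_generic[OF p, THEN generic_element] u' by simp_all
  note uu = is_elementD[OF U]
  have PB: "is_pullback E (pol1 p) (scod u) (fobj (Delta_f E (pol1 p)) (scod u)) (snd (pb E (pol1 p) (scod u)))"
    by (rule Delta_pullback) (simp_all add: P u')
  note b = is_pullbackD[OF PB]
  have PA: "is_pullback E (pol1 p) (sdom u) (fobj (Delta_f E (pol1 p)) (sdom u)) (snd (pb E (pol1 p) (sdom u)))"
    by (rule Delta_pullback) (simp_all add: P u')
  note a = is_pullbackD[OF PA]
  have X: "is_element (Idn E (Dom E (pol2 p))) (pol2 p) (fobj (Delta_f E (pol1 p)) (scod u))
     (Pi_element (pol2 p) (fobj (Delta_f E (pol1 p)) (scod u)))"
    by (rule Pi_element_element) (simp_all add: P b)
  have Y: "is_element (Idn E (Dom E (pol2 p))) (pol2 p) (fobj (Delta_f E (pol1 p)) (sdom u))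
     (Pi_element (pol2 p) (fobj (Delta_f E (pol1 p)) (sdom u)))"
    by (rule Pi_element_element) (simp_all add: P a)
  note y = is_element_idnD[OF Y]
  let ?s = "sarr (ncmp (Pi_counit E (pol2 p)) (fobj (Delta_f E (pol1 p)) (sdom u)))"
  have "snd (pb E (pol1 p) (scod u)) \<cdot> sarr ?u \<cdot> ?s = sarr u \<cdot> snd (pb E (pol1 p) (sdom u)) \<cdot> ?s"
    using comp_left_eq[OF dl(7), of ?s] y by (simp add: dl(3-5) a(1-8) b(1-8) u')
  then have cm: "classifies ?V ?m (El (Idn E (Cod E (pol2 p)) \<cdot> elB ?U) (Idn E (Dom E (pol2 p)) \<cdot> elA ?U) (elC ?U) (sarr u \<cdot> elS ?U))"
    using classifies_map_source[OF pi(4) X, of "snd (pb E (pol1 p) (scod u))"] b y uu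
    by (simp add: poly_element_simps[of p "scod u"] poly_element_def[of p "scod u"] Let_def poly_element_simps)
  have "classifies ?V (?m \<cdot> w) (El (Idn E (Cod E (pol2 p)) \<cdot> elB D) (Idn E (Dom E (pol2 p)) \<cdot> elA D) (elC D) (sarr u \<cdot> elS D))"
    by (rule classifies_comp[OF V U cm _ D c]) (use el[OF U] in \<open>simp_all add: uu u' P\<close>)
  then show ?thesis
    unfolding names_def m using el[OF D] by (simp add: d)
qed

lemma is_cartD:
  assumes "is_cart E X Y f"
  shows "is_poly E X Y (csrc f)" "is_poly E X Y (ctrg f)"
    "car0 f \<in> Arr E" "Dom E (car0 f) = Dom E (pol2 (csrc f))" "Cod E (car0 f) = Dom E (pol2 (ctrg f))"
    "car1 f \<in> Arr E" "Dom E (car1 f) = Dom E (pol3 (csrc f))" "Cod E (car1 f) = Dom E (pol3 (ctrg f))"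
    "pol1 (ctrg f) \<cdot> car0 f = pol1 (csrc f)" "pol3 (ctrg f) \<cdot> car1 f = pol3 (csrc f)"
    "is_pullback E (pol2 (ctrg f)) (car1 f) (car0 f) (pol2 (csrc f))"
  using assms is_polyD(7)[of X Y "csrc f"] is_polyD(7)[of X Y "ctrg f"] by (auto simp: is_cart_def)

lemma cart_element:
  assumes f: "is_cart E X Y f" and D: "is_element (pol1 (csrc f)) (pol2 (csrc f)) h D"
  shows "is_element (pol1 (ctrg f)) (pol2 (ctrg f)) h (El (car1 f \<cdot> elB D) (car0 f \<cdot> elA D) (elC D) (elS D))"
  by (rule element_comp[OF D is_cartD(11)[OF f]]) (simp_all add: is_cartD(9)[OF f] is_polyD[OF is_cartD(2)[OF f]])

text \<open>Of the three factors of the component, the first replaces a section by its image in the iterated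
  pullback, the second is the inverse Beck-Chevalley isomorphism, and the third projects from the
  pullback along \<open>f1\<close>. The last two together send \<open>(b, a, c, s)\<close> to \<open>(f1 b, f0 a, c, s)\<close> by the formula for the
  inverse, and the first disappears once sections are composed down to the domain of \<open>h\<close>.\<close>

lemma
  assumes f: "is_cart E X Y f" and h: "h \<in> Arr E" "Cod E h = X"
  shows P2_arr: "ncmp (P2 E X Y f) h \<in> Arr (slice E Y)"
    "sdom (ncmp (P2 E X Y f) h) = fobj (P1 E X Y (csrc f)) h" "scod (ncmp (P2 E X Y f) h) = fobj (P1 E X Y (ctrg f)) h"
    and P2_names: "names (csrc f) h w D \<Longrightarrow>
      names (ctrg f) h (sarr (ncmp (P2 E X Y f) h) \<cdot> w) (El (car1 f \<cdot> elB D) (car0 f \<cdot> elA D) (elC D) (elS D))"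
proof -
  note F = is_cartD[OF f] note P = is_polyD[OF F(1)] and Q = is_polyD[OF F(2)]
  define p where "p = csrc f" define q where "q = ctrg f"
  define f0 where "f0 = car0 f" define f1 where "f1 = car1 f"
  note F = F[folded p_def q_def f0_def f1_def] and P = P[folded p_def] and Q = Q[folded q_def]
  define k where "k = fobj (Delta_f E (pol1 q)) h"
  have PK: "is_pullback E (pol1 q) h k (snd (pb E (pol1 q) h))"
    unfolding k_def by (rule Delta_pullback) (simp_all add: Q h)
  note pk = is_pullbackD[OF PK]
  have k: "k \<in> Arr E" "Cod E k = Dom E (pol2 q)" using pk Q by simp_all
  have ctr: "ctrg f = q" "csrc f = p" "car0 f = f0" "car1 f = f1" by (simp_all add: q_def p_def f0_def f1_def)
  define z where "z = Beck_Chevalley E (pol2 p) f1 f0 (pol2 q) k"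
  note BC = Beck_Chevalley[OF P(8) Q(8) F(11) k, folded z_def]
  define U where "U = Pi_element (pol2 p) (fobj (Delta_f E f0) k)"
  define d where "d = Delta_comp E f0 (pol1 q) h"
  have d: "d \<in> Arr (slice E (Dom E (pol2 p)))" "sdom d = fobj (Delta_f E (pol1 p)) h" "scod d = fobj (Delta_f E f0) k"
    "snd (pb E (pol1 q) h) \<cdot> snd (pb E f0 k) \<cdot> sarr d = snd (pb E (pol1 p) h)"
    using Delta_comp[of f0 "pol1 q" h] by (simp_all add: d_def F Q h k_def)
  define \<pi> where "\<pi> = farr (Pi_f E (pol2 p)) d"
  note pi = Pi_arr_classifies[OF P(8) d(1), unfolded d(2,3), folded \<pi>_def U_def]
  define m where "m = snd (pb E f1 (fobj (Pi_f E (pol2 q)) k))"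
  define M where "M = fobj (Delta_f E f1) (fobj (Pi_f E (pol2 q)) k)"
  note r = Pi_obj[OF Q(8) k]
  have PM: "is_pullback E f1 (fobj (Pi_f E (pol2 q)) k) M m"
    unfolding M_def m_def by (rule Delta_pullback) (simp_all add: F r Q)
  note pm = is_pullbackD[OF PM]
  have zM: "sdom z = M" by (simp add: BC M_def)
  have sz: "z \<in> Arr (slice E (Dom E (pol3 p)))" "\<pi> \<in> Arr (slice E (Dom E (pol3 p)))" using BC(1) pi(1) P by simp_all
  interpret Sl: category "slice E (Dom E (pol3 p))" by (rule slice_category)
  have iz: "inverse_of (slice E (Dom E (pol3 p))) z = \<lparr>sdom = scod z, scod = sdom z, sarr = inverse_of E (sarr z)\<rparr>"
    by (rule slice_inverse_of[OF sz(1) BC(4)])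
  have iz': "inverse_of (slice E (Dom E (pol3 p))) z \<in> Arr (slice E (Dom E (pol3 p)))"
    by (rule Sl.iso_inverse(1)[OF slice_isoI[OF sz(1) BC(4)]])
  let ?c = "Sigma_counit E f1 (fobj (Pi_f E (pol2 q)) k)"
  have ce: "?c = \<lparr>sdom = f1 \<cdot> M, scod = fobj (Pi_f E (pol2 q)) k, sarr = m\<rparr>"
    by (simp add: Sigma_counit_def M_def m_def Delta_obj r F Q)
  have c: "?c \<in> Arr (slice E (Dom E (pol3 q)))"
    using pm r F Q by (simp add: in_slice_arr ce)
  have fq: "pol3 q \<cdot> f1 \<cdot> M = pol3 p \<cdot> M"
    using comp_left_eq[OF F(10), of M] pm F Q by simp
  have nc: "ncmp (P2 E X Y f) h = farr (Sigma_f E (pol3 q)) ?c \<cdot>\<^bsub>slice E Y\<^esub> farr (Sigma_f E (pol3 p))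
      (inverse_of (slice E (Dom E (pol3 p))) z) \<cdot>\<^bsub>slice E Y\<^esub> farr (Sigma_f E (pol3 p)) \<pi>"
    using h P by (simp add: P2_def Let_def ctr k_def z_def \<pi>_def d_def)
  interpret SY: category "slice E Y" by (rule slice_category)
  have S3: "is_functor (slice E (Dom E (pol3 q))) (slice E Y) (Sigma_f E (pol3 q))"
    "is_functor (slice E (Dom E (pol3 p))) (slice E Y) (Sigma_f E (pol3 p))"
    using Sigma_functor[OF Q(3)] Sigma_functor[OF P(3)] P Q by simp_all
  have A: "farr (Sigma_f E (pol3 q)) ?c \<in> Arr (slice E Y)"
    "farr (Sigma_f E (pol3 p)) (inverse_of (slice E (Dom E (pol3 p))) z) \<in> Arr (slice E Y)"
    "farr (Sigma_f E (pol3 p)) \<pi> \<in> Arr (slice E Y)"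
    using is_functorD(2)[OF S3(1) c] is_functorD(2)[OF S3(2) iz'] is_functorD(2)[OF S3(2) sz(2)] by simp_all
  have B: "sdom (farr (Sigma_f E (pol3 q)) ?c) = pol3 p \<cdot> M" "scod (farr (Sigma_f E (pol3 q)) ?c) = pol3 q \<cdot> fobj (Pi_f E (pol2 q)) k"
    "sarr (farr (Sigma_f E (pol3 q)) ?c) = m"
    using c fq by (simp_all add: Sigma_f_simps ce)
  have C: "sdom (farr (Sigma_f E (pol3 p)) (inverse_of (slice E (Dom E (pol3 p))) z)) = pol3 p \<cdot> fobj (Pi_f E (pol2 p)) (fobj (Delta_f E f0) k)"
    "scod (farr (Sigma_f E (pol3 p)) (inverse_of (slice E (Dom E (pol3 p))) z)) = pol3 p \<cdot> M"
    "sarr (farr (Sigma_f E (pol3 p)) (inverse_of (slice E (Dom E (pol3 p))) z)) = inverse_of E (sarr z)"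
    using iz' by (simp_all add: Sigma_f_simps iz BC(3) zM)
  have D: "sdom (farr (Sigma_f E (pol3 p)) \<pi>) = pol3 p \<cdot> fobj (Pi_f E (pol2 p)) (fobj (Delta_f E (pol1 p)) h)"
    "scod (farr (Sigma_f E (pol3 p)) \<pi>) = pol3 p \<cdot> fobj (Pi_f E (pol2 p)) (fobj (Delta_f E f0) k)"
    "sarr (farr (Sigma_f E (pol3 p)) \<pi>) = sarr \<pi>"
    using sz(2) by (simp_all add: Sigma_f_simps pi)
  have hP: "fobj (P1 E X Y p) h = pol3 p \<cdot> fobj (Pi_f E (pol2 p)) (fobj (Delta_f E (pol1 p)) h)"
    "fobj (P1 E X Y q) h = pol3 q \<cdot> fobj (Pi_f E (pol2 q)) k"
    using P1_obj[OF F(1) h] P1_obj[OF F(2) h] by (simp_all add: poly_element_simps k_def)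
  show "ncmp (P2 E X Y f) h \<in> Arr (slice E Y)"
    unfolding nc by (intro SY.comp_arr A) (simp_all add: B C D)
  show "sdom (ncmp (P2 E X Y f) h) = fobj (P1 E X Y (csrc f)) h" "scod (ncmp (P2 E X Y f) h) = fobj (P1 E X Y (ctrg f)) h"
    by (simp_all add: nc B C D ctr hP)
  \<comment> \<open>It remains to see where the generic element goes.\<close>
  let ?Up = "poly_element p h" and ?Uq = "poly_element q h"
  have Up: "is_element (pol1 p) (pol2 p) h ?Up" and Uq: "is_element (pol1 q) (pol2 q) h ?Uq"
    using poly_element_generic[OF F(1) h, THEN generic_element] poly_element_generic[OF F(2) h, THEN generic_element] by simp_all
  note up = is_elementD[OF Up]
  define V where "V = Pi_element (pol2 q) k"
  have V: "is_element (Idn E (Dom E (pol2 q))) (pol2 q) k V"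
    unfolding V_def by (rule Pi_element_element[OF Q(8) k])
  let ?g = "m \<cdot> inverse_of E (sarr z)"
  have g: "classifies V ?g (El (f1 \<cdot> elB U) (f0 \<cdot> elA U) (elC U) (snd (pb E f0 k) \<cdot> elS U))"
    using BC(5) by (simp add: V_def m_def U_def)
  have PL: "is_pullback E f0 k (fobj (Delta_f E f0) k) (snd (pb E f0 k))"
    by (rule Delta_pullback) (simp_all add: F k)
  note pl = is_pullbackD[OF PL]
  have U: "is_element (Idn E (Dom E (pol2 p))) (pol2 p) (fobj (Delta_f E f0) k) U"
    unfolding U_def by (rule Pi_element_element) (simp_all add: P pl F)
  note u = is_element_idnD[OF U]
  have E1: "is_element f0 (pol2 p) k (El (elB U) (elA U) (elC U) (snd (pb E f0 k) \<cdot> elS U))"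
    unfolding is_element_def
    using u(1) comp_left_eq[OF pl(9)[symmetric], of "elS U"] by (simp add: u(2-15) pl(1-8) k F)
  have E2: "is_element (Idn E (Dom E (pol2 q))) (pol2 q) k
      (El (f1 \<cdot> elB U) (f0 \<cdot> elA U) (elC U) (snd (pb E f0 k) \<cdot> elS U))"
    using element_comp[OF E1 F(11), of "Idn E (Dom E (pol2 q))"] by (simp add: Q F)
  let ?W = "Pi_element (pol2 p) (fobj (Delta_f E (pol1 p)) h)"
  have PH: "is_pullback E (pol1 p) h (fobj (Delta_f E (pol1 p)) h) (snd (pb E (pol1 p) h))"
    by (rule Delta_pullback) (simp_all add: P h)
  note ph = is_pullbackD[OF PH]
  have W: "is_element (Idn E (Dom E (pol2 p))) (pol2 p) (fobj (Delta_f E (pol1 p)) h) ?W"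
    by (rule Pi_element_element) (simp_all add: P ph)
  note w = is_element_idnD[OF W]
  note d' = d(1)[unfolded in_slice_arr d(2,3)]
  have ds: "fobj (Delta_f E f0) k \<cdot> sarr d \<cdot> elS ?W = elA ?W"
    using comp_left_eq[of "fobj (Delta_f E f0) k" "sarr d" "fobj (Delta_f E (pol1 p)) h" "elS ?W"] d' w(4-7)
    by (simp add: pl)
  have E3: "is_element (Idn E (Dom E (pol2 p))) (pol2 p) (fobj (Delta_f E f0) k) (El (elB ?W) (elA ?W) (elC ?W) (sarr d \<cdot> elS ?W))"
    by (rule is_element_idnI[OF w(1)]) (use d' ds w(4-6) in \<open>simp_all add: pl F\<close>)
  have cV: "classifies V (?g \<cdot> sarr \<pi>) (El (f1 \<cdot> elB ?W) (f0 \<cdot> elA ?W) (elC ?W) (snd (pb E f0 k) \<cdot> sarr d \<cdot> elS ?W))"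
    using classifies_comp[OF V U g E2 E3 pi(4)] by (simp add: F u pl P)
  have cg: "classifies ?Uq (?g \<cdot> sarr \<pi>) (El (f1 \<cdot> elB ?Up) (f0 \<cdot> elA ?Up) (elC ?Up) (elS ?Up))"
  proof -
    have "snd (pb E (pol1 q) h) \<cdot> snd (pb E f0 k) \<cdot> sarr d \<cdot> elS ?W = (snd (pb E (pol1 q) h) \<cdot> snd (pb E f0 k) \<cdot> sarr d) \<cdot> elS ?W"
      using d' w(4-6) by (simp add: pl pk)
    then have "snd (pb E (pol1 q) h) \<cdot> snd (pb E f0 k) \<cdot> sarr d \<cdot> elS ?W = elS ?Up"
      by (simp add: d(4) poly_element_simps)
    moreover have "?Uq = El (elB V) (elA V) (elC V) (snd (pb E (pol1 q) h) \<cdot> elS V)"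
      by (simp add: poly_element_def Let_def V_def k_def)
    ultimately show ?thesis
      using classifies_map_source[OF cV V pk(4)] pk(6,8) by (simp add: poly_element_simps)
  qed
  have E4: "is_element (pol1 q) (pol2 q) h (El (f1 \<cdot> elB D) (f0 \<cdot> elA D) (elC D) (elS D))"
    if "is_element (pol1 p) (pol2 p) h D" for D
    using cart_element[OF f, unfolded ctr, OF that] .
  have cg': "classifies ?Uq (sarr (ncmp (P2 E X Y f) h)) (El (f1 \<cdot> elB ?Up) (f0 \<cdot> elA ?Up) (elC ?Up) (Idn E (Dom E h) \<cdot> elS ?Up))"
    using cg iso_inverse[OF BC(4)] BC(1)[unfolded in_slice_arr zM BC(3)] pi(1)[unfolded in_slice_arr pi(2,3)]
    by (simp add: nc B C D up pm)
  show "names (ctrg f) h (sarr (ncmp (P2 E X Y f) h) \<cdot> w) (El (car1 f \<cdot> elB D) (car0 f \<cdot> elA D) (elC D) (elS D))"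
    if n: "names (csrc f) h w D"
  proof -
    have D: "is_element (pol1 p) (pol2 p) h D" and w: "classifies ?Up w D" using n by (simp_all add: names_def ctr)
    have "classifies ?Uq (sarr (ncmp (P2 E X Y f) h) \<cdot> w) (El (f1 \<cdot> elB D) (f0 \<cdot> elA D) (elC D) (Idn E (Dom E h) \<cdot> elS D))"
      by (rule classifies_comp[OF Uq Up cg' _ D w]) (use E4[OF Up] in \<open>simp_all add: up F P h\<close>)
    then show ?thesis using E4[OF D] is_elementD[OF D] by (simp add: names_def ctr)
  qed
qed

end

section \<open>The 2-category of categories\<close>

lemma CAT_simps [simp]:
  "Cell0 CAT = {C. category C}" "HomCat CAT = func_cat" "Unit1 CAT = id_func"
  "Hcomp1 CAT C D K = comp_func C"
  "Assoc CAT B C D K H G F = id_ntrans B K (comp_func B H (comp_func B G F))"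
  "Lunit CAT C D F = id_ntrans C D F" "Runit CAT C D F = id_ntrans C D F"
  "ndom (Hcomp2 CAT C D K \<sigma> \<tau>) = comp_func C (ndom \<sigma>) (ndom \<tau>)"
  "ncod (Hcomp2 CAT C D K \<sigma> \<tau>) = comp_func C (ncod \<sigma>) (ncod \<tau>)"
  "X \<in> Obj C \<Longrightarrow> ncmp (Hcomp2 CAT C D K \<sigma> \<tau>) X = ncmp \<sigma> (fobj (ncod \<tau>) X) \<cdot>\<^bsub>K\<^esub> farr (ndom \<sigma>) (ncmp \<tau> X)"
  by (simp_all add: CAT_def)

lemma hcomp_ntrans:
  assumes C: "category C" and D: "category D" and K: "category K" and s: "is_ntrans D K \<sigma>" and t: "is_ntrans C D \<tau>"
  shows "is_ntrans C K (Hcomp2 CAT C D K \<sigma> \<tau>)"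
proof -
  interpret C: category C by (rule C)
  interpret D: category D by (rule D)
  interpret K: category K by (rule K)
  note S = is_ntransD[OF s] and T = is_ntransD[OF t]
  note F = is_functorD(1-6)[OF T(1)] is_functorD(1-6)[OF T(2)] and G = is_functorD(1-6)[OF S(1)] is_functorD(1-6)[OF S(2)]
  show ?thesis
  proof (rule is_ntransI)
    fix f assume f: "f \<in> Arr C"
    have 1: "farr (ndom \<sigma>) (ncmp \<tau> (Cod C f)) \<cdot>\<^bsub>K\<^esub> farr (ndom \<sigma>) (farr (ndom \<tau>) f)
        = farr (ndom \<sigma>) (farr (ncod \<tau>) f) \<cdot>\<^bsub>K\<^esub> farr (ndom \<sigma>) (ncmp \<tau> (Dom C f))"
      using arg_cong[OF T(6)[OF f], of "farr (ndom \<sigma>)"] f by (simp add: F G T(3-5))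
    have 2: "ncmp \<sigma> (fobj (ncod \<tau>) (Cod C f)) \<cdot>\<^bsub>K\<^esub> farr (ndom \<sigma>) (farr (ncod \<tau>) f)
        = farr (ncod \<sigma>) (farr (ncod \<tau>) f) \<cdot>\<^bsub>K\<^esub> ncmp \<sigma> (fobj (ncod \<tau>) (Dom C f))"
      using S(6)[of "farr (ncod \<tau>) f"] f by (simp add: F)
    show "ncmp (Hcomp2 CAT C D K \<sigma> \<tau>) (Cod C f) \<cdot>\<^bsub>K\<^esub> farr (ndom (Hcomp2 CAT C D K \<sigma> \<tau>)) f
        = farr (ncod (Hcomp2 CAT C D K \<sigma> \<tau>)) f \<cdot>\<^bsub>K\<^esub> ncmp (Hcomp2 CAT C D K \<sigma> \<tau>) (Dom C f)"
      using f K.comp_left_eq[OF 2, of "farr (ndom \<sigma>) (ncmp \<tau> (Dom C f))"] by (simp add: F G S(3-5) T(3-5) 1)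
  next
    show "ncmp (Hcomp2 CAT C D K \<sigma> \<tau>) \<in> extensional (Obj C)" by (simp add: CAT_def)
  qed (simp_all add: F G S(1-5) T(1-5) comp_func_functor[OF C T(1) S(1)] comp_func_functor[OF C T(2) S(2)])
qed

text \<open>The components of a horizontal composite are composites of components with images under a functor.\<close>

lemma hcomp_ntrans_iso:
  assumes cats: "category C" "category D" "category K"
    and s: "is_iso (func_cat D K) \<sigma>" and t: "is_iso (func_cat C D) \<tau>"
  shows "is_iso (func_cat C K) (Hcomp2 CAT C D K \<sigma> \<tau>)"
proof -
  interpret K: category K by (rule cats)
  have st: "is_ntrans D K \<sigma>" "is_ntrans C D \<tau>"
    using category.iso_inverse(6)[OF func_cat_category s] category.iso_inverse(6)[OF func_cat_category t] cats by simp_all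
  note S = is_ntransD[OF st(1)] and T = is_ntransD[OF st(2)]
  note f = is_functorD(1)[OF T(2)]
  show ?thesis
  proof (rule iso_ntransI[OF cats(1,3) hcomp_ntrans[OF cats st]])
    fix X assume X: "X \<in> Obj C"
    have "is_iso K (farr (ndom \<sigma>) (ncmp \<tau> X))"
      by (rule functor_iso[OF cats(2,3) S(1) iso_ntransD[OF cats(1,2) t X]])
    moreover have "is_iso K (ncmp \<sigma> (fobj (ncod \<tau>) X))"
      by (rule iso_ntransD[OF cats(2,3) s f[OF X]])
    ultimately show "is_iso K (ncmp (Hcomp2 CAT C D K \<sigma> \<tau>) X)"
      using X K.iso_comp[of "farr (ndom \<sigma>) (ncmp \<tau> X)" "ncmp \<sigma> (fobj (ncod \<tau>) X)"]
      by (simp add: S(4) T(3,5) f is_functorD(4)[OF S(1)])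
  qed
qed

text \<open>Composition of functors is strictly associative and unital and all coherence cells are identities, so
  every axiom is a comparison of components.\<close>

lemma CAT_bicategory:
  "bicategory (CAT :: (('u, 'v) cat, ('u, 'v, 'u, 'v) func, ('u, 'v, 'u, 'v) ntrans) bicat)"
proof (rule bicategory.intro)
  fix x y :: "('u, 'v) cat" assume "x \<in> Cell0 CAT" "y \<in> Cell0 CAT"
  then show "category (HomCat CAT x y)" by (simp add: func_cat_category)
next
  fix x :: "('u, 'v) cat" assume "x \<in> Cell0 CAT"
  then show "Unit1 CAT x \<in> Obj (HomCat CAT x x)" by (simp add: id_func_functor)
next
  fix x y z :: "('u, 'v) cat" assume "x \<in> Cell0 CAT" "y \<in> Cell0 CAT" "z \<in> Cell0 CAT"
  then have c: "category x" "category y" "category z" by simp_all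
  interpret x: category x by (rule c)
  interpret y: category y by (rule c)
  interpret z: category z by (rule c)
  show "functor_maps (prod_cat (HomCat CAT y z) (HomCat CAT x y)) (HomCat CAT x z)
    (\<lambda>(g, f). Hcomp1 CAT x y z g f) (\<lambda>(\<tau>, \<sigma>). Hcomp2 CAT x y z \<tau> \<sigma>)"
    unfolding functor_maps_def
  proof (intro conjI allI ballI)
    fix X assume X: "X \<in> Obj (prod_cat (HomCat CAT y z) (HomCat CAT x y))"
    obtain G F where GF: "X = (G, F)" "is_functor y z G" "is_functor x y F" using X by (auto simp: prod_cat_def)
    note g = is_functorD[OF GF(2)] and f = is_functorD[OF GF(3)]
    show "(case X of (g, f) \<Rightarrow> Hcomp1 CAT x y z g f) \<in> Obj (HomCat CAT x z)"
      by (simp add: comp_func_functor[OF c(1) GF(3,2)] GF(1))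
    have "Hcomp2 CAT x y z (id_ntrans y z G) (id_ntrans x y F) = id_ntrans x z (comp_func x G F)"
      by (rule ntrans_eqI[of x z])
        (simp_all add: hcomp_ntrans id_ntrans_ntrans c GF comp_func_functor[OF c(1) GF(3,2)] g(1-6) f(1-6))
    then show "(case Idn (prod_cat (HomCat CAT y z) (HomCat CAT x y)) X of (\<tau>, \<sigma>) \<Rightarrow> Hcomp2 CAT x y z \<tau> \<sigma>)
        = Idn (HomCat CAT x z) (case X of (g, f) \<Rightarrow> Hcomp1 CAT x y z g f)"
      by (simp add: GF prod_cat_def)
  next
    fix X Y f assume "f \<in> hom (prod_cat (HomCat CAT y z) (HomCat CAT x y)) X Y"
    then show "(case f of (\<tau>, \<sigma>) \<Rightarrow> Hcomp2 CAT x y z \<tau> \<sigma>)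
      \<in> hom (HomCat CAT x z) (case X of (g, f) \<Rightarrow> Hcomp1 CAT x y z g f) (case Y of (g, f) \<Rightarrow> Hcomp1 CAT x y z g f)"
      by (auto simp: prod_cat_def hcomp_ntrans c)
  next
    fix X Y Z f g assume fg: "f \<in> hom (prod_cat (HomCat CAT y z) (HomCat CAT x y)) X Y"
      "g \<in> hom (prod_cat (HomCat CAT y z) (HomCat CAT x y)) Y Z"
    obtain \<sigma> \<tau> \<sigma>' \<tau>' where e: "f = (\<sigma>, \<tau>)" "g = (\<sigma>', \<tau>')" by (cases f, cases g)
    have t: "is_ntrans y z \<sigma>" "is_ntrans x y \<tau>" "is_ntrans y z \<sigma>'" "is_ntrans x y \<tau>'"
      and m: "ncod \<sigma> = ndom \<sigma>'" "ncod \<tau> = ndom \<tau>'"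
      using fg by (auto simp: e prod_cat_def)
    note S = is_ntransD[OF t(1)] and T = is_ntransD[OF t(2)] and S' = is_ntransD[OF t(3)] and T' = is_ntransD[OF t(4)]
    note n = is_functorD(1-6)[OF S(1)] is_functorD(1-6)[OF T(1)] is_functorD(1-6)[OF S'(1)] is_functorD(1-6)[OF T'(1)]
      is_functorD(1-6)[OF S'(2)] is_functorD(1-6)[OF T'(2)]
    have "Hcomp2 CAT x y z (\<sigma>' \<cdot>\<^bsub>func_cat y z\<^esub> \<sigma>) (\<tau>' \<cdot>\<^bsub>func_cat x y\<^esub> \<tau>)
      = Hcomp2 CAT x y z \<sigma>' \<tau>' \<cdot>\<^bsub>func_cat x z\<^esub> Hcomp2 CAT x y z \<sigma> \<tau>"
    proof (rule ntrans_eqI[of x z])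
      fix X assume X: "X \<in> Obj x"
      have 1: "ncmp \<sigma> (fobj (ncod \<tau>') X) \<cdot>\<^bsub>z\<^esub> farr (ndom \<sigma>) (ncmp \<tau>' X)
          = farr (ndom \<sigma>') (ncmp \<tau>' X) \<cdot>\<^bsub>z\<^esub> ncmp \<sigma> (fobj (ndom \<tau>') X)"
        using S(6)[of "ncmp \<tau>' X"] X by (simp add: T' m)
      show "ncmp (Hcomp2 CAT x y z (\<sigma>' \<cdot>\<^bsub>func_cat y z\<^esub> \<sigma>) (\<tau>' \<cdot>\<^bsub>func_cat x y\<^esub> \<tau>)) X
        = ncmp (Hcomp2 CAT x y z \<sigma>' \<tau>' \<cdot>\<^bsub>func_cat x z\<^esub> Hcomp2 CAT x y z \<sigma> \<tau>) X"
        using X z.comp_left_eq[OF 1, of "farr (ndom \<sigma>) (ncmp \<tau> X)"]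
        by (simp add: n S(3-5) T(3-5) S'(3-5) T'(3-5) m)
    qed (simp_all add: hcomp_ntrans vcomp_ntrans c t m)
    then show "(case g \<cdot>\<^bsub>prod_cat (HomCat CAT y z) (HomCat CAT x y)\<^esub> f of (\<tau>, \<sigma>) \<Rightarrow> Hcomp2 CAT x y z \<tau> \<sigma>)
        = (case g of (\<tau>, \<sigma>) \<Rightarrow> Hcomp2 CAT x y z \<tau> \<sigma>) \<cdot>\<^bsub>HomCat CAT x z\<^esub> (case f of (\<tau>, \<sigma>) \<Rightarrow> Hcomp2 CAT x y z \<tau> \<sigma>)"
      by (simp add: e prod_cat_def)
  qed
next
  fix w x y z :: "('u, 'v) cat" and f g h
  assume "w \<in> Cell0 CAT" "x \<in> Cell0 CAT" "y \<in> Cell0 CAT" "z \<in> Cell0 CAT"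
  then have c: "category w" "category x" "category y" "category z" by simp_all
  interpret w: category w by (rule c)
  assume fgh: "f \<in> Obj (HomCat CAT w x)" "g \<in> Obj (HomCat CAT x y)" "h \<in> Obj (HomCat CAT y z)"
  then have f: "is_functor w x f" "is_functor x y g" "is_functor y z h" by simp_all
  have hgf: "is_functor w z (comp_func w h (comp_func w g f))"
    by (intro comp_func_functor[OF c(1) _ f(3)] comp_func_functor[OF c(1) f(1,2)])
  show "Assoc CAT w x y z h g f \<in> hom (HomCat CAT w z)
      (Hcomp1 CAT w x z (Hcomp1 CAT x y z h g) f) (Hcomp1 CAT w y z h (Hcomp1 CAT w x y g f))"
    using hgf by (simp add: id_ntrans_ntrans c comp_func_assoc[OF f(1)])
  show "is_iso (HomCat CAT w z) (Assoc CAT w x y z h g f)"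
    using category.iso_idn[OF func_cat_category[OF c(1,4)]] hgf by simp
next
  fix w x y z :: "('u, 'v) cat" and \<phi> \<gamma> \<theta> f g h f' g' h'
  assume "w \<in> Cell0 CAT" "x \<in> Cell0 CAT" "y \<in> Cell0 CAT" "z \<in> Cell0 CAT"
  then have c: "category w" "category x" "category y" "category z" by simp_all
  interpret w: category w by (rule c)
  interpret z: category z by (rule c)
  assume "\<phi> \<in> hom (HomCat CAT w x) f f'" "\<gamma> \<in> hom (HomCat CAT x y) g g'" "\<theta> \<in> hom (HomCat CAT y z) h h'"
  then have t: "is_ntrans w x \<phi>" "is_ntrans x y \<gamma>" "is_ntrans y z \<theta>" and e: "f = ndom \<phi>" "g = ndom \<gamma>" "h = ndom \<theta>"
    "f' = ncod \<phi>" "g' = ncod \<gamma>" "h' = ncod \<theta>" by auto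
  note T = is_ntransD[OF t(1)] is_ntransD[OF t(2)] is_ntransD[OF t(3)]
  note F = is_functorD(1-6)[OF T(1)] is_functorD(1-6)[OF T(2)] is_functorD(1-6)[OF T(8)] is_functorD(1-6)[OF T(9)]
    is_functorD(1-6)[OF T(15)] is_functorD(1-6)[OF T(16)]
  show "Assoc CAT w x y z h' g' f' \<cdot>\<^bsub>HomCat CAT w z\<^esub> Hcomp2 CAT w x z (Hcomp2 CAT x y z \<theta> \<gamma>) \<phi>
      = Hcomp2 CAT w y z \<theta> (Hcomp2 CAT w x y \<gamma> \<phi>) \<cdot>\<^bsub>HomCat CAT w z\<^esub> Assoc CAT w x y z h g f"
    unfolding CAT_simps e
  proof (rule ntrans_eqI[of w z])
    fix X assume X: "X \<in> Obj w"
    show "ncmp (id_ntrans w z (comp_func w (ncod \<theta>) (comp_func w (ncod \<gamma>) (ncod \<phi>))) \<cdot>\<^bsub>func_cat w z\<^esub> Hcomp2 CAT w x z (Hcomp2 CAT x y z \<theta> \<gamma>) \<phi>) X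
      = ncmp (Hcomp2 CAT w y z \<theta> (Hcomp2 CAT w x y \<gamma> \<phi>) \<cdot>\<^bsub>func_cat w z\<^esub> id_ntrans w z (comp_func w (ndom \<theta>) (comp_func w (ndom \<gamma>) (ndom \<phi>)))) X"
      using X by (simp add: T(3-5,10-12,17-19) F)
  qed (simp_all add: hcomp_ntrans vcomp_ntrans id_ntrans_ntrans c t
      comp_func_assoc[OF T(1)] comp_func_assoc[OF T(2)] comp_func_functor[OF c(1) comp_func_functor[OF c(1) T(1,8)] T(15)]
      comp_func_functor[OF c(1) comp_func_functor[OF c(1) T(2,9)] T(16)])
next
  fix x y :: "('u, 'v) cat" and f
  assume "x \<in> Cell0 CAT" "y \<in> Cell0 CAT" "f \<in> Obj (HomCat CAT x y)"
  then have c: "category x" "category y" and f: "is_functor x y f" by simp_all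
  show "Lunit CAT x y f \<in> hom (HomCat CAT x y) (Hcomp1 CAT x y y (Unit1 CAT y) f) f"
    "Runit CAT x y f \<in> hom (HomCat CAT x y) (Hcomp1 CAT x x y f (Unit1 CAT x)) f"
    by (simp_all add: comp_func_id[OF f] id_ntrans_ntrans c f)
  show "is_iso (HomCat CAT x y) (Lunit CAT x y f)" "is_iso (HomCat CAT x y) (Runit CAT x y f)"
    using category.iso_idn[OF func_cat_category[OF c]] f by simp_all
next
  fix x y :: "('u, 'v) cat" and \<phi> f f'
  assume "x \<in> Cell0 CAT" "y \<in> Cell0 CAT" "\<phi> \<in> hom (HomCat CAT x y) f f'"
  then have c: "category x" "category y" and t: "is_ntrans x y \<phi>" and e: "f = ndom \<phi>" "f' = ncod \<phi>" by auto
  interpret x: category x by (rule c)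
  interpret y: category y by (rule c)
  note T = is_ntransD[OF t]
  note F = is_functorD(1-6)[OF T(1)] is_functorD(1-6)[OF T(2)]
  show "Lunit CAT x y f' \<cdot>\<^bsub>HomCat CAT x y\<^esub> Hcomp2 CAT x y y (Idn (HomCat CAT y y) (Unit1 CAT y)) \<phi>
      = \<phi> \<cdot>\<^bsub>HomCat CAT x y\<^esub> Lunit CAT x y f"
    by (rule ntrans_eqI[of x y])
      (simp_all add: hcomp_ntrans vcomp_ntrans id_ntrans_ntrans id_func_functor c t e comp_func_id[OF T(1)] comp_func_id[OF T(2)] T(1-5) F)
  show "Runit CAT x y f' \<cdot>\<^bsub>HomCat CAT x y\<^esub> Hcomp2 CAT x x y \<phi> (Idn (HomCat CAT x x) (Unit1 CAT x))
      = \<phi> \<cdot>\<^bsub>HomCat CAT x y\<^esub> Runit CAT x y f"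
    by (rule ntrans_eqI[of x y])
      (simp_all add: hcomp_ntrans vcomp_ntrans id_ntrans_ntrans id_func_functor c t e comp_func_id[OF T(1)] comp_func_id[OF T(2)] T(1-5) F)
next
  fix v w x y z :: "('u, 'v) cat" and f g h k
  assume "v \<in> Cell0 CAT" "w \<in> Cell0 CAT" "x \<in> Cell0 CAT" "y \<in> Cell0 CAT" "z \<in> Cell0 CAT"
  then have c: "category v" "category w" "category x" "category y" "category z" by simp_all
  interpret v: category v by (rule c)
  interpret w: category w by (rule c)
  interpret z: category z by (rule c)
  assume "f \<in> Obj (HomCat CAT v w)" "g \<in> Obj (HomCat CAT w x)" "h \<in> Obj (HomCat CAT x y)" "k \<in> Obj (HomCat CAT y z)"
  then have f: "is_functor v w f" "is_functor w x g" "is_functor x y h" "is_functor y z k" by simp_all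
  note ff = is_functorD(1-6)[OF f(1)] is_functorD(1-6)[OF f(2)] is_functorD(1-6)[OF f(3)] is_functorD(1-6)[OF f(4)]
  note gf = comp_func_functor[OF c(1) f(1,2)] and hg = comp_func_functor[OF c(2) f(2,3)] and kh = comp_func_functor[OF c(3) f(3,4)]
  note hgf = comp_func_functor[OF c(1) gf f(3)] and khg = comp_func_functor[OF c(2) hg f(4)]
  note ca = comp_func_assoc[OF f(1)] comp_func_assoc[OF f(2)] comp_func_assoc[OF gf]
  show "Assoc CAT v x y z k h (Hcomp1 CAT v w x g f)
        \<cdot>\<^bsub>HomCat CAT v z\<^esub> Assoc CAT v w x z (Hcomp1 CAT x y z k h) g f
      = Hcomp2 CAT v y z (Idn (HomCat CAT y z) k) (Assoc CAT v w x y h g f)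
        \<cdot>\<^bsub>HomCat CAT v z\<^esub> Assoc CAT v w y z k (Hcomp1 CAT w x y h g) f
        \<cdot>\<^bsub>HomCat CAT v z\<^esub> Hcomp2 CAT v w z (Assoc CAT w x y z k h g) (Idn (HomCat CAT v w) f)"
    by (rule ntrans_eqI[of v z])
      (simp_all add: vcomp_ntrans hcomp_ntrans id_ntrans_ntrans c f gf hg kh hgf khg
        comp_func_functor[OF c(1) hgf f(4)] ca ff)
next
  fix x y z :: "('u, 'v) cat" and f g
  assume "x \<in> Cell0 CAT" "y \<in> Cell0 CAT" "z \<in> Cell0 CAT" "f \<in> Obj (HomCat CAT x y)" "g \<in> Obj (HomCat CAT y z)"
  then have c: "category x" "category y" "category z" and f: "is_functor x y f" "is_functor y z g" by simp_all
  interpret x: category x by (rule c)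
  interpret z: category z by (rule c)
  note ff = is_functorD(1-6)[OF f(1)] is_functorD(1-6)[OF f(2)]
  show "Hcomp2 CAT x y z (Idn (HomCat CAT y z) g) (Lunit CAT x y f)
        \<cdot>\<^bsub>HomCat CAT x z\<^esub> Assoc CAT x y y z g (Unit1 CAT y) f
      = Hcomp2 CAT x y z (Runit CAT y z g) (Idn (HomCat CAT x y) f)"
    by (rule ntrans_eqI[of x z])
      (simp_all add: vcomp_ntrans hcomp_ntrans id_ntrans_ntrans comp_func_functor[OF c(1) f] c f comp_func_id[OF f(1)] comp_func_id[OF f(2)] ff)
qed

section \<open>Composition of polynomials\<close>

context pullback_category
begin

abbreviation idc :: "'a poly \<Rightarrow> 'a cart" where
  "idc p \<equiv> \<lparr>csrc = p, ctrg = p, car0 = Idn E (Dom E (pol2 p)), car1 = Idn E (Cod E (pol2 p))\<rparr>"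

lemma poly_hom_simps [simp]:
  "Obj (poly_hom E X Y) = {p. is_poly E X Y p}" "Arr (poly_hom E X Y) = {f. is_cart E X Y f}"
  "Dom (poly_hom E X Y) = csrc" "Cod (poly_hom E X Y) = ctrg"
  "Idn (poly_hom E X Y) p = idc p"
  "g \<cdot>\<^bsub>poly_hom E X Y\<^esub> f = \<lparr>csrc = csrc f, ctrg = ctrg g, car0 = car0 g \<cdot> car0 f, car1 = car1 g \<cdot> car1 f\<rparr>"
  by (simp_all add: poly_hom_def)

lemma is_cartI:
  assumes "is_poly E X Y (csrc f)" "is_poly E X Y (ctrg f)"
    "pol1 (ctrg f) \<cdot> car0 f = pol1 (csrc f)" "pol3 (ctrg f) \<cdot> car1 f = pol3 (csrc f)"
    and pb: "is_pullback E (pol2 (ctrg f)) (car1 f) (car0 f) (pol2 (csrc f))"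
  shows "is_cart E X Y f"
  using assms is_pullbackD[OF pb] by (simp add: is_cart_def)

lemma id_cart: "is_poly E X Y p \<Longrightarrow> is_cart E X Y (idc p)"
  using is_polyD[of X Y p] by (intro is_cartI) (simp_all add: pullback_idn_right)

lemma comp_cart:
  assumes f: "is_cart E X Y f" and g: "is_cart E X Y g" and fg: "ctrg f = csrc g"
  shows "is_cart E X Y \<lparr>csrc = csrc f, ctrg = ctrg g, car0 = car0 g \<cdot> car0 f, car1 = car1 g \<cdot> car1 f\<rparr>"
proof -
  note F = is_cartD[OF f, unfolded fg] and G = is_cartD[OF g]
  note P = is_polyD[OF F(1)] and Q = is_polyD[OF G(1)] and R = is_polyD[OF G(2)]
  show ?thesis
    by (rule is_cartI)
      (use F(9,10) pullback_paste[OF G(11) F(11)] comp_left_eq[OF G(9), of "car0 f"] comp_left_eq[OF G(10), of "car1 f"]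
        in \<open>simp_all add: F(1-8) G(1-8) P Q R\<close>)
qed

lemma poly_hom_category: "category (poly_hom E X Y)"
proof (rule category.intro)
  fix f W X' g Y' h Z
  assume fgh: "f \<in> hom (poly_hom E X Y) W X'" "g \<in> hom (poly_hom E X Y) X' Y'" "h \<in> hom (poly_hom E X Y) Y' Z"
  then have c: "is_cart E X Y f" "is_cart E X Y g" "is_cart E X Y h" "ctrg f = csrc g" "ctrg g = csrc h" by simp_all
  note f = is_cartD[OF c(1)] and g = is_cartD[OF c(2)] and h = is_cartD[OF c(3)]
  note p = is_polyD[OF h(1)] and q = is_polyD[OF g(1)]
  show "(h \<cdot>\<^bsub>poly_hom E X Y\<^esub> g) \<cdot>\<^bsub>poly_hom E X Y\<^esub> f = h \<cdot>\<^bsub>poly_hom E X Y\<^esub> (g \<cdot>\<^bsub>poly_hom E X Y\<^esub> f)"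
    by (simp add: f(3-8) g(3-8) h(3-8) c(4,5) p q)
next
  fix f X' Y' assume "f \<in> hom (poly_hom E X Y) X' Y'"
  then have c: "is_cart E X Y f" "X' = csrc f" "Y' = ctrg f" by simp_all
  note f = is_cartD[OF c(1)]
  note p = is_polyD[OF f(1)] and q = is_polyD[OF f(2)]
  show "Idn (poly_hom E X Y) Y' \<cdot>\<^bsub>poly_hom E X Y\<^esub> f = f" "f \<cdot>\<^bsub>poly_hom E X Y\<^esub> Idn (poly_hom E X Y) X' = f"
    by (simp_all add: f(3-8) c(2,3) p q)
qed (auto simp: is_cartD id_cart comp_cart)

text \<open>A triple \<open>(p, q, r)\<close> around \<open>(f, g)\<close> is an element of \<open>g\<close>: \<open>r\<close> is its underlying map, \<open>(g p, q)\<close> its fibre and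
  \<open>p\<close> its section. Morphisms of triples are classifying arrows, and so the terminal triples, the
  distributivity pullbacks, are the generic elements.\<close>

lemma is_pba_iff:
  assumes "g \<in> Arr E" "Cod E g = Dom E f"
  shows "is_pba E f g P \<longleftrightarrow> is_element (Idn E (Dom E f)) f g (El (pba_r P) (g \<cdot> pba_p P) (pba_q P) (pba_p P))"
proof
  assume "is_pba E f g P"
  then have P: "pba_p P \<in> Arr E" "Cod E (pba_p P) = Dom E g" "is_pullback E f (pba_r P) (g \<cdot> pba_p P) (pba_q P)"
    by (auto simp: is_pba_def)
  then show "is_element (Idn E (Dom E f)) f g (El (pba_r P) (g \<cdot> pba_p P) (pba_q P) (pba_p P))"
    using assms by (intro is_element_idnI) simp_all
next
  assume D: "is_element (Idn E (Dom E f)) f g (El (pba_r P) (g \<cdot> pba_p P) (pba_q P) (pba_p P))"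
  note d = is_element_idnD[OF D, simplified]
  show "is_pba E f g P" unfolding is_pba_def using d assms by simp
qed

lemma pba_hom_classifies:
  assumes g: "g \<in> Arr E" "Cod E g = Dom E f" and P: "is_pba E f g P" and Q: "is_pba E f g Q"
  shows "classifies (El (pba_r Q) (g \<cdot> pba_p Q) (pba_q Q) (pba_p Q)) t (El (pba_r P) (g \<cdot> pba_p P) (pba_q P) (pba_p P))
    \<longleftrightarrow> (\<exists>s. \<lparr>pba_src = P, pba_trg = Q, pba_s = s, pba_t = t\<rparr> \<in> hom (pba_cat E f g) P Q)"
proof -
  note p = is_element_idnD[OF P[unfolded is_pba_iff[OF g]], simplified] and q = is_element_idnD[OF Q[unfolded is_pba_iff[OF g]], simplified]
  have pt: "Dom E (pba_p P) = Dom E (pba_q P)" "Dom E (pba_p Q) = Dom E (pba_q Q)"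
    using p(5,13) q(5,13) g p(4,6) q(4,6) by simp_all
  show ?thesis
  proof
    assume c: "classifies (El (pba_r Q) (g \<cdot> pba_p Q) (pba_q Q) (pba_p Q)) t (El (pba_r P) (g \<cdot> pba_p P) (pba_q P) (pba_p P))"
    obtain s where "is_cover (El (pba_r Q) (g \<cdot> pba_p Q) (pba_q Q) (pba_p Q)) t (El (pba_r P) (g \<cdot> pba_p P) (pba_q P) (pba_p P)) s"
      using classifies_cover[OF c] by blast
    note s = is_coverD[OF this, unfolded element.select_convs] and t = classifiesD[OF c, unfolded element.select_convs]
    have "\<lparr>pba_src = P, pba_trg = Q, pba_s = s, pba_t = t\<rparr> \<in> hom (pba_cat E f g) P Q"
      using s(1,2,3,5,6) t by (simp add: pba_cat_def is_pba_mor_def P Q p(4,6,11,15) q(4,6,11,15) g pt)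
    then show "\<exists>s. \<lparr>pba_src = P, pba_trg = Q, pba_s = s, pba_t = t\<rparr> \<in> hom (pba_cat E f g) P Q" by blast
  next
    assume "\<exists>s. \<lparr>pba_src = P, pba_trg = Q, pba_s = s, pba_t = t\<rparr> \<in> hom (pba_cat E f g) P Q"
    then obtain s where "\<lparr>pba_src = P, pba_trg = Q, pba_s = s, pba_t = t\<rparr> \<in> hom (pba_cat E f g) P Q" by blast
    then have s: "s \<in> Arr E" "Dom E s = Dom E (pba_q P)" "Cod E s = Dom E (pba_q Q)" "t \<in> Arr E"
      "Dom E t = Cod E (pba_q P)" "Cod E t = Cod E (pba_q Q)" "pba_p Q \<cdot> s = pba_p P" "pba_q Q \<cdot> s = t \<cdot> pba_q P"
      "pba_r Q \<cdot> t = pba_r P" by (simp_all add: pba_cat_def is_pba_mor_def)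
    show "classifies (El (pba_r Q) (g \<cdot> pba_p Q) (pba_q Q) (pba_p Q)) t (El (pba_r P) (g \<cdot> pba_p P) (pba_q P) (pba_p P))"
      by (rule classifiesI[where v = s]) (simp_all add: s p(4,6,15) q(4,6,15) g pt)
  qed
qed

lemma generic_dpb:
  assumes g: "g \<in> Arr E" "Cod E g = Dom E f" and Q: "is_pba E f g Q"
  shows "is_dpb E f g Q \<longleftrightarrow> is_generic (Idn E (Dom E f)) f g (El (pba_r Q) (g \<cdot> pba_p Q) (pba_q Q) (pba_p Q))"
    (is "_ \<longleftrightarrow> is_generic _ _ _ ?Q")
proof -
  have Q': "is_element (Idn E (Dom E f)) f g ?Q" using Q is_pba_iff[OF g] by simp
  note q = is_element_idnD[OF Q', simplified]
  have qd: "Dom E (pba_q Q) = Dom E (pba_p Q)" using q(13) comp_dom[of "pba_p Q" g] q(4,6) g by metis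
  have main: "(\<exists>!u. u \<in> hom (pba_cat E f g) P Q) \<longleftrightarrow>
    (\<exists>!t. classifies ?Q t (El (pba_r P) (g \<cdot> pba_p P) (pba_q P) (pba_p P)))" if P: "is_pba E f g P" for P
  proof -
    note iff = pba_hom_classifies[OF g P Q]
    have 1: "u = \<lparr>pba_src = P, pba_trg = Q, pba_s = pba_s u, pba_t = pba_t u\<rparr>" if "u \<in> hom (pba_cat E f g) P Q" for u
      using that by (simp add: pba_cat_def)
    \<comment> \<open>The component \<open>pba_s\<close> is a map into a pullback and therefore determined by \<open>pba_t\<close>.\<close>
    have 2: "u = u'" if u: "u \<in> hom (pba_cat E f g) P Q" "u' \<in> hom (pba_cat E f g) P Q" "pba_t u = pba_t u'" for u u'
    proof -
      have m: "is_pba_mor E f g u" "is_pba_mor E f g u'" "pba_src u = P" "pba_trg u = Q" "pba_src u' = P" "pba_trg u' = Q"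
        using u by (simp_all add: pba_cat_def)
      have eq: "pba_q Q \<cdot> pba_s u = pba_q Q \<cdot> pba_s u'" "pba_p Q \<cdot> pba_s u = pba_p Q \<cdot> pba_s u'"
        using m u(3) by (simp_all add: is_pba_mor_def)
      have ty: "pba_s u \<in> Arr E" "pba_s u' \<in> Arr E" "Dom E (pba_s u) = Dom E (pba_s u')"
        "Cod E (pba_s u) = Dom E (pba_q Q)" "Cod E (pba_s u') = Dom E (pba_q Q)"
        using m by (simp_all add: is_pba_mor_def)
      have "pba_s u = pba_s u'"
        by (rule pullback_eqI[OF q(1)])
          (use eq in \<open>simp_all add: ty q(4,6) g qd\<close>)
      then show ?thesis using m u(3) by simp
    qed
    show ?thesis
    proof
      assume e: "\<exists>!u. u \<in> hom (pba_cat E f g) P Q"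
      then obtain u where u: "u \<in> hom (pba_cat E f g) P Q" by blast
      show "\<exists>!t. classifies ?Q t (El (pba_r P) (g \<cdot> pba_p P) (pba_q P) (pba_p P))"
      proof (rule ex_ex1I)
        show "\<exists>t. classifies ?Q t (El (pba_r P) (g \<cdot> pba_p P) (pba_q P) (pba_p P))"
          unfolding iff using u 1[OF u] by metis
        fix t t' assume "classifies ?Q t (El (pba_r P) (g \<cdot> pba_p P) (pba_q P) (pba_p P))"
          "classifies ?Q t' (El (pba_r P) (g \<cdot> pba_p P) (pba_q P) (pba_p P))"
        then show "t = t'" unfolding iff using e by (metis pba_mor.select_convs(4))
      qed
    next
      assume e: "\<exists>!t. classifies ?Q t (El (pba_r P) (g \<cdot> pba_p P) (pba_q P) (pba_p P))"
      show "\<exists>!u. u \<in> hom (pba_cat E f g) P Q"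
      proof (rule ex_ex1I)
        show "\<exists>u. u \<in> hom (pba_cat E f g) P Q" using e unfolding iff by blast
        fix u u' assume u: "u \<in> hom (pba_cat E f g) P Q" "u' \<in> hom (pba_cat E f g) P Q"
        have "pba_t u = pba_t u'" using e u 1[OF u(1)] 1[OF u(2)] unfolding iff by metis
        then show "u = u'" using 2 u by blast
      qed
    qed
  qed
  have obj: "Obj (pba_cat E f g) = {P. is_pba E f g P}" by (simp add: pba_cat_def)
  show ?thesis
  proof
    assume d: "is_dpb E f g Q"
    show "is_generic (Idn E (Dom E f)) f g ?Q"
      unfolding is_generic_def
    proof (intro conjI allI impI Q')
      fix D assume D: "is_element (Idn E (Dom E f)) f g D"
      note dd = is_element_idnD[OF D]
      define P where "P = \<lparr>pba_p = elS D, pba_q = elC D, pba_r = elB D\<rparr>"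
      have e: "El (pba_r P) (g \<cdot> pba_p P) (pba_q P) (pba_p P) = D" using dd by (simp add: P_def)
      have "is_pba E f g P" using is_pba_iff[OF g, of P] D e by simp
      then show "\<exists>!u. classifies ?Q u D" using d main[of P] e by (simp add: is_dpb_def terminal_def obj)
    qed
  next
    assume "is_generic (Idn E (Dom E f)) f g ?Q"
    then show "is_dpb E f g Q"
      using main Q is_pba_iff[OF g] by (simp add: is_dpb_def terminal_def obj is_generic_def)
  qed
qed

lemma dpb_generic:
  assumes f: "exponentiable E f" and g: "g \<in> Arr E" "Cod E g = Dom E f"
  defines "Q \<equiv> dpb E f g"
  shows "is_generic (Idn E (Dom E f)) f g (El (pba_r Q) (g \<cdot> pba_p Q) (pba_q Q) (pba_p Q))" "is_pba E f g Q"
    "is_dpb E f g Q"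
proof -
  let ?U = "Pi_element f g"
  have U: "is_generic (Idn E (Dom E f)) f g ?U" by (rule Pi_element_generic[OF f g])
  note u = is_element_idnD[OF generic_element[OF U]]
  define R where "R = \<lparr>pba_p = elS ?U, pba_q = elC ?U, pba_r = elB ?U\<rparr>"
  have e: "El (pba_r R) (g \<cdot> pba_p R) (pba_q R) (pba_p R) = ?U" using u(7) by (simp add: R_def)
  have "is_pba E f g R" using is_pba_iff[OF g, of R] generic_element[OF U] e by simp
  then have "is_dpb E f g R" using generic_dpb[OF g, of R] U e by simp
  then show d: "is_dpb E f g Q" unfolding Q_def dpb_def by (rule someI)
  then show p: "is_pba E f g Q" by (simp add: is_dpb_def terminal_def pba_cat_def)
  show "is_generic (Idn E (Dom E f)) f g (El (pba_r Q) (g \<cdot> pba_p Q) (pba_q Q) (pba_p Q))"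
    using generic_dpb[OF g p] d by simp
qed

lemma dpb_lift:
  assumes f: "exponentiable E f" and g: "g \<in> Arr E" "Cod E g = Dom E f" and P: "is_pba E f g P"
  defines "Q \<equiv> dpb E f g" and "u \<equiv> dpb_lift E f g P"
  shows "pba_s u \<in> Arr E" "Dom E (pba_s u) = Dom E (pba_q P)" "Cod E (pba_s u) = Dom E (pba_q Q)"
    "pba_t u \<in> Arr E" "Dom E (pba_t u) = Cod E (pba_q P)" "Cod E (pba_t u) = Cod E (pba_q Q)"
    "pba_p Q \<cdot> pba_s u = pba_p P" "pba_q Q \<cdot> pba_s u = pba_t u \<cdot> pba_q P" "pba_r Q \<cdot> pba_t u = pba_r P"
proof -
  have "\<exists>!u. u \<in> hom (pba_cat E f g) P Q"
    using dpb_generic(3)[OF f g] P by (simp add: is_dpb_def terminal_def Q_def pba_cat_def)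
  from theI'[OF this] have "u \<in> hom (pba_cat E f g) P Q" by (simp add: u_def Q_def dpb_lift_def)
  then show "pba_s u \<in> Arr E" "Dom E (pba_s u) = Dom E (pba_q P)" "Cod E (pba_s u) = Dom E (pba_q Q)"
    "pba_t u \<in> Arr E" "Dom E (pba_t u) = Cod E (pba_q P)" "Cod E (pba_t u) = Cod E (pba_q Q)"
    "pba_p Q \<cdot> pba_s u = pba_p P" "pba_q Q \<cdot> pba_s u = pba_t u \<cdot> pba_q P" "pba_r Q \<cdot> pba_t u = pba_r P"
    by (auto simp: pba_cat_def is_pba_mor_def)
qed

text \<open>The distributivity pullback is around \<open>(q2, \<pi>\<^sub>C)\<close>, and \<open>\<pi>\<^sub>C\<close> is the pullback of \<open>p3\<close> along \<open>q1\<close>. Thus \<open>G\<close> carries the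
  generic element of the polynomial functor of \<open>q\<close> at \<open>p3\<close>, with fibre \<open>F\<close>.\<close>

lemma comp_diagram:
  assumes p: "is_poly E X Y p" and q: "is_poly E Y Z q"
  shows comp_base: "is_pullback E (pol3 p) (pol1 q) (piB E q p) (piC E q p)"
    and comp_dpb: "is_generic (Idn E (Dom E (pol2 q))) (pol2 q) (piC E q p) (El (GD E q p) (FC E q p) (FG E q p) (FP E q p))"
    and comp_generic: "is_generic (pol1 q) (pol2 q) (pol3 p) (El (GD E q p) (FC E q p) (FG E q p) (FB E q p))"
    and comp_fibre: "is_pullback E (pol2 p) (FB E q p) (HA E q p) (HF E q p)"
proof -
  note P = is_polyD[OF p] and Q = is_polyD[OF q]
  show b: "is_pullback E (pol3 p) (pol1 q) (piB E q p) (piC E q p)"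
    unfolding piB_def piC_def by (rule pb_pullback) (simp_all add: P Q)
  note b' = is_pullbackD[OF b]
  have c: "piC E q p \<in> Arr E" "Cod E (piC E q p) = Dom E (pol2 q)" using b' Q by simp_all
  show d: "is_generic (Idn E (Dom E (pol2 q))) (pol2 q) (piC E q p) (El (GD E q p) (FC E q p) (FG E q p) (FP E q p))"
    using dpb_generic(1)[OF Q(8) c] by (simp add: GD_def FC_def FG_def FP_def dp_def)
  show g: "is_generic (pol1 q) (pol2 q) (pol3 p) (El (GD E q p) (FC E q p) (FG E q p) (FB E q p))"
    using generic_pullback[OF d is_pullback_sym[OF b]] Q by (simp add: FB_def)
  note G = is_elementD[OF generic_element[OF g], simplified]
  show "is_pullback E (pol2 p) (FB E q p) (HA E q p) (HF E q p)"
    unfolding HA_def HF_def by (rule pb_pullback) (simp_all add: P G)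
qed

lemma comp_arrows:
  assumes p: "is_poly E X Y p" and q: "is_poly E Y Z q"
  shows "GD E q p \<in> Arr E" "FC E q p \<in> Arr E" "FG E q p \<in> Arr E" "FB E q p \<in> Arr E" "HA E q p \<in> Arr E" "HF E q p \<in> Arr E"
    "Cod E (GD E q p) = Dom E (pol3 q)" "Cod E (FC E q p) = Dom E (pol2 q)" "Cod E (FB E q p) = Dom E (pol3 p)"
    "Cod E (HA E q p) = Dom E (pol2 p)" "Cod E (FG E q p) = Dom E (GD E q p)" "Cod E (HF E q p) = Dom E (FG E q p)"
    "Dom E (FC E q p) = Dom E (FG E q p)" "Dom E (FB E q p) = Dom E (FG E q p)" "Dom E (HA E q p) = Dom E (HF E q p)"
    "pol3 p \<cdot> FB E q p = pol1 q \<cdot> FC E q p" "pol2 q \<cdot> FC E q p = GD E q p \<cdot> FG E q p"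
    "pol2 p \<cdot> HA E q p = FB E q p \<cdot> HF E q p"
  using is_elementD[OF generic_element[OF comp_generic[OF assms]], simplified] is_pullbackD[OF comp_fibre[OF assms]]
    is_polyD[OF p] is_polyD[OF q] by simp_all

lemma comp_square:
  assumes p: "is_poly E X Y p" and q: "is_poly E Y Z q"
  shows "is_pullback E (pol2 q) (GD E q p) (FC E q p) (FG E q p)"
  using is_elementD(1)[OF generic_element[OF comp_generic[OF assms]]] by simp

lemma comp_poly_simps [simp]:
  "pol1 (comp_poly E q p) = pol1 p \<cdot> HA E q p" "pol2 (comp_poly E q p) = FG E q p \<cdot> HF E q p"
  "pol3 (comp_poly E q p) = pol3 q \<cdot> GD E q p"
  by (simp_all add: comp_poly_def)

lemma comp_poly_poly:
  assumes p: "is_poly E X Y p" and q: "is_poly E Y Z q"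
  shows "is_poly E X Z (comp_poly E q p)"
proof -
  note P = is_polyD[OF p] and Q = is_polyD[OF q] and A = comp_arrows[OF assms]
  have "exponentiable E (FG E q p \<cdot> HF E q p)"
    by (rule exponentiable_comp[OF exponentiable_pullback[OF P(8) comp_fibre[OF assms]]
          exponentiable_pullback[OF Q(8) comp_square[OF assms]] A(12)])
  then show ?thesis by (simp add: is_poly_def A P Q)
qed

text \<open>The fibres of an identity are isomorphisms \<open>c\<close>, and an element with section \<open>s\<close> is named by \<open>s c\<^sup>-\<^sup>1\<close>.\<close>

lemma idn_exponentiable:
  assumes X: "X \<in> Obj E" shows "exponentiable E (Idn E X)"
proof (rule exponentiableI)
  fix g assume "g \<in> Arr E" "Cod E g = Dom E (Idn E X)"
  then have g: "g \<in> Arr E" "Cod E g = X" using X by simp_all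
  let ?U = "El g g (Idn E (Dom E g)) (Idn E (Dom E g))"
  have d: "is_pullback E (Idn E X) (elB D) (elA D) (elC D)" "elS D \<in> Arr E" "Dom E (elS D) = Dom E (elA D)"
    "Cod E (elS D) = Dom E g" "g \<cdot> elS D = elA D" "elB D \<in> Arr E" "elA D \<in> Arr E" "elC D \<in> Arr E"
    "Cod E (elB D) = X" "Dom E (elC D) = Dom E (elA D)" "Cod E (elC D) = Dom E (elB D)" "elA D = elB D \<cdot> elC D"
    "is_iso E (elC D)"
    if D: "is_element (Idn E (Dom E (Idn E X))) (Idn E X) g D" for D
  proof -
    note e = is_element_idnD[OF D]
    show "elA D = elB D \<cdot> elC D" using e(16) idn_comp[OF e(10), of X] e(14) X by simp
    show "is_iso E (elC D)" using pullback_iso_left[OF e(1)] X by simp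
    show "Cod E (elB D) = X" using e(12) X by simp
  qed (rule is_element_idnD[OF D])+
  have "is_generic (Idn E (Dom E (Idn E X))) (Idn E X) g ?U"
    unfolding is_generic_def
  proof (intro conjI allI impI ex_ex1I)
    show "is_element (Idn E (Dom E (Idn E X))) (Idn E X) g ?U"
      by (rule is_element_idnI) (simp_all add: pullback_idn_left g X)
  next
    fix D assume D: "is_element (Idn E (Dom E (Idn E X))) (Idn E X) g D"
    note d = d[OF D] note j = iso_inverse(1-5)[OF d(13)]
    have "elA D \<cdot> inverse_of E (elC D) = elB D"
      unfolding d(12) by (simp add: j d(6,8,11))
    then show "\<exists>u. classifies ?U u D"
      by (intro exI[of _ "elS D \<cdot> inverse_of E (elC D)"] classifiesI[where v = "elS D"])
        (simp_all add: j d(2-11) g comp_left_eq[OF d(5), of "inverse_of E (elC D)"])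
  next
    fix D u u' assume D: "is_element (Idn E (Dom E (Idn E X))) (Idn E X) g D"
      and c: "classifies ?U u D" "classifies ?U u' D"
    note d = d[OF D]
    have "u \<cdot> elC D = elS D" if c: "classifies ?U u D" for u
    proof -
      obtain v where "is_cover ?U u D v" using classifies_cover[OF c] by blast
      note v = is_coverD[OF this, unfolded element.select_convs]
      have "v = elS D" "v = u \<cdot> elC D" using v(1,3,5,6) by simp_all
      then show ?thesis by simp
    qed
    then have e: "u \<cdot> elC D = u' \<cdot> elC D" using c by simp
    show "u = u'"
      by (rule iso_cancel_right[OF d(13) _ _ _ _ e])
        (use classifiesD[OF c(1)] classifiesD[OF c(2)] in \<open>simp_all add: d(11)\<close>)
  qed
  then show "\<exists>U. is_generic (Idn E (Dom E (Idn E X))) (Idn E X) g U" by blast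
qed (simp add: X)

lemma id_poly_poly: "X \<in> Obj E \<Longrightarrow> is_poly E X X (id_poly E X)"
  by (simp add: is_poly_def id_poly_def idn_exponentiable)

section \<open>Composable data\<close>

text \<open>A composable pair of fibres, to be thought of as a generalised point of the composite \<open>q p\<close>: \<open>d : W \<rightarrow> D\<close> with
  fibre \<open>(c, g)\<close>, \<open>g : V \<rightarrow> W\<close>, and over \<open>V\<close> a map \<open>b : V \<rightarrow> B\<close> with fibre \<open>(a, e)\<close>, \<open>e : U \<rightarrow> V\<close>.\<close>

definition composable :: "'a poly \<Rightarrow> 'a poly \<Rightarrow> 'a \<Rightarrow> 'a \<Rightarrow> 'a \<Rightarrow> 'a \<Rightarrow> 'a \<Rightarrow> 'a \<Rightarrow> bool" where
  "composable q p d c g b a e \<longleftrightarrow> is_pullback E (pol2 q) d c g \<and> is_pullback E (pol2 p) b a e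
     \<and> Dom E b = Dom E c \<and> pol3 p \<cdot> b = pol1 q \<cdot> c"

text \<open>The maps \<open>x : W \<rightarrow> G\<close>, \<open>w : V \<rightarrow> F\<close> and \<open>y : U \<rightarrow> H\<close> into the composite that correspond to a composable pair.\<close>

definition composite :: "'a poly \<Rightarrow> 'a poly \<Rightarrow> 'a \<Rightarrow> 'a \<Rightarrow> 'a \<Rightarrow> 'a \<Rightarrow> 'a \<Rightarrow> 'a \<Rightarrow> 'a \<Rightarrow> 'a \<Rightarrow> 'a \<Rightarrow> bool" where
  "composite q p x w y d c g b a e \<longleftrightarrow>
     x \<in> Arr E \<and> Dom E x = Dom E d \<and> Cod E x = Dom E (GD E q p)
   \<and> w \<in> Arr E \<and> Dom E w = Dom E g \<and> Cod E w = Dom E (FG E q p)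
   \<and> y \<in> Arr E \<and> Dom E y = Dom E e \<and> Cod E y = Dom E (HF E q p)
   \<and> GD E q p \<cdot> x = d \<and> FC E q p \<cdot> w = c \<and> FG E q p \<cdot> w = x \<cdot> g \<and> FB E q p \<cdot> w = b
   \<and> HA E q p \<cdot> y = a \<and> HF E q p \<cdot> y = w \<cdot> e"

lemma composableD:
  assumes "composable q p d c g b a e" and p: "is_poly E X Y p" and q: "is_poly E Y Z q"
  shows "is_pullback E (pol2 q) d c g" "is_pullback E (pol2 p) b a e"
    "d \<in> Arr E" "c \<in> Arr E" "g \<in> Arr E" "b \<in> Arr E" "a \<in> Arr E" "e \<in> Arr E"
    "Cod E d = Dom E (pol3 q)" "Cod E c = Dom E (pol2 q)" "Cod E g = Dom E d" "Dom E c = Dom E g"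
    "Cod E b = Dom E (pol3 p)" "Cod E a = Dom E (pol2 p)" "Cod E e = Dom E g" "Dom E b = Dom E g" "Dom E a = Dom E e"
    "pol3 p \<cdot> b = pol1 q \<cdot> c" "pol2 q \<cdot> c = d \<cdot> g" "pol2 p \<cdot> a = b \<cdot> e"
  using assms(1) is_pullbackD[of E "pol2 q" d c g] is_pullbackD[of E "pol2 p" b a e] is_polyD[OF p] is_polyD[OF q]
  unfolding composable_def by auto

lemma compositeD:
  assumes "composite q p x w y d c g b a e"
  shows "x \<in> Arr E" "Dom E x = Dom E d" "Cod E x = Dom E (GD E q p)"
    "w \<in> Arr E" "Dom E w = Dom E g" "Cod E w = Dom E (FG E q p)"
    "y \<in> Arr E" "Dom E y = Dom E e" "Cod E y = Dom E (HF E q p)"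
    "GD E q p \<cdot> x = d" "FC E q p \<cdot> w = c" "FG E q p \<cdot> w = x \<cdot> g" "FB E q p \<cdot> w = b"
    "HA E q p \<cdot> y = a" "HF E q p \<cdot> y = w \<cdot> e"
  using assms unfolding composite_def by simp_all

lemma comp_FP:
  assumes p: "is_poly E X Y p" and q: "is_poly E Y Z q"
  shows "FP E q p \<in> Arr E" "Dom E (FP E q p) = Dom E (FG E q p)" "Cod E (FP E q p) = Dom E (piB E q p)"
proof -
  note D = is_element_idnD[OF generic_element[OF comp_dpb[OF assms]], unfolded element.select_convs]
  show "FP E q p \<in> Arr E" by (rule D(4))
  show "Dom E (FP E q p) = Dom E (FG E q p)" using D(5,13) by metis
  show "Cod E (FP E q p) = Dom E (piB E q p)" using D(6) is_pullbackD(6)[OF comp_base[OF assms]] by metis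
qed

text \<open>Links \<open>composite\<close> to the lifts by which horizontal composition and the associator are defined.\<close>

lemma composite_lift:
  assumes p: "is_poly E X Y p" and q: "is_poly E Y Z q" and D: "composable q p d c g b a e"
    and u: "u \<in> Arr E" "Dom E u = Dom E g" "Cod E u = Dom E (piB E q p)" "piB E q p \<cdot> u = b" "piC E q p \<cdot> u = c"
  defines "st \<equiv> dpb_lift E (pol2 q) (piC E q p) \<lparr>pba_p = u, pba_q = g, pba_r = d\<rparr>"
  shows "composite q p (pba_t st) (pba_s st) (pb_lift E (pol2 p) (FB E q p) a (pba_s st \<cdot> e)) d c g b a e"
proof -
  note P = is_polyD[OF p] and Q = is_polyD[OF q] and A = comp_arrows[OF p q] and C = composableD[OF D p q]
  note B = is_pullbackD[OF comp_base[OF p q]]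
  have piC: "piC E q p \<in> Arr E" "Cod E (piC E q p) = Dom E (pol2 q)" using B Q by simp_all
  have pba: "is_pba E (pol2 q) (piC E q p) \<lparr>pba_p = u, pba_q = g, pba_r = d\<rparr>"
    unfolding is_pba_iff[OF piC]
    by (rule is_element_idnI) (simp_all add: u C piC B)
  have L': "pba_s st \<in> Arr E" "Dom E (pba_s st) = Dom E g" "Cod E (pba_s st) = Dom E (FG E q p)"
    "pba_t st \<in> Arr E" "Dom E (pba_t st) = Dom E d" "Cod E (pba_t st) = Dom E (GD E q p)"
    "FP E q p \<cdot> pba_s st = u" "FG E q p \<cdot> pba_s st = pba_t st \<cdot> g" "GD E q p \<cdot> pba_t st = d"
    using dpb_lift[OF Q(8) piC pba] C(11) A(11) by (simp_all add: st_def GD_def FG_def FP_def dp_def)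
  note FP = comp_FP[OF p q]
  have FCs: "FC E q p \<cdot> pba_s st = c" "FB E q p \<cdot> pba_s st = b"
    by (simp_all add: FC_def FB_def FP B(1-8) L'(1-3,7) u)
  have e: "pol2 p \<cdot> a = FB E q p \<cdot> pba_s st \<cdot> e"
    using comp_left_eq[OF FCs(2), of e] C(20) by (simp add: L'(1-3) C(3-17) A(1-15))
  have y: "pb_lift E (pol2 p) (FB E q p) a (pba_s st \<cdot> e) \<in> Arr E"
    "Dom E (pb_lift E (pol2 p) (FB E q p) a (pba_s st \<cdot> e)) = Dom E e"
    "Cod E (pb_lift E (pol2 p) (FB E q p) a (pba_s st \<cdot> e)) = Dom E (HF E q p)"
    "HA E q p \<cdot> pb_lift E (pol2 p) (FB E q p) a (pba_s st \<cdot> e) = a"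
    "HF E q p \<cdot> pb_lift E (pol2 p) (FB E q p) a (pba_s st \<cdot> e) = pba_s st \<cdot> e"
    using pb_lift[of "pol2 p" "FB E q p" a "pba_s st \<cdot> e"] e A(15)
    by (simp_all add: P A(1-14) L'(1-3) C(3-17) HA_def HF_def)
  show ?thesis unfolding composite_def using y L' FCs by simp
qed

lemma composite_ex:
  assumes p: "is_poly E X Y p" and q: "is_poly E Y Z q" and D: "composable q p d c g b a e"
  shows "\<exists>x w y. composite q p x w y d c g b a e"
proof -
  note C = composableD[OF D p q] and Q = is_polyD[OF q] and P = is_polyD[OF p]
  have "\<exists>u. is_lift (piB E q p) (piC E q p) b c u"
    by (rule pullback_lift[OF comp_base[OF p q]]) (simp_all add: C Q P)
  then obtain u where "is_lift (piB E q p) (piC E q p) b c u" by blast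
  note u = is_liftD[OF this]
  show ?thesis using composite_lift[OF p q D u(1) _ u(3-5)] u(2) C(16) by auto
qed

text \<open>The map \<open>x\<close> names an element of the generic one on \<open>G\<close>, and \<open>w\<close> and \<open>y\<close> are maps into pullbacks over it.
  All identities between 2-cells into a composite come from this lemma.\<close>

lemma composite_unique:
  assumes p: "is_poly E X Y p" and q: "is_poly E Y Z q" and D: "composable q p d c g b a e"
    and c: "composite q p x w y d c g b a e" "composite q p x' w' y' d c g b a e"
  shows "x = x'" "w = w'" "y = y'"
proof -
  note C = composableD[OF D p q] and P = is_polyD[OF p] and Q = is_polyD[OF q] and A = comp_arrows[OF p q]
  note N = compositeD[OF c(1)] and N' = compositeD[OF c(2)]
  have el: "is_element (pol1 q) (pol2 q) (pol3 p) (El d c g b)"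
    by (simp add: is_element_def C P Q)
  have cl: "classifies (El (GD E q p) (FC E q p) (FG E q p) (FB E q p)) x (El d c g b)"
    if "composite q p x w y d c g b a e" for x w y
    by (rule classifiesI[where v = w]) (use compositeD[OF that] in \<open>simp_all add: C A\<close>)
  show x: "x = x'" using generic_unique[OF comp_generic[OF p q] el] cl c by blast
  show w: "w = w'"
    by (rule pullback_eqI[OF comp_square[OF p q]]) (simp_all add: N N' x A)
  show "y = y'"
    by (rule pullback_eqI[OF comp_fibre[OF p q]]) (simp_all add: N N' w A)
qed

lemma composite_pullback:
  assumes p: "is_poly E X Y p" and q: "is_poly E Y Z q" and D: "composable q p d c g b a e"
    and c: "composite q p x w y d c g b a e"
  shows "is_pullback E (pol2 (comp_poly E q p)) x y (g \<cdot> e)"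
proof -
  note C = composableD[OF D p q] and A = comp_arrows[OF p q] and N = compositeD[OF c]
  have 1: "is_pullback E (FG E q p) x w g"
    by (rule pullback_cancel[OF comp_square[OF p q]]) (simp_all add: N A C(1))
  have 2: "is_pullback E (HF E q p) w y e"
    by (rule pullback_cancel[OF comp_fibre[OF p q]]) (simp_all add: N A C(2))
  show ?thesis using pullback_paste'[OF 2 1] by simp
qed

lemma composite_restrict:
  assumes p: "is_poly E X Y p" and q: "is_poly E Y Z q" and D: "composable q p d c g b a e"
    and c: "composite q p x w y d c g b a e"
    and t: "t \<in> Arr E" "Cod E t = Dom E d" "t1 \<in> Arr E" "Cod E t1 = Dom E g" "t2 \<in> Arr E" "Cod E t2 = Dom E e"
      "g' \<in> Arr E" "Dom E g' = Dom E t1" "Cod E g' = Dom E t" "e' \<in> Arr E" "Dom E e' = Dom E t2" "Cod E e' = Dom E t1"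
    and eq: "g \<cdot> t1 = t \<cdot> g'" "e \<cdot> t2 = t1 \<cdot> e'"
  shows "composite q p (x \<cdot> t) (w \<cdot> t1) (y \<cdot> t2) (d \<cdot> t) (c \<cdot> t1) g' (b \<cdot> t1) (a \<cdot> t2) e'"
proof -
  note C = composableD[OF D p q] and A = comp_arrows[OF p q] and N = compositeD[OF c]
  show ?thesis
    unfolding composite_def
    using comp_left_eq[OF N(10), of t] comp_left_eq[OF N(11), of t1] comp_left_eq[OF N(12), of t1]
      comp_left_eq[OF N(13), of t1] comp_left_eq[OF N(14), of t2] comp_left_eq[OF N(15), of t2]
    by (simp add: N(1-9) t A(1-15) C(3-17) eq)
qed

text \<open>Every fibre of the composite arises from a composable pair: pull \<open>F \<rightarrow> G\<close> back along \<open>x\<close> and factor the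
  fibre through the result.\<close>

lemma composite_decompose:
  assumes p: "is_poly E X Y p" and q: "is_poly E Y Z q"
    and pb: "is_pullback E (pol2 (comp_poly E q p)) x y \<gamma>"
  obtains d c g b a e w where "composable q p d c g b a e" "composite q p x w y d c g b a e" "g \<cdot> e = \<gamma>"
proof -
  note P = is_polyD[OF p] and Q = is_polyD[OF q] and A = comp_arrows[OF p q]
  have pb': "is_pullback E (FG E q p \<cdot> HF E q p) x y \<gamma>" using pb by simp
  note D = is_pullbackD[OF pb']
  have x: "Cod E x = Dom E (GD E q p)" using D(5) A(3,6,11,12) by simp
  have y: "Cod E y = Dom E (HF E q p)" using D(7) A(3,6,12) by simp
  have eq: "FG E q p \<cdot> HF E q p \<cdot> y = x \<cdot> \<gamma>" using D(9) A(3,6,12) y D(3) by simp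
  let ?w = "fst (pb E (FG E q p) x)" and ?g = "snd (pb E (FG E q p) x)"
  have W: "is_pullback E (FG E q p) x ?w ?g" by (rule pb_pullback) (simp_all add: A x D)
  note w = is_pullbackD[OF W]
  have "\<exists>e. is_lift ?w ?g (HF E q p \<cdot> y) \<gamma> e"
    by (rule pullback_lift[OF W]) (simp_all add: A y D(1-4,6,8) eq)
  then obtain e where "is_lift ?w ?g (HF E q p \<cdot> y) \<gamma> e" by blast
  note e = is_liftD[OF this]
  have ey: "Dom E e = Dom E y" using e(2) A y D(3) by simp
  have V: "is_pullback E (HF E q p) ?w y e"
    by (rule pullback_cancel'[OF W]) (simp_all add: pb' e A)
  have 1: "is_pullback E (pol2 q) (GD E q p \<cdot> x) (FC E q p \<cdot> ?w) ?g"
    by (rule pullback_paste[OF comp_square[OF p q] W])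
  have 2: "is_pullback E (pol2 p) (FB E q p \<cdot> ?w) (HA E q p \<cdot> y) e"
    by (rule pullback_paste[OF comp_fibre[OF p q] V])
  have c: "composable q p (GD E q p \<cdot> x) (FC E q p \<cdot> ?w) ?g (FB E q p \<cdot> ?w) (HA E q p \<cdot> y) e"
    unfolding composable_def using 1 2 comp_left_eq[OF A(16), of ?w] by (simp add: A(1-15) w(1-8) P Q)
  have "composite q p x ?w y (GD E q p \<cdot> x) (FC E q p \<cdot> ?w) ?g (FB E q p \<cdot> ?w) (HA E q p \<cdot> y) e"
    unfolding composite_def by (simp add: D(1-4) x y w ey e(1,3-5) A(1-15))
  then show ?thesis using that c e(5) by blast
qed

lemma composable_cart:
  assumes f: "is_cart E X Y f" and g: "is_cart E Y Z g" and D: "composable (csrc g) (csrc f) d c \<gamma> b a e"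
  shows "composable (ctrg g) (ctrg f) (car1 g \<cdot> d) (car0 g \<cdot> c) \<gamma> (car1 f \<cdot> b) (car0 f \<cdot> a) e"
proof -
  note F = is_cartD[OF f] and G = is_cartD[OF g]
  note C = composableD[OF D F(1) G(1)]
  note P' = is_polyD[OF F(2)] and Q' = is_polyD[OF G(2)]
  have "pol3 (ctrg f) \<cdot> car1 f \<cdot> b = pol1 (ctrg g) \<cdot> car0 g \<cdot> c"
    using comp_left_eq[OF F(10), of b] comp_left_eq[OF G(9), of c] by (simp add: F(3-8) G(3-8) C(3-18) P' Q')
  then show ?thesis
    unfolding composable_def
    using pullback_paste[OF G(11) C(1)] pullback_paste[OF F(11) C(2)] by (simp add: F(3-8) G(3-8) C(3-17))
qed

lemma generic_composable:
  assumes p: "is_poly E X Y p" and q: "is_poly E Y Z q"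
  shows "composable q p (GD E q p) (FC E q p) (FG E q p) (FB E q p) (HA E q p) (HF E q p)"
  unfolding composable_def using comp_square[OF assms] comp_fibre[OF assms] comp_arrows[OF assms] by simp

text \<open>The lifts that define the horizontal composite are those that name the image of the generic
  composable pair under \<open>f\<close> and \<open>g\<close>.\<close>

lemma hcomp_cart_composite:
  assumes f: "is_cart E X Y f" and g: "is_cart E Y Z g"
  defines "p \<equiv> csrc f" and "q \<equiv> csrc g"
  shows "csrc (hcomp_cart E g f) = comp_poly E q p" "ctrg (hcomp_cart E g f) = comp_poly E (ctrg g) (ctrg f)"
    "\<exists>w. composite (ctrg g) (ctrg f) (car1 (hcomp_cart E g f)) w (car0 (hcomp_cart E g f))
      (car1 g \<cdot> GD E q p) (car0 g \<cdot> FC E q p) (FG E q p) (car1 f \<cdot> FB E q p) (car0 f \<cdot> HA E q p) (HF E q p)"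
proof -
  note F = is_cartD[OF f, folded p_def] and G = is_cartD[OF g, folded q_def]
  show "csrc (hcomp_cart E g f) = comp_poly E q p" "ctrg (hcomp_cart E g f) = comp_poly E (ctrg g) (ctrg f)"
    by (simp_all add: hcomp_cart_def Let_def p_def q_def)
  note P = is_polyD[OF F(1)] and P' = is_polyD[OF F(2)] and Q = is_polyD[OF G(1)] and Q' = is_polyD[OF G(2)]
  note B = is_pullbackD[OF comp_base[OF F(1) G(1)]]
  define u where "u = pb_lift E (pol3 (ctrg f)) (pol1 (ctrg g)) (car1 f \<cdot> piB E q p) (car0 g \<cdot> piC E q p)"
  have e: "pol3 (ctrg f) \<cdot> car1 f \<cdot> piB E q p = pol1 (ctrg g) \<cdot> car0 g \<cdot> piC E q p"
    using comp_left_eq[OF F(10), of "piB E q p"] comp_left_eq[OF G(9), of "piC E q p"]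
    by (simp add: F(3-8) G(3-8) P' Q' B Q)
  have u: "u \<in> Arr E" "Dom E u = Dom E (piB E q p)" "Cod E u = Dom E (piB E (ctrg g) (ctrg f))"
    "piB E (ctrg g) (ctrg f) \<cdot> u = car1 f \<cdot> piB E q p" "piC E (ctrg g) (ctrg f) \<cdot> u = car0 g \<cdot> piC E q p"
    using pb_lift[of "pol3 (ctrg f)" "pol1 (ctrg g)" "car1 f \<cdot> piB E q p" "car0 g \<cdot> piC E q p"] e
    by (simp_all add: u_def piB_def[of E "ctrg g"] piC_def[of E "ctrg g"] P' Q' F(3-8) G(3-8) B Q)
  note FP = comp_FP[OF F(1) G(1)]
  note B' = is_pullbackD[OF comp_base[OF F(2) G(2)]]
  have uF: "piB E (ctrg g) (ctrg f) \<cdot> u \<cdot> FP E q p = car1 f \<cdot> FB E q p"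
    "piC E (ctrg g) (ctrg f) \<cdot> u \<cdot> FP E q p = car0 g \<cdot> FC E q p"
    using comp_left_eq[OF u(4), of "FP E q p"] comp_left_eq[OF u(5), of "FP E q p"]
    by (simp_all add: FB_def FC_def FP u(1-3) B' B F(3-8) G(3-8) P Q)
  show "\<exists>w. composite (ctrg g) (ctrg f) (car1 (hcomp_cart E g f)) w (car0 (hcomp_cart E g f))
      (car1 g \<cdot> GD E q p) (car0 g \<cdot> FC E q p) (FG E q p) (car1 f \<cdot> FB E q p) (car0 f \<cdot> HA E q p) (HF E q p)"
    using composite_lift[OF F(2) G(2) composable_cart[OF f g generic_composable[OF F(1) G(1), unfolded p_def q_def]],
        folded p_def q_def, of "u \<cdot> FP E q p"] uF
    by (auto simp: hcomp_cart_def Let_def p_def[symmetric] q_def[symmetric] u_def[symmetric] FP u(1-3))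
qed

text \<open>A morphism into a composite that names composable data is cartesian because such data form a fibre of
  the composite.\<close>

lemma composite_is_cart:
  assumes p: "is_poly E X Y p" and q: "is_poly E Y Z q" and D: "composable q p d c g b a e"
    and c: "composite q p (car1 f) w (car0 f) d c g b a e"
    and f: "ctrg f = comp_poly E q p" "is_poly E X Z (csrc f)" "pol2 (csrc f) = g \<cdot> e"
      "pol1 (csrc f) = pol1 p \<cdot> a" "pol3 (csrc f) = pol3 q \<cdot> d"
  shows "is_cart E X Z f"
proof -
  note A = comp_arrows[OF p q] and N = compositeD[OF c]
    and P = is_polyD[OF p] and Q = is_polyD[OF q]
  show ?thesis
    by (rule is_cartI)
      (use composite_pullback[OF p q D c] comp_poly_poly[OF p q] in \<open>simp_all add: f N A P Q\<close>)
qed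

lemma hcomp_cart_cart:
  assumes f: "is_cart E X Y f" and g: "is_cart E Y Z g"
  shows "is_cart E X Z (hcomp_cart E g f)"
proof -
  note F = is_cartD[OF f] and G = is_cartD[OF g] note H = hcomp_cart_composite[OF f g]
  note P' = is_polyD[OF F(2)] and Q' = is_polyD[OF G(2)] and A = comp_arrows[OF F(1) G(1)]
  obtain w where w: "composite (ctrg g) (ctrg f) (car1 (hcomp_cart E g f)) w (car0 (hcomp_cart E g f))
      (car1 g \<cdot> GD E (csrc g) (csrc f)) (car0 g \<cdot> FC E (csrc g) (csrc f)) (FG E (csrc g) (csrc f))
      (car1 f \<cdot> FB E (csrc g) (csrc f)) (car0 f \<cdot> HA E (csrc g) (csrc f)) (HF E (csrc g) (csrc f))"
    using H(3) by blast
  show ?thesis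
    by (rule composite_is_cart[OF F(2) G(2) composable_cart[OF f g generic_composable[OF F(1) G(1)]] w])
      (use comp_left_eq[OF F(9), of "HA E (csrc g) (csrc f)"] comp_left_eq[OF G(10), of "GD E (csrc g) (csrc f)"]
        in \<open>simp_all add: H(1,2) comp_poly_poly[OF F(1) G(1)] F(3-8) G(3-8) P' Q' A\<close>)
qed

text \<open>Horizontal composites act componentwise: restrict the generic case.\<close>

lemma hcomp_composite:
  assumes f: "is_cart E X Y f" and g: "is_cart E Y Z g" and D: "composable (csrc g) (csrc f) d c \<gamma> b a e"
    and c: "composite (csrc g) (csrc f) x w y d c \<gamma> b a e"
  shows "\<exists>w'. composite (ctrg g) (ctrg f) (car1 (hcomp_cart E g f) \<cdot> x) w' (car0 (hcomp_cart E g f) \<cdot> y)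
    (car1 g \<cdot> d) (car0 g \<cdot> c) \<gamma> (car1 f \<cdot> b) (car0 f \<cdot> a) e"
proof -
  note F = is_cartD[OF f] and G = is_cartD[OF g]
  note A = comp_arrows[OF F(1) G(1)] and N = compositeD[OF c] and C = composableD[OF D F(1) G(1)]
  obtain v where v: "composite (ctrg g) (ctrg f) (car1 (hcomp_cart E g f)) v (car0 (hcomp_cart E g f))
      (car1 g \<cdot> GD E (csrc g) (csrc f)) (car0 g \<cdot> FC E (csrc g) (csrc f)) (FG E (csrc g) (csrc f))
      (car1 f \<cdot> FB E (csrc g) (csrc f)) (car0 f \<cdot> HA E (csrc g) (csrc f)) (HF E (csrc g) (csrc f))"
    using hcomp_cart_composite[OF f g] by blast
  have "composite (ctrg g) (ctrg f) (car1 (hcomp_cart E g f) \<cdot> x) (v \<cdot> w) (car0 (hcomp_cart E g f) \<cdot> y)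
    ((car1 g \<cdot> GD E (csrc g) (csrc f)) \<cdot> x) ((car0 g \<cdot> FC E (csrc g) (csrc f)) \<cdot> w) \<gamma>
    ((car1 f \<cdot> FB E (csrc g) (csrc f)) \<cdot> w) ((car0 f \<cdot> HA E (csrc g) (csrc f)) \<cdot> y) e"
    by (rule composite_restrict[OF F(2) G(2) composable_cart[OF f g generic_composable[OF F(1) G(1)]] v])
      (simp_all add: N A C F(3-8) G(3-8))
  then have "composite (ctrg g) (ctrg f) (car1 (hcomp_cart E g f) \<cdot> x) (v \<cdot> w) (car0 (hcomp_cart E g f) \<cdot> y)
    (car1 g \<cdot> d) (car0 g \<cdot> c) \<gamma> (car1 f \<cdot> b) (car0 f \<cdot> a) e"
    by (simp add: N A C F(3-8) G(3-8))
  then show ?thesis by blast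
qed

section \<open>Coherence for polynomials\<close>

text \<open>With the next lemma: the two ways of bracketing a composable triple as a pair.\<close>

lemma composable_left:
  assumes p: "is_poly E W X p" and q: "is_poly E X Y q" and r: "is_poly E Y Z r"
    and 1: "composable r q d1 c1 g1 d2 c2 g2" and 2: "composable q p d2 c2 g2 d3 c3 g3"
    and c: "composite r q x w y d1 c1 g1 d2 c2 g2"
  shows "composable (comp_poly E r q) p x y (g1 \<cdot> g2) d3 c3 g3"
proof -
  note D = composableD[OF 2 p q] and N = compositeD[OF c] and A = comp_arrows[OF q r]
    and Q = is_polyD[OF q]
  have "pol1 q \<cdot> HA E r q \<cdot> y = pol3 p \<cdot> d3" using D(18) N(14) by simp
  then show ?thesis
    unfolding composable_def using composite_pullback[OF q r 1 c] D(2) by (simp add: D(15-17) N(7-9) A Q)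
qed

lemma composable_right:
  assumes p: "is_poly E W X p" and q: "is_poly E X Y q" and r: "is_poly E Y Z r"
    and 1: "composable r q d1 c1 g1 d2 c2 g2" and 2: "composable q p d2 c2 g2 d3 c3 g3"
    and c: "composite q p x w y d2 c2 g2 d3 c3 g3"
  shows "composable r (comp_poly E q p) d1 c1 g1 x y (g2 \<cdot> g3)"
proof -
  note C = composableD[OF 1 q r] and N = compositeD[OF c] and A = comp_arrows[OF p q]
    and Q = is_polyD[OF q]
  have "pol3 q \<cdot> GD E q p \<cdot> x = pol1 r \<cdot> c1" using C(18) N(10) by simp
  then show ?thesis
    unfolding composable_def using composite_pullback[OF p q 2 c] C(1) by (simp add: C(12,16) N(1-3) A Q)
qed

text \<open>Reads the definition of the associator in terms of composable data. The generic pair for \<open>(r q) p\<close>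
  has its first member in the composite \<open>r q\<close>; taking this member apart over the pullback \<open>M\<close>, with projections
  \<open>mg\<close> and \<open>mf\<close>, gives a composable triple. The two lifts in the definition name the composite of the two inner members and then
  the composite of the outer one with it.\<close>

lemma assoc_cart_composite:
  assumes p: "is_poly E W X p" and q: "is_poly E X Y q" and r: "is_poly E Y Z r"
  defines "rq \<equiv> comp_poly E r q" and "qp \<equiv> comp_poly E q p" and "\<alpha> \<equiv> assoc_cart E r q p"
  shows "csrc \<alpha> = comp_poly E rq p" "ctrg \<alpha> = comp_poly E r qp"
    "\<exists>mg mf n t s x u. is_pullback E (GD E rq p) (FG E r q) mg mf
       \<and> n \<in> Arr E \<and> Dom E n = Dom E (FG E rq p) \<and> Cod E n = Dom E mg
       \<and> mg \<cdot> n = FG E rq p \<and> mf \<cdot> n = HF E r q \<cdot> FC E rq p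
       \<and> composable r q (GD E r q \<cdot> GD E rq p) (FC E r q \<cdot> mf) mg (FB E r q \<cdot> mf) (HA E r q \<cdot> FC E rq p) n
       \<and> composable q p (FB E r q \<cdot> mf) (HA E r q \<cdot> FC E rq p) n (FB E rq p) (HA E rq p) (HF E rq p)
       \<and> composite q p t s x (FB E r q \<cdot> mf) (HA E r q \<cdot> FC E rq p) n (FB E rq p) (HA E rq p) (HF E rq p)
       \<and> composite r qp (car1 \<alpha>) u (car0 \<alpha>) (GD E r q \<cdot> GD E rq p) (FC E r q \<cdot> mf) mg t x (n \<cdot> HF E rq p)"
proof -
  note P = is_polyD[OF p] and Q = is_polyD[OF q] and R = is_polyD[OF r]
  have rq: "is_poly E X Z rq" unfolding rq_def by (rule comp_poly_poly[OF q r])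
  have qp: "is_poly E W Y qp" unfolding qp_def by (rule comp_poly_poly[OF p q])
  note A = comp_arrows[OF q r] and B = comp_arrows[OF p rq]
  have pol: "pol1 rq = pol1 q \<cdot> HA E r q" "pol2 rq = FG E r q \<cdot> HF E r q" "pol3 rq = pol3 r \<cdot> GD E r q"
    by (simp_all add: rq_def)
  define mg where "mg = fst (pb E (GD E rq p) (FG E r q))"
  define mf where "mf = snd (pb E (GD E rq p) (FG E r q))"
  have cG: "Cod E (GD E rq p) = Cod E (FG E r q)" using B(7) by (simp add: pol A R)
  have M: "is_pullback E (GD E rq p) (FG E r q) mg mf"
    unfolding mg_def mf_def by (rule pb_pullback) (simp_all add: A(1-15) B(1-6,9-15) cG R)
  note m = is_pullbackD[OF M]
  have cF: "Cod E (FC E rq p) = Dom E (HF E r q)" using B(8) by (simp add: pol A)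
  have e1: "FG E r q \<cdot> HF E r q \<cdot> FC E rq p = GD E rq p \<cdot> FG E rq p"
    using B(17) by (simp add: pol A(1-15) B(2) cF)
  define n where "n = pb_lift E (GD E rq p) (FG E r q) (FG E rq p) (HF E r q \<cdot> FC E rq p)"
  have n: "n \<in> Arr E" "Dom E n = Dom E (FG E rq p)" "Cod E n = Dom E mg" "mg \<cdot> n = FG E rq p"
    "mf \<cdot> n = HF E r q \<cdot> FC E rq p"
    unfolding n_def mg_def mf_def
    using pb_lift[of "GD E rq p" "FG E r q" "FG E rq p" "HF E r q \<cdot> FC E rq p"]
    by (simp_all add: A(1-15) B(1-6,11-15) cG cF e1)
  have sq: "is_pullback E (FG E r q \<cdot> HF E r q) (GD E rq p) (FC E rq p) (FG E rq p)"
    using comp_square[OF p rq] by (simp add: pol)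
  have N: "is_pullback E (HF E r q) mf (FC E rq p) n"
    by (rule pullback_cancel'[OF is_pullback_sym[OF M]]) (use sq in \<open>simp_all add: n A m(6)\<close>)
  have p1: "is_pullback E (pol2 r) (GD E r q \<cdot> GD E rq p) (FC E r q \<cdot> mf) mg"
    by (rule pullback_paste[OF comp_square[OF q r] is_pullback_sym[OF M]])
  have p2: "is_pullback E (pol2 q) (FB E r q \<cdot> mf) (HA E r q \<cdot> FC E rq p) n"
    by (rule pullback_paste[OF comp_fibre[OF q r] N])
  have c1: "composable r q (GD E r q \<cdot> GD E rq p) (FC E r q \<cdot> mf) mg (FB E r q \<cdot> mf) (HA E r q \<cdot> FC E rq p) n"
    unfolding composable_def using p1 p2 comp_left_eq[OF A(16), of mf]
    by (simp add: A(1-15) m(1-4,6-8) Q R)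
  have e2: "pol3 p \<cdot> FB E rq p = pol1 q \<cdot> HA E r q \<cdot> FC E rq p"
    using B(16) by (simp add: pol A(1-15) Q B(1-6,9-15) cF)
  have c2: "composable q p (FB E r q \<cdot> mf) (HA E r q \<cdot> FC E rq p) n (FB E rq p) (HA E rq p) (HF E rq p)"
    unfolding composable_def using p2 comp_fibre[OF p rq] e2 by (simp add: A(1-15) B(1-6,9-15) cF)
  define v where "v = pb_lift E (pol3 p) (pol1 q) (FB E rq p) (HA E r q \<cdot> FC E rq p)"
  have v: "v \<in> Arr E" "Dom E v = Dom E n" "Cod E v = Dom E (piB E q p)"
    "piB E q p \<cdot> v = FB E rq p" "piC E q p \<cdot> v = HA E r q \<cdot> FC E rq p"
    unfolding v_def piB_def piC_def
    using pb_lift[of "pol3 p" "pol1 q" "FB E rq p" "HA E r q \<cdot> FC E rq p"] e2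
    by (simp_all add: P Q A(1-15) B(1-6,9-15) cF n)
  define ab where "ab = dpb_lift E (pol2 q) (piC E q p) \<lparr>pba_p = v, pba_q = n, pba_r = FB E r q \<cdot> mf\<rparr>"
  define x where "x = pb_lift E (pol2 p) (FB E q p) (HA E rq p) (pba_s ab \<cdot> HF E rq p)"
  have ab: "composite q p (pba_t ab) (pba_s ab) x (FB E r q \<cdot> mf) (HA E r q \<cdot> FC E rq p) n (FB E rq p) (HA E rq p) (HF E rq p)"
    unfolding ab_def x_def by (rule composite_lift[OF p q c2 v])
  have c3: "composable r qp (GD E r q \<cdot> GD E rq p) (FC E r q \<cdot> mf) mg (pba_t ab) x (n \<cdot> HF E rq p)"
    unfolding qp_def by (rule composable_right[OF p q r c1 c2 ab])
  note C3 = composableD[OF c3 qp r] and QP = is_polyD[OF qp]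
  define w where "w = pb_lift E (pol3 qp) (pol1 r) (pba_t ab) (FC E r q \<cdot> mf)"
  have w: "w \<in> Arr E" "Dom E w = Dom E mg" "Cod E w = Dom E (piB E r qp)"
    "piB E r qp \<cdot> w = pba_t ab" "piC E r qp \<cdot> w = FC E r q \<cdot> mf"
    unfolding w_def piB_def piC_def
    using pb_lift[of "pol3 qp" "pol1 r" "pba_t ab" "FC E r q \<cdot> mf"]
    by (simp_all add: C3 QP R)
  define cd where "cd = dpb_lift E (pol2 r) (piC E r qp) \<lparr>pba_p = w, pba_q = mg, pba_r = GD E r q \<cdot> GD E rq p\<rparr>"
  have al: "\<alpha> = \<lparr>csrc = comp_poly E rq p, ctrg = comp_poly E r qp,
      car0 = pb_lift E (pol2 qp) (FB E r qp) x (pba_s cd \<cdot> n \<cdot> HF E rq p), car1 = pba_t cd\<rparr>"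
    unfolding \<alpha>_def assoc_cart_def Let_def
    by (simp only: rq_def[symmetric] qp_def[symmetric] mg_def[symmetric] mf_def[symmetric] n_def[symmetric] v_def[symmetric]
        ab_def[symmetric] w_def[symmetric] cd_def[symmetric] x_def[symmetric])
  show "csrc \<alpha> = comp_poly E rq p" "ctrg \<alpha> = comp_poly E r qp" by (simp_all add: al)
  have "composite r qp (pba_t cd) (pba_s cd) (pb_lift E (pol2 qp) (FB E r qp) x (pba_s cd \<cdot> n \<cdot> HF E rq p))
      (GD E r q \<cdot> GD E rq p) (FC E r q \<cdot> mf) mg (pba_t ab) x (n \<cdot> HF E rq p)"
    unfolding cd_def by (rule composite_lift[OF qp r c3 w])
  then show "\<exists>mg mf n t s x u. is_pullback E (GD E rq p) (FG E r q) mg mf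
       \<and> n \<in> Arr E \<and> Dom E n = Dom E (FG E rq p) \<and> Cod E n = Dom E mg
       \<and> mg \<cdot> n = FG E rq p \<and> mf \<cdot> n = HF E r q \<cdot> FC E rq p
       \<and> composable r q (GD E r q \<cdot> GD E rq p) (FC E r q \<cdot> mf) mg (FB E r q \<cdot> mf) (HA E r q \<cdot> FC E rq p) n
       \<and> composable q p (FB E r q \<cdot> mf) (HA E r q \<cdot> FC E rq p) n (FB E rq p) (HA E rq p) (HF E rq p)
       \<and> composite q p t s x (FB E r q \<cdot> mf) (HA E r q \<cdot> FC E rq p) n (FB E rq p) (HA E rq p) (HF E rq p)
       \<and> composite r qp (car1 \<alpha>) u (car0 \<alpha>) (GD E r q \<cdot> GD E rq p) (FC E r q \<cdot> mf) mg t x (n \<cdot> HF E rq p)"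
    using M n c1 c2 ab unfolding al by (simp only: cart.select_convs) blast
qed

lemma assoc_cart_cart:
  assumes p: "is_poly E W X p" and q: "is_poly E X Y q" and r: "is_poly E Y Z r"
  shows "is_cart E W Z (assoc_cart E r q p)"
proof -
  let ?rq = "comp_poly E r q" and ?qp = "comp_poly E q p"
  have rq: "is_poly E X Z ?rq" by (rule comp_poly_poly[OF q r])
  have qp: "is_poly E W Y ?qp" by (rule comp_poly_poly[OF p q])
  note A = comp_arrows[OF q r] and B = comp_arrows[OF p rq] and D = comp_arrows[OF p q]
    and P = is_polyD[OF p] and R = is_polyD[OF r]
  obtain mg mf n t s x u where n: "n \<in> Arr E" "Dom E n = Dom E (FG E ?rq p)" "Cod E n = Dom E mg" "mg \<cdot> n = FG E ?rq p"
    and c1: "composable r q (GD E r q \<cdot> GD E ?rq p) (FC E r q \<cdot> mf) mg (FB E r q \<cdot> mf) (HA E r q \<cdot> FC E ?rq p) n"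
    and c2: "composable q p (FB E r q \<cdot> mf) (HA E r q \<cdot> FC E ?rq p) n (FB E ?rq p) (HA E ?rq p) (HF E ?rq p)"
    and ab: "composite q p t s x (FB E r q \<cdot> mf) (HA E r q \<cdot> FC E ?rq p) n (FB E ?rq p) (HA E ?rq p) (HF E ?rq p)"
    and cd: "composite r ?qp (car1 (assoc_cart E r q p)) u (car0 (assoc_cart E r q p))
      (GD E r q \<cdot> GD E ?rq p) (FC E r q \<cdot> mf) mg t x (n \<cdot> HF E ?rq p)"
    using assoc_cart_composite(3)[OF assms] by blast
  note N = compositeD[OF ab] and C = composableD[OF c1 q r]
  have cG: "Cod E (GD E ?rq p) = Dom E (GD E r q)" using B(7) A R by simp
  show ?thesis
    by (rule composite_is_cart[OF qp r composable_right[OF p q r c1 c2 ab] cd])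
      (use comp_left_eq[OF n(4), of "HF E ?rq p"] comp_poly_poly[OF p rq]
        in \<open>simp_all add: assoc_cart_composite(1,2)[OF assms] n(1-3) B(1-6,11-15) C(5) N A(1-15) D(1-15) cG P R\<close>)
qed

text \<open>The associator rebrackets composable triples. Any triple is a restriction of the generic one, the
  middle stage being restricted along the map \<open>k\<close> into \<open>M\<close>.\<close>

lemma assoc_composite:
  assumes p: "is_poly E W X p" and q: "is_poly E X Y q" and r: "is_poly E Y Z r"
    and 1: "composable r q d1 c1 g1 d2 c2 g2" and 2: "composable q p d2 c2 g2 d3 c3 g3"
    and c: "composite r q x w y d1 c1 g1 d2 c2 g2"
    and c': "composite (comp_poly E r q) p x1 w1 y1 x y (g1 \<cdot> g2) d3 c3 g3"
    and c0: "composite q p x0 w0 y0 d2 c2 g2 d3 c3 g3"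
  shows "\<exists>w2. composite r (comp_poly E q p) (car1 (assoc_cart E r q p) \<cdot> x1) w2 (car0 (assoc_cart E r q p) \<cdot> y1)
      d1 c1 g1 x0 y0 (g2 \<cdot> g3)"
proof -
  let ?rq = "comp_poly E r q" and ?qp = "comp_poly E q p" and ?\<alpha> = "assoc_cart E r q p"
  have rq: "is_poly E X Z ?rq" by (rule comp_poly_poly[OF q r])
  have qp: "is_poly E W Y ?qp" by (rule comp_poly_poly[OF p q])
  note A = comp_arrows[OF q r] and B = comp_arrows[OF p rq] and R = is_polyD[OF r]
  obtain mg mf n t s z u where M: "is_pullback E (GD E ?rq p) (FG E r q) mg mf"
    and n: "n \<in> Arr E" "Dom E n = Dom E (FG E ?rq p)" "Cod E n = Dom E mg" "mg \<cdot> n = FG E ?rq p"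
      "mf \<cdot> n = HF E r q \<cdot> FC E ?rq p"
    and c1: "composable r q (GD E r q \<cdot> GD E ?rq p) (FC E r q \<cdot> mf) mg (FB E r q \<cdot> mf) (HA E r q \<cdot> FC E ?rq p) n"
    and c2: "composable q p (FB E r q \<cdot> mf) (HA E r q \<cdot> FC E ?rq p) n (FB E ?rq p) (HA E ?rq p) (HF E ?rq p)"
    and ab: "composite q p t s z (FB E r q \<cdot> mf) (HA E r q \<cdot> FC E ?rq p) n (FB E ?rq p) (HA E ?rq p) (HF E ?rq p)"
    and cd: "composite r ?qp (car1 ?\<alpha>) u (car0 ?\<alpha>)
      (GD E r q \<cdot> GD E ?rq p) (FC E r q \<cdot> mf) mg t z (n \<cdot> HF E ?rq p)"
    using assoc_cart_composite(3)[OF p q r] by blast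
  note m = is_pullbackD[OF M]
  note T1 = composableD[OF 1 q r] and T2 = composableD[OF 2 p q]
  note N = compositeD[OF c] and N' = compositeD[OF c'] and AB = compositeD[OF ab]
  have cG: "Cod E (GD E ?rq p) = Dom E (GD E r q)" using B(7) A R by simp
  have cF: "Cod E (FC E ?rq p) = Dom E (HF E r q)" using B(8) A by simp
  have w1: "Dom E w1 = Dom E g2" using N'(5) T1 by simp
  have x1: "Dom E x1 = Dom E d1" using N'(2) N(2) by simp
  have "\<exists>k. is_lift mg mf (x1 \<cdot> g1) w k"
    by (rule pullback_lift[OF M])
      (simp_all add: N'(1,3) x1 T1(3-17) N(4-6,12) A cG[symmetric] comp_left_eq[OF N'(10), of g1] B)
  then obtain k where "is_lift mg mf (x1 \<cdot> g1) w k" by blast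
  note k = is_liftD[OF this]
  have kd: "Dom E k = Dom E g1" using k(2) N'(1) x1 T1(5,11) by simp
  have nk: "n \<cdot> w1 = k \<cdot> g2"
    by (rule pullback_eqI[OF M])
      (simp_all add: n(1-3) w1 k(1,3) kd m(3,4,6) N'(4,6,11,12) T1(3-17) B(1-6,11-15) N'(1,3) x1 cF A(1-15)
        comp_left_eq[OF n(4), of w1] comp_left_eq[OF n(5), of w1] comp_left_eq[OF k(4), of g2] comp_left_eq[OF k(5), of g2]
        N(4-9,15))
  have y1: "Dom E y1 = Dom E g3" using N'(8) by simp
  have "composite q p (t \<cdot> k) (s \<cdot> w1) (z \<cdot> y1) ((FB E r q \<cdot> mf) \<cdot> k) ((HA E r q \<cdot> FC E ?rq p) \<cdot> w1) g2 (FB E ?rq p \<cdot> w1) (HA E ?rq p \<cdot> y1) g3"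
    by (rule composite_restrict[OF p q c2 ab])
      (simp_all add: k(1,3) kd w1 y1 N'(4,6,7,9,15) T2(3-17) T1(3-17) n(1-3) nk A(1-15) m(3,4,6-8) B(1-6,11-15))
  then have "composite q p (t \<cdot> k) (s \<cdot> w1) (z \<cdot> y1) d2 c2 g2 d3 c3 g3"
    by (simp add: A(1-15) m(3,4,6-8) k(1,3,5) kd N(13,14) B(1-6,9-15) cF w1 N'(4,6,7,9,11,13,14) y1)
  note u0 = composite_unique[OF p q 2 this c0]
  have "composite r ?qp (car1 ?\<alpha> \<cdot> x1) (u \<cdot> k) (car0 ?\<alpha> \<cdot> y1) ((GD E r q \<cdot> GD E ?rq p) \<cdot> x1) ((FC E r q \<cdot> mf) \<cdot> k) g1 (t \<cdot> k) (z \<cdot> y1) (g2 \<cdot> g3)"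
  proof (rule composite_restrict[OF qp r composable_right[OF p q r c1 c2 ab] cd])
    show "mg \<cdot> k = x1 \<cdot> g1" by (rule k(4))
    show "(n \<cdot> HF E ?rq p) \<cdot> y1 = k \<cdot> g2 \<cdot> g3"
      using comp_left_eq[OF nk, of g3]
      by (simp add: n(1-3) B(1-6,11-15) N'(4,6,7,9,15) y1 w1 k(1,3) kd T1(3-17) T2(3-17))
  qed (simp_all add: N'(1,3,4,6,7,9) x1 y1 k(1,3) kd T1(3-17) T2(3-17) A(1-15) B(1-6,11-15) m(3,4,6-8) n(1-3) cG AB(1-3))
  then have "composite r ?qp (car1 ?\<alpha> \<cdot> x1) (u \<cdot> k) (car0 ?\<alpha> \<cdot> y1) d1 c1 g1 x0 y0 (g2 \<cdot> g3)"
    by (simp add: A(1-15) B(1-6,11-15) cG N'(1,3,10) x1 N(10,11) m(3,4,6-8) k(1,3,5) kd u0)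
  then show ?thesis by blast
qed

text \<open>A composable pair whose first member is itself a composite extends the pair below it to a triple.\<close>

lemma composable_inner:
  assumes p: "is_poly E W X p" and q: "is_poly E X Y q" and r: "is_poly E Y Z r"
    and 1: "composable r q d1 c1 g1 d2 c2 g2" and c: "composite r q x w y d1 c1 g1 d2 c2 g2"
    and 2: "composable (comp_poly E r q) p x y \<gamma> d3 c3 g3"
  shows "composable q p d2 c2 g2 d3 c3 g3"
proof -
  have rq: "is_poly E X Z (comp_poly E r q)" by (rule comp_poly_poly[OF q r])
  note C = composableD[OF 2 p rq]
  note D = composableD[OF 1 q r] and N = compositeD[OF c] and A = comp_arrows[OF q r] and Q = is_polyD[OF q]
  have cy: "Dom E \<gamma> = Dom E g2" using C(12) N(8) by simp
  show ?thesis
    unfolding composable_def using D(2) C(2) C(18,16,12) N(14) cy N(7,9) A Q by (simp add: D)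
qed

lemma composite_decompose3:
  assumes p: "is_poly E W X p" and q: "is_poly E X Y q" and r: "is_poly E Y Z r"
    and pb: "is_pullback E (pol2 (comp_poly E (comp_poly E r q) p)) x1 y1 \<gamma>"
  obtains d1 c1 g1 d2 c2 g2 d3 c3 g3 x w y w1 where
    "composable r q d1 c1 g1 d2 c2 g2" "composable q p d2 c2 g2 d3 c3 g3"
    "composite r q x w y d1 c1 g1 d2 c2 g2" "composite (comp_poly E r q) p x1 w1 y1 x y (g1 \<cdot> g2) d3 c3 g3"
    "(g1 \<cdot> g2) \<cdot> g3 = \<gamma>"
proof -
  have rq: "is_poly E X Z (comp_poly E r q)" by (rule comp_poly_poly[OF q r])
  obtain x y g d3 c3 g3 w1 where 1: "composable (comp_poly E r q) p x y g d3 c3 g3"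
    "composite (comp_poly E r q) p x1 w1 y1 x y g d3 c3 g3" "g \<cdot> g3 = \<gamma>"
    using composite_decompose[OF p rq pb] by blast
  note C = composableD[OF 1(1) p rq]
  obtain d1 c1 g1 d2 c2 g2 w where 2: "composable r q d1 c1 g1 d2 c2 g2" "composite r q x w y d1 c1 g1 d2 c2 g2" "g1 \<cdot> g2 = g"
    using composite_decompose[OF q r C(1)] by blast
  show ?thesis using that 1 2 composable_inner[OF p q r 2(1,2) 1(1)] by blast
qed

lemma cart_eqI: "\<lbrakk>csrc f = csrc g; ctrg f = ctrg g; car0 f = car0 g; car1 f = car1 g\<rbrakk> \<Longrightarrow> f = (g :: 'a cart)"
  by simp

text \<open>The identity of a polynomial, regarded as a fibre of it. Decomposing this fibre of a composite
  reduces equations between 2-cells to equations between composable data.\<close>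

lemma pullback_idns: "is_poly E X Y p \<Longrightarrow> is_pullback E (pol2 p) (Idn E (Dom E (pol3 p))) (Idn E (Dom E (pol2 p))) (pol2 p)"
  using is_polyD[of X Y p] pullback_idn_right[of "pol2 p"] by simp

text \<open>Both sides send a composable triple to its image under \<open>\<theta>\<close>, \<open>\<gamma>\<close> and \<open>\<phi>\<close>, bracketed to the right.\<close>

lemma assoc_natural:
  assumes ph: "is_cart E W X \<phi>" and ga: "is_cart E X Y \<gamma>" and th: "is_cart E Y Z \<theta>"
  shows "assoc_cart E (ctrg \<theta>) (ctrg \<gamma>) (ctrg \<phi>) \<cdot>\<^bsub>poly_hom E W Z\<^esub> hcomp_cart E (hcomp_cart E \<theta> \<gamma>) \<phi>
      = hcomp_cart E \<theta> (hcomp_cart E \<gamma> \<phi>) \<cdot>\<^bsub>poly_hom E W Z\<^esub> assoc_cart E (csrc \<theta>) (csrc \<gamma>) (csrc \<phi>)"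
proof -
  note p = is_cartD(1)[OF ph] and q = is_cartD(1)[OF ga] and r = is_cartD(1)[OF th]
  note p' = is_cartD(2)[OF ph] and q' = is_cartD(2)[OF ga] and r' = is_cartD(2)[OF th]
  let ?p = "csrc \<phi>" and ?q = "csrc \<gamma>" and ?r = "csrc \<theta>" and ?p' = "ctrg \<phi>" and ?q' = "ctrg \<gamma>" and ?r' = "ctrg \<theta>"
  have rq: "is_poly E X Z (comp_poly E ?r ?q)" by (rule comp_poly_poly[OF q r])
  let ?S = "comp_poly E (comp_poly E ?r ?q) ?p"
  have S: "is_poly E W Z ?S" by (rule comp_poly_poly[OF p rq])
  let ?x = "Idn E (Dom E (pol3 ?S))" and ?y = "Idn E (Dom E (pol2 ?S))"
  obtain d1 c1 g1 d2 c2 g2 d3 c3 g3 x w y w1 where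
    1: "composable ?r ?q d1 c1 g1 d2 c2 g2" and 2: "composable ?q ?p d2 c2 g2 d3 c3 g3"
    and c: "composite ?r ?q x w y d1 c1 g1 d2 c2 g2"
    and c': "composite (comp_poly E ?r ?q) ?p ?x w1 ?y x y (g1 \<cdot> g2) d3 c3 g3"
    using composite_decompose3[OF p q r pullback_idns[OF S]] by metis
  obtain x0 w0 y0 where c0: "composite ?q ?p x0 w0 y0 d2 c2 g2 d3 c3 g3" using composite_ex[OF p q 2] by blast
  note tg = hcomp_cart_cart[OF ga th] and gp = hcomp_cart_cart[OF ph ga]
  note h = hcomp_cart_composite(1,2)
  let ?TG = "hcomp_cart E \<theta> \<gamma>" and ?GP = "hcomp_cart E \<gamma> \<phi>"
  obtain v1 where l1: "composite ?r' ?q' (car1 ?TG \<cdot> x) v1 (car0 ?TG \<cdot> y) (car1 \<theta> \<cdot> d1) (car0 \<theta> \<cdot> c1) g1 (car1 \<gamma> \<cdot> d2) (car0 \<gamma> \<cdot> c2) g2"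
    using hcomp_composite[OF ga th 1 c] by blast
  obtain v2 where l2: "composite (comp_poly E ?r' ?q') ?p' (car1 (hcomp_cart E ?TG \<phi>) \<cdot> ?x) v2 (car0 (hcomp_cart E ?TG \<phi>) \<cdot> ?y)
      (car1 ?TG \<cdot> x) (car0 ?TG \<cdot> y) (g1 \<cdot> g2) (car1 \<phi> \<cdot> d3) (car0 \<phi> \<cdot> c3) g3"
    using hcomp_composite[OF ph tg, unfolded h[OF ga th], OF composable_left[OF p q r 1 2 c] c'] by blast
  obtain v3 where l3: "composite ?q' ?p' (car1 ?GP \<cdot> x0) v3 (car0 ?GP \<cdot> y0) (car1 \<gamma> \<cdot> d2) (car0 \<gamma> \<cdot> c2) g2 (car1 \<phi> \<cdot> d3) (car0 \<phi> \<cdot> c3) g3"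
    using hcomp_composite[OF ph ga 2 c0] by blast
  note k1 = composable_cart[OF ga th 1] and k2 = composable_cart[OF ph ga 2]
  obtain v4 where L: "composite ?r' (comp_poly E ?q' ?p')
      (car1 (assoc_cart E ?r' ?q' ?p') \<cdot> car1 (hcomp_cart E ?TG \<phi>) \<cdot> ?x) v4 (car0 (assoc_cart E ?r' ?q' ?p') \<cdot> car0 (hcomp_cart E ?TG \<phi>) \<cdot> ?y)
      (car1 \<theta> \<cdot> d1) (car0 \<theta> \<cdot> c1) g1 (car1 ?GP \<cdot> x0) (car0 ?GP \<cdot> y0) (g2 \<cdot> g3)"
    using assoc_composite[OF p' q' r' k1 k2 l1 l2 l3] by blast
  obtain v5 where r1: "composite ?r (comp_poly E ?q ?p) (car1 (assoc_cart E ?r ?q ?p) \<cdot> ?x) v5 (car0 (assoc_cart E ?r ?q ?p) \<cdot> ?y)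
      d1 c1 g1 x0 y0 (g2 \<cdot> g3)"
    using assoc_composite[OF p q r 1 2 c c' c0] by blast
  obtain v6 where R: "composite ?r' (comp_poly E ?q' ?p')
      (car1 (hcomp_cart E \<theta> ?GP) \<cdot> car1 (assoc_cart E ?r ?q ?p) \<cdot> ?x) v6 (car0 (hcomp_cart E \<theta> ?GP) \<cdot> car0 (assoc_cart E ?r ?q ?p) \<cdot> ?y)
      (car1 \<theta> \<cdot> d1) (car0 \<theta> \<cdot> c1) g1 (car1 ?GP \<cdot> x0) (car0 ?GP \<cdot> y0) (g2 \<cdot> g3)"
    using hcomp_composite[OF gp th, unfolded h[OF ph ga], OF composable_right[OF p q r 1 2 c0] r1] by blast
  note U = composite_unique[OF comp_poly_poly[OF p' q'] r' composable_right[OF p' q' r' k1 k2 l3] L R]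
  note a = is_cartD[OF assoc_cart_cart[OF p q r], unfolded assoc_cart_composite(1,2)[OF p q r]]
  note b = is_cartD[OF hcomp_cart_cart[OF ph tg], unfolded h[OF ph tg] h[OF ga th]]
  show ?thesis
  proof (rule cart_eqI)
    show "car0 (assoc_cart E ?r' ?q' ?p' \<cdot>\<^bsub>poly_hom E W Z\<^esub> hcomp_cart E ?TG \<phi>)
        = car0 (hcomp_cart E \<theta> ?GP \<cdot>\<^bsub>poly_hom E W Z\<^esub> assoc_cart E ?r ?q ?p)"
      using U(3) comp_idn[OF a(3,4)] comp_idn[OF b(3,4)] by simp
    show "car1 (assoc_cart E ?r' ?q' ?p' \<cdot>\<^bsub>poly_hom E W Z\<^esub> hcomp_cart E ?TG \<phi>)
        = car1 (hcomp_cart E \<theta> ?GP \<cdot>\<^bsub>poly_hom E W Z\<^esub> assoc_cart E ?r ?q ?p)"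
      using U(1) comp_idn[OF a(6,7)] comp_idn[OF b(6,7)] by simp
  qed (simp_all add: h[OF ph tg] h[OF ga th] h[OF gp th] h[OF ph ga] assoc_cart_composite(1,2)[OF p q r] assoc_cart_composite(1,2)[OF p' q' r'])
qed

lemma hcomp_composite_left:
  assumes f: "is_cart E X Y f" and q: "is_poly E Y Z q" and D: "composable q (csrc f) d c \<gamma> b a e"
    and c: "composite q (csrc f) x w y d c \<gamma> b a e"
  shows "\<exists>w'. composite q (ctrg f) (car1 (hcomp_cart E (idc q) f) \<cdot> x) w' (car0 (hcomp_cart E (idc q) f) \<cdot> y)
    d c \<gamma> (car1 f \<cdot> b) (car0 f \<cdot> a) e"
  using hcomp_composite[OF f id_cart[OF q], of d c \<gamma> b a e x w y] D c composableD[OF D is_cartD(1)[OF f] q] is_polyD[OF q]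
  by simp

lemma hcomp_composite_right:
  assumes p: "is_poly E X Y p" and g: "is_cart E Y Z g" and D: "composable (csrc g) p d c \<gamma> b a e"
    and c: "composite (csrc g) p x w y d c \<gamma> b a e"
  shows "\<exists>w'. composite (ctrg g) p (car1 (hcomp_cart E g (idc p)) \<cdot> x) w' (car0 (hcomp_cart E g (idc p)) \<cdot> y)
    (car1 g \<cdot> d) (car0 g \<cdot> c) \<gamma> b a e"
  using hcomp_composite[OF id_cart[OF p] g, of d c \<gamma> b a e x w y] D c composableD[OF D p is_cartD(1)[OF g]] is_polyD[OF p]
  by simp

lemma generic_composite:
  assumes p: "is_poly E X Y p" and q: "is_poly E Y Z q"
  shows "composite q p (Idn E (Dom E (GD E q p))) (Idn E (Dom E (FG E q p))) (Idn E (Dom E (HF E q p)))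
    (GD E q p) (FC E q p) (FG E q p) (FB E q p) (HA E q p) (HF E q p)"
  unfolding composite_def using comp_arrows[OF p q] by simp

lemma hcomp_idn:
  assumes p: "is_poly E X Y p" and q: "is_poly E Y Z q"
  shows "hcomp_cart E (idc q) (idc p) = idc (comp_poly E q p)"
proof -
  note A = comp_arrows[OF p q] and P = is_polyD[OF p] and Q = is_polyD[OF q]
  note h = hcomp_cart_composite[OF id_cart[OF p] id_cart[OF q], simplified]
  note D = generic_composable[OF p q]
  obtain w where w: "composite q p (car1 (hcomp_cart E (idc q) (idc p))) w (car0 (hcomp_cart E (idc q) (idc p)))
    (GD E q p) (FC E q p) (FG E q p) (FB E q p) (HA E q p) (HF E q p)"
    using h(3) by (auto simp: A(1-15) P Q)
  note U = composite_unique[OF p q D w generic_composite[OF p q]]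
  show ?thesis by (rule cart_eqI) (simp_all add: h(1,2) U A)
qed

lemma hcomp_comp:
  assumes f: "is_cart E X Y f" and f': "is_cart E X Y f'" and g: "is_cart E Y Z g" and g': "is_cart E Y Z g'"
    and m: "ctrg f = csrc f'" "ctrg g = csrc g'"
  shows "hcomp_cart E (g' \<cdot>\<^bsub>poly_hom E Y Z\<^esub> g) (f' \<cdot>\<^bsub>poly_hom E X Y\<^esub> f)
    = hcomp_cart E g' f' \<cdot>\<^bsub>poly_hom E X Z\<^esub> hcomp_cart E g f"
proof -
  let ?g = "g' \<cdot>\<^bsub>poly_hom E Y Z\<^esub> g" and ?f = "f' \<cdot>\<^bsub>poly_hom E X Y\<^esub> f"
  have ff: "is_cart E X Y ?f" and gg: "is_cart E Y Z ?g"
    using comp_cart[OF f f' m(1)] comp_cart[OF g g' m(2)] by simp_all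
  note F = is_cartD[OF f] and F' = is_cartD[OF f'] and G = is_cartD[OF g] and G' = is_cartD[OF g']
  note A = comp_arrows[OF F(1) G(1)] and P = is_polyD[OF F(1)] and Q = is_polyD[OF G(1)]
    and P' = is_polyD[OF F'(1)] and Q' = is_polyD[OF G'(1)]
  note h = hcomp_cart_composite
  note D = generic_composable[OF F(1) G(1)]
  note D1 = composable_cart[OF f g D]
  obtain w where w: "composite (ctrg g) (ctrg f) (car1 (hcomp_cart E g f)) w (car0 (hcomp_cart E g f))
      (car1 g \<cdot> GD E (csrc g) (csrc f)) (car0 g \<cdot> FC E (csrc g) (csrc f)) (FG E (csrc g) (csrc f))
      (car1 f \<cdot> FB E (csrc g) (csrc f)) (car0 f \<cdot> HA E (csrc g) (csrc f)) (HF E (csrc g) (csrc f))"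
    using h(3)[OF f g] by blast
  obtain w' where w': "composite (ctrg g') (ctrg f') (car1 (hcomp_cart E g' f') \<cdot> car1 (hcomp_cart E g f)) w'
      (car0 (hcomp_cart E g' f') \<cdot> car0 (hcomp_cart E g f))
      (car1 g' \<cdot> car1 g \<cdot> GD E (csrc g) (csrc f)) (car0 g' \<cdot> car0 g \<cdot> FC E (csrc g) (csrc f)) (FG E (csrc g) (csrc f))
      (car1 f' \<cdot> car1 f \<cdot> FB E (csrc g) (csrc f)) (car0 f' \<cdot> car0 f \<cdot> HA E (csrc g) (csrc f)) (HF E (csrc g) (csrc f))"
    using hcomp_composite[OF f' g', folded m, OF D1 w] by blast
  obtain v where v: "composite (ctrg g') (ctrg f') (car1 (hcomp_cart E ?g ?f)) v (car0 (hcomp_cart E ?g ?f))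
      (car1 g' \<cdot> car1 g \<cdot> GD E (csrc g) (csrc f)) (car0 g' \<cdot> car0 g \<cdot> FC E (csrc g) (csrc f)) (FG E (csrc g) (csrc f))
      (car1 f' \<cdot> car1 f \<cdot> FB E (csrc g) (csrc f)) (car0 f' \<cdot> car0 f \<cdot> HA E (csrc g) (csrc f)) (HF E (csrc g) (csrc f))"
    using h(3)[OF ff gg] by (auto simp: F(3-8) F'(3-8) G(3-8) G'(3-8) A(1-15) P Q P' Q' m)
  note U = composite_unique[OF F'(2) G'(2) composable_cart[OF f' g' D1[unfolded m]] v[unfolded m] w'[unfolded m]]
  show ?thesis
    by (rule cart_eqI) (use h(1,2)[OF ff gg] U in \<open>simp_all add: h(1,2)[OF f g] h(1,2)[OF f' g']\<close>)
qed

lemma id_poly_simps [simp]: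
  "pol1 (id_poly E X) = Idn E X" "pol2 (id_poly E X) = Idn E X" "pol3 (id_poly E X) = Idn E X"
  by (simp_all add: id_poly_def)

lemma lunit_data:
  assumes p: "is_poly E X Y p" and Y: "Y \<in> Obj E"
  shows "is_iso E (FG E (id_poly E Y) p)" "is_cart E X Y (lunit_cart E Y p)"
    "csrc (lunit_cart E Y p) = comp_poly E (id_poly E Y) p" "ctrg (lunit_cart E Y p) = p"
    "car1 (lunit_cart E Y p) \<cdot> FG E (id_poly E Y) p = FB E (id_poly E Y) p"
    "car0 (lunit_cart E Y p) = HA E (id_poly E Y) p"
proof -
  let ?q = "id_poly E Y"
  note q = id_poly_poly[OF Y]
  note A = comp_arrows[OF p q] and P = is_polyD[OF p]
  show i: "is_iso E (FG E ?q p)" using pullback_iso_left[OF comp_square[OF p q]] Y by simp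
  note I = iso_inverse(1-5)[OF i]
  have h: "is_pullback E (HF E ?q p) (inverse_of E (FG E ?q p)) (Idn E (Dom E (HF E ?q p))) (FG E ?q p \<cdot> HF E ?q p)"
    by (rule pullback_of_isos[OF iso_inverse_iso[OF i]])
      (use comp_left_eq[OF I(4), of "HF E ?q p"] in \<open>simp_all add: I(1-3) A(1-15)\<close>)
  have pb: "is_pullback E (pol2 p) (FB E ?q p \<cdot> inverse_of E (FG E ?q p)) (HA E ?q p) (FG E ?q p \<cdot> HF E ?q p)"
    using pullback_paste[OF comp_fibre[OF p q] h] A(5,15) by simp
  have F: "FC E ?q p = GD E ?q p \<cdot> FG E ?q p" using A(17) A(2,8) Y by simp
  have e: "pol3 p \<cdot> FB E ?q p \<cdot> inverse_of E (FG E ?q p) = GD E ?q p"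
    using comp_left_eq[OF A(16), of "inverse_of E (FG E ?q p)"] A(1-15) I Y P by (simp add: F)
  show s: "csrc (lunit_cart E Y p) = comp_poly E ?q p" "ctrg (lunit_cart E Y p) = p"
    "car0 (lunit_cart E Y p) = HA E ?q p"
    by (simp_all add: lunit_cart_def)
  have c1: "car1 (lunit_cart E Y p) = FB E ?q p \<cdot> inverse_of E (FG E ?q p)" by (simp add: lunit_cart_def)
  have gd: "Cod E (GD E ?q p) = Y" using A(7) Y by simp
  show "is_cart E X Y (lunit_cart E Y p)"
    by (rule is_cartI) (use comp_poly_poly[OF p q] p pb e in \<open>simp_all add: s c1 A(1) gd\<close>)
  show "car1 (lunit_cart E Y p) \<cdot> FG E ?q p = FB E ?q p"
    by (simp add: c1 I A(1-15))
qed

text \<open>On composable data with an identity on the left, \<open>g\<close> is invertible and the left unitor forgets \<open>d\<close>; the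
  equation for \<open>b\<close> is stated without the inverse of \<open>g\<close>.\<close>

lemma lunit_composite:
  assumes p: "is_poly E X Y p" and Y: "Y \<in> Obj E"
    and c: "composite (id_poly E Y) p x w y d c g b a e"
  shows "car1 (lunit_cart E Y p) \<cdot> x \<cdot> g = b" "car0 (lunit_cart E Y p) \<cdot> y = a"
proof -
  note L = lunit_data[OF p Y] note l = is_cartD[OF L(2), unfolded L(3,4)]
  note A = comp_arrows[OF p id_poly_poly[OF Y]] and N = compositeD[OF c]
  have "car1 (lunit_cart E Y p) \<cdot> FG E (id_poly E Y) p \<cdot> w = b"
    using comp_left_eq[OF L(5), of w] N(13) by (simp add: l N(4-6) A(1-15) Y)
  then show "car1 (lunit_cart E Y p) \<cdot> x \<cdot> g = b" by (simp add: N(12))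
  show "car0 (lunit_cart E Y p) \<cdot> y = a" by (simp add: L(6) N(14))
qed

lemma lunit_natural:
  assumes f: "is_cart E X Y f" and Y: "Y \<in> Obj E"
  shows "lunit_cart E Y (ctrg f) \<cdot>\<^bsub>poly_hom E X Y\<^esub> hcomp_cart E (idc (id_poly E Y)) f
    = f \<cdot>\<^bsub>poly_hom E X Y\<^esub> lunit_cart E Y (csrc f)"
proof -
  note F = is_cartD[OF f] and q = id_poly_poly[OF Y]
  define K where "K = hcomp_cart E (idc (id_poly E Y)) f"
  note L = lunit_data[OF F(1) Y] and L' = lunit_data[OF F(2) Y]
  note D = generic_composable[OF F(1) q] and h = hcomp_cart_composite(1,2)[OF f id_cart[OF q], unfolded cart.select_convs, folded K_def]
  let ?p = "csrc f"
  note H = is_cartD[OF hcomp_cart_cart[OF f id_cart[OF q]], folded K_def, unfolded h]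
  note A = comp_arrows[OF F(1) q]
  note l = is_cartD[OF L(2), unfolded L(3,4)] and l' = is_cartD[OF L'(2), unfolded L'(3,4)]
  have FGc: "Cod E (FG E (id_poly E Y) ?p) = Dom E (pol3 (comp_poly E (id_poly E Y) ?p))"
    using A(1,7,11) Y by simp
  obtain w where w: "composite (id_poly E Y) (ctrg f) (car1 K \<cdot> Idn E (Dom E (GD E (id_poly E Y) ?p))) w
      (car0 K \<cdot> Idn E (Dom E (HF E (id_poly E Y) ?p))) (GD E (id_poly E Y) ?p) (FC E (id_poly E Y) ?p) (FG E (id_poly E Y) ?p)
      (car1 f \<cdot> FB E (id_poly E Y) ?p) (car0 f \<cdot> HA E (id_poly E Y) ?p) (HF E (id_poly E Y) ?p)"
    using hcomp_composite_left[OF f q D generic_composite[OF F(1) q], folded K_def] by blast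
  note U = lunit_composite[OF F(2) Y w]
  have i0: "car0 K \<cdot> Idn E (Dom E (HF E (id_poly E Y) ?p)) = car0 K"
    using comp_idn[OF H(3,4)] A(3,6,12) by simp
  have i1: "car1 K \<cdot> Idn E (Dom E (GD E (id_poly E Y) ?p)) = car1 K"
    using comp_idn[OF H(6,7)] A(1,7,11) Y by simp
  have "(car1 (lunit_cart E Y (ctrg f)) \<cdot> car1 K) \<cdot> FG E (id_poly E Y) ?p = (car1 f \<cdot> car1 (lunit_cart E Y ?p)) \<cdot> FG E (id_poly E Y) ?p"
    using U(1) unfolding i1 by (simp add: L(5) l(6-8) l'(6-8) H(6-8) F(6-8) FGc A(3))
  then have 1: "car1 (lunit_cart E Y (ctrg f)) \<cdot> car1 K = car1 f \<cdot> car1 (lunit_cart E Y ?p)"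
    by (rule iso_cancel_right[OF L(1), rotated -1]) (simp_all add: l(6-8) l'(6-8) H(6-8) F(6-8) FGc)
  show ?thesis
    unfolding K_def[symmetric]
  proof (rule cart_eqI)
    show "car0 (lunit_cart E Y (ctrg f) \<cdot>\<^bsub>poly_hom E X Y\<^esub> K) = car0 (f \<cdot>\<^bsub>poly_hom E X Y\<^esub> lunit_cart E Y ?p)"
      using U(2) unfolding i0 by (simp add: L(6))
    show "car1 (lunit_cart E Y (ctrg f) \<cdot>\<^bsub>poly_hom E X Y\<^esub> K) = car1 (f \<cdot>\<^bsub>poly_hom E X Y\<^esub> lunit_cart E Y ?p)"
      using 1 by simp
  qed (use h in \<open>simp_all add: L(3,4) L'(3,4)\<close>)
qed

lemma runit_data:
  assumes p: "is_poly E X Y p" and X: "X \<in> Obj E"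
  shows "is_cart E X Y (runit_cart E X p)"
    "csrc (runit_cart E X p) = comp_poly E p (id_poly E X)" "ctrg (runit_cart E X p) = p"
    "car1 (runit_cart E X p) = GD E p (id_poly E X)"
    "car0 (runit_cart E X p) = FC E p (id_poly E X) \<cdot> HF E p (id_poly E X)"
proof -
  let ?q = "id_poly E X"
  note q = id_poly_poly[OF X]
  note A = comp_arrows[OF q p] and P = is_polyD[OF p]
  have i: "is_iso E (HF E p ?q)" using pullback_iso_left[OF comp_fibre[OF q p]] X by simp
  have "is_pullback E (FG E p ?q) (Idn E (Dom E (GD E p ?q))) (HF E p ?q) (FG E p ?q \<cdot> HF E p ?q)"
    by (rule pullback_of_isos[OF _ i]) (simp_all add: A(1-15))
  from pullback_paste[OF comp_square[OF q p] this]
  have pb: "is_pullback E (pol2 p) (GD E p ?q) (FC E p ?q \<cdot> HF E p ?q) (FG E p ?q \<cdot> HF E p ?q)"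
    by (simp add: A)
  have e: "pol1 p \<cdot> FC E p ?q \<cdot> HF E p ?q = HA E p ?q"
    using comp_left_eq[OF A(16)[symmetric], of "HF E p ?q"] A(18) by (simp add: A(1-15) X P)
  show s: "csrc (runit_cart E X p) = comp_poly E p ?q" "ctrg (runit_cart E X p) = p"
    "car1 (runit_cart E X p) = GD E p ?q" "car0 (runit_cart E X p) = FC E p ?q \<cdot> HF E p ?q"
    by (simp_all add: runit_cart_def)
  have ha: "Cod E (HA E p ?q) = X" using A(10) X by simp
  show "is_cart E X Y (runit_cart E X p)"
    by (rule is_cartI) (use comp_poly_poly[OF q p] p pb e in \<open>simp_all add: s A(5) ha\<close>)
qed

text \<open>On composable data with an identity on the right, \<open>e\<close> is invertible and the right unitor forgets the
  second fibre.\<close>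

lemma runit_composite:
  assumes p: "is_poly E X Y p" and X: "X \<in> Obj E" and D: "composable p (id_poly E X) d c g b a e"
    and c: "composite p (id_poly E X) x w y d c g b a e"
  shows "car1 (runit_cart E X p) \<cdot> x = d" "car0 (runit_cart E X p) \<cdot> y = c \<cdot> e"
proof -
  note A = comp_arrows[OF id_poly_poly[OF X] p] and N = compositeD[OF c]
    and C = composableD[OF D id_poly_poly[OF X] p]
  show "car1 (runit_cart E X p) \<cdot> x = d" "car0 (runit_cart E X p) \<cdot> y = c \<cdot> e"
    using comp_left_eq[OF N(11), of e] by (simp_all add: runit_data[OF p X] N A(1-15) C(3-17))
qed

lemma runit_natural:
  assumes f: "is_cart E X Y f" and X: "X \<in> Obj E"
  shows "runit_cart E X (ctrg f) \<cdot>\<^bsub>poly_hom E X Y\<^esub> hcomp_cart E f (idc (id_poly E X))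
    = f \<cdot>\<^bsub>poly_hom E X Y\<^esub> runit_cart E X (csrc f)"
proof -
  note F = is_cartD[OF f] and q = id_poly_poly[OF X]
  note L = runit_data[OF F(1) X] and L' = runit_data[OF F(2) X]
  note D = generic_composable[OF q F(1)] and h = hcomp_cart_composite[OF id_cart[OF q] f, simplified]
  let ?H = "hcomp_cart E f (idc (id_poly E X))" and ?p = "csrc f" and ?i = "id_poly E X"
  note A = comp_arrows[OF q F(1)]
  obtain w where w: "composite (ctrg f) ?i (car1 ?H) w (car0 ?H) (car1 f \<cdot> GD E ?p ?i) (car0 f \<cdot> FC E ?p ?i) (FG E ?p ?i)
      (FB E ?p ?i) (HA E ?p ?i) (HF E ?p ?i)"
    using h(3) A(4,5,9,10) X by auto
  have "composable (ctrg f) ?i (car1 f \<cdot> GD E ?p ?i) (car0 f \<cdot> FC E ?p ?i) (FG E ?p ?i)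
      (FB E ?p ?i) (HA E ?p ?i) (HF E ?p ?i)"
    using composable_cart[OF id_cart[OF q] f, simplified, OF D] A(4,5,9,10) X by simp
  note U = runit_composite[OF F(2) X this w]
  show ?thesis
    by (rule cart_eqI)
      (use U in \<open>simp_all add: L(2-5) L'(2,3) h(1,2) A(1-15) F(3-8) is_polyD[OF F(1)]\<close>)
qed

text \<open>Both sides rebracket a composable quadruple from the left to the right.\<close>

lemma poly_pentagon:
  assumes f: "is_poly E V W f" and g: "is_poly E W X g" and h: "is_poly E X Y h" and k: "is_poly E Y Z k"
  shows "assoc_cart E k h (comp_poly E g f) \<cdot>\<^bsub>poly_hom E V Z\<^esub> assoc_cart E (comp_poly E k h) g f
    = hcomp_cart E (idc k) (assoc_cart E h g f) \<cdot>\<^bsub>poly_hom E V Z\<^esub> assoc_cart E k (comp_poly E h g) f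
        \<cdot>\<^bsub>poly_hom E V Z\<^esub> hcomp_cart E (assoc_cart E k h g) (idc f)"
proof -
  let ?gf = "comp_poly E g f" and ?hg = "comp_poly E h g" and ?kh = "comp_poly E k h"
  note gf = comp_poly_poly[OF f g] and hg = comp_poly_poly[OF g h] and kh = comp_poly_poly[OF h k]
  note khg = comp_poly_poly[OF g kh]
  note h_gf = comp_poly_poly[OF gf h]
  let ?S = "comp_poly E (comp_poly E ?kh g) f"
  have S: "is_poly E V Z ?S" by (rule comp_poly_poly[OF f khg])
  let ?x = "Idn E (Dom E (pol3 ?S))" and ?y = "Idn E (Dom E (pol2 ?S))"
  \<comment> \<open>The identity of the source, taken apart into a composable quadruple.\<close>
  obtain x3 y3 \<Gamma> d4 c4 g4 w4 where k4: "composable (comp_poly E ?kh g) f x3 y3 \<Gamma> d4 c4 g4"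
    and n4: "composite (comp_poly E ?kh g) f ?x w4 ?y x3 y3 \<Gamma> d4 c4 g4"
    using composite_decompose[OF f khg pullback_idns[OF S]] by metis
  obtain d1 c1 g1 d2 c2 g2 d3 c3 g3 x2 w y2 w1 where
    12: "composable k h d1 c1 g1 d2 c2 g2" and 23: "composable h g d2 c2 g2 d3 c3 g3"
    and n2: "composite k h x2 w y2 d1 c1 g1 d2 c2 g2"
    and n3: "composite ?kh g x3 w1 y3 x2 y2 (g1 \<cdot> g2) d3 c3 g3" and gam: "(g1 \<cdot> g2) \<cdot> g3 = \<Gamma>"
    using composite_decompose3[OF g h k composableD(1)[OF k4 f khg]] by metis
  note k123 = composable_left[OF g h k 12 23 n2]
  note 34 = composable_inner[OF f g kh k123 n3 k4]
  note C1 = composableD[OF 12 h k] and C2 = composableD[OF 23 g h] and C3 = composableD[OF 34 f g]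
  have gg: "g1 \<cdot> g2 \<cdot> g3 = \<Gamma>" using gam C1 C2 by simp
  obtain a34 w34 b34 where n34: "composite g f a34 w34 b34 d3 c3 g3 d4 c4 g4" using composite_ex[OF f g 34] by blast
  obtain a23 w23 b23 where n23: "composite h g a23 w23 b23 d2 c2 g2 d3 c3 g3" using composite_ex[OF g h 23] by blast
  note k2_34 = composable_right[OF f g h 23 34 n34]
  note k23_4 = composable_left[OF f g h 23 34 n23]
  note k1_23 = composable_right[OF g h k 12 23 n23]
  obtain a w' b where n2_34: "composite h ?gf a w' b d2 c2 g2 a34 b34 (g3 \<cdot> g4)" using composite_ex[OF gf h k2_34] by blast
  obtain a' w'' b' where n23_4: "composite ?hg f a' w'' b' a23 b23 (g2 \<cdot> g3) d4 c4 g4" using composite_ex[OF f hg k23_4] by blast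
  let ?A = "assoc_cart E k h ?gf" and ?B = "assoc_cart E ?kh g f"
  obtain v1 where l1: "composite ?kh ?gf (car1 ?B \<cdot> ?x) v1 (car0 ?B \<cdot> ?y) x2 y2 (g1 \<cdot> g2) a34 b34 (g3 \<cdot> g4)"
    using assoc_composite[OF f g kh k123 34 n3 n4[folded gam] n34] by blast
  obtain v2 where L: "composite k (comp_poly E h ?gf) (car1 ?A \<cdot> car1 ?B \<cdot> ?x) v2 (car0 ?A \<cdot> car0 ?B \<cdot> ?y) d1 c1 g1 a b (g2 \<cdot> g3 \<cdot> g4)"
    using assoc_composite[OF gf h k 12 k2_34 n2 l1 n2_34] by blast
  let ?C = "assoc_cart E k h g" and ?D = "assoc_cart E k ?hg f" and ?E = "assoc_cart E h g f"
  let ?H = "hcomp_cart E ?C (idc f)" and ?K = "hcomp_cart E (idc k) ?E"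
  note cC = assoc_cart_cart[OF g h k] and cE = assoc_cart_cart[OF f g h]
  note sC = assoc_cart_composite(1,2)[OF g h k] and sE = assoc_cart_composite(1,2)[OF f g h]
  obtain v3 where r1: "composite k ?hg (car1 ?C \<cdot> x3) v3 (car0 ?C \<cdot> y3) d1 c1 g1 a23 b23 (g2 \<cdot> g3)"
    using assoc_composite[OF g h k 12 23 n2 n3 n23] by blast
  obtain v4 where r2: "composite (comp_poly E k ?hg) f (car1 ?H \<cdot> ?x) v4 (car0 ?H \<cdot> ?y) (car1 ?C \<cdot> x3) (car0 ?C \<cdot> y3) (g1 \<cdot> g2 \<cdot> g3) d4 c4 g4"
    using hcomp_composite_right[OF f cC, unfolded sC, OF k4 n4] gg by auto
  obtain v5 where r3: "composite k (comp_poly E ?hg f) (car1 ?D \<cdot> car1 ?H \<cdot> ?x) v5 (car0 ?D \<cdot> car0 ?H \<cdot> ?y) d1 c1 g1 a' b' ((g2 \<cdot> g3) \<cdot> g4)"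
    using assoc_composite[OF f hg k k1_23 k23_4 r1 r2 n23_4] by blast
  obtain v6 where r4: "composite h ?gf (car1 ?E \<cdot> a') v6 (car0 ?E \<cdot> b') d2 c2 g2 a34 b34 (g3 \<cdot> g4)"
    using assoc_composite[OF f g h 23 34 n23 n23_4 n34] by blast
  note u = composite_unique[OF gf h k2_34 r4 n2_34]
  have g234: "(g2 \<cdot> g3) \<cdot> g4 = g2 \<cdot> g3 \<cdot> g4" using C2 C3 by simp
  obtain v7 where R: "composite k (comp_poly E h ?gf) (car1 ?K \<cdot> car1 ?D \<cdot> car1 ?H \<cdot> ?x) v7 (car0 ?K \<cdot> car0 ?D \<cdot> car0 ?H \<cdot> ?y) d1 c1 g1 a b (g2 \<cdot> g3 \<cdot> g4)"
    using hcomp_composite_left[OF cE k, unfolded sE, OF composable_right[OF f hg k k1_23 k23_4 n23_4] r3] u g234 by auto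
  note U = composite_unique[OF h_gf k composable_right[OF gf h k 12 k2_34 n2_34] L R]
  note hH = hcomp_cart_composite(1,2)[OF id_cart[OF f] cC, unfolded sC cart.select_convs]
    and hK = hcomp_cart_composite(1,2)[OF cE id_cart[OF k], unfolded sE cart.select_convs]
  note sB = assoc_cart_composite(1,2)[OF f g kh] and sA = assoc_cart_composite(1,2)[OF gf h k]
  note B = is_cartD[OF assoc_cart_cart[OF f g kh], unfolded sB] and H = is_cartD[OF hcomp_cart_cart[OF id_cart[OF f] cC], unfolded hH]
  show ?thesis
  proof (rule cart_eqI)
    show "car0 (?A \<cdot>\<^bsub>poly_hom E V Z\<^esub> ?B) = car0 (?K \<cdot>\<^bsub>poly_hom E V Z\<^esub> ?D \<cdot>\<^bsub>poly_hom E V Z\<^esub> ?H)"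
      using U(3) comp_idn[OF B(3,4)] comp_idn[OF H(3,4)] by simp
    show "car1 (?A \<cdot>\<^bsub>poly_hom E V Z\<^esub> ?B) = car1 (?K \<cdot>\<^bsub>poly_hom E V Z\<^esub> ?D \<cdot>\<^bsub>poly_hom E V Z\<^esub> ?H)"
      using U(1) comp_idn[OF B(6,7)] comp_idn[OF H(6,7)] by simp
  qed (simp_all add: sA sB hH hK sC sE)
qed

text \<open>Both sides remove the middle member from a composable triple over \<open>g\<close>, the identity and \<open>f\<close>.\<close>

lemma poly_triangle:
  assumes f: "is_poly E X Y f" and g: "is_poly E Y Z g" and Y: "Y \<in> Obj E"
  shows "hcomp_cart E (idc g) (lunit_cart E Y f) \<cdot>\<^bsub>poly_hom E X Z\<^esub> assoc_cart E g (id_poly E Y) f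
    = hcomp_cart E (runit_cart E Y g) (idc f)"
proof -
  let ?i = "id_poly E Y"
  note i = id_poly_poly[OF Y]
  note gi = comp_poly_poly[OF i g]
  let ?S = "comp_poly E (comp_poly E g ?i) f"
  have S: "is_poly E X Z ?S" by (rule comp_poly_poly[OF f gi])
  let ?x = "Idn E (Dom E (pol3 ?S))" and ?y = "Idn E (Dom E (pol2 ?S))"
  obtain d1 c1 g1 d2 c2 g2 d3 c3 g3 x w y w1 where
    12: "composable g ?i d1 c1 g1 d2 c2 g2" and 23: "composable ?i f d2 c2 g2 d3 c3 g3"
    and n2: "composite g ?i x w y d1 c1 g1 d2 c2 g2"
    and n3: "composite (comp_poly E g ?i) f ?x w1 ?y x y (g1 \<cdot> g2) d3 c3 g3"
    using composite_decompose3[OF f i g pullback_idns[OF S]] by metis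
  note C1 = composableD[OF 12 i g] and C2 = composableD[OF 23 f i]
  obtain a w' b where n23: "composite ?i f a w' b d2 c2 g2 d3 c3 g3" using composite_ex[OF f i 23] by blast
  note l = lunit_composite[OF f Y n23] and r = runit_composite[OF g Y 12 n2]
  let ?A = "assoc_cart E g ?i f" and ?L = "lunit_cart E Y f" and ?R = "runit_cart E Y g"
  let ?K = "hcomp_cart E (idc g) ?L" and ?H = "hcomp_cart E ?R (idc f)"
  note dL = lunit_data[OF f Y] and dR = runit_data[OF g Y]
  obtain v1 where 1: "composite g (comp_poly E ?i f) (car1 ?A \<cdot> ?x) v1 (car0 ?A \<cdot> ?y) d1 c1 g1 a b (g2 \<cdot> g3)"
    using assoc_composite[OF f i g 12 23 n2 n3 n23] by blast
  note k1 = composable_right[OF f i g 12 23 n23]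
  obtain v2 where 2: "composite g f (car1 ?K \<cdot> car1 ?A \<cdot> ?x) v2 (car0 ?K \<cdot> car0 ?A \<cdot> ?y) d1 c1 g1 (car1 ?L \<cdot> a) (car0 ?L \<cdot> b) (g2 \<cdot> g3)"
    using hcomp_composite_left[OF dL(2) g, unfolded dL(3,4), OF k1 1] by blast
  have k2: "composable g f d1 c1 g1 (car1 ?L \<cdot> a) (car0 ?L \<cdot> b) (g2 \<cdot> g3)"
    using composable_cart[OF dL(2) id_cart[OF g], unfolded dL(3,4) cart.select_convs, OF k1] C1 is_polyD[OF g] by simp
  note N2 = compositeD[OF 2]
  obtain v3 where 3: "composite g f (car1 ?H \<cdot> ?x) v3 (car0 ?H \<cdot> ?y) (car1 ?R \<cdot> x) (car0 ?R \<cdot> y) (g1 \<cdot> g2) d3 c3 g3"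
    using hcomp_composite_right[OF f dR(1), unfolded dR(2,3), OF composable_left[OF f i g 12 23 n2] n3] by blast
  have k3: "composable g f (car1 ?R \<cdot> x) (car0 ?R \<cdot> y) (g1 \<cdot> g2) d3 c3 g3"
    using composable_cart[OF id_cart[OF f] dR(1), unfolded dR(2,3) cart.select_convs, OF composable_left[OF f i g 12 23 n2]]
      C2 is_polyD[OF f] by simp
  \<comment> \<open>The two sides produce data that differ only in the intermediate stage, by the map \<open>g2\<close>.\<close>
  have dt: "Dom E (car0 ?K \<cdot> car0 ?A \<cdot> ?y) = Dom E g3" using N2(8) C2 by simp
  have bt: "c3 \<cdot> Idn E (Dom E g3) = c3" using C2 by simp
  have "composite g f ((car1 ?K \<cdot> car1 ?A \<cdot> ?x) \<cdot> Idn E (Dom E d1)) (v2 \<cdot> g2) ((car0 ?K \<cdot> car0 ?A \<cdot> ?y) \<cdot> Idn E (Dom E g3))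
     (d1 \<cdot> Idn E (Dom E d1)) (c1 \<cdot> g2) (g1 \<cdot> g2) ((car1 ?L \<cdot> a) \<cdot> g2) ((car0 ?L \<cdot> b) \<cdot> Idn E (Dom E g3)) g3"
    by (rule composite_restrict[OF f g k2 2]) (simp_all add: C1(3-17) C2(3-17))
  moreover have "(car1 ?L \<cdot> a) \<cdot> g2 = d3"
    using l(1) compositeD[OF n23] is_cartD[OF dL(2), unfolded dL(3,4)] comp_arrows[OF f i] C2(3-17) Y by simp
  moreover have "(car1 ?K \<cdot> car1 ?A \<cdot> ?x) \<cdot> Idn E (Dom E d1) = car1 ?K \<cdot> car1 ?A \<cdot> ?x"
    by (rule comp_idn[OF N2(1,2)])
  moreover have "(car0 ?K \<cdot> car0 ?A \<cdot> ?y) \<cdot> Idn E (Dom E g3) = car0 ?K \<cdot> car0 ?A \<cdot> ?y"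
    by (rule comp_idn[OF N2(7) dt])
  ultimately have 4: "composite g f (car1 ?K \<cdot> car1 ?A \<cdot> ?x) (v2 \<cdot> g2) (car0 ?K \<cdot> car0 ?A \<cdot> ?y) (car1 ?R \<cdot> x) (car0 ?R \<cdot> y) (g1 \<cdot> g2) d3 c3 g3"
    using C1(3) by (simp only: comp_idn[OF C1(3) refl] l(2) r bt)
  note U = composite_unique[OF f g k3 4 3]
  note sA = assoc_cart_composite(1,2)[OF f i g]
  note hH = hcomp_cart_composite(1,2)[OF id_cart[OF f] dR(1), unfolded dR(2,3) cart.select_convs]
    and hK = hcomp_cart_composite(1,2)[OF dL(2) id_cart[OF g], unfolded dL(3,4) cart.select_convs]
  note A = is_cartD[OF assoc_cart_cart[OF f i g], unfolded sA] and H = is_cartD[OF hcomp_cart_cart[OF id_cart[OF f] dR(1)], unfolded hH]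
  show ?thesis
  proof (rule cart_eqI)
    show "car0 (?K \<cdot>\<^bsub>poly_hom E X Z\<^esub> ?A) = car0 ?H"
      using U(3) comp_idn[OF A(3,4)] comp_idn[OF H(3,4)] by simp
    show "car1 (?K \<cdot>\<^bsub>poly_hom E X Z\<^esub> ?A) = car1 ?H"
      using U(1) comp_idn[OF A(6,7)] comp_idn[OF H(6,7)] by simp
  qed (simp_all add: sA hH hK)
qed

section \<open>The local functors\<close>

lemma element_eta [simp]: "El (elB D) (elA D) (elC D) (elS D) = D"
  by simp

text \<open>Restriction for an element \<open>D'\<close> that is already known to be one, in which case only the equations have
  to be checked.\<close>

lemma names_restrictI:
  assumes p: "is_poly E X Y p" and h: "h \<in> Arr E" "Cod E h = X" and w: "names p h w D"
    and D': "is_element (pol1 p) (pol2 p) h D'"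
    and t: "t \<in> Arr E" "Cod E t = Dom E (elB D)" "t' \<in> Arr E" "Cod E t' = Dom E (elA D)"
    and eq: "elB D' = elB D \<cdot> t" "elA D' = elA D \<cdot> t'" "elC D \<cdot> t' = t \<cdot> elC D'" "elS D' = elS D \<cdot> t'"
  shows "names p h (w \<cdot> t) D'"
proof -
  have D: "is_element (pol1 p) (pol2 p) h D" and c: "classifies (poly_element p h) w D" using w by (simp_all add: names_def)
  note d = is_elementD[OF D] and d' = is_elementD[OF D']
  have ty: "Dom E t = Dom E (elB D')" "Dom E t' = Dom E (elA D')" unfolding eq by (simp_all add: t d)
  have "classifies (poly_element p h) (w \<cdot> t) (El (elB D \<cdot> t) (elA D \<cdot> t') (elC D') (elS D \<cdot> t'))"
    by (rule classifies_restrict[OF generic_element[OF poly_element_generic[OF p h]] D c])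
      (simp_all add: t ty eq(3) d'(13,15,17))
  then show ?thesis unfolding names_def using D' by (simp add: eq[symmetric])
qed

text \<open>A converse of restriction, by which an arbitrary element is recognised as a restriction of the generic
  one. The fibres are pullbacks, so the map between them exists, and \<open>classified_unique\<close> compares the sections.\<close>

lemma names_compare:
  assumes p: "is_poly E X Y p" and h: "h \<in> Arr E" "Cod E h = X"
    and w: "names p h w D'" and wv: "names p h (w \<cdot> v) D" and v: "v \<in> Arr E" "Cod E v = Dom E (elB D')"
  shows "elB D' \<cdot> v = elB D"
    "\<exists>t. t \<in> Arr E \<and> Dom E t = Dom E (elA D) \<and> Cod E t = Dom E (elA D') \<and> elA D' \<cdot> t = elA D
      \<and> elC D' \<cdot> t = v \<cdot> elC D \<and> elS D' \<cdot> t = elS D"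
proof -
  let ?U = "poly_element p h"
  have D': "is_element (pol1 p) (pol2 p) h D'" and c': "classifies ?U w D'" using w by (simp_all add: names_def)
  have D: "is_element (pol1 p) (pol2 p) h D" and c: "classifies ?U (w \<cdot> v) D" using wv by (simp_all add: names_def)
  note d' = is_elementD[OF D'] and d = is_elementD[OF D]
  have U: "is_element (pol1 p) (pol2 p) h ?U" by (rule generic_element[OF poly_element_generic[OF p h]])
  note u = is_elementD[OF U] and C' = classifiesD[OF c'] and C = classifiesD[OF c]
  show b: "elB D' \<cdot> v = elB D"
    using comp_left_eq[OF C'(4), of v] C(4) by (simp add: v C'(1-3) u)
  have vd: "Dom E v = Dom E (elB D)" using C(2) by (simp add: v C'(1-3))
  have "\<exists>t. is_lift (elA D') (elC D') (elA D) (v \<cdot> elC D) t"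
    by (rule pullback_lift[OF d'(1)]) (simp_all add: d(10-18) d'(10-17) v vd comp_left_eq[OF b, of "elC D"])
  then obtain t where "is_lift (elA D') (elC D') (elA D) (v \<cdot> elC D) t" by blast
  note t = is_liftD[OF this]
  have "classifies ?U (w \<cdot> v) (El (elB D' \<cdot> v) (elA D' \<cdot> t) (elC D) (elS D' \<cdot> t))"
    by (rule classifies_restrict[OF U D' c']) (simp_all add: v t vd d)
  then have "elS D = elS D' \<cdot> t" using classified_unique[OF U D c] t(4) by simp
  then show "\<exists>t. t \<in> Arr E \<and> Dom E t = Dom E (elA D) \<and> Cod E t = Dom E (elA D') \<and> elA D' \<cdot> t = elA D
      \<and> elC D' \<cdot> t = v \<cdot> elC D \<and> elS D' \<cdot> t = elS D"
    using t by (intro exI[of _ t]) simp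
qed

lemma P1_arr_sarr:
  assumes p: "is_poly E X Y p" and u: "u \<in> Arr (slice E X)"
  shows "sarr (farr (P1 E X Y p) u) \<in> Arr E"
    "Dom E (sarr (farr (P1 E X Y p) u)) = Dom E (elB (poly_element p (sdom u)))"
    "Cod E (sarr (farr (P1 E X Y p) u)) = Dom E (elB (poly_element p (scod u)))"
  using P1_arr[OF p u] P1_obj_arr[OF p] u by (simp_all add: in_slice_arr)

lemma P1_names_self:
  assumes p: "is_poly E X Y p" and u: "u \<in> Arr (slice E X)"
  defines "U \<equiv> poly_element p (sdom u)"
  shows "names p (scod u) (sarr (farr (P1 E X Y p) u)) (El (elB U) (elA U) (elC U) (sarr u \<cdot> elS U))"
  using P1_arr_names[OF p u names_self[OF p]] u P1_arr_sarr[OF p u] by (simp add: U_def in_slice_arr)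

lemma P2_sarr:
  assumes f: "is_cart E X Y f" and h: "h \<in> Arr E" "Cod E h = X"
  shows "sarr (ncmp (P2 E X Y f) h) \<in> Arr E"
    "Dom E (sarr (ncmp (P2 E X Y f) h)) = Dom E (elB (poly_element (csrc f) h))"
    "Cod E (sarr (ncmp (P2 E X Y f) h)) = Dom E (elB (poly_element (ctrg f) h))"
  using P2_arr[OF f h] P1_obj_arr[OF is_cartD(1)[OF f] h] P1_obj_arr[OF is_cartD(2)[OF f] h]
  by (simp_all add: in_slice_arr)

lemma P2_names_self:
  assumes f: "is_cart E X Y f" and h: "h \<in> Arr E" "Cod E h = X"
  defines "U \<equiv> poly_element (csrc f) h"
  shows "names (ctrg f) h (sarr (ncmp (P2 E X Y f) h)) (El (car1 f \<cdot> elB U) (car0 f \<cdot> elA U) (elC U) (elS U))"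
  using P2_names[OF f h names_self[OF is_cartD(1)[OF f] h]] P2_sarr[OF f h] by (simp add: U_def)

lemma P2_simps [simp]: "ndom (P2 E X Y f) = P1 E X Y (csrc f)" "ncod (P2 E X Y f) = P1 E X Y (ctrg f)"
  by (simp_all add: P2_def Let_def)

text \<open>Naturality: both composites name \<open>(f1 b, f0 a, c, u s)\<close>.\<close>

lemma P2_ntrans:
  assumes f: "is_cart E X Y f" shows "is_ntrans (slice E X) (slice E Y) (P2 E X Y f)"
proof (rule is_ntransI)
  note F = is_cartD[OF f]
  fix u assume u: "u \<in> Arr (slice E X)"
  note u' = u[unfolded in_slice_arr]
  have h: "sdom u \<in> Arr E" "Cod E (sdom u) = X" and h': "scod u \<in> Arr E" "Cod E (scod u) = X" using u' by simp_all
  let ?U = "poly_element (csrc f) (sdom u)"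
  have 1: "names (ctrg f) (scod u) (sarr (ncmp (P2 E X Y f) (scod u)) \<cdot> sarr (farr (P1 E X Y (csrc f)) u))
    (El (car1 f \<cdot> elB ?U) (car0 f \<cdot> elA ?U) (elC ?U) (sarr u \<cdot> elS ?U))"
    using P2_names[OF f h' P1_names_self[OF F(1) u]] by simp
  have 2: "names (ctrg f) (scod u) (sarr (farr (P1 E X Y (ctrg f)) u) \<cdot> sarr (ncmp (P2 E X Y f) (sdom u)))
    (El (car1 f \<cdot> elB ?U) (car0 f \<cdot> elA ?U) (elC ?U) (sarr u \<cdot> elS ?U))"
    using P1_arr_names[OF F(2) u P2_names_self[OF f h]] by simp
  show "ncmp (P2 E X Y f) (Cod (slice E X) u) \<cdot>\<^bsub>slice E Y\<^esub> farr (ndom (P2 E X Y f)) u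
      = farr (ncod (P2 E X Y f)) u \<cdot>\<^bsub>slice E Y\<^esub> ncmp (P2 E X Y f) (Dom (slice E X) u)"
    using names_unique[OF F(2) h' 1 2]
    by (intro slice_arr_eqI) (simp_all add: P2_arr[OF f h] P2_arr[OF f h'] P1_arr[OF F(1) u] P1_arr[OF F(2) u])
qed (use P1_functor is_cartD[OF f] P2_arr[OF f] in \<open>simp_all, simp add: P2_def Let_def\<close>)

lemma P_local_functor: "functor_maps (poly_hom E X Y) (func_cat (slice E X) (slice E Y)) (P1 E X Y) (P2 E X Y)"
  unfolding functor_maps_def
proof (intro conjI allI ballI)
  fix p assume "p \<in> Obj (poly_hom E X Y)"
  then have p: "is_poly E X Y p" by simp
  show "P1 E X Y p \<in> Obj (func_cat (slice E X) (slice E Y))" using P1_functor[OF p] by simp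
  note P = is_polyD[OF p]
  have "P2 E X Y (idc p) = id_ntrans (slice E X) (slice E Y) (P1 E X Y p)"
  proof (rule ntrans_eqI[of "slice E X" "slice E Y"])
    fix h assume "h \<in> Obj (slice E X)"
    then have h: "h \<in> Arr E" "Cod E h = X" by simp_all
    note U = is_elementD[OF generic_element[OF poly_element_generic[OF p h]]]
    have "sarr (ncmp (P2 E X Y (idc p)) h) = Idn E (Dom E (elB (poly_element p h)))"
      using names_unique[OF p h _ names_self[OF p h]] P2_names_self[OF id_cart[OF p] h] by (simp add: U P)
    then show "ncmp (P2 E X Y (idc p)) h = ncmp (id_ntrans (slice E X) (slice E Y) (P1 E X Y p)) h"
      using h by (intro slice_arr_eqI) (simp_all add: P2_arr[OF id_cart[OF p] h] P1_obj_arr[OF p h])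
  qed (simp_all add: P2_ntrans[OF id_cart[OF p]] id_ntrans_ntrans slice_category P1_functor[OF p])
  then show "P2 E X Y (Idn (poly_hom E X Y) p) = Idn (func_cat (slice E X) (slice E Y)) (P1 E X Y p)" by simp
next
  fix p q f assume "f \<in> hom (poly_hom E X Y) p q"
  then show "P2 E X Y f \<in> hom (func_cat (slice E X) (slice E Y)) (P1 E X Y p) (P1 E X Y q)"
    by (auto simp: P2_ntrans)
next
  fix p q r f g assume "f \<in> hom (poly_hom E X Y) p q" "g \<in> hom (poly_hom E X Y) q r"
  then have f: "is_cart E X Y f" and g: "is_cart E X Y g" and m: "ctrg f = csrc g" by auto
  let ?gf = "g \<cdot>\<^bsub>poly_hom E X Y\<^esub> f"
  have gf: "is_cart E X Y ?gf" using comp_cart[OF f g m] by simp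
  note F = is_cartD[OF f] and G = is_cartD[OF g] and P = is_polyD[OF is_cartD(1)[OF f]]
  show "P2 E X Y ?gf = P2 E X Y g \<cdot>\<^bsub>func_cat (slice E X) (slice E Y)\<^esub> P2 E X Y f"
  proof (rule ntrans_eqI[of "slice E X" "slice E Y"])
    fix h assume "h \<in> Obj (slice E X)"
    then have h: "h \<in> Arr E" "Cod E h = X" by simp_all
    note U = is_elementD[OF generic_element[OF poly_element_generic[OF F(1) h]]]
    have 1: "names (ctrg g) h (sarr (ncmp (P2 E X Y g) h) \<cdot> sarr (ncmp (P2 E X Y f) h))
      (El (car1 g \<cdot> car1 f \<cdot> elB (poly_element (csrc f) h)) (car0 g \<cdot> car0 f \<cdot> elA (poly_element (csrc f) h))
        (elC (poly_element (csrc f) h)) (elS (poly_element (csrc f) h)))"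
      using P2_names[OF g h P2_names_self[OF f h, unfolded m]] by simp
    have 2: "names (ctrg g) h (sarr (ncmp (P2 E X Y ?gf) h))
      (El (car1 g \<cdot> car1 f \<cdot> elB (poly_element (csrc f) h)) (car0 g \<cdot> car0 f \<cdot> elA (poly_element (csrc f) h))
        (elC (poly_element (csrc f) h)) (elS (poly_element (csrc f) h)))"
      using P2_names_self[OF gf h] by (simp add: F(3-8) G(3-8) U P m is_polyD[OF G(1)])
    show "ncmp (P2 E X Y ?gf) h = ncmp (P2 E X Y g \<cdot>\<^bsub>func_cat (slice E X) (slice E Y)\<^esub> P2 E X Y f) h"
      using names_unique[OF G(2) h 2 1] h P2_arr(2,3)[OF gf h]
      by (intro slice_arr_eqI) (simp_all add: P2_arr[OF f h] P2_arr[OF g h])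
  qed (use P2_ntrans[OF gf] in \<open>simp_all add: vcomp_ntrans slice_category P2_ntrans[OF f] P2_ntrans[OF g] m\<close>)
qed

text \<open>At the terminal object of \<open>\<E>/X\<close> a section carries no information, so that elements are just maps to \<open>B\<close>.\<close>

lemma poly_element_terminal:
  assumes p: "is_poly E X Y p" and X: "X \<in> Obj E"
  shows "is_iso E (elB (poly_element p (Idn E X)))"
proof -
  let ?h = "Idn E X"
  have h: "?h \<in> Arr E" "Cod E ?h = X" using X by simp_all
  note P = is_polyD[OF p]
  let ?U = "poly_element p ?h"
  note U = poly_element_generic[OF p h] note u = is_elementD[OF generic_element[OF U]]
  let ?D = "El (Idn E (Dom E (pol3 p))) (Idn E (Dom E (pol2 p))) (pol2 p) (pol1 p)"
  have D: "is_element (pol1 p) (pol2 p) ?h ?D"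
    unfolding is_element_def using pullback_idns[OF p] by (simp add: P X)
  obtain w where w: "names p ?h w ?D" using names_ex[OF p h D] by blast
  have wc: "classifies ?U w ?D" using w by (simp add: names_def)
  note W = classifiesD[OF wc, simplified]
  have bB: "Cod E (elB ?U) = Dom E (pol3 p)" using u(14) P by simp
  have "elS ?U = pol1 p \<cdot> elA ?U" using u(9) u(6) u(8) X by simp
  then have "names p ?h (w \<cdot> elB ?U) ?U"
    by (intro names_restrictI[OF p h w generic_element[OF U], of _ "elA ?U"]) (simp_all add: u(10-18) bB P)
  then have 1: "w \<cdot> elB ?U = Idn E (Dom E (elB ?U))"
    using names_unique[OF p h _ names_self[OF p h]] by blast
  show ?thesis
    by (rule is_isoI[of _ w]) (use W P in \<open>simp_all add: u(10-17) bB 1\<close>)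
qed

text \<open>By the preceding lemma the component at the terminal object is \<open>f1\<close> up to isomorphism, and with \<open>f1\<close>
  its pullback \<open>f0\<close> is invertible too.\<close>

lemma P2_reflects_iso:
  assumes f: "is_cart E X Y f" and X: "X \<in> Obj E"
    and iso: "is_iso (func_cat (slice E X) (slice E Y)) (P2 E X Y f)"
  shows "is_iso (poly_hom E X Y) f"
proof -
  note F = is_cartD[OF f] note P = is_polyD[OF F(1)] and Q = is_polyD[OF F(2)]
  let ?h = "Idn E X"
  have h: "?h \<in> Arr E" "Cod E ?h = X" using X by simp_all
  have m: "is_iso E (sarr (ncmp (P2 E X Y f) ?h))"
    by (rule slice_isoD[OF iso_ntransD[OF slice_category slice_category iso]]) (simp add: X)
  let ?U = "poly_element (csrc f) ?h" and ?V = "poly_element (ctrg f) ?h"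
  note U = poly_element_terminal[OF F(1) X] and V = poly_element_terminal[OF F(2) X]
  note u = is_elementD[OF generic_element[OF poly_element_generic[OF F(1) h]]]
  have e: "elB ?V \<cdot> sarr (ncmp (P2 E X Y f) ?h) = car1 f \<cdot> elB ?U"
    using P2_names_self[OF f h] classifiesD(4) unfolding names_def by fastforce
  have "is_iso E (car1 f \<cdot> elB ?U)"
    unfolding e[symmetric] by (rule iso_comp[OF m V]) (simp add: P2_sarr[OF f h])
  then have i1: "is_iso E (car1 f)"
    by (rule iso_left_factor[OF _ U]) (simp_all add: F(3-8) u P)
  have i0: "is_iso E (car0 f)" by (rule pullback_iso_right[OF F(11) i1])
  note I1 = iso_inverse(1-5)[OF i1] and I0 = iso_inverse(1-5)[OF i0]
  let ?g = "\<lparr>csrc = ctrg f, ctrg = csrc f, car0 = inverse_of E (car0 f), car1 = inverse_of E (car1 f)\<rparr>"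
  have q: "car1 f \<cdot> pol2 (csrc f) \<cdot> inverse_of E (car0 f) = car1 f \<cdot> inverse_of E (car1 f) \<cdot> pol2 (ctrg f)"
    using comp_left_eq[OF is_pullbackD(9)[OF F(11), symmetric], of "inverse_of E (car0 f)"]
      comp_left_eq[OF I1(5), of "pol2 (ctrg f)"] by (simp add: I1 I0 F(3-8) P Q)
  have q': "pol2 (csrc f) \<cdot> inverse_of E (car0 f) = inverse_of E (car1 f) \<cdot> pol2 (ctrg f)"
    by (rule iso_cancel_left[OF i1 _ _ _ _ q]) (simp_all add: I1 I0 F(3-8) P Q)
  have g1: "pol1 (csrc f) \<cdot> inverse_of E (car0 f) = pol1 (ctrg f)"
    using comp_left_eq[OF F(9), of "inverse_of E (car0 f)"] by (simp add: I0 F(3-8) Q)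
  have g3: "pol3 (csrc f) \<cdot> inverse_of E (car1 f) = pol3 (ctrg f)"
    using comp_left_eq[OF F(10), of "inverse_of E (car1 f)"] by (simp add: I1 F(3-8) Q)
  have gp: "is_pullback E (pol2 (csrc f)) (inverse_of E (car1 f)) (inverse_of E (car0 f)) (pol2 (ctrg f))"
    by (rule pullback_of_isos[OF iso_inverse_iso[OF i1] iso_inverse_iso[OF i0] _ _ _ _ _ _ q'])
      (simp_all add: I1 I0 F(3-8) P Q)
  have g: "is_cart E X Y ?g"
    by (rule is_cartI) (simp_all add: F(1,2) g1 g3 gp)
  show ?thesis
    by (rule category.is_isoI[OF poly_hom_category, of f _ _ ?g]) (use f g in \<open>simp_all add: I1 I0 F(3-8) P Q\<close>)
qed

section \<open>The comparison cells\<close>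

text \<open>An element \<open>(d, c, g, s)\<close> of the functor of \<open>q\<close> at the value of the functor of \<open>p\<close>, with \<open>s\<close> itself naming
  \<open>(b, a, e, s')\<close>, is a composable pair with a section \<open>s'\<close>.\<close>

lemma names_composable:
  assumes p: "is_poly E X Y p" and q: "is_poly E Y Z q" and h: "h \<in> Arr E" "Cod E h = X"
    and 1: "names q (fobj (P1 E X Y p) h) u D1" and 2: "names p h (elS D1) D2"
  shows "composable q p (elB D1) (elA D1) (elC D1) (elB D2) (elA D2) (elC D2)"
proof -
  note P = is_polyD[OF p]
  have D1: "is_element (pol1 q) (pol2 q) (fobj (P1 E X Y p) h) D1" using 1 by (simp add: names_def)
  have D2: "is_element (pol1 p) (pol2 p) h D2" and c2: "classifies (poly_element p h) (elS D1) D2"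
    using 2 by (simp_all add: names_def)
  note d1 = is_elementD[OF D1] and d2 = is_elementD[OF D2] and c = classifiesD[OF c2]
  note u = is_elementD[OF generic_element[OF poly_element_generic[OF p h]]]
  have bB: "Cod E (elB (poly_element p h)) = Dom E (pol3 p)" using u(14) P by simp
  have "pol3 p \<cdot> elB D2 = (pol3 p \<cdot> elB (poly_element p h)) \<cdot> elS D1"
    unfolding c(4)[symmetric] using c(1,3) by (simp add: u(11) bB P)
  also have "\<dots> = pol1 q \<cdot> elA D1" using d1(9) by (simp add: P1_obj[OF p h])
  finally show ?thesis
    unfolding composable_def using d1(1,7) d2(1) c(2) by simp
qed

lemma names_composite_element:
  assumes p: "is_poly E X Y p" and q: "is_poly E Y Z q" and h: "h \<in> Arr E" "Cod E h = X"
    and 1: "names q (fobj (P1 E X Y p) h) u D1" and 2: "names p h (elS D1) D2"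
    and c: "composite q p x w y (elB D1) (elA D1) (elC D1) (elB D2) (elA D2) (elC D2)"
  shows "is_element (pol1 (comp_poly E q p)) (pol2 (comp_poly E q p)) h (El x y (elC D1 \<cdot> elC D2) (elS D2))"
proof -
  note C = names_composable[OF p q h 1 2]
  note K = composableD[OF C p q] and N = compositeD[OF c] and A = comp_arrows[OF p q] and P = is_polyD[OF p]
  have D2: "is_element (pol1 p) (pol2 p) h D2" using 2 by (simp add: names_def)
  note d2 = is_elementD[OF D2]
  have "h \<cdot> elS D2 = (pol1 p \<cdot> HA E q p) \<cdot> y" using d2(9) N(14) by (simp add: A N P)
  then show ?thesis
    unfolding is_element_def using composite_pullback[OF p q C c]
    by (simp add: d2(6-8) N(7-9) A(1-15) P h K(17))
qed

text \<open>The map is defined by what it does to the generic pair, and every other pair is a restriction of that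
  one, first over \<open>q\<close> and then over \<open>p\<close>.\<close>

lemma Phi_ex:
  assumes p: "is_poly E X Y p" and q: "is_poly E Y Z q" and h: "h \<in> Arr E" "Cod E h = X"
  defines "H \<equiv> fobj (P1 E X Y p) h"
  shows "\<exists>m. m \<in> Arr E \<and> Dom E m = Dom E (elB (poly_element q H)) \<and> Cod E m = Dom E (elB (poly_element (comp_poly E q p) h))
    \<and> (\<forall>u D1 D2 x w y. names q H u D1 \<longrightarrow> names p h (elS D1) D2
        \<longrightarrow> composite q p x w y (elB D1) (elA D1) (elC D1) (elB D2) (elA D2) (elC D2)
        \<longrightarrow> names (comp_poly E q p) h (m \<cdot> u) (El x y (elC D1 \<cdot> elC D2) (elS D2)))"
proof -
  have qp: "is_poly E X Z (comp_poly E q p)" by (rule comp_poly_poly[OF p q])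
  have H: "H \<in> Arr E" "Cod E H = Y" using P1_obj_arr[OF p h] by (simp_all add: H_def)
  let ?U = "poly_element q H"
  note n1 = names_self[OF q H]
  note U = is_elementD[OF generic_element[OF poly_element_generic[OF q H]]]
  have sU: "elS ?U \<in> Arr E" "Cod E (elS ?U) = Dom E (elB (poly_element p h))"
    using U(6,8) P1_obj_arr(3)[OF p h] by (simp_all add: H_def)
  obtain D where n2: "names p h (elS ?U) D" using ex_names[OF p h sU] by blast
  note C = names_composable[OF p q h n1[unfolded H_def] n2[unfolded H_def], folded H_def]
  obtain x w y where c: "composite q p x w y (elB ?U) (elA ?U) (elC ?U) (elB D) (elA D) (elC D)"
    using composite_ex[OF p q C] by blast
  have El: "is_element (pol1 (comp_poly E q p)) (pol2 (comp_poly E q p)) h (El x y (elC ?U \<cdot> elC D) (elS D))"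
    using names_composite_element[OF p q h n1[unfolded H_def] n2[unfolded H_def] c[unfolded H_def]] by (simp add: H_def)
  obtain m where m: "names (comp_poly E q p) h m (El x y (elC ?U \<cdot> elC D) (elS D))"
    using names_ex[OF qp h El] by blast
  note N = compositeD[OF c] and K = composableD[OF C p q]
  have "m \<in> Arr E" "Dom E m = Dom E (elB ?U)" "Cod E m = Dom E (elB (poly_element (comp_poly E q p) h))"
    using names_arr[OF m] N(2) by simp_all
  moreover have "names (comp_poly E q p) h (m \<cdot> u) (El x' y' (elC D1 \<cdot> elC D2) (elS D2))"
    if u: "names q H u D1" and s: "names p h (elS D1) D2"
      and c': "composite q p x' w' y' (elB D1) (elA D1) (elC D1) (elB D2) (elA D2) (elC D2)" for u D1 D2 x' w' y'
  proof -
    have D1: "is_element (pol1 q) (pol2 q) H D1" using u by (simp add: names_def)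
    have ua: "u \<in> Arr E" "Dom E u = Dom E (elB D1)" "Cod E u = Dom E (elB ?U)" using names_arr[OF u] by simp_all
    have u': "names q H (Idn E (Dom E (elB ?U)) \<cdot> u) D1" using u ua by simp
    note cmp = names_compare[OF q H n1 u' ua(1,3)]
    obtain t1 where t1: "t1 \<in> Arr E" "Dom E t1 = Dom E (elA D1)" "Cod E t1 = Dom E (elA ?U)"
      "elA ?U \<cdot> t1 = elA D1" "elC ?U \<cdot> t1 = u \<cdot> elC D1" "elS ?U \<cdot> t1 = elS D1" using cmp(2) by blast
    have bD: "Dom E (elB D) = Dom E (elA ?U)" using names_arr[OF n2] U(7) by simp
    have s': "names p h (elS ?U \<cdot> t1) D2" using s t1(6) by simp
    have ct: "Cod E t1 = Dom E (elB D)" using t1(3) bD by simp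
    note cmp2 = names_compare[OF p h n2 s' t1(1) ct]
    obtain t2 where t2: "t2 \<in> Arr E" "Dom E t2 = Dom E (elA D2)" "Cod E t2 = Dom E (elA D)"
      "elA D \<cdot> t2 = elA D2" "elC D \<cdot> t2 = t1 \<cdot> elC D2" "elS D \<cdot> t2 = elS D2" using cmp2(2) by blast
    note C' = names_composable[OF p q h u[unfolded H_def] s, folded H_def]
    note K' = composableD[OF C' p q]
    have "composite q p (x \<cdot> u) (w \<cdot> t1) (y \<cdot> t2) (elB ?U \<cdot> u) (elA ?U \<cdot> t1) (elC D1) (elB D \<cdot> t1) (elA D \<cdot> t2) (elC D2)"
      by (rule composite_restrict[OF p q C c]) (simp_all add: ua t1(1-3,5) t2(1-3,5) K(12,17) K'(3-17))
    then have "composite q p (x \<cdot> u) (w \<cdot> t1) (y \<cdot> t2) (elB D1) (elA D1) (elC D1) (elB D2) (elA D2) (elC D2)"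
      by (simp only: cmp(1) cmp2(1) t1(4) t2(4))
    note e = composite_unique[OF p q C' c' this]
    show ?thesis
    proof (rule names_restrictI[OF qp h m])
      show "is_element (pol1 (comp_poly E q p)) (pol2 (comp_poly E q p)) h (El x' y' (elC D1 \<cdot> elC D2) (elS D2))"
        using names_composite_element[OF p q h u[unfolded H_def] s c'] .
      show "elC (El x y (elC ?U \<cdot> elC D) (elS D)) \<cdot> t2 = u \<cdot> elC (El x' y' (elC D1 \<cdot> elC D2) (elS D2))"
        using comp_left_eq[OF t1(5), of "elC D2"] by (simp add: t2(1,3,5) t1(1-3) K(3-17) K'(3-17) ua)
    qed (simp_all add: ua N e t2 K(17))
  qed
  ultimately show ?thesis by blast
qed

text \<open>The map \<open>\<Pi>\<^bsub>q2\<^esub> \<Delta>\<^bsub>q1\<^esub> \<Sigma>\<^bsub>p3\<^esub> \<Pi>\<^bsub>p2\<^esub> \<Delta>\<^bsub>p1\<^esub> h \<rightarrow> \<Pi>\<^bsub>(q p)2\<^esub> \<Delta>\<^bsub>(q p)1\<^esub> h\<close> that turns a composable pair of elements into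
  one element. It is specified by this property, which determines it, rather than as a composite of
  canonical isomorphisms.\<close>

definition Phi_arr :: "'o \<Rightarrow> 'o \<Rightarrow> 'a poly \<Rightarrow> 'a poly \<Rightarrow> 'a \<Rightarrow> 'a" where
  "Phi_arr X Y q p h = (SOME m. m \<in> Arr E \<and> Dom E m = Dom E (elB (poly_element q (fobj (P1 E X Y p) h)))
    \<and> Cod E m = Dom E (elB (poly_element (comp_poly E q p) h))
    \<and> (\<forall>u D1 D2 x w y. names q (fobj (P1 E X Y p) h) u D1 \<longrightarrow> names p h (elS D1) D2
        \<longrightarrow> composite q p x w y (elB D1) (elA D1) (elC D1) (elB D2) (elA D2) (elC D2)
        \<longrightarrow> names (comp_poly E q p) h (m \<cdot> u) (El x y (elC D1 \<cdot> elC D2) (elS D2))))"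

lemma
  assumes p: "is_poly E X Y p" and q: "is_poly E Y Z q" and h: "h \<in> Arr E" "Cod E h = X"
  shows Phi_arr: "Phi_arr X Y q p h \<in> Arr E" "Dom E (Phi_arr X Y q p h) = Dom E (elB (poly_element q (fobj (P1 E X Y p) h)))"
      "Cod E (Phi_arr X Y q p h) = Dom E (elB (poly_element (comp_poly E q p) h))"
    and Phi_names: "\<lbrakk>names q (fobj (P1 E X Y p) h) u D1; names p h (elS D1) D2;
        composite q p x w y (elB D1) (elA D1) (elC D1) (elB D2) (elA D2) (elC D2)\<rbrakk>
      \<Longrightarrow> names (comp_poly E q p) h (Phi_arr X Y q p h \<cdot> u) (El x y (elC D1 \<cdot> elC D2) (elS D2))"
  using someI_ex[OF Phi_ex[OF p q h]] unfolding Phi_arr_def[symmetric] by blast+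

lemma ex_names_composite:
  assumes p: "is_poly E X Y p" and q: "is_poly E Y Z q" and h: "h \<in> Arr E" "Cod E h = X"
    and u: "names q (fobj (P1 E X Y p) h) u D1"
  obtains D2 x w y where "names p h (elS D1) D2"
    "composite q p x w y (elB D1) (elA D1) (elC D1) (elB D2) (elA D2) (elC D2)"
proof -
  have D1: "is_element (pol1 q) (pol2 q) (fobj (P1 E X Y p) h) D1" using u by (simp add: names_def)
  note d = is_elementD[OF D1]
  have "elS D1 \<in> Arr E" "Cod E (elS D1) = Dom E (elB (poly_element p h))"
    using d(6,8) P1_obj_arr(3)[OF p h] by simp_all
  then obtain D2 where D2: "names p h (elS D1) D2" using ex_names[OF p h] by blast
  show ?thesis using that D2 composite_ex[OF p q names_composable[OF p q h u D2]] by blast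
qed

text \<open>The inverse takes the generic element of the composite functor apart into a composable pair.\<close>

lemma Phi_iso:
  assumes p: "is_poly E X Y p" and q: "is_poly E Y Z q" and h: "h \<in> Arr E" "Cod E h = X"
  shows "is_iso E (Phi_arr X Y q p h)"
proof -
  define H where "H = fobj (P1 E X Y p) h"
  have H: "H \<in> Arr E" "Cod E H = Y" "Dom E H = Dom E (elB (poly_element p h))"
    using P1_obj_arr[OF p h] by (simp_all add: H_def)
  let ?qp = "comp_poly E q p"
  have qp: "is_poly E X Z ?qp" by (rule comp_poly_poly[OF p q])
  let ?F = "Phi_arr X Y q p h"
  let ?U = "poly_element ?qp h" and ?V = "poly_element q H"
  note P = is_polyD[OF p] and Q = is_polyD[OF q] and A = comp_arrows[OF p q]
  have Ue: "is_element (pol1 ?qp) (pol2 ?qp) h ?U" by (rule generic_element[OF poly_element_generic[OF qp h]])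
  note U = is_elementD[OF Ue]
  note ph = Phi_arr[OF p q h, folded H_def]
  \<comment> \<open>The generic element of the composite functor is read as a composable pair.\<close>
  obtain d c g b a e w where C: "composable q p d c g b a e" and N: "composite q p (elB ?U) w (elA ?U) d c g b a e"
    and ge: "g \<cdot> e = elC ?U" using composite_decompose[OF p q U(1)] by blast
  note K = composableD[OF C p q] and n = compositeD[OF N]
  have "h \<cdot> elS ?U = pol1 p \<cdot> a" using U(9) by (simp add: A P n)
  then have E2: "is_element (pol1 p) (pol2 p) h (El b a e (elS ?U))"
    unfolding is_element_def using K(2) U(6-8) n(8) K(17) h by (simp add: P)
  obtain s where s: "names p h s (El b a e (elS ?U))" using names_ex[OF p h E2] by blast
  note sA = names_arr[OF s, simplified]
  have bs: "elB (poly_element p h) \<cdot> s = b" using s classifiesD(4)[of _ s] unfolding names_def by fastforce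
  have bB: "elB (poly_element p h) \<in> Arr E" "Cod E (elB (poly_element p h)) = Dom E (pol3 p)"
    using is_elementD(11,14)[OF generic_element[OF poly_element_generic[OF p h]]] P by simp_all
  have "H \<cdot> s = pol1 q \<cdot> c" unfolding H_def P1_obj[OF p h] using sA bs bB K(18) P by simp
  then have E1: "is_element (pol1 q) (pol2 q) H (El d c g s)"
    unfolding is_element_def using K(1) H sA K(12,16) Q by simp
  obtain i where i: "names q H i (El d c g s)" using names_ex[OF q H(1,2) E1] by blast
  have iA: "i \<in> Arr E" "Dom E i = Dom E (elB ?U)" "Cod E i = Dom E (elB ?V)" using names_arr[OF i] n(2) by simp_all
  have 1: "names ?qp h (?F \<cdot> i) ?U"
    using Phi_names[OF p q h i[unfolded H_def], of "El b a e (elS ?U)" "elB ?U" w "elA ?U"] s N ge by simp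
  have Fi: "?F \<cdot> i = Idn E (Dom E (elB ?U))" using names_unique[OF qp h 1 names_self[OF qp h]] .
  \<comment> \<open>Conversely, compare with the generic composable pair.\<close>
  note v1 = names_self[OF q H(1,2)]
  obtain D2 x w' y where D2: "names p h (elS ?V) D2" and N': "composite q p x w' y (elB ?V) (elA ?V) (elC ?V) (elB D2) (elA D2) (elC D2)"
    using ex_names_composite[OF p q h v1[unfolded H_def], folded H_def] by blast
  note C' = names_composable[OF p q h v1[unfolded H_def] D2[unfolded H_def], folded H_def]
  note K' = composableD[OF C' p q] and n' = compositeD[OF N']
  have V: "is_element (pol1 q) (pol2 q) H ?V" by (rule generic_element[OF poly_element_generic[OF q H(1,2)]])
  have F: "names ?qp h (?F \<cdot> Idn E (Dom E (elB ?V))) (El x y (elC ?V \<cdot> elC D2) (elS D2))"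
    using Phi_names[OF p q h v1[unfolded H_def] D2[unfolded H_def]] N' by (simp add: H_def)
  have F': "names ?qp h (Idn E (Dom E (elB ?U)) \<cdot> ?F) (El x y (elC ?V \<cdot> elC D2) (elS D2))"
    using F ph by simp
  note cmp = names_compare[OF qp h names_self[OF qp h] F' ph(1,3), simplified]
  obtain t where t: "t \<in> Arr E" "Dom E t = Dom E y" "Cod E t = Dom E (elA ?U)" "elA ?U \<cdot> t = y"
    "elC ?U \<cdot> t = ?F \<cdot> elC ?V \<cdot> elC D2" "elS ?U \<cdot> t = elS D2" using cmp(2) by blast
  have td: "Dom E t = Dom E (elC D2)" "Cod E t = Dom E e" using t(2,3) n'(8) n(8) by simp_all
  have pbw: "is_pullback E (FG E q p) (elB ?U) w g"
    by (rule pullback_cancel[OF comp_square[OF p q]]) (simp_all add: n A K(1))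
  have "\<exists>k. is_lift w g w' (?F \<cdot> elC ?V) k"
    by (rule pullback_lift[OF pbw])
      (simp_all add: n' ph K'(3-17) A comp_left_eq[OF cmp(1), of "elC ?V"] U(11))
  then obtain k where "is_lift w g w' (?F \<cdot> elC ?V) k" by blast
  note k = is_liftD[OF this]
  have kd: "Dom E k = Dom E (elC ?V)" "Cod E k = Dom E g" using k(2,3) n'(5) n(5) by simp_all
  have et: "e \<cdot> t = k \<cdot> elC D2"
  proof (rule pullback_eqI[OF pbw])
    show "w \<cdot> e \<cdot> t = w \<cdot> k \<cdot> elC D2"
      using comp_left_eq[OF n(15), of t] comp_left_eq[OF k(4), of "elC D2"] n'(15)
      by (simp add: t(1,4) td k(1) kd n(4-9) K(3-17) K'(3-17) A(1-15))
    have "g \<cdot> e \<cdot> t = ?F \<cdot> elC ?V \<cdot> elC D2"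
      using comp_left_eq[OF ge, of t] t(5) by (simp add: t(1) td K(3-17))
    also have "\<dots> = g \<cdot> k \<cdot> elC D2"
      using comp_left_eq[OF k(5), of "elC D2"] by (simp add: k(1) kd K(3-17) K'(3-17) ph)
    finally show "g \<cdot> e \<cdot> t = g \<cdot> k \<cdot> elC D2" .
  qed (simp_all add: t(1) td k(1) kd K(3-17) K'(3-17) n(4-6))
  have "names p h (s \<cdot> k) D2"
  proof (rule names_restrictI[OF p h s, of D2 k t])
    show "is_element (pol1 p) (pol2 p) h D2" using D2 by (simp add: names_def)
    show "elB D2 = elB (El b a e (elS ?U)) \<cdot> k"
      using comp_left_eq[OF n(13), of k] n'(13) by (simp add: k(1,4) kd n(4-6) A)
    show "elA D2 = elA (El b a e (elS ?U)) \<cdot> t"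
      using comp_left_eq[OF n(14), of t] n'(14) by (simp add: t(1,3,4) n(7-9) A)
  qed (simp_all add: k(1) kd t(1,6) td et K(16,17))
  then have sk: "s \<cdot> k = elS ?V" using names_unique[OF p h _ D2] by blast
  have "names q H (i \<cdot> ?F) ?V"
  proof (rule names_restrictI[OF q H(1,2) i V, of ?F k])
    show "elB ?V = elB (El d c g s) \<cdot> ?F"
      using comp_left_eq[OF n(10), of ?F] n'(10) cmp(1) by (simp add: ph n(1-3) A)
    show "elA ?V = elA (El d c g s) \<cdot> k"
      using comp_left_eq[OF n(11), of k] n'(11) by (simp add: k(1,4) kd n(4-6) A)
  qed (use n(2) in \<open>simp_all add: ph k(1,5) kd sk K(12)\<close>)
  then have iF: "i \<cdot> ?F = Idn E (Dom E (elB ?V))" using names_unique[OF q H(1,2) _ names_self[OF q H(1,2)]] by blast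
  show ?thesis by (rule is_isoI[of _ i]) (simp_all add: ph iA Fi iF)
qed

definition Phi :: "'o \<Rightarrow> 'o \<Rightarrow> 'o \<Rightarrow> 'a poly \<Rightarrow> 'a poly \<Rightarrow> 'a slice_ntrans" where
  "Phi X Y Z q p = \<lparr>ndom = comp_func (slice E X) (P1 E Y Z q) (P1 E X Y p), ncod = P1 E X Z (comp_poly E q p),
     ncmp = (\<lambda>h\<in>Obj (slice E X). \<lparr>sdom = fobj (P1 E Y Z q) (fobj (P1 E X Y p) h),
        scod = fobj (P1 E X Z (comp_poly E q p)) h, sarr = Phi_arr X Y q p h\<rparr>)\<rparr>"

lemma Phi_simps [simp]:
  "ndom (Phi X Y Z q p) = comp_func (slice E X) (P1 E Y Z q) (P1 E X Y p)"
  "ncod (Phi X Y Z q p) = P1 E X Z (comp_poly E q p)"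
  "\<lbrakk>h \<in> Arr E; Cod E h = X\<rbrakk> \<Longrightarrow> ncmp (Phi X Y Z q p) h = \<lparr>sdom = fobj (P1 E Y Z q) (fobj (P1 E X Y p) h),
        scod = fobj (P1 E X Z (comp_poly E q p)) h, sarr = Phi_arr X Y q p h\<rparr>"
  by (simp_all add: Phi_def)

lemma Phi_ntrans:
  assumes p: "is_poly E X Y p" and q: "is_poly E Y Z q"
  shows "is_ntrans (slice E X) (slice E Z) (Phi X Y Z q p)"
proof (rule is_ntransI)
  let ?qp = "comp_poly E q p"
  have qp: "is_poly E X Z ?qp" by (rule comp_poly_poly[OF p q])
  note A = comp_arrows[OF p q] and Q = is_polyD[OF q]
  show "is_functor (slice E X) (slice E Z) (ndom (Phi X Y Z q p))" "is_functor (slice E X) (slice E Z) (ncod (Phi X Y Z q p))"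
    using comp_func_functor[OF slice_category P1_functor[OF p] P1_functor[OF q]] P1_functor[OF qp] by simp_all
  show "ncmp (Phi X Y Z q p) \<in> extensional (Obj (slice E X))" by (simp add: Phi_def)
  fix h assume "h \<in> Obj (slice E X)"
  then have h: "h \<in> Arr E" "Cod E h = X" by simp_all
  note H = P1_obj_arr(1,2)[OF p h]
  let ?H = "fobj (P1 E X Y p) h"
  let ?V = "poly_element q ?H"
  obtain D2 x w y where D2: "names p h (elS ?V) D2" and N: "composite q p x w y (elB ?V) (elA ?V) (elC ?V) (elB D2) (elA D2) (elC D2)"
    using ex_names_composite[OF p q h names_self[OF q H]] by blast
  note n = compositeD[OF N]
  note pa = Phi_arr[OF p q h]
  have "names ?qp h (Phi_arr X Y q p h) (El x y (elC ?V \<cdot> elC D2) (elS D2))"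
    using Phi_names[OF p q h names_self[OF q H] D2 N] pa by simp
  then have e: "elB (poly_element ?qp h) \<cdot> Phi_arr X Y q p h = x"
    using classifiesD(4) unfolding names_def by fastforce
  note U = is_elementD[OF generic_element[OF poly_element_generic[OF qp h]]]
  have ty: "Cod E (elB (poly_element ?qp h)) = Dom E (GD E q p)" using U(14) A(3,6,11,12) by simp
  have "(pol3 q \<cdot> GD E q p) \<cdot> elB (poly_element ?qp h) \<cdot> Phi_arr X Y q p h = pol3 q \<cdot> elB ?V"
    unfolding e using n(1-3,10) by (simp add: A(1-15) Q)
  then show "ncmp (Phi X Y Z q p) h \<in> Arr (slice E Z) \<and>
      Dom (slice E Z) (ncmp (Phi X Y Z q p) h) = fobj (ndom (Phi X Y Z q p)) h \<and>
      Cod (slice E Z) (ncmp (Phi X Y Z q p) h) = fobj (ncod (Phi X Y Z q p)) h"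
    using h P1_obj_arr[OF q H] P1_obj_arr[OF qp h] pa
    by (simp add: in_slice_arr P1_obj[OF qp h] P1_obj[OF q H] U(11) ty A(1-15) Q)
next
  let ?qp = "comp_poly E q p"
  have qp: "is_poly E X Z ?qp" by (rule comp_poly_poly[OF p q])
  fix u assume u: "u \<in> Arr (slice E X)"
  note u' = u[unfolded in_slice_arr]
  have h: "sdom u \<in> Arr E" "Cod E (sdom u) = X" and h': "scod u \<in> Arr E" "Cod E (scod u) = X" using u' by simp_all
  let ?Pu = "farr (P1 E X Y p) u"
  note Pu = P1_arr[OF p u]
  note H = P1_obj_arr(1,2)[OF p h]
  let ?V = "poly_element q (fobj (P1 E X Y p) (sdom u))"
  note V = names_self[OF q H]
  obtain D2 x w y where D2: "names p (sdom u) (elS ?V) D2"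
    and N: "composite q p x w y (elB ?V) (elA ?V) (elC ?V) (elB D2) (elA D2) (elC D2)"
    using ex_names_composite[OF p q h V] by blast
  note pa = Phi_arr[OF p q h]
  have "names ?qp (sdom u) (Phi_arr X Y q p (sdom u)) (El x y (elC ?V \<cdot> elC D2) (elS D2))"
    using Phi_names[OF p q h V D2 N] pa by simp
  from P1_arr_names[OF qp u this]
  have 1: "names ?qp (scod u) (sarr (farr (P1 E X Z ?qp) u) \<cdot> Phi_arr X Y q p (sdom u)) (El x y (elC ?V \<cdot> elC D2) (sarr u \<cdot> elS D2))"
    by simp
  have 2: "names q (fobj (P1 E X Y p) (scod u)) (sarr (farr (P1 E Y Z q) ?Pu)) (El (elB ?V) (elA ?V) (elC ?V) (sarr ?Pu \<cdot> elS ?V))"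
    using P1_names_self[OF q Pu(1)] Pu by simp
  have 3: "names p (scod u) (sarr ?Pu \<cdot> elS ?V) (El (elB D2) (elA D2) (elC D2) (sarr u \<cdot> elS D2))"
    by (rule P1_arr_names[OF p u D2])
  have 4: "names ?qp (scod u) (Phi_arr X Y q p (scod u) \<cdot> sarr (farr (P1 E Y Z q) ?Pu)) (El x y (elC ?V \<cdot> elC D2) (sarr u \<cdot> elS D2))"
    using Phi_names[OF p q h' 2, of "El (elB D2) (elA D2) (elC D2) (sarr u \<cdot> elS D2)"] 3 N by simp
  show "ncmp (Phi X Y Z q p) (Cod (slice E X) u) \<cdot>\<^bsub>slice E Z\<^esub> farr (ndom (Phi X Y Z q p)) u
      = farr (ncod (Phi X Y Z q p)) u \<cdot>\<^bsub>slice E Z\<^esub> ncmp (Phi X Y Z q p) (Dom (slice E X) u)"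
    using names_unique[OF qp h' 4 1] u h h' P1_arr[OF q Pu(1)] P1_arr[OF qp u] Pu
    by (intro slice_arr_eqI) simp_all
qed

lemma Phi_is_iso:
  assumes p: "is_poly E X Y p" and q: "is_poly E Y Z q"
  shows "is_iso (func_cat (slice E X) (slice E Z)) (Phi X Y Z q p)"
proof (rule iso_ntransI[OF slice_category slice_category Phi_ntrans[OF p q]])
  fix h assume h: "h \<in> Obj (slice E X)"
  show "is_iso (slice E Z) (ncmp (Phi X Y Z q p) h)"
    by (rule slice_isoI)
      (use is_ntransD(3)[OF Phi_ntrans[OF p q] h] h Phi_iso[OF p q] in simp_all)
qed

text \<open>The elements of the identity polynomial that correspond to a map \<open>w\<close> into the domain of \<open>h\<close>.\<close>

lemma id_element:
  assumes "X \<in> Obj E" "h \<in> Arr E" "Cod E h = X" "w \<in> Arr E" "Cod E w = Dom E h"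
  shows "is_element (pol1 (id_poly E X)) (pol2 (id_poly E X)) h (El (h \<cdot> w) (h \<cdot> w) (Idn E (Dom E w)) w)"
  unfolding is_element_def using assms by (simp add: pullback_idn_left)

definition Psi_arr :: "'o \<Rightarrow> 'a \<Rightarrow> 'a" where
  "Psi_arr X h = (SOME m. names (id_poly E X) h m (El h h (Idn E (Dom E h)) (Idn E (Dom E h))))"

lemma
  assumes X: "X \<in> Obj E" and h: "h \<in> Arr E" "Cod E h = X"
  shows Psi_arr: "Psi_arr X h \<in> Arr E" "Dom E (Psi_arr X h) = Dom E h"
      "Cod E (Psi_arr X h) = Dom E (elB (poly_element (id_poly E X) h))"
    and Psi_names_self: "names (id_poly E X) h (Psi_arr X h) (El h h (Idn E (Dom E h)) (Idn E (Dom E h)))"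
    and Psi_names: "\<lbrakk>w \<in> Arr E; Cod E w = Dom E h\<rbrakk>
      \<Longrightarrow> names (id_poly E X) h (Psi_arr X h \<cdot> w) (El (h \<cdot> w) (h \<cdot> w) (Idn E (Dom E w)) w)"
proof -
  note p = id_poly_poly[OF X]
  have "is_element (pol1 (id_poly E X)) (pol2 (id_poly E X)) h (El h h (Idn E (Dom E h)) (Idn E (Dom E h)))"
    using id_element[OF X h, of "Idn E (Dom E h)"] h by simp
  from someI_ex[OF names_ex[OF p h this]]
  show n: "names (id_poly E X) h (Psi_arr X h) (El h h (Idn E (Dom E h)) (Idn E (Dom E h)))"
    unfolding Psi_arr_def .
  show "Psi_arr X h \<in> Arr E" "Dom E (Psi_arr X h) = Dom E h"
      "Cod E (Psi_arr X h) = Dom E (elB (poly_element (id_poly E X) h))"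
    using names_arr[OF n] by simp_all
  show "names (id_poly E X) h (Psi_arr X h \<cdot> w) (El (h \<cdot> w) (h \<cdot> w) (Idn E (Dom E w)) w)"
    if w: "w \<in> Arr E" "Cod E w = Dom E h"
    by (rule names_restrictI[OF p h n id_element[OF X h w], of _ w]) (simp_all add: w h)
qed

text \<open>The inverse is \<open>s c\<^sup>-\<^sup>1\<close> for the generic element \<open>(b, a, c, s)\<close>, whose \<open>c\<close> is a pullback of an identity.\<close>

lemma Psi_iso:
  assumes X: "X \<in> Obj E" and h: "h \<in> Arr E" "Cod E h = X"
  shows "is_iso E (Psi_arr X h)"
proof -
  let ?i = "id_poly E X"
  note p = id_poly_poly[OF X]
  let ?U = "poly_element ?i h"
  have Ue: "is_element (pol1 ?i) (pol2 ?i) h ?U" by (rule generic_element[OF poly_element_generic[OF p h]])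
  note U = is_elementD[OF Ue]
  note ps = Psi_arr[OF X h]
  have iso: "is_iso E (elC ?U)" using pullback_iso_left[OF U(1)] X by simp
  note I = iso_inverse(1-5)[OF iso]
  have hA: "elA ?U = h \<cdot> elS ?U" using U(9,12,16) X by simp
  have bA: "elB ?U \<cdot> elC ?U = h \<cdot> elS ?U" using U(18,9,12,16) X by simp
  have "names ?i h (Idn E (Dom E (elB ?U)) \<cdot> elC ?U) (El (h \<cdot> elS ?U) (h \<cdot> elS ?U) (Idn E (Dom E (elS ?U))) (elS ?U))"
  proof (rule names_restrictI[OF p h names_self[OF p h] id_element[OF X h U(6,8)], of _ "Idn E (Dom E (elA ?U))"])
    show "elB (El (h \<cdot> elS ?U) (h \<cdot> elS ?U) (Idn E (Dom E (elS ?U))) (elS ?U)) = elB ?U \<cdot> elC ?U"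
      by (simp add: bA)
    show "elA (El (h \<cdot> elS ?U) (h \<cdot> elS ?U) (Idn E (Dom E (elS ?U))) (elS ?U)) = elA ?U \<cdot> Idn E (Dom E (elA ?U))"
      using U(12) by (simp add: hA[symmetric])
  qed (simp_all add: U(6,7,12,13,15,17))
  then have "names ?i h (elC ?U) (El (h \<cdot> elS ?U) (h \<cdot> elS ?U) (Idn E (Dom E (elS ?U))) (elS ?U))"
    by (simp add: U(13,17))
  then have ps_s: "Psi_arr X h \<cdot> elS ?U = elC ?U"
    using names_unique[OF p h Psi_names[OF X h U(6,8)]] by blast
  have n: "names ?i h (Idn E (Dom E (elB ?U)) \<cdot> Psi_arr X h) (El h h (Idn E (Dom E h)) (Idn E (Dom E h)))"
    using Psi_names_self[OF X h] ps by simp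
  obtain t where t: "t \<in> Arr E" "Dom E t = Dom E h" "Cod E t = Dom E (elA ?U)" "elC ?U \<cdot> t = Psi_arr X h"
    "elS ?U \<cdot> t = Idn E (Dom E h)"
    using names_compare(2)[OF p h names_self[OF p h] n ps(1,3)] ps h by auto
  have "inverse_of E (elC ?U) \<cdot> Psi_arr X h = t"
    unfolding t(4)[symmetric] using comp_left_eq[OF I(4), of t] by (simp add: I(1-3) t(1-3) U(13,15))
  then have 2: "(elS ?U \<cdot> inverse_of E (elC ?U)) \<cdot> Psi_arr X h = Idn E (Dom E h)"
    by (simp add: I(1-3) U(6,7,13,15,17) ps t(5))
  have 1: "Psi_arr X h \<cdot> elS ?U \<cdot> inverse_of E (elC ?U) = Idn E (Dom E (elB ?U))"
    using comp_left_eq[OF ps_s, of "inverse_of E (elC ?U)"] by (simp add: I U(6-8,13,15,17) ps)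
  show ?thesis
    by (rule is_isoI[of _ "elS ?U \<cdot> inverse_of E (elC ?U)"]) (simp_all add: ps I(1-3) U(6-8,13,15,17) 1 2)
qed

definition Psi :: "'o \<Rightarrow> 'a slice_ntrans" where
  "Psi X = \<lparr>ndom = id_func (slice E X), ncod = P1 E X X (id_poly E X),
     ncmp = (\<lambda>h\<in>Obj (slice E X). \<lparr>sdom = h, scod = fobj (P1 E X X (id_poly E X)) h, sarr = Psi_arr X h\<rparr>)\<rparr>"

lemma Psi_simps [simp]:
  "ndom (Psi X) = id_func (slice E X)" "ncod (Psi X) = P1 E X X (id_poly E X)"
  "\<lbrakk>h \<in> Arr E; Cod E h = X\<rbrakk>
    \<Longrightarrow> ncmp (Psi X) h = \<lparr>sdom = h, scod = fobj (P1 E X X (id_poly E X)) h, sarr = Psi_arr X h\<rparr>"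
  by (simp_all add: Psi_def)

lemma Psi_ntrans:
  assumes X: "X \<in> Obj E" shows "is_ntrans (slice E X) (slice E X) (Psi X)"
proof (rule is_ntransI)
  note p = id_poly_poly[OF X]
  show "is_functor (slice E X) (slice E X) (ndom (Psi X))" "is_functor (slice E X) (slice E X) (ncod (Psi X))"
    using P1_functor[OF p] by (simp_all add: id_func_functor slice_category)
  show "ncmp (Psi X) \<in> extensional (Obj (slice E X))" by (simp add: Psi_def)
  fix h assume "h \<in> Obj (slice E X)"
  then have h: "h \<in> Arr E" "Cod E h = X" by simp_all
  note U = is_elementD[OF generic_element[OF poly_element_generic[OF p h]]]
  have "elB (poly_element (id_poly E X) h) \<cdot> Psi_arr X h = h"
    using Psi_names_self[OF X h] classifiesD(4) unfolding names_def by fastforce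
  then show "ncmp (Psi X) h \<in> Arr (slice E X) \<and>
      Dom (slice E X) (ncmp (Psi X) h) = fobj (ndom (Psi X)) h \<and> Cod (slice E X) (ncmp (Psi X) h) = fobj (ncod (Psi X)) h"
    using h P1_obj_arr[OF p h] Psi_arr[OF X h] U(11,14) X by (simp add: in_slice_arr P1_obj[OF p h])
next
  note p = id_poly_poly[OF X]
  fix u assume u: "u \<in> Arr (slice E X)"
  note u' = u[unfolded in_slice_arr]
  have h: "sdom u \<in> Arr E" "Cod E (sdom u) = X" and h': "scod u \<in> Arr E" "Cod E (scod u) = X" using u' by simp_all
  have su: "sarr u \<in> Arr E" "Cod E (sarr u) = Dom E (scod u)" using u' by simp_all
  have 1: "names (id_poly E X) (scod u) (Psi_arr X (scod u) \<cdot> sarr u) (El (sdom u) (sdom u) (Idn E (Dom E (sdom u))) (sarr u))"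
    using Psi_names[OF X h' su] u' by simp
  have 2: "names (id_poly E X) (scod u) (sarr (farr (P1 E X X (id_poly E X)) u) \<cdot> Psi_arr X (sdom u))
      (El (sdom u) (sdom u) (Idn E (Dom E (sdom u))) (sarr u))"
    using P1_arr_names[OF p u Psi_names_self[OF X h]] u' by simp
  show "ncmp (Psi X) (Cod (slice E X) u) \<cdot>\<^bsub>slice E X\<^esub> farr (ndom (Psi X)) u
      = farr (ncod (Psi X)) u \<cdot>\<^bsub>slice E X\<^esub> ncmp (Psi X) (Dom (slice E X) u)"
    using names_unique[OF p h' 1 2] u h h' P1_arr[OF p u] by (intro slice_arr_eqI) simp_all
qed

lemma Psi_is_iso:
  assumes X: "X \<in> Obj E" shows "is_iso (func_cat (slice E X) (slice E X)) (Psi X)"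
proof (rule iso_ntransI[OF slice_category slice_category Psi_ntrans[OF X]])
  fix h assume h: "h \<in> Obj (slice E X)"
  show "is_iso (slice E X) (ncmp (Psi X) h)"
    by (rule slice_isoI) (use is_ntransD(3)[OF Psi_ntrans[OF X] h] h Psi_iso[OF X] in simp_all)
qed

text \<open>Both composites name the image under \<open>f\<close> and \<open>g\<close> of the composite of the generic pair.\<close>

lemma Phi_natural:
  assumes f: "is_cart E X Y f" and g: "is_cart E Y Z g"
  shows "Phi X Y Z (ctrg g) (ctrg f) \<cdot>\<^bsub>func_cat (slice E X) (slice E Z)\<^esub>
      Hcomp2 CAT (slice E X) (slice E Y) (slice E Z) (P2 E Y Z g) (P2 E X Y f)
    = P2 E X Z (hcomp_cart E g f) \<cdot>\<^bsub>func_cat (slice E X) (slice E Z)\<^esub> Phi X Y Z (csrc g) (csrc f)"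
proof (rule ntrans_eqI[of "slice E X" "slice E Z"])
  note F = is_cartD[OF f] and G = is_cartD[OF g] and gf = hcomp_cart_cart[OF f g]
  note hc = hcomp_cart_composite(1,2)[OF f g]
  note c = comp_poly_poly[OF F(2) G(2)]
  fix h assume "h \<in> Obj (slice E X)"
  then have h: "h \<in> Arr E" "Cod E h = X" by simp_all
  let ?H = "fobj (P1 E X Y (csrc f)) h" and ?H' = "fobj (P1 E X Y (ctrg f)) h"
  note H = P1_obj_arr(1,2)[OF F(1) h] and H' = P1_obj_arr(1,2)[OF F(2) h]
  let ?a = "ncmp (P2 E X Y f) h"
  note a = P2_arr[OF f h]
  let ?V = "poly_element (csrc g) ?H"
  obtain D2 x w y where D2: "names (csrc f) h (elS ?V) D2"
    and N: "composite (csrc g) (csrc f) x w y (elB ?V) (elA ?V) (elC ?V) (elB D2) (elA D2) (elC D2)"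
    using ex_names_composite[OF F(1) G(1) h names_self[OF G(1) H]] by blast
  note C = names_composable[OF F(1) G(1) h names_self[OF G(1) H] D2]
  obtain w' where N': "composite (ctrg g) (ctrg f) (car1 (hcomp_cart E g f) \<cdot> x) w' (car0 (hcomp_cart E g f) \<cdot> y)
    (car1 g \<cdot> elB ?V) (car0 g \<cdot> elA ?V) (elC ?V) (car1 f \<cdot> elB D2) (car0 f \<cdot> elA D2) (elC D2)"
    using hcomp_composite[OF f g C N] by blast
  have 1: "names (ctrg g) ?H' (sarr (ncmp (P2 E Y Z g) ?H') \<cdot> sarr (farr (P1 E Y Z (csrc g)) ?a))
      (El (car1 g \<cdot> elB ?V) (car0 g \<cdot> elA ?V) (elC ?V) (sarr ?a \<cdot> elS ?V))"
    using P2_names[OF g H' P1_names_self[OF G(1) a(1), unfolded a(2,3)]] by simp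
  have 2: "names (ctrg f) h (sarr ?a \<cdot> elS ?V) (El (car1 f \<cdot> elB D2) (car0 f \<cdot> elA D2) (elC D2) (elS D2))"
    by (rule P2_names[OF f h D2])
  have 3: "names (comp_poly E (ctrg g) (ctrg f)) h
      (Phi_arr X Y (ctrg g) (ctrg f) h \<cdot> sarr (ncmp (P2 E Y Z g) ?H') \<cdot> sarr (farr (P1 E Y Z (csrc g)) ?a))
      (El (car1 (hcomp_cart E g f) \<cdot> x) (car0 (hcomp_cart E g f) \<cdot> y) (elC ?V \<cdot> elC D2) (elS D2))"
    using Phi_names[OF F(2) G(2) h 1, of "El (car1 f \<cdot> elB D2) (car0 f \<cdot> elA D2) (elC D2) (elS D2)"] 2 N' by simp
  have "names (comp_poly E (csrc g) (csrc f)) h (Phi_arr X Y (csrc g) (csrc f) h) (El x y (elC ?V \<cdot> elC D2) (elS D2))"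
    using Phi_names[OF F(1) G(1) h names_self[OF G(1) H] D2 N] Phi_arr[OF F(1) G(1) h] by simp
  from P2_names[OF gf h, unfolded hc, OF this]
  have 4: "names (comp_poly E (ctrg g) (ctrg f)) h (sarr (ncmp (P2 E X Z (hcomp_cart E g f)) h) \<cdot> Phi_arr X Y (csrc g) (csrc f) h)
      (El (car1 (hcomp_cart E g f) \<cdot> x) (car0 (hcomp_cart E g f) \<cdot> y) (elC ?V \<cdot> elC D2) (elS D2))"
    by simp
  show "ncmp (Phi X Y Z (ctrg g) (ctrg f) \<cdot>\<^bsub>func_cat (slice E X) (slice E Z)\<^esub>
      Hcomp2 CAT (slice E X) (slice E Y) (slice E Z) (P2 E Y Z g) (P2 E X Y f)) h
    = ncmp (P2 E X Z (hcomp_cart E g f) \<cdot>\<^bsub>func_cat (slice E X) (slice E Z)\<^esub> Phi X Y Z (csrc g) (csrc f)) h"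
    using names_unique[OF c h 3 4] h P1_arr[OF G(1) a(1)] a P2_arr[OF gf h]
    by (intro slice_arr_eqI) (simp_all add: hc)
qed (simp_all add: vcomp_ntrans hcomp_ntrans slice_category Phi_ntrans[OF is_cartD(1)[OF f] is_cartD(1)[OF g]]
    Phi_ntrans[OF is_cartD(2)[OF f] is_cartD(2)[OF g]] P2_ntrans f g hcomp_cart_cart[OF f g] hcomp_cart_composite(1,2)[OF f g])

text \<open>Take the generic element of the iterated functor, a composable triple with a section. One side
  composes it bracketed to the left and then applies the associator, the other composes it bracketed to
  the right; by \<open>assoc_composite\<close> both name the same element.\<close>

lemma Phi_assoc:
  assumes p: "is_poly E W X p" and q: "is_poly E X Y q" and r: "is_poly E Y Z r"
  shows "P2 E W Z (assoc_cart E r q p) \<cdot>\<^bsub>func_cat (slice E W) (slice E Z)\<^esub> Phi W X Z (comp_poly E r q) p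
      \<cdot>\<^bsub>func_cat (slice E W) (slice E Z)\<^esub> Hcomp2 CAT (slice E W) (slice E X) (slice E Z) (Phi X Y Z r q)
          (id_ntrans (slice E W) (slice E X) (P1 E W X p))
    = Phi W Y Z r (comp_poly E q p) \<cdot>\<^bsub>func_cat (slice E W) (slice E Z)\<^esub>
        Hcomp2 CAT (slice E W) (slice E Y) (slice E Z) (id_ntrans (slice E Y) (slice E Z) (P1 E Y Z r)) (Phi W X Y q p)
        \<cdot>\<^bsub>func_cat (slice E W) (slice E Z)\<^esub> id_ntrans (slice E W) (slice E Z)
            (comp_func (slice E W) (P1 E Y Z r) (comp_func (slice E W) (P1 E X Y q) (P1 E W X p)))"
    (is "?L = ?R")
proof -
  note qp = comp_poly_poly[OF p q] and rq = comp_poly_poly[OF q r]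
  let ?\<alpha> = "assoc_cart E r q p"
  note al = assoc_cart_cart[OF p q r] and s = assoc_cart_composite(1,2)[OF p q r]
  note c = comp_poly_poly[OF qp r]
  note fp = P1_functor[OF p] and fq = P1_functor[OF q] and fr = P1_functor[OF r]
  note sc = slice_category
  have cf: "is_functor (slice E W) (slice E Z) (comp_func (slice E W) (P1 E Y Z r) (comp_func (slice E W) (P1 E X Y q) (P1 E W X p)))"
    by (intro comp_func_functor[OF sc _ fr] comp_func_functor[OF sc fp fq])
  show ?thesis
  proof (rule ntrans_eqI[of "slice E W" "slice E Z"])
    fix h assume h0: "h \<in> Obj (slice E W)"
    then have h: "h \<in> Arr E" "Cod E h = W" by simp_all
    let ?H = "fobj (P1 E W X p) h" let ?K = "fobj (P1 E X Y q) ?H"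
    note H = P1_obj_arr(1,2)[OF p h] note K = P1_obj_arr(1,2)[OF q H]
    let ?V = "poly_element r ?K"
    note nV = names_self[OF r K]
    obtain D2 x w y where D2: "names q ?H (elS ?V) D2"
      and N: "composite r q x w y (elB ?V) (elA ?V) (elC ?V) (elB D2) (elA D2) (elC D2)"
      using ex_names_composite[OF q r H nV] by blast
    obtain D3 x0 w0 y0 where D3: "names p h (elS D2) D3"
      and N0: "composite q p x0 w0 y0 (elB D2) (elA D2) (elC D2) (elB D3) (elA D3) (elC D3)"
      using ex_names_composite[OF p q h D2] by blast
    note C1 = names_composable[OF q r H nV D2] and C2 = names_composable[OF p q h D2 D3]
    note k1 = composableD[OF C1 q r] and k2 = composableD[OF C2 p q]
    have ge: "(elC ?V \<cdot> elC D2) \<cdot> elC D3 = elC ?V \<cdot> elC D2 \<cdot> elC D3" using k1 k2 by simp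
    obtain x1 w1 y1 where N1: "composite (comp_poly E r q) p x1 w1 y1 x y (elC ?V \<cdot> elC D2) (elB D3) (elA D3) (elC D3)"
      using composite_ex[OF p rq composable_left[OF p q r C1 C2 N]] by blast
    obtain w2 where N2: "composite r (comp_poly E q p) (car1 ?\<alpha> \<cdot> x1) w2 (car0 ?\<alpha> \<cdot> y1) (elB ?V) (elA ?V) (elC ?V) x0 y0 (elC D2 \<cdot> elC D3)"
      using assoc_composite[OF p q r C1 C2 N N1 N0] by blast
    have 1: "names (comp_poly E r q) ?H (Phi_arr X Y r q ?H) (El x y (elC ?V \<cdot> elC D2) (elS D2))"
      using Phi_names[OF q r H nV D2 N] Phi_arr[OF q r H] by simp
    have 2: "names (comp_poly E (comp_poly E r q) p) h (Phi_arr W X (comp_poly E r q) p h \<cdot> Phi_arr X Y r q ?H)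
      (El x1 y1 (elC ?V \<cdot> elC D2 \<cdot> elC D3) (elS D3))"
      using Phi_names[OF p rq h 1, of D3] D3 N1 ge by simp
    have 3: "names (comp_poly E r (comp_poly E q p)) h (sarr (ncmp (P2 E W Z ?\<alpha>) h) \<cdot> Phi_arr W X (comp_poly E r q) p h \<cdot> Phi_arr X Y r q ?H)
      (El (car1 ?\<alpha> \<cdot> x1) (car0 ?\<alpha> \<cdot> y1) (elC ?V \<cdot> elC D2 \<cdot> elC D3) (elS D3))"
      using P2_names[OF al h, unfolded s, OF 2] by simp
    let ?f = "ncmp (Phi W X Y q p) h"
    have f: "?f \<in> Arr (slice E Y)" "sdom ?f = ?K" "scod ?f = fobj (P1 E W Y (comp_poly E q p)) h" "sarr ?f = Phi_arr W X q p h"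
      using is_ntransD(3)[OF Phi_ntrans[OF p q] h0] h by simp_all
    have 4: "names r (fobj (P1 E W Y (comp_poly E q p)) h) (sarr (farr (P1 E Y Z r) ?f))
      (El (elB ?V) (elA ?V) (elC ?V) (Phi_arr W X q p h \<cdot> elS ?V))"
      using P1_names_self[OF r f(1), unfolded f(2-4)] .
    have 5: "names (comp_poly E q p) h (Phi_arr W X q p h \<cdot> elS ?V) (El x0 y0 (elC D2 \<cdot> elC D3) (elS D3))"
      by (rule Phi_names[OF p q h D2 D3 N0])
    have 6: "names (comp_poly E r (comp_poly E q p)) h (Phi_arr W Y r (comp_poly E q p) h \<cdot> sarr (farr (P1 E Y Z r) ?f))
      (El (car1 ?\<alpha> \<cdot> x1) (car0 ?\<alpha> \<cdot> y1) (elC ?V \<cdot> elC D2 \<cdot> elC D3) (elS D3))"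
      using Phi_names[OF qp r h 4, of "El x0 y0 (elC D2 \<cdot> elC D3) (elS D3)"] 5 N2 by simp
    note F = P1_arr[OF r f(1), unfolded f(2,3)] and Fs = P1_arr_sarr[OF r f(1), unfolded f(2,3)]
    note M = P1_obj_arr[OF qp h]
    note ph = Phi_arr[OF q r H] Phi_arr[OF qp r h]
    have i2: "farr (P1 E Y Z r) (farr (P1 E X Y q) (Idn (slice E X) ?H)) = Idn (slice E Z) (fobj (P1 E Y Z r) ?K)"
      using is_functorD(5)[OF fq, of ?H] is_functorD(5)[OF fr, of ?K] H K by simp
    have iH: "Idn (slice E X) ?H \<in> Arr (slice E X)" using H(1,2) by (simp add: in_slice_arr)
    note R = P1_obj_arr[OF r K] and R' = P1_obj_arr[OF r M(1,2)]
    show "ncmp ?L h = ncmp ?R h"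
      using names_unique[OF c h 3 6] h0 H K M iH F Fs ph R R' i2 P2_arr[OF al h]
      by (intro slice_arr_eqI) (simp_all add: s f(2-4))
  qed (use cf in \<open>simp_all add: vcomp_ntrans hcomp_ntrans id_ntrans_ntrans sc fp fr P2_ntrans[OF al] Phi_ntrans[OF p q] Phi_ntrans[OF q r]
      Phi_ntrans[OF p rq] Phi_ntrans[OF qp r] s comp_func_assoc[OF fp]\<close>)
qed

lemma Phi_lunit:
  assumes p: "is_poly E X Y p" and Y: "Y \<in> Obj E"
  shows "P2 E X Y (lunit_cart E Y p) \<cdot>\<^bsub>func_cat (slice E X) (slice E Y)\<^esub> Phi X Y Y (id_poly E Y) p
      \<cdot>\<^bsub>func_cat (slice E X) (slice E Y)\<^esub> Hcomp2 CAT (slice E X) (slice E Y) (slice E Y) (Psi Y)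
          (id_ntrans (slice E X) (slice E Y) (P1 E X Y p))
    = id_ntrans (slice E X) (slice E Y) (P1 E X Y p)" (is "?L = ?R")
proof -
  let ?i = "id_poly E Y"
  note i = id_poly_poly[OF Y] and L = lunit_data[OF p Y]
  note sc = slice_category and fp = P1_functor[OF p]
  show ?thesis
  proof (rule ntrans_eqI[of "slice E X" "slice E Y"])
    fix h assume h0: "h \<in> Obj (slice E X)"
    then have h: "h \<in> Arr E" "Cod E h = X" by simp_all
    let ?H = "fobj (P1 E X Y p) h" and ?U = "poly_element p h"
    note H = P1_obj_arr[OF p h]
    note U = is_elementD[OF generic_element[OF poly_element_generic[OF p h]]]
    let ?D = "El ?H ?H (Idn E (Dom E ?H)) (Idn E (Dom E ?H))"
    note n1 = Psi_names_self[OF Y H(1,2)]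
    have n2: "names p h (elS ?D) ?U" using names_self[OF p h] by (simp add: H)
    note C = names_composable[OF p i h n1 n2]
    obtain x w y where N: "composite ?i p x w y (elB ?D) (elA ?D) (elC ?D) (elB ?U) (elA ?U) (elC ?U)"
      using composite_ex[OF p i C] by blast
    note l = lunit_composite[OF p Y N] and n = compositeD[OF N, simplified]
    have "names (comp_poly E ?i p) h (Phi_arr X Y ?i p h \<cdot> Psi_arr Y ?H) (El x y (elC ?U) (elS ?U))"
      using Phi_names[OF p i h n1 n2 N] by (simp add: U H)
    from P2_names[OF L(2) h, unfolded L(3,4), OF this]
    have "names p h (sarr (ncmp (P2 E X Y (lunit_cart E Y p)) h) \<cdot> Phi_arr X Y ?i p h \<cdot> Psi_arr Y ?H) ?U"
      using l n by (simp add: H)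
    then have 1: "sarr (ncmp (P2 E X Y (lunit_cart E Y p)) h) \<cdot> Phi_arr X Y ?i p h \<cdot> Psi_arr Y ?H = Idn E (Dom E ?H)"
      using names_unique[OF p h _ names_self[OF p h]] by (simp add: H)
    have iH: "Idn (slice E Y) ?H \<in> Arr (slice E Y)" using H(1,2) by (simp add: in_slice_arr)
    show "ncmp ?L h = ncmp ?R h"
      using 1 h0 iH H(1,2) P2_arr[OF L(2) h] Psi_arr[OF Y H(1,2)]
      by (intro slice_arr_eqI) (simp_all add: L(3,4))
  qed (simp_all add: vcomp_ntrans hcomp_ntrans id_ntrans_ntrans sc fp P2_ntrans[OF L(2)] Phi_ntrans[OF p i] Psi_ntrans[OF Y] L(3,4) comp_func_id[OF fp])
qed

lemma Phi_runit:
  assumes p: "is_poly E X Y p" and X: "X \<in> Obj E"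
  shows "P2 E X Y (runit_cart E X p) \<cdot>\<^bsub>func_cat (slice E X) (slice E Y)\<^esub> Phi X X Y p (id_poly E X)
      \<cdot>\<^bsub>func_cat (slice E X) (slice E Y)\<^esub> Hcomp2 CAT (slice E X) (slice E X) (slice E Y)
          (id_ntrans (slice E X) (slice E Y) (P1 E X Y p)) (Psi X)
    = id_ntrans (slice E X) (slice E Y) (P1 E X Y p)" (is "?L = ?R")
proof -
  let ?i = "id_poly E X"
  note i = id_poly_poly[OF X] and L = runit_data[OF p X]
  note sc = slice_category and fp = P1_functor[OF p]
  show ?thesis
  proof (rule ntrans_eqI[of "slice E X" "slice E Y"])
    fix h assume h0: "h \<in> Obj (slice E X)"
    then have h: "h \<in> Arr E" "Cod E h = X" by simp_all
    let ?U = "poly_element p h" and ?I = "fobj (P1 E X X ?i) h"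
    note I = P1_obj_arr[OF i h] and H = P1_obj_arr[OF p h]
    note U = is_elementD[OF generic_element[OF poly_element_generic[OF p h]]]
    let ?f = "ncmp (Psi X) h"
    have f: "?f \<in> Arr (slice E X)" "sdom ?f = h" "scod ?f = ?I" "sarr ?f = Psi_arr X h"
      using is_ntransD(3)[OF Psi_ntrans[OF X] h0] h by simp_all
    let ?D = "El (elB ?U) (elA ?U) (elC ?U) (Psi_arr X h \<cdot> elS ?U)"
    let ?D2 = "El (h \<cdot> elS ?U) (h \<cdot> elS ?U) (Idn E (Dom E (elS ?U))) (elS ?U)"
    have n1: "names p ?I (sarr (farr (P1 E X Y p) ?f)) ?D"
      using P1_names_self[OF p f(1), unfolded f(2-4)] .
    have n2: "names ?i h (elS ?D) ?D2"
      using Psi_names[OF X h U(6,8)] by simp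
    note C = names_composable[OF i p h n1 n2]
    obtain x w y where N: "composite p ?i x w y (elB ?D) (elA ?D) (elC ?D) (elB ?D2) (elA ?D2) (elC ?D2)"
      using composite_ex[OF i p C] by blast
    note l = runit_composite[OF p X C N]
    have "names (comp_poly E p ?i) h (Phi_arr X X p ?i h \<cdot> sarr (farr (P1 E X Y p) ?f)) (El x y (elC ?U) (elS ?U))"
      using Phi_names[OF i p h n1 n2 N] by (simp add: U)
    from P2_names[OF L(1) h, unfolded L(2,3), OF this]
    have "names p h (sarr (ncmp (P2 E X Y (runit_cart E X p)) h) \<cdot> Phi_arr X X p ?i h \<cdot> sarr (farr (P1 E X Y p) ?f)) ?U"
      using l by (simp add: U)
    then have 1: "sarr (ncmp (P2 E X Y (runit_cart E X p)) h) \<cdot> Phi_arr X X p ?i h \<cdot> sarr (farr (P1 E X Y p) ?f) = Idn E (Dom E (fobj (P1 E X Y p) h))"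
      using names_unique[OF p h _ names_self[OF p h]] by (simp add: H)
    note F = P1_arr[OF p f(1), unfolded f(2,3)] and Fs = P1_arr_sarr[OF p f(1), unfolded f(2,3)]
    note M = P1_obj_arr[OF p I(1,2)]
    show "ncmp ?L h = ncmp ?R h"
      using 1 h0 H I F Fs M P2_arr[OF L(1) h] by (intro slice_arr_eqI) (simp_all add: L(2,3))
  qed (simp_all add: vcomp_ntrans hcomp_ntrans id_ntrans_ntrans sc fp P2_ntrans[OF L(1)] Phi_ntrans[OF i p] Psi_ntrans[OF X] L(2,3) comp_func_id[OF fp])
qed

section \<open>The bicategory of polynomials and its homomorphism\<close>

lemma id_ntrans_iso: "is_functor (slice E X) (slice E Y) F
    \<Longrightarrow> is_iso (func_cat (slice E X) (slice E Y)) (id_ntrans (slice E X) (slice E Y) F)"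
  using category.iso_idn[OF func_cat_category[OF slice_category slice_category], of F X Y] by simp

text \<open>In \<open>Phi_assoc\<close> all cells except the image of the associator are known to be invertible, so this image
  is invertible, and invertibility is reflected. The unitors are treated in the same way.\<close>

lemma assoc_is_iso:
  assumes p: "is_poly E W X p" and q: "is_poly E X Y q" and r: "is_poly E Y Z r" and W: "W \<in> Obj E"
  shows "is_iso (poly_hom E W Z) (assoc_cart E r q p)"
proof (rule P2_reflects_iso[OF assoc_cart_cart[OF p q r] W])
  note qp = comp_poly_poly[OF p q] and rq = comp_poly_poly[OF q r]
  note sc = slice_category and fp = P1_functor[OF p] and fq = P1_functor[OF q] and fr = P1_functor[OF r]
  note s = assoc_cart_composite(1,2)[OF p q r]
  interpret F: category "func_cat (slice E W) (slice E Z)" by (rule func_cat_category[OF sc sc])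
  let ?i = "id_ntrans (slice E W) (slice E Z)
    (comp_func (slice E W) (P1 E Y Z r) (comp_func (slice E W) (P1 E X Y q) (P1 E W X p)))"
  let ?b = "Hcomp2 CAT (slice E W) (slice E X) (slice E Z) (Phi X Y Z r q) (id_ntrans (slice E W) (slice E X) (P1 E W X p))"
  let ?d = "Hcomp2 CAT (slice E W) (slice E Y) (slice E Z) (id_ntrans (slice E Y) (slice E Z) (P1 E Y Z r)) (Phi W X Y q p)"
  let ?a = "Phi W X Z (comp_poly E r q) p" and ?c = "Phi W Y Z r (comp_poly E q p)"
  have b: "is_iso (func_cat (slice E W) (slice E Z)) ?b"
    by (rule hcomp_ntrans_iso[OF sc sc sc Phi_is_iso[OF q r] id_ntrans_iso[OF fp]])
  have d: "is_iso (func_cat (slice E W) (slice E Z)) ?d"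
    by (rule hcomp_ntrans_iso[OF sc sc sc id_ntrans_iso[OF fr] Phi_is_iso[OF p q]])
  have i: "is_iso (func_cat (slice E W) (slice E Z)) ?i"
    by (intro id_ntrans_iso comp_func_functor[OF sc _ fr] comp_func_functor[OF sc fp fq])
  have ab: "is_iso (func_cat (slice E W) (slice E Z)) (?a \<cdot>\<^bsub>func_cat (slice E W) (slice E Z)\<^esub> ?b)"
    by (rule F.iso_comp[OF b Phi_is_iso[OF p rq]]) simp
  have "is_iso (func_cat (slice E W) (slice E Z))
    (?c \<cdot>\<^bsub>func_cat (slice E W) (slice E Z)\<^esub> ?d \<cdot>\<^bsub>func_cat (slice E W) (slice E Z)\<^esub> ?i)"
    by (intro F.iso_comp[OF _ Phi_is_iso[OF qp r]] F.iso_comp[OF i d]) simp_all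
  then show "is_iso (func_cat (slice E W) (slice E Z)) (P2 E W Z (assoc_cart E r q p))"
    unfolding Phi_assoc[OF p q r, symmetric]
    by (rule F.iso_left_factor[OF _ ab]) (simp_all add: P2_ntrans[OF assoc_cart_cart[OF p q r]] s)
qed

lemma lunit_is_iso:
  assumes p: "is_poly E X Y p" and X: "X \<in> Obj E" and Y: "Y \<in> Obj E"
  shows "is_iso (poly_hom E X Y) (lunit_cart E Y p)"
proof (rule P2_reflects_iso[OF lunit_data(2)[OF p Y] X])
  note sc = slice_category and fp = P1_functor[OF p] and L = lunit_data[OF p Y]
  interpret F: category "func_cat (slice E X) (slice E Y)" by (rule func_cat_category[OF sc sc])
  have "is_iso (func_cat (slice E X) (slice E Y)) (Hcomp2 CAT (slice E X) (slice E Y) (slice E Y) (Psi Y)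
      (id_ntrans (slice E X) (slice E Y) (P1 E X Y p)))"
    by (rule hcomp_ntrans_iso[OF sc sc sc Psi_is_iso[OF Y] id_ntrans_iso[OF fp]])
  from F.iso_comp[OF this Phi_is_iso[OF p id_poly_poly[OF Y]]]
  have k: "is_iso (func_cat (slice E X) (slice E Y)) (Phi X Y Y (id_poly E Y) p \<cdot>\<^bsub>func_cat (slice E X) (slice E Y)\<^esub>
      Hcomp2 CAT (slice E X) (slice E Y) (slice E Y) (Psi Y) (id_ntrans (slice E X) (slice E Y) (P1 E X Y p)))"
    by simp
  show "is_iso (func_cat (slice E X) (slice E Y)) (P2 E X Y (lunit_cart E Y p))"
    by (rule F.iso_left_factor[OF back_subst[of "is_iso _", OF id_ntrans_iso[OF fp] Phi_lunit[OF p Y, symmetric]] k])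
      (simp_all add: P2_ntrans[OF L(2)] L(3))
qed

lemma runit_is_iso:
  assumes p: "is_poly E X Y p" and X: "X \<in> Obj E"
  shows "is_iso (poly_hom E X Y) (runit_cart E X p)"
proof (rule P2_reflects_iso[OF runit_data(1)[OF p X] X])
  note sc = slice_category and fp = P1_functor[OF p] and L = runit_data[OF p X]
  interpret F: category "func_cat (slice E X) (slice E Y)" by (rule func_cat_category[OF sc sc])
  have "is_iso (func_cat (slice E X) (slice E Y)) (Hcomp2 CAT (slice E X) (slice E X) (slice E Y)
      (id_ntrans (slice E X) (slice E Y) (P1 E X Y p)) (Psi X))"
    by (rule hcomp_ntrans_iso[OF sc sc sc id_ntrans_iso[OF fp] Psi_is_iso[OF X]])
  from F.iso_comp[OF this Phi_is_iso[OF id_poly_poly[OF X] p]]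
  have k: "is_iso (func_cat (slice E X) (slice E Y)) (Phi X X Y p (id_poly E X) \<cdot>\<^bsub>func_cat (slice E X) (slice E Y)\<^esub>
      Hcomp2 CAT (slice E X) (slice E X) (slice E Y) (id_ntrans (slice E X) (slice E Y) (P1 E X Y p)) (Psi X))"
    by simp
  show "is_iso (func_cat (slice E X) (slice E Y)) (P2 E X Y (runit_cart E X p))"
    by (rule F.iso_left_factor[OF back_subst[of "is_iso _", OF id_ntrans_iso[OF fp] Phi_runit[OF p X, symmetric]] k])
      (simp_all add: P2_ntrans[OF L(1)] L(2))
qed

lemma Poly_simps [simp]:
  "Cell0 (Poly E) = Obj E" "HomCat (Poly E) = poly_hom E" "Unit1 (Poly E) = id_poly E"
  "Hcomp1 (Poly E) X Y Z = comp_poly E" "Hcomp2 (Poly E) X Y Z = hcomp_cart E"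
  "Assoc (Poly E) W X Y Z = assoc_cart E" "Lunit (Poly E) X Y = lunit_cart E Y" "Runit (Poly E) X Y = runit_cart E X"
  by (simp_all add: Poly_def)

lemma hcomp_functor_maps:
  "functor_maps (prod_cat (poly_hom E Y Z) (poly_hom E X Y)) (poly_hom E X Z)
    (\<lambda>(q, p). comp_poly E q p) (\<lambda>(g, f). hcomp_cart E g f)"
  unfolding functor_maps_def
proof (intro conjI allI ballI)
  fix P assume "P \<in> Obj (prod_cat (poly_hom E Y Z) (poly_hom E X Y))"
  then obtain q p where P: "P = (q, p)" and q: "is_poly E Y Z q" and p: "is_poly E X Y p" by (auto simp: prod_cat_def)
  show "(case P of (q, p) \<Rightarrow> comp_poly E q p) \<in> Obj (poly_hom E X Z)"
    using comp_poly_poly[OF p q] by (simp add: P)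
  show "(case Idn (prod_cat (poly_hom E Y Z) (poly_hom E X Y)) P of (g, f) \<Rightarrow> hcomp_cart E g f)
      = Idn (poly_hom E X Z) (case P of (q, p) \<Rightarrow> comp_poly E q p)"
    using hcomp_idn[OF p q] by (simp add: P prod_cat_def)
next
  fix P Q f assume "f \<in> hom (prod_cat (poly_hom E Y Z) (poly_hom E X Y)) P Q"
  then show "(case f of (g, f) \<Rightarrow> hcomp_cart E g f)
      \<in> hom (poly_hom E X Z) (case P of (q, p) \<Rightarrow> comp_poly E q p) (case Q of (q, p) \<Rightarrow> comp_poly E q p)"
    by (auto simp: prod_cat_def hcomp_cart_cart hcomp_cart_composite(1,2))
next
  fix P Q R f g assume "f \<in> hom (prod_cat (poly_hom E Y Z) (poly_hom E X Y)) P Q"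
    "g \<in> hom (prod_cat (poly_hom E Y Z) (poly_hom E X Y)) Q R"
  then obtain f1 f2 g1 g2 where e: "f = (f1, f2)" "g = (g1, g2)"
    and c: "is_cart E Y Z f1" "is_cart E X Y f2" "is_cart E Y Z g1" "is_cart E X Y g2"
    and m: "ctrg f2 = csrc g2" "ctrg f1 = csrc g1"
    by (cases f, cases g) (auto simp: prod_cat_def)
  show "(case g \<cdot>\<^bsub>prod_cat (poly_hom E Y Z) (poly_hom E X Y)\<^esub> f of (g, f) \<Rightarrow> hcomp_cart E g f)
      = (case g of (g, f) \<Rightarrow> hcomp_cart E g f) \<cdot>\<^bsub>poly_hom E X Z\<^esub> (case f of (g, f) \<Rightarrow> hcomp_cart E g f)"
    using hcomp_comp[OF c(2,4,1,3) m] by (simp add: e prod_cat_def del: poly_hom_simps)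
qed

lemma Poly_bicategory: "bicategory (Poly E)"
proof (rule bicategory.intro, unfold Poly_simps)
  fix X Y Z W p q r assume o: "X \<in> Obj E" "Y \<in> Obj E"
  show "category (poly_hom E X Y)" by (rule poly_hom_category)
  show "functor_maps (prod_cat (poly_hom E Y Z) (poly_hom E X Y)) (poly_hom E X Z)
    (\<lambda>(q, p). comp_poly E q p) (\<lambda>(g, f). hcomp_cart E g f)"
    by (rule hcomp_functor_maps)
next
  fix X assume "X \<in> Obj E"
  then show "id_poly E X \<in> Obj (poly_hom E X X)" by (simp add: id_poly_poly)
next
  fix W X Y Z p q r assume W: "W \<in> Obj E"
    and "p \<in> Obj (poly_hom E W X)" "q \<in> Obj (poly_hom E X Y)" "r \<in> Obj (poly_hom E Y Z)"
  then have p: "is_poly E W X p" "is_poly E X Y q" "is_poly E Y Z r" by simp_all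
  show "assoc_cart E r q p \<in> hom (poly_hom E W Z) (comp_poly E (comp_poly E r q) p) (comp_poly E r (comp_poly E q p))"
    using assoc_cart_cart[OF p] assoc_cart_composite(1,2)[OF p] by simp
  show "is_iso (poly_hom E W Z) (assoc_cart E r q p)" by (rule assoc_is_iso[OF p W])
next
  fix W X Y Z \<phi> \<gamma> \<theta> p q r p' q' r' assume "\<phi> \<in> hom (poly_hom E W X) p p'" "\<gamma> \<in> hom (poly_hom E X Y) q q'"
    "\<theta> \<in> hom (poly_hom E Y Z) r r'"
  then show "assoc_cart E r' q' p' \<cdot>\<^bsub>poly_hom E W Z\<^esub> hcomp_cart E (hcomp_cart E \<theta> \<gamma>) \<phi>
      = hcomp_cart E \<theta> (hcomp_cart E \<gamma> \<phi>) \<cdot>\<^bsub>poly_hom E W Z\<^esub> assoc_cart E r q p"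
    using assoc_natural[of W X \<phi> Y \<gamma> Z \<theta>] by auto
next
  fix X Y p assume o: "X \<in> Obj E" "Y \<in> Obj E" and "p \<in> Obj (poly_hom E X Y)"
  then have p: "is_poly E X Y p" by simp
  show "lunit_cart E Y p \<in> hom (poly_hom E X Y) (comp_poly E (id_poly E Y) p) p"
    using lunit_data[OF p o(2)] by simp
  show "is_iso (poly_hom E X Y) (lunit_cart E Y p)" by (rule lunit_is_iso[OF p o])
  show "runit_cart E X p \<in> hom (poly_hom E X Y) (comp_poly E p (id_poly E X)) p"
    using runit_data[OF p o(1)] by simp
  show "is_iso (poly_hom E X Y) (runit_cart E X p)" by (rule runit_is_iso[OF p o(1)])
next
  fix X Y \<phi> p p' assume o: "X \<in> Obj E" "Y \<in> Obj E" and "\<phi> \<in> hom (poly_hom E X Y) p p'"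
  then have f: "is_cart E X Y \<phi>" and e: "p = csrc \<phi>" "p' = ctrg \<phi>" by auto
  show "lunit_cart E Y p' \<cdot>\<^bsub>poly_hom E X Y\<^esub> hcomp_cart E (Idn (poly_hom E Y Y) (id_poly E Y)) \<phi>
      = \<phi> \<cdot>\<^bsub>poly_hom E X Y\<^esub> lunit_cart E Y p"
    using lunit_natural[OF f o(2)] by (simp add: e)
  show "runit_cart E X p' \<cdot>\<^bsub>poly_hom E X Y\<^esub> hcomp_cart E \<phi> (Idn (poly_hom E X X) (id_poly E X))
      = \<phi> \<cdot>\<^bsub>poly_hom E X Y\<^esub> runit_cart E X p"
    using runit_natural[OF f o(1)] by (simp add: e)
next
  fix V W X Y Z p q r s assume "p \<in> Obj (poly_hom E V W)" "q \<in> Obj (poly_hom E W X)" "r \<in> Obj (poly_hom E X Y)" "s \<in> Obj (poly_hom E Y Z)"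
  then have p: "is_poly E V W p" "is_poly E W X q" "is_poly E X Y r" "is_poly E Y Z s" by simp_all
  show "assoc_cart E s r (comp_poly E q p) \<cdot>\<^bsub>poly_hom E V Z\<^esub> assoc_cart E (comp_poly E s r) q p
      = hcomp_cart E (Idn (poly_hom E Y Z) s) (assoc_cart E r q p) \<cdot>\<^bsub>poly_hom E V Z\<^esub> assoc_cart E s (comp_poly E r q) p
        \<cdot>\<^bsub>poly_hom E V Z\<^esub> hcomp_cart E (assoc_cart E s r q) (Idn (poly_hom E V W) p)"
    using poly_pentagon[OF p] unfolding poly_hom_simps(5) .
next
  fix X Y Z p q assume Y: "Y \<in> Obj E" and "p \<in> Obj (poly_hom E X Y)" "q \<in> Obj (poly_hom E Y Z)"
  then have p: "is_poly E X Y p" "is_poly E Y Z q" by simp_all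
  show "hcomp_cart E (Idn (poly_hom E Y Z) q) (lunit_cart E Y p) \<cdot>\<^bsub>poly_hom E X Z\<^esub> assoc_cart E q (id_poly E Y) p
      = hcomp_cart E (runit_cart E Y q) (Idn (poly_hom E X Y) p)"
    using poly_triangle[OF p Y] unfolding poly_hom_simps(5) .
qed

lemma P_homomorphism: "homomorphism (Poly E) CAT (slice E) (P1 E) (P2 E) Phi Psi"
proof (intro homomorphism.intro homomorphism_axioms.intro Poly_bicategory CAT_bicategory, unfold Poly_simps CAT_simps)
  fix X assume "X \<in> Obj E"
  then show "Psi X \<in> hom (func_cat (slice E X) (slice E X)) (id_func (slice E X)) (P1 E X X (id_poly E X))"
    and "is_iso (func_cat (slice E X) (slice E X)) (Psi X)"
    by (simp_all add: Psi_ntrans Psi_is_iso)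
  show "slice E X \<in> {C. category C}" by (simp add: slice_category)
next
  fix X Y
  show "functor_maps (poly_hom E X Y) (func_cat (slice E X) (slice E Y)) (P1 E X Y) (P2 E X Y)"
    by (rule P_local_functor)
next
  fix X Y Z p q assume "p \<in> Obj (poly_hom E X Y)" "q \<in> Obj (poly_hom E Y Z)"
  then have p: "is_poly E X Y p" "is_poly E Y Z q" by simp_all
  show "Phi X Y Z q p \<in> hom (func_cat (slice E X) (slice E Z)) (comp_func (slice E X) (P1 E Y Z q) (P1 E X Y p)) (P1 E X Z (comp_poly E q p))"
    using Phi_ntrans[OF p] by simp
  show "is_iso (func_cat (slice E X) (slice E Z)) (Phi X Y Z q p)" by (rule Phi_is_iso[OF p])
next
  fix X Y Z \<phi> \<gamma> p q p' q' assume "\<phi> \<in> hom (poly_hom E X Y) p p'" "\<gamma> \<in> hom (poly_hom E Y Z) q q'"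
  then show "Phi X Y Z q' p' \<cdot>\<^bsub>func_cat (slice E X) (slice E Z)\<^esub> Hcomp2 CAT (slice E X) (slice E Y) (slice E Z) (P2 E Y Z \<gamma>) (P2 E X Y \<phi>)
      = P2 E X Z (hcomp_cart E \<gamma> \<phi>) \<cdot>\<^bsub>func_cat (slice E X) (slice E Z)\<^esub> Phi X Y Z q p"
    using Phi_natural[of X Y \<phi> Z \<gamma>] by auto
next
  fix W X Y Z p q r assume "p \<in> Obj (poly_hom E W X)" "q \<in> Obj (poly_hom E X Y)" "r \<in> Obj (poly_hom E Y Z)"
  then have p: "is_poly E W X p" "is_poly E X Y q" "is_poly E Y Z r" by simp_all
  show "P2 E W Z (assoc_cart E r q p) \<cdot>\<^bsub>func_cat (slice E W) (slice E Z)\<^esub> Phi W X Z (comp_poly E r q) p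
      \<cdot>\<^bsub>func_cat (slice E W) (slice E Z)\<^esub> Hcomp2 CAT (slice E W) (slice E X) (slice E Z) (Phi X Y Z r q)
          (Idn (func_cat (slice E W) (slice E X)) (P1 E W X p))
    = Phi W Y Z r (comp_poly E q p) \<cdot>\<^bsub>func_cat (slice E W) (slice E Z)\<^esub>
        Hcomp2 CAT (slice E W) (slice E Y) (slice E Z) (Idn (func_cat (slice E Y) (slice E Z)) (P1 E Y Z r)) (Phi W X Y q p)
        \<cdot>\<^bsub>func_cat (slice E W) (slice E Z)\<^esub> id_ntrans (slice E W) (slice E Z)
            (comp_func (slice E W) (P1 E Y Z r) (comp_func (slice E W) (P1 E X Y q) (P1 E W X p)))"
    using Phi_assoc[OF p] unfolding func_cat_simps(5) .
next
  fix X Y p assume o: "X \<in> Obj E" "Y \<in> Obj E" and "p \<in> Obj (poly_hom E X Y)"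
  then have p: "is_poly E X Y p" by simp
  show "P2 E X Y (lunit_cart E Y p) \<cdot>\<^bsub>func_cat (slice E X) (slice E Y)\<^esub> Phi X Y Y (id_poly E Y) p
      \<cdot>\<^bsub>func_cat (slice E X) (slice E Y)\<^esub> Hcomp2 CAT (slice E X) (slice E Y) (slice E Y) (Psi Y)
          (Idn (func_cat (slice E X) (slice E Y)) (P1 E X Y p))
    = id_ntrans (slice E X) (slice E Y) (P1 E X Y p)"
    using Phi_lunit[OF p o(2)] unfolding func_cat_simps(5) .
  show "P2 E X Y (runit_cart E X p) \<cdot>\<^bsub>func_cat (slice E X) (slice E Y)\<^esub> Phi X X Y p (id_poly E X)
      \<cdot>\<^bsub>func_cat (slice E X) (slice E Y)\<^esub> Hcomp2 CAT (slice E X) (slice E X) (slice E Y)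
          (Idn (func_cat (slice E X) (slice E Y)) (P1 E X Y p)) (Psi X)
    = id_ntrans (slice E X) (slice E Y) (P1 E X Y p)"
    using Phi_runit[OF p o(1)] unfolding func_cat_simps(5) .
qed

end

theorem theorem3p2p6:
  fixes E :: "('o, 'a) cat"
  assumes "category E" and "has_pullbacks E"
  shows "\<exists>\<Phi> \<Psi>. homomorphism (Poly E) CAT (slice E) (P1 E) (P2 E) \<Phi> \<Psi>"
proof -
  interpret pullback_category E
    by (intro pullback_category.intro pullback_category_axioms.intro assms)
  show ?thesis using P_homomorphism by blast
qed

end
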